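(* For all positive coprime integers $k$ and $l$, the data $(\mathbb C[\mathbb{WP}_{k,l,q}],\pi,\mathcal H^{\theta},D^{\theta})$ define a $2$-summable odd spectral triple over $\mathbb C[\mathbb{WP}_{k,l,q}]$.
   Context: Fix $q\in(0,1)$, $[n]_q=\frac{q^n-q^{-n}}{q-q^{-1}}$, $\mathbb N=\{1,2,\dots\}$, $\mathbb N_0=\{0\}\cup\mathbb N$. $U_q(\mathfrak{su}_2)$ is the unital complex algebra generated by $e,f,K,K^{-1}$ (the Cartan generator is denoted $K$ to distinguish it from the integer $k$) with $Ke=qeK$, $Kf=q^{-1}fK$, $[e,f]=\frac{K^2-K^{-2}}{q-q^{-1}}$, $KK^{-1}=K^{-1}K=1$. It is a Hopf $*$-algebra with $\triangle(K)=K\otimes K$, $\triangle(e)=e\otimes K+K^{-1}\otimes e$, $\triangle(f)=f\otimes K+K^{-1}\otimes f$, $S(K)=K^{-1}$, $S(e)=-qe$, $S(f)=-q^{-1}f$, $\epsilon(K)=1$, $\epsilon(e)=\epsilon(f)=0$, $e^*=f$, $K^*=K$. For $\lambda\in\frac12\mathbb N_0$, $M_\lambda$ is the irreducible module with basis $u_{\lambda m}$, $m\in\{-\lambda,-\lambda+1,\dots,\lambda\}$, and representation $\varrho_\lambda(e)u_{\lambda m}=\sqrt{[\lambda-m]_q[\lambda+m+1]_q}\,u_{\lambda,m+1}$, $\varrho_\lambda(f)u_{\lambda m}=\sqrt{[\lambda-m+1]_q[\lambda+m]_q}\,u_{\lambda,m-1}$, $\varrho_\lambda(K)u_{\lambda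 m}=q^mu_{\lambda m}$; $u^*_{\lambda m}$ is the dual basis. $\mathbb C[SU_{2,q}]=\bigoplus_{\lambda\in\frac12\mathbb N_0}M_\lambda^*\otimes M_\lambda$ has linear basis $t^\lambda_{mn}=u^*_{\lambda m}\otimes u_{\lambda n}$; its elements are functionals on $U_q(\mathfrak{su}_2)$ via $t^\lambda_{mn}(x)=u^*_{\lambda m}(\varrho_\lambda(x)u_{\lambda n})$. It is a unital $*$-algebra with $(tt')(x)=t(x')t'(x'')$ where $\triangle(x)=x'\otimes x''$ (Sweedler), unit $t^0_{00}$, and $t^*(x)=\overline{t(S(x)^* )}$. As a $*$-algebra it is generated by $\alpha=t^{1/2}_{\frac12,\frac12}$ and $\beta=t^{1/2}_{\frac12,-\frac12}$. Coaction: $B=\mathbb C[u,u^{-1}]$ with $u$ grouplike and unitary; for positive coprime integers $k,l$, $\theta:\mathbb C[SU_{2,q}]\to\mathbb C[SU_{2,q}]\otimes B$ is the $*$-homomorphism with $\alpha\mapsto\alpha\otimes u^{-k}$, $\beta\mapsto\beta\otimes u^l$, and $\mathbb C[\mathbb{WP}_{k,l,q}]=\{t:\theta(t)=t\otimes1\}$. On $M_{\frac12}$, with basis $e_\pm=u_{\frac12,\pm\frac12}$, put $\theta_{-k}(e_+)=e_+\otimes u^{-k}$, $\theta_{-k}(e_-)=e_-\otimes u^l$. The coaction $\hat\theta=\theta\otimes\theta_{-k}$ on $\mathbb C[SU_{2,q}]\otimes M_{\frac12}$ is the tensor product coaction (the $B$-components are multiplied); an element $w$ is coinvariant if $\hat\theta(w)=w\otimes1$.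 Hilbert spaces: the Haar state $h$ is the linear functional with $h(1)=1$ and $h(t^\lambda_{mn})=0$ for $\lambda>0$; $L^2(SU_{2,q})$ is the completion of $\mathbb C[SU_{2,q}]$ in the inner product $\langle a,b\rangle=h(a^*b)$, $\eta:\mathbb C[SU_{2,q}]\to L^2(SU_{2,q})$ is the inclusion, and $\pi_h(t)\eta(t')=\eta(tt')$ is the GNS representation. $\mathcal H=L^2(SU_{2,q})\otimes M_{\frac12}$ with $e_\pm$ orthonormal, $\pi=\pi_h\otimes\iota$ (with $\iota$ the identity). $\mathcal H^\theta\subset\mathcal H$ is the closure of the space of coinvariant elements of $\mathbb C[SU_{2,q}]\otimes M_{\frac12}$, and $\pi$ also denotes the restriction $\mathbb C[\mathbb{WP}_{k,l,q}]\to\mathcal B(\mathcal H^\theta)$. Dirac operator: write $r^\pm=r\pm\frac12$, $C_{j\mu}=q^{-(j+\mu)/2}\frac{[j-\mu]_q^{1/2}}{[2j]_q^{1/2}}$, $S_{j\mu}=q^{(j-\mu)/2}\frac{[j+\mu]_q^{1/2}}{[2j]_q^{1/2}}$. $\mathcal H$ has the orthonormal basis $$|jm\mu\downarrow\rangle=q^m\sqrt{[2j^-+1]_q}\big(C_{j\mu}\eta(t^{j^-}_{m,\mu^+})\otimes e_-+S_{j\mu}\eta(t^{j^-}_{m,\mu^-})\otimes e_+\big)\quad(j\in\tfrac12\mathbb N,\ -j^-\le m\le j^-,\ -j\le\mu\le j),$$ $$|jm\mu\uparrow\rangle=q^m\sqrt{[2j^++1]_q}\big(-S_{j+1,\mu}\eta(t^{j^+}_{m,\mu^+})\otimes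 e_-+C_{j+1,\mu}\eta(t^{j^+}_{m,\mu^-})\otimes e_+\big)\quad(j\in\tfrac12\mathbb N_0,\ -j^+\le m\le j^+,\ -j\le\mu\le j),$$ with indices in integer steps (terms with out-of-range indices have coefficient zero). $D$ is the self-adjoint operator on $\mathcal H$ diagonal in this basis with $D|jm\mu\uparrow\rangle=(2j+\frac32)|jm\mu\uparrow\rangle$ and $D|jm\mu\downarrow\rangle=-(2j+\frac12)|jm\mu\downarrow\rangle$. $D$ restricts to $\mathcal H^\theta$, which has a basis of vectors of this form, and $D^\theta=D+\frac12$ on $\mathcal H^\theta$. An odd spectral triple $(\mathcal A,\pi,H,D)$ consists of a unital $*$-algebra $\mathcal A$ with a faithful $*$-representation $\pi$ by bounded operators on a Hilbert space $H$ and a densely defined self-adjoint operator $D$ on $H$ with compact resolvent such that $[D,\pi(a)]$ extends to a bounded operator for all $a\in\mathcal A$ (no chirality grading is required). For an invertible such $D$, $2$-summable means that the sum of the eigenvalues of $D^{-2}$ (with multiplicity) over the eigenspaces of $D$ with $|\text{eigenvalue}|\le\Lambda$ diverges logarithmically, i.e. grows at the order of $\log\Lambda$, as $\Lambda\to\infty$. *)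

theory Defs
  imports
    "HOL-Analysis.Analysis"
    "HOL-Algebra.Module"
    "HOL-Library.Function_Algebras"
    "HOL-Library.Landau_Symbols"
begin

section \<open>Complex Hilbert spaces\<close>

text \<open>The inner product is antilinear in the first argument.\<close>

class complex_hilbert = banach +
  fixes scaleC :: "complex \<Rightarrow> 'a \<Rightarrow> 'a"
    and cinner :: "'a \<Rightarrow> 'a \<Rightarrow> complex"
  assumes scaleC_add_right: "scaleC c (x + y) = scaleC c x + scaleC c y"
    and scaleC_add_left: "scaleC (c + d) x = scaleC c x + scaleC d x"
    and scaleC_scaleC: "scaleC c (scaleC d x) = scaleC (c * d) x"
    and scaleC_of_real: "scaleC (complex_of_real r) x = r *\<^sub>R x"
    and cinner_commute: "cinner x y = cnj (cinner y x)"
    and cinner_add_right: "cinner x (y + z) = cinner x y + cinner x z"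
    and cinner_scaleC_right: "cinner x (scaleC c y) = c * cinner x y"
    and cinner_self: "cinner x x = complex_of_real ((norm x)\<^sup>2)"

global_interpretation complex_vector:
  vector_space "scaleC :: complex \<Rightarrow> 'a \<Rightarrow> 'a::complex_hilbert"
proof
  fix x :: 'a
  show "scaleC 1 x = x"
    using scaleC_of_real[of 1 x] by simp
qed (simp_all add: scaleC_add_right scaleC_add_left scaleC_scaleC)

instantiation prod :: (complex_hilbert, complex_hilbert) complex_hilbert
begin

definition scaleC_prod :: "complex \<Rightarrow> 'a \<times> 'b \<Rightarrow> 'a \<times> 'b" where
  "scaleC_prod c x = (scaleC c (fst x), scaleC c (snd x))"

definition cinner_prod :: "'a \<times> 'b \<Rightarrow> 'a \<times> 'b \<Rightarrow> complex" where
  "cinner_prod x y = cinner (fst x) (fst y) + cinner (snd x) (snd y)"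

instance
proof
  fix x y z :: "'a \<times> 'b" and c d :: complex and r :: real
  show "scaleC c (x + y) = scaleC c x + scaleC c y"
    by (simp add: scaleC_prod_def scaleC_add_right)
  show "scaleC (c + d) x = scaleC c x + scaleC d x"
    by (simp add: scaleC_prod_def scaleC_add_left)
  show "scaleC c (scaleC d x) = scaleC (c * d) x"
    by (simp add: scaleC_prod_def scaleC_scaleC)
  show "scaleC (complex_of_real r) x = r *\<^sub>R x"
    by (simp add: scaleC_prod_def scaleC_of_real scaleR_prod_def)
  show "cinner x y = cnj (cinner y x)"
    using cinner_commute[of "fst x" "fst y"] cinner_commute[of "snd x" "snd y"]
    by (simp add: cinner_prod_def)
  show "cinner x (y + z) = cinner x y + cinner x z"
    by (simp add: cinner_prod_def cinner_add_right)
  show "cinner x (scaleC c y) = c * cinner x y"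
    by (simp add: cinner_prod_def scaleC_prod_def cinner_scaleC_right distrib_left)
  show "cinner x x = complex_of_real ((norm x)\<^sup>2)"
    by (simp add: cinner_prod_def cinner_self norm_prod_def)
qed

end


section \<open>Unital star-algebras and their representations\<close>

definition complex_ring :: "complex ring" where
  "complex_ring = \<lparr>carrier = UNIV, monoid.mult = (*), one = 1, zero = 0, add = (+)\<rparr>"

record 'a star_algebra = "(complex, 'a) module" +
  star :: "'a \<Rightarrow> 'a"

locale unital_star_algebra =
  ring A + module complex_ring A for A :: "('a, 'm) star_algebra_scheme" (structure) +
  assumes smult_mult_left:
      "\<lbrakk>x \<in> carrier A; y \<in> carrier A\<rbrakk> \<Longrightarrow> (c \<odot>\<^bsub>A\<^esub> x) \<otimes>\<^bsub>A\<^esub> y = c \<odot>\<^bsub>A\<^esub> (x \<otimes>\<^bsub>A\<^esub> y)"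
    and smult_mult_right:
      "\<lbrakk>x \<in> carrier A; y \<in> carrier A\<rbrakk> \<Longrightarrow> x \<otimes>\<^bsub>A\<^esub> (c \<odot>\<^bsub>A\<^esub> y) = c \<odot>\<^bsub>A\<^esub> (x \<otimes>\<^bsub>A\<^esub> y)"
    and star_closed: "x \<in> carrier A \<Longrightarrow> star A x \<in> carrier A"
    and star_star: "x \<in> carrier A \<Longrightarrow> star A (star A x) = x"
    and star_add:
      "\<lbrakk>x \<in> carrier A; y \<in> carrier A\<rbrakk> \<Longrightarrow> star A (x \<oplus>\<^bsub>A\<^esub> y) = star A x \<oplus>\<^bsub>A\<^esub> star A y"
    and star_smult: "x \<in> carrier A \<Longrightarrow> star A (c \<odot>\<^bsub>A\<^esub> x) = cnj c \<odot>\<^bsub>A\<^esub> star A x"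
    and star_mult:
      "\<lbrakk>x \<in> carrier A; y \<in> carrier A\<rbrakk> \<Longrightarrow> star A (x \<otimes>\<^bsub>A\<^esub> y) = star A y \<otimes>\<^bsub>A\<^esub> star A x"

definition star_hom ::
  "('a, 'm) star_algebra_scheme \<Rightarrow> ('b, 'n) star_algebra_scheme \<Rightarrow> ('a \<Rightarrow> 'b) \<Rightarrow> bool" where
  "star_hom A B f \<longleftrightarrow>
     f \<in> ring_hom A B \<and>
     (\<forall>c. \<forall>x\<in>carrier A. f (c \<odot>\<^bsub>A\<^esub> x) = c \<odot>\<^bsub>B\<^esub> f x) \<and>
     (\<forall>x\<in>carrier A. f (star A x) = star B (f x))"

text \<open>
  A Hilbert space \<open>H\<close> is a closed complex subspace of a type of class \<open>complex_hilbert\<close>;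
  a bounded operator on \<open>H\<close> is a function that is only looked at on \<open>H\<close>.
\<close>

definition closed_csubspace :: "'h::complex_hilbert set \<Rightarrow> bool" where
  "closed_csubspace H \<longleftrightarrow> complex_vector.subspace H \<and> closed H"

definition bounded_operator_on :: "'h::complex_hilbert set \<Rightarrow> ('h \<Rightarrow> 'h) \<Rightarrow> bool" where
  "bounded_operator_on H T \<longleftrightarrow>
     (\<forall>x\<in>H. T x \<in> H) \<and>
     (\<forall>x\<in>H. \<forall>y\<in>H. T (x + y) = T x + T y) \<and>
     (\<forall>c. \<forall>x\<in>H. T (scaleC c x) = scaleC c (T x)) \<and>
     (\<exists>C. \<forall>x\<in>H. norm (T x) \<le> C * norm x)"

definition faithful_star_rep ::
  "('a, 'm) star_algebra_scheme \<Rightarrow> 'h::complex_hilbert set \<Rightarrow> ('a \<Rightarrow> 'h \<Rightarrow> 'h) \<Rightarrow> bool" where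
  "faithful_star_rep A H \<pi> \<longleftrightarrow>
     (\<forall>a\<in>carrier A. bounded_operator_on H (\<pi> a)) \<and>
     (\<forall>x\<in>H. \<pi> \<one>\<^bsub>A\<^esub> x = x) \<and>
     (\<forall>a\<in>carrier A. \<forall>b\<in>carrier A. \<forall>x\<in>H. \<pi> (a \<oplus>\<^bsub>A\<^esub> b) x = \<pi> a x + \<pi> b x) \<and>
     (\<forall>c. \<forall>a\<in>carrier A. \<forall>x\<in>H. \<pi> (c \<odot>\<^bsub>A\<^esub> a) x = scaleC c (\<pi> a x)) \<and>
     (\<forall>a\<in>carrier A. \<forall>b\<in>carrier A. \<forall>x\<in>H. \<pi> (a \<otimes>\<^bsub>A\<^esub> b) x = \<pi> a (\<pi> b x)) \<and>
     (\<forall>a\<in>carrier A. \<forall>x\<in>H. \<forall>y\<in>H. cinner (\<pi> (star A a) x) y = cinner x (\<pi> a y)) \<and>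
     (\<forall>a\<in>carrier A. \<forall>b\<in>carrier A. (\<forall>x\<in>H. \<pi> a x = \<pi> b x) \<longrightarrow> a = b)"


section \<open>Unbounded operators and spectral triples\<close>

text \<open>
  Unbounded operators on \<open>H\<close> are given by their graphs: \<open>(x, y) \<in> D\<close> means that \<open>x\<close> is in the
  domain and \<open>D x = y\<close>.
\<close>

definition operator_on :: "'h::complex_hilbert set \<Rightarrow> ('h \<times> 'h) set \<Rightarrow> bool" where
  "operator_on H D \<longleftrightarrow> D \<subseteq> H \<times> H \<and> single_valued D \<and> complex_vector.subspace D"

definition adjoint_on :: "'h::complex_hilbert set \<Rightarrow> ('h \<times> 'h) set \<Rightarrow> ('h \<times> 'h) set" where
  "adjoint_on H D = {(y, z). y \<in> H \<and> z \<in> H \<and> (\<forall>(x, w)\<in>D. cinner w y = cinner x z)}"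

definition self_adjoint_on :: "'h::complex_hilbert set \<Rightarrow> ('h \<times> 'h) set \<Rightarrow> bool" where
  "self_adjoint_on H D \<longleftrightarrow>
     operator_on H D \<and> H \<subseteq> closure (Domain D) \<and> adjoint_on H D = D"

text \<open>The graph of the inverse of \<open>D - z\<close>.\<close>

definition resolvent :: "('h::complex_hilbert \<times> 'h) set \<Rightarrow> complex \<Rightarrow> ('h \<times> 'h) set" where
  "resolvent D z = {(y - scaleC z x, x) | x y. (x, y) \<in> D}"

definition resolvent_set :: "'h::complex_hilbert set \<Rightarrow> ('h \<times> 'h) set \<Rightarrow> complex set" where
  "resolvent_set H D =
     {z. single_valued (resolvent D z) \<and> Domain (resolvent D z) = H \<and>
         (\<exists>C. \<forall>(u, v)\<in>resolvent D z. norm v \<le> C * norm u)}"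

definition compact_resolvent :: "'h::complex_hilbert set \<Rightarrow> ('h \<times> 'h) set \<Rightarrow> bool" where
  "compact_resolvent H D \<longleftrightarrow>
     (\<exists>z\<in>resolvent_set H D. compact (closure (resolvent D z `` (H \<inter> cball 0 1))))"

text \<open>
  \<open>T\<close> preserves the domain of \<open>D\<close>, and \<open>D T - T D\<close> is bounded on it, hence extends to a bounded
  operator since the domain is dense.
\<close>

definition bounded_commutator :: "('h::complex_hilbert \<times> 'h) set \<Rightarrow> ('h \<Rightarrow> 'h) \<Rightarrow> bool" where
  "bounded_commutator D T \<longleftrightarrow>
     (\<exists>C. \<forall>(x, y)\<in>D. \<exists>z. (T x, z) \<in> D \<and> norm (z - T y) \<le> C * norm x)"

definition odd_spectral_triple ::
  "('a, 'm) star_algebra_scheme \<Rightarrow> ('a \<Rightarrow> 'h \<Rightarrow> 'h) \<Rightarrow> 'h::complex_hilbert set \<Rightarrow> ('h \<times> 'h) set \<Rightarrow> bool"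
  where
  "odd_spectral_triple A \<pi> H D \<longleftrightarrow>
     unital_star_algebra A \<and>
     closed_csubspace H \<and>
     faithful_star_rep A H \<pi> \<and>
     self_adjoint_on H D \<and>
     compact_resolvent H D \<and>
     (\<forall>a\<in>carrier A. bounded_commutator D (\<pi> a))"

definition eigenspace :: "('h::complex_hilbert \<times> 'h) set \<Rightarrow> real \<Rightarrow> 'h set" where
  "eigenspace D e = {x. (x, e *\<^sub>R x) \<in> D}"

definition eigenvalues :: "('h::complex_hilbert \<times> 'h) set \<Rightarrow> real set" where
  "eigenvalues D = {e. \<exists>x\<in>eigenspace D e. x \<noteq> 0}"

text \<open>
  Used for self-adjoint \<open>D\<close> with compact resolvent: all eigenvalues are then real, and the sums and
  dimensions below are finite.
\<close>

definition two_summable :: "'h::complex_hilbert set \<Rightarrow> ('h \<times> 'h) set \<Rightarrow> bool" where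
  "two_summable H D \<longleftrightarrow>
     0 \<in> resolvent_set H D \<and>
     (\<lambda>\<Lambda>::real. \<Sum>e | e \<in> eigenvalues D \<and> \<bar>e\<bar> \<le> \<Lambda>.
        real (complex_vector.dim (eigenspace D e)) / e\<^sup>2) \<in> \<Theta>(\<lambda>\<Lambda>. ln \<Lambda>)"


section \<open>Functionals on the quantized enveloping algebra\<close>

definition qnum :: "real \<Rightarrow> real \<Rightarrow> real" where
  "qnum q x = (q powr x - q powr (- x)) / (q - 1 / q)"

datatype generator = Ge | Gf | GK | GKinv

text \<open>
  The algebra \<open>U\<^sub>q(su\<^sub>2)\<close> is spanned by the monomials in its generators, so a linear functional on it
  is given by its values on monomials, i.e. by a function on words.  The functions that arise are
  those compatible with the defining relations; the lemmas below show that matrix coefficients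
  and the operations used on functionals stay within this set.
\<close>

type_synonym functional = "generator list \<Rightarrow> complex"

definition Uq_dual :: "real \<Rightarrow> functional set" where
  "Uq_dual q = {\<phi>. \<forall>x y.
     \<phi> (x @ [GK, Ge] @ y) = complex_of_real q * \<phi> (x @ [Ge, GK] @ y) \<and>
     \<phi> (x @ [GK, Gf] @ y) = complex_of_real (inverse q) * \<phi> (x @ [Gf, GK] @ y) \<and>
     \<phi> (x @ [Ge, Gf] @ y) - \<phi> (x @ [Gf, Ge] @ y) =
       (\<phi> (x @ [GK, GK] @ y) - \<phi> (x @ [GKinv, GKinv] @ y)) / complex_of_real (q - 1 / q) \<and>
     \<phi> (x @ [GK, GKinv] @ y) = \<phi> (x @ y) \<and>
     \<phi> (x @ [GKinv, GK] @ y) = \<phi> (x @ y)}"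

definition fscale :: "complex \<Rightarrow> functional \<Rightarrow> functional" where
  "fscale c \<phi> = (\<lambda>w. c * \<phi> w)"

global_interpretation functional: vector_space fscale
  by standard (auto simp: fscale_def fun_eq_iff algebra_simps)

text \<open>\<open>coprod w\<close> lists the summands of the coproduct of the monomial \<open>w\<close>.\<close>

fun coprod_gen :: "generator \<Rightarrow> (generator list \<times> generator list) list" where
  "coprod_gen Ge = [([Ge], [GK]), ([GKinv], [Ge])]"
| "coprod_gen Gf = [([Gf], [GK]), ([GKinv], [Gf])]"
| "coprod_gen GK = [([GK], [GK])]"
| "coprod_gen GKinv = [([GKinv], [GKinv])]"

fun coprod :: "generator list \<Rightarrow> (generator list \<times> generator list) list" where
  "coprod [] = [([], [])]"
| "coprod (g # w) = [(a @ a', b @ b'). (a, b) \<leftarrow> coprod_gen g, (a', b') \<leftarrow> coprod w]"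

definition fmult :: "functional \<Rightarrow> functional \<Rightarrow> functional" where
  "fmult s t = (\<lambda>w. \<Sum>(a, b)\<leftarrow>coprod w. s a * t b)"

text \<open>
  The antipode is antimultiplicative and maps a generator \<open>g\<close> to the multiple
  \<open>antipode_coeff q g\<close> of the generator \<open>antipode_gen g\<close>.
\<close>

fun antipode_gen :: "generator \<Rightarrow> generator" where
  "antipode_gen Ge = Ge"
| "antipode_gen Gf = Gf"
| "antipode_gen GK = GKinv"
| "antipode_gen GKinv = GK"

fun antipode_coeff :: "real \<Rightarrow> generator \<Rightarrow> complex" where
  "antipode_coeff q Ge = complex_of_real (- q)"
| "antipode_coeff q Gf = complex_of_real (- inverse q)"
| "antipode_coeff q GK = 1"
| "antipode_coeff q GKinv = 1"

fun star_gen :: "generator \<Rightarrow> generator" where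
  "star_gen Ge = Gf"
| "star_gen Gf = Ge"
| "star_gen GK = GK"
| "star_gen GKinv = GKinv"

definition antipode_word :: "generator list \<Rightarrow> generator list" where
  "antipode_word w = rev (map antipode_gen w)"

definition antipode_word_coeff :: "real \<Rightarrow> generator list \<Rightarrow> complex" where
  "antipode_word_coeff q w = (\<Prod>g\<leftarrow>w. antipode_coeff q g)"

definition star_word :: "generator list \<Rightarrow> generator list" where
  "star_word w = rev (map star_gen w)"

text \<open>With \<open>S(w) = c v\<close> for a scalar \<open>c\<close> and a word \<open>v\<close>, one has \<open>S(w)\<^sup>* = cnj c v\<^sup>*\<close>.\<close>

definition fstar :: "real \<Rightarrow> functional \<Rightarrow> functional" where
  "fstar q t = (\<lambda>w. cnj (cnj (antipode_word_coeff q w) * t (star_word (antipode_word w))))"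


section \<open>The quantum group\<close>

text \<open>Spins and weights are real numbers, restricted to the following sets.\<close>

definition half_nats :: "real set" where
  "half_nats = range (\<lambda>n::nat. real n / 2)"

definition weights :: "real \<Rightarrow> real set" where
  "weights s = {m. \<exists>i::nat. m = - s + real i \<and> m \<le> s}"

text \<open>
  Matrix entries of the representation of spin \<open>s\<close>: \<open>rep q s w m n\<close> is the coefficient of the
  basis vector of weight \<open>m\<close> in the image under \<open>w\<close> of the one of weight \<open>n\<close>.
\<close>

definition rep_gen :: "real \<Rightarrow> real \<Rightarrow> generator \<Rightarrow> real \<Rightarrow> real \<Rightarrow> real" where
  "rep_gen q s g m n =
     (if m \<in> weights s \<and> n \<in> weights s then
        (case g of
           Ge \<Rightarrow> if m = n + 1 then sqrt (qnum q (s - n) * qnum q (s + n + 1)) else 0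
         | Gf \<Rightarrow> if m = n - 1 then sqrt (qnum q (s - n + 1) * qnum q (s + n)) else 0
         | GK \<Rightarrow> if m = n then q powr n else 0
         | GKinv \<Rightarrow> if m = n then q powr (- n) else 0)
      else 0)"

fun rep :: "real \<Rightarrow> real \<Rightarrow> generator list \<Rightarrow> real \<Rightarrow> real \<Rightarrow> real" where
  "rep q s [] m n = (if m = n \<and> n \<in> weights s then 1 else 0)"
| "rep q s (g # w) m n = (\<Sum>p\<in>weights s. rep_gen q s g m p * rep q s w p n)"

text \<open>Matrix coefficients; they are \<open>0\<close> if \<open>m\<close> or \<open>n\<close> is out of range.\<close>

definition tcoef :: "real \<Rightarrow> real \<Rightarrow> real \<Rightarrow> real \<Rightarrow> functional" where
  "tcoef q s m n = (\<lambda>w. complex_of_real (rep q s w m n))"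

lemma finite_weights: "finite (weights s)"
proof (rule finite_subset)
  show "weights s \<subseteq> (\<lambda>i::nat. - s + real i) ` {..nat \<lceil>2 * s\<rceil>}"
    unfolding weights_def
  proof clarify
    fix m i assume "- s + real i \<le> s"
    then have "real i \<le> 2 * s" by simp
    then have "i \<le> nat \<lceil>2 * s\<rceil>" by linarith
    then show "- s + real i \<in> (\<lambda>i::nat. - s + real i) ` {..nat \<lceil>2 * s\<rceil>}" by blast
  qed
qed simp

lemma rep_out: "m \<notin> weights s \<or> n \<notin> weights s \<Longrightarrow> rep q s w m n = 0"
proof (induction w arbitrary: m)
  case (Cons g w)
  show ?case
  proof (cases "m \<in> weights s")
    case True
    with Cons.prems have "n \<notin> weights s" by blast
    then show ?thesis by (simp add: Cons.IH)
  qed (simp add: rep_gen_def)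
qed auto

lemma rep_append: "rep q s (u @ v) m n = (\<Sum>p\<in>weights s. rep q s u m p * rep q s v p n)"
proof (induction u arbitrary: m)
  case Nil
  have "(\<Sum>p\<in>weights s. rep q s [] m p * rep q s v p n) =
        (\<Sum>p\<in>weights s. if p = m then rep q s v m n else 0)"
    by (rule sum.cong) auto
  also have "\<dots> = rep q s v m n"
    using rep_out[of m s n q v] by (simp add: sum.delta[OF finite_weights])
  finally show ?case by simp
next
  case (Cons g u)
  have "rep q s ((g # u) @ v) m n =
        (\<Sum>p\<in>weights s. \<Sum>r\<in>weights s. rep_gen q s g m p * (rep q s u p r * rep q s v r n))"
    by (simp add: Cons.IH sum_distrib_left)
  also have "\<dots> =
        (\<Sum>r\<in>weights s. \<Sum>p\<in>weights s. rep_gen q s g m p * (rep q s u p r * rep q s v r n))"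
    by (rule sum.swap)
  finally show ?case by (simp add: sum_distrib_right mult.assoc)
qed

lemma rep_two: "rep q s [g, h] m n = (\<Sum>p\<in>weights s. rep_gen q s g m p * rep_gen q s h p n)"
proof -
  have "rep q s [h] p n = rep_gen q s h p n" for p
  proof -
    have "rep q s [h] p n = (\<Sum>r\<in>weights s. if r = n then rep_gen q s h p n else 0)"
      by (auto intro!: sum.cong)
    then show ?thesis by (simp add: sum.delta[OF finite_weights] rep_gen_def)
  qed
  then show ?thesis by simp
qed

lemma rep_two_single:
  assumes "\<And>p. p \<in> weights s \<Longrightarrow> p \<noteq> c \<Longrightarrow> rep_gen q s h p n = 0"
  shows "rep q s [g, h] m n = rep_gen q s g m c * rep_gen q s h c n"
proof -
  have "rep q s [g, h] m n =
        (\<Sum>p\<in>weights s. if p = c then rep_gen q s g m c * rep_gen q s h c n else 0)"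
    unfolding rep_two by (rule sum.cong) (use assms in auto)
  then show ?thesis by (simp add: sum.delta[OF finite_weights] rep_gen_def)
qed

lemma rep_two_cases:
  "rep q s [g, Ge] m n = rep_gen q s g m (n + 1) * rep_gen q s Ge (n + 1) n"
  "rep q s [g, Gf] m n = rep_gen q s g m (n - 1) * rep_gen q s Gf (n - 1) n"
  "rep q s [g, GK] m n = rep_gen q s g m n * rep_gen q s GK n n"
  "rep q s [g, GKinv] m n = rep_gen q s g m n * rep_gen q s GKinv n n"
  by (rule rep_two_single; simp add: rep_gen_def)+

lemma qnum_nonneg:
  assumes "0 < q" "q < 1" "0 \<le> x"
  shows "0 \<le> qnum q x"
proof -
  have "q powr x \<le> 1" using assms by (simp add: powr_le1)
  moreover have "1 \<le> q powr (- x)" using calculation assms by (simp add: powr_minus field_simps)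
  moreover have "q * q < 1 * 1" using assms by (intro mult_strict_mono) auto
  then have "q - 1 / q < 0" using assms by (simp add: field_simps)
  ultimately show ?thesis unfolding qnum_def
    by (intro divide_nonpos_neg) auto
qed

lemma weights_shift:
  assumes "n \<in> weights s"
  shows weights_Suc: "n + 1 \<notin> weights s \<Longrightarrow> s < n + 1" and weights_pred: "n - 1 \<notin> weights s \<Longrightarrow> n = - s"
    and weights_ge: "- s \<le> n" and weights_le: "n \<le> s"
proof -
  from assms obtain i :: nat where i: "n = - s + real i" "n \<le> s" by (auto simp: weights_def)
  then show "- s \<le> n" "n \<le> s" by auto
  show "n = - s" if "n - 1 \<notin> weights s"
  proof (cases i)
    case (Suc i')
    then have "n - 1 = - s + real i'" using i by simp
    then show ?thesis using i that unfolding weights_def by auto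
  qed (use i in auto)
  show "s < n + 1" if "n + 1 \<notin> weights s"
  proof (rule ccontr)
    assume "\<not> s < n + 1"
    moreover have "n + 1 = - s + real (Suc i)" using i by simp
    ultimately have "n + 1 \<in> weights s" unfolding weights_def by (metis (mono_tags, lifting) mem_Collect_eq not_less)
    with that show False by simp
  qed
qed

lemma weights_max:
  assumes "s \<in> half_nats" "n \<in> weights s" "n + 1 \<notin> weights s"
  shows "n = s"
proof -
  from assms obtain i j :: nat where ij: "n = - s + real i" "s = real j / 2"
    by (auto simp: weights_def half_nats_def)
  have "n \<le> s" "s < n + 1" using weights_shift[OF assms(2)] assms(3) by auto
  then have "i \<le> j" "j < i + 1" using ij by linarith+
  then show ?thesis using ij by simp
qed

lemma qnum_identity:
  assumes "0 < q"
  shows "qnum q (a + 1) * qnum q b - qnum q a * qnum q (b + 1) = qnum q (b - a)"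
proof -
  define A B where "A = q powr a" and "B = q powr b"
  have AB: "A > 0" "B > 0" using assms by (auto simp: A_def B_def)
  have e: "q powr (a + 1) = A * q" "q powr - (a + 1) = 1 / (A * q)" "q powr (b + 1) = B * q"
    "q powr - (b + 1) = 1 / (B * q)" "q powr - a = 1 / A" "q powr - b = 1 / B"
    "q powr (b - a) = B / A" "q powr - (b - a) = A / B"
    using assms by (simp_all add: A_def B_def powr_add powr_diff powr_minus_divide del: minus_diff_eq minus_add_distrib)
  show ?thesis
  proof (cases "q - 1 / q = 0")
    case False
    define r where "r = q - 1 / q"
    have *: "X / r * (Y / r) - Z / r * (V / r) = N / r" if "X * Y - Z * V = N * r" for X Y Z V N
    proof -
      have "X / r * (Y / r) - Z / r * (V / r) = (X * Y - Z * V) / (r * r)"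
        by (simp add: diff_divide_distrib)
      then show ?thesis using that False by (simp add: r_def)
    qed
    have "(A * q - 1 / (A * q)) / r * ((B - 1 / B) / r) - (A - 1 / A) / r * ((B * q - 1 / (B * q)) / r) =
          (B / A - A / B) / r"
      using AB assms by (intro *) (simp add: r_def field_simps)
    then show ?thesis unfolding qnum_def e A_def[symmetric] B_def[symmetric] r_def .
  qed (simp add: qnum_def)
qed

lemma rep_relations:
  assumes "0 < q" "q < 1" "s \<in> half_nats"
  shows "rep q s [GK, Ge] m n = q * rep q s [Ge, GK] m n"
    and "rep q s [GK, Gf] m n = inverse q * rep q s [Gf, GK] m n"
    and "rep q s [Ge, Gf] m n - rep q s [Gf, Ge] m n =
           (rep q s [GK, GK] m n - rep q s [GKinv, GKinv] m n) / (q - 1 / q)"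
    and "rep q s [GK, GKinv] m n = rep q s [] m n"
    and "rep q s [GKinv, GK] m n = rep q s [] m n"
proof -
  show "rep q s [GK, Ge] m n = q * rep q s [Ge, GK] m n"
    "rep q s [GK, Gf] m n = inverse q * rep q s [Gf, GK] m n"
    "rep q s [GK, GKinv] m n = rep q s [] m n"
    "rep q s [GKinv, GK] m n = rep q s [] m n"
    using assms(1) unfolding rep_two_cases
    by (auto simp: rep_gen_def powr_add powr_diff powr_minus field_simps)
  show "rep q s [Ge, Gf] m n - rep q s [Gf, Ge] m n =
           (rep q s [GK, GK] m n - rep q s [GKinv, GKinv] m n) / (q - 1 / q)"
  proof (cases "m = n \<and> n \<in> weights s")
    case True
    note W = weights_ge[of n s] weights_le[of n s]
    have nn: "0 \<le> qnum q (s - n)" "0 \<le> qnum q (s + n + 1)" "0 \<le> qnum q (s - n + 1)" "0 \<le> qnum q (s + n)"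
      using True W assms by (auto intro!: qnum_nonneg)
    have z: "qnum q 0 = 0" using assms by (simp add: qnum_def)
    have "rep q s [Ge, Gf] m n = qnum q (s - n + 1) * qnum q (s + n)"
    proof (cases "n - 1 \<in> weights s")
      case T: True
      then show ?thesis using True nn unfolding rep_two_cases
        by (simp add: rep_gen_def algebra_simps flip: real_sqrt_mult)
    next
      case False
      then have "n = - s" using weights_pred True by blast
      then show ?thesis using False z unfolding rep_two_cases by (simp add: rep_gen_def)
    qed
    moreover have "rep q s [Gf, Ge] m n = qnum q (s - n) * qnum q (s + n + 1)"
    proof (cases "n + 1 \<in> weights s")
      case T: True
      then show ?thesis using True nn unfolding rep_two_cases
        by (simp add: rep_gen_def algebra_simps flip: real_sqrt_mult)
    next
      case False
      then have "n = s" using weights_max assms True by blast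
      then show ?thesis using False z unfolding rep_two_cases by (simp add: rep_gen_def)
    qed
    moreover have "qnum q ((s + n) - (s - n)) =
        (rep q s [GK, GK] m n - rep q s [GKinv, GKinv] m n) / (q - 1 / q)"
      using True unfolding rep_two_cases by (simp add: rep_gen_def qnum_def flip: powr_add)
    ultimately show ?thesis using qnum_identity[OF assms(1), of "s - n" "s + n"] by simp
  qed (unfold rep_two_cases, auto simp: rep_gen_def)
qed

lemma tcoef_middle:
  "tcoef q s m n (x @ w @ y) = (\<Sum>a\<in>weights s. \<Sum>b\<in>weights s.
     complex_of_real (rep q s x m a) * tcoef q s a b w * complex_of_real (rep q s y b n))"
  unfolding tcoef_def rep_append by (simp add: sum_distrib_left mult.assoc)

lemma tcoef_in_Uq_dual:
  assumes "0 < q" "q < 1" "s \<in> half_nats"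
  shows "tcoef q s m n \<in> Uq_dual q"
proof -
  note R = rep_relations[OF assms]
  have 1: "tcoef q s a b [GK, Ge] = q * tcoef q s a b [Ge, GK]"
    "tcoef q s a b [GK, Gf] = inverse q * tcoef q s a b [Gf, GK]"
    "tcoef q s a b [GK, GKinv] = tcoef q s a b []"
    "tcoef q s a b [GKinv, GK] = tcoef q s a b []" for a b
    unfolding tcoef_def R by simp_all
  have 2: "tcoef q s a b [Ge, Gf] = tcoef q s a b [Gf, Ge] +
        (tcoef q s a b [GK, GK] - tcoef q s a b [GKinv, GKinv]) / (q - 1 / q)" for a b
    using R(3)[of a b, THEN arg_cong[where f = complex_of_real]]
    unfolding tcoef_def by (simp add: algebra_simps)
  have tcoef_0: "tcoef q s m n (x @ y) = (\<Sum>a\<in>weights s. \<Sum>b\<in>weights s.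
     complex_of_real (rep q s x m a) * tcoef q s a b [] * complex_of_real (rep q s y b n))" for x y
    using tcoef_middle[of q s m n x "[]" y] by simp
  show ?thesis
    unfolding Uq_dual_def mem_Collect_eq
  proof (intro allI conjI)
    fix x y
    show "tcoef q s m n (x @ [GK, Ge] @ y) = complex_of_real q * tcoef q s m n (x @ [Ge, GK] @ y)"
      unfolding tcoef_middle 1 by (simp add: sum_distrib_left mult_ac)
    show "tcoef q s m n (x @ [GK, Gf] @ y) = complex_of_real (inverse q) * tcoef q s m n (x @ [Gf, GK] @ y)"
      unfolding tcoef_middle 1 by (simp add: sum_distrib_left mult_ac)
    show "tcoef q s m n (x @ [Ge, Gf] @ y) - tcoef q s m n (x @ [Gf, Ge] @ y) =
        (tcoef q s m n (x @ [GK, GK] @ y) - tcoef q s m n (x @ [GKinv, GKinv] @ y)) / complex_of_real (q - 1 / q)"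
      unfolding tcoef_middle 2
      by (simp add: sum_divide_distrib distrib_left distrib_right diff_divide_distrib
          left_diff_distrib right_diff_distrib sum.distrib sum_subtractf)
    show "tcoef q s m n (x @ [GK, GKinv] @ y) = tcoef q s m n (x @ y)"
      unfolding tcoef_middle[of _ _ _ _ x "[GK, GKinv]" y] tcoef_0[of x y] 1 ..
    show "tcoef q s m n (x @ [GKinv, GK] @ y) = tcoef q s m n (x @ y)"
      unfolding tcoef_middle[of _ _ _ _ x "[GKinv, GK]" y] tcoef_0[of x y] 1 ..
  qed
qed

lemma Uq_dualD:
  assumes "\<phi> \<in> Uq_dual q"
  shows "\<phi> (x @ GK # Ge # y) = complex_of_real q * \<phi> (x @ Ge # GK # y)"
    and "\<phi> (x @ GK # Gf # y) = complex_of_real (inverse q) * \<phi> (x @ Gf # GK # y)"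
    and "\<phi> (x @ Ge # Gf # y) = \<phi> (x @ Gf # Ge # y) +
           (\<phi> (x @ GK # GK # y) - \<phi> (x @ GKinv # GKinv # y)) / complex_of_real (q - 1 / q)"
    and "\<phi> (x @ GK # GKinv # y) = \<phi> (x @ y)"
    and "\<phi> (x @ GKinv # GK # y) = \<phi> (x @ y)"
proof -
  have "\<forall>x y.
     \<phi> (x @ [GK, Ge] @ y) = complex_of_real q * \<phi> (x @ [Ge, GK] @ y) \<and>
     \<phi> (x @ [GK, Gf] @ y) = complex_of_real (inverse q) * \<phi> (x @ [Gf, GK] @ y) \<and>
     \<phi> (x @ [Ge, Gf] @ y) - \<phi> (x @ [Gf, Ge] @ y) =
       (\<phi> (x @ [GK, GK] @ y) - \<phi> (x @ [GKinv, GKinv] @ y)) / complex_of_real (q - 1 / q) \<and>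
     \<phi> (x @ [GK, GKinv] @ y) = \<phi> (x @ y) \<and>
     \<phi> (x @ [GKinv, GK] @ y) = \<phi> (x @ y)"
    using assms unfolding Uq_dual_def mem_Collect_eq .
  note * = this[rule_format, of x y, unfolded append_Cons append_Nil]
  show "\<phi> (x @ GK # Ge # y) = complex_of_real q * \<phi> (x @ Ge # GK # y)"
    "\<phi> (x @ GK # Gf # y) = complex_of_real (inverse q) * \<phi> (x @ Gf # GK # y)"
    "\<phi> (x @ GK # GKinv # y) = \<phi> (x @ y)"
    "\<phi> (x @ GKinv # GK # y) = \<phi> (x @ y)"
    using * by blast+
  have "\<phi> (x @ Ge # Gf # y) - \<phi> (x @ Gf # Ge # y) =
       (\<phi> (x @ GK # GK # y) - \<phi> (x @ GKinv # GKinv # y)) / complex_of_real (q - 1 / q)"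
    using * by blast
  then show "\<phi> (x @ Ge # Gf # y) = \<phi> (x @ Gf # Ge # y) +
       (\<phi> (x @ GK # GK # y) - \<phi> (x @ GKinv # GKinv # y)) / complex_of_real (q - 1 / q)"
    by (metis add.commute diff_add_cancel)
qed

lemma Uq_dual_Kinv:
  assumes "\<phi> \<in> Uq_dual q" "q \<noteq> 0"
  shows "\<phi> (x @ GKinv # Ge # y) = complex_of_real (inverse q) * \<phi> (x @ Ge # GKinv # y)"
    and "\<phi> (x @ GKinv # Gf # y) = complex_of_real q * \<phi> (x @ Gf # GKinv # y)"
proof -
  note K = Uq_dualD[OF assms(1)]
  have "\<phi> (x @ Ge # GKinv # y) = complex_of_real q * \<phi> (x @ GKinv # Ge # y)"
    using K(5)[of x "Ge # GKinv # y"] K(1)[of "x @ [GKinv]" "GKinv # y"]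
      K(4)[of "x @ [GKinv, Ge]" y] by simp
  then show "\<phi> (x @ GKinv # Ge # y) = complex_of_real (inverse q) * \<phi> (x @ Ge # GKinv # y)"
    using assms(2) by simp
  have "\<phi> (x @ Gf # GKinv # y) = complex_of_real (inverse q) * \<phi> (x @ GKinv # Gf # y)"
    using K(5)[of x "Gf # GKinv # y"] K(2)[of "x @ [GKinv]" "GKinv # y"]
      K(4)[of "x @ [GKinv, Gf]" y] by simp
  then show "\<phi> (x @ GKinv # Gf # y) = complex_of_real q * \<phi> (x @ Gf # GKinv # y)"
    using assms(2) by simp
qed

lemma sum_coprod_Cons:
  "(\<Sum>(a, b)\<leftarrow>coprod (g # w). F a b) =
     (\<Sum>(a, b)\<leftarrow>coprod_gen g. \<Sum>(a', b')\<leftarrow>coprod w. (F (a @ a') (b @ b') :: complex))"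
  by (cases g) (simp_all add: split_def o_def)

lemma sum_coprod_append:
  "(\<Sum>(a, b)\<leftarrow>coprod (u @ v). F a b) =
     (\<Sum>(a, b)\<leftarrow>coprod u. \<Sum>(a', b')\<leftarrow>coprod v. (F (a @ a') (b @ b') :: complex))"
proof (induction u arbitrary: F)
  case (Cons g u)
  show ?case
    unfolding append_Cons sum_coprod_Cons Cons.IH by (simp add: split_def)
qed simp

lemma fmult_middle:
  "fmult f g (x @ w @ y) =
     (\<Sum>(a, b)\<leftarrow>coprod x. \<Sum>(u, v)\<leftarrow>coprod w. \<Sum>(c, d)\<leftarrow>coprod y.
        f (a @ u @ c) * g (b @ v @ d))"
  unfolding fmult_def sum_coprod_append ..

lemma fmult_in_Uq_dual:
  assumes "f \<in> Uq_dual q" "g \<in> Uq_dual q" "q \<noteq> 0"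
  shows "fmult f g \<in> Uq_dual q"
proof -
  note Rf = Uq_dualD[OF assms(1)] Uq_dual_Kinv[OF assms(1,3)]
    and Rg = Uq_dualD[OF assms(2)] Uq_dual_Kinv[OF assms(2,3)]
  define T where "T w = (\<lambda>(a, b) (c, d). \<Sum>(u, v)\<leftarrow>coprod w. f (a @ u @ c) * g (b @ v @ d))" for w
  have swap: "(\<Sum>p\<leftarrow>xs. \<Sum>r\<leftarrow>ys. F p r) = (\<Sum>r\<leftarrow>ys. \<Sum>p\<leftarrow>xs. (F p r :: complex))"
    for F and xs ys :: "(generator list \<times> generator list) list"
    by (induction xs) (simp_all add: sum_list_addf)
  have M: "fmult f g (x @ w @ y) = (\<Sum>p\<leftarrow>coprod x. \<Sum>r\<leftarrow>coprod y. T w p r)" for x w y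
    unfolding fmult_middle T_def split_def by (subst swap) (rule refl)
  have T1: "T [GK, Ge] p r = complex_of_real q * T [Ge, GK] p r" for p r
    by (cases p; cases r) (simp add: T_def Rf Rg distrib_left mult.left_commute del: of_real_inverse)
  have T2: "T [GK, Gf] p r = complex_of_real (inverse q) * T [Gf, GK] p r" for p r
    by (cases p; cases r) (simp add: T_def Rf Rg distrib_left mult.left_commute del: of_real_inverse)
  have T3: "T [Ge, Gf] p r = T [Gf, Ge] p r +
      (T [GK, GK] p r - T [GKinv, GKinv] p r) / complex_of_real (q - 1 / q)" for p r
  proof (cases p; cases r)
    fix a b c d assume pr: "p = (a, b)" "r = (c, d)"
    define k where "k = complex_of_real (q - 1 / q)"
    define Q where "Q = complex_of_real q"
    define Q' where "Q' = complex_of_real (inverse q)"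
    have "(f1 + (f2 - f3) * i) * g2 + f3 * (g1 + (g2 - g3) * i) =
        f1 * g2 + (f3 * g1 + (f2 * g2 - f3 * g3) * i)" for f1 f2 f3 g1 g2 g3 i :: complex
      by (simp add: algebra_simps)
    then have ring: "(f1 + (f2 - f3) / k) * g2 + f3 * (g1 + (g2 - g3) / k) =
        f1 * g2 + (f3 * g1 + (f2 * g2 - f3 * g3) / k)" for f1 f2 f3 g1 g2 g3
      unfolding divide_inverse .
    show ?thesis
      unfolding pr T_def prod.case
      apply (simp add: Rf Rg k_def[symmetric] Q_def[symmetric] Q'_def[symmetric]
          del: of_real_inverse of_real_diff of_real_divide)
      apply (rule ring)
      done
  qed
  have T4: "T [GK, GKinv] p r = T [] p r" "T [GKinv, GK] p r = T [] p r" for p r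
    by (cases p; cases r; simp add: T_def Rf Rg)+
  have M0: "fmult f g (x @ y) = (\<Sum>p\<leftarrow>coprod x. \<Sum>r\<leftarrow>coprod y. T [] p r)" for x y
    using M[of x "[]" y] by simp
  show ?thesis
    unfolding Uq_dual_def mem_Collect_eq
  proof (intro allI conjI)
    fix x y
    show "fmult f g (x @ [GK, Ge] @ y) = complex_of_real q * fmult f g (x @ [Ge, GK] @ y)"
      unfolding M T1 by (simp only: sum_list_const_mult)
    show "fmult f g (x @ [GK, Gf] @ y) = complex_of_real (inverse q) * fmult f g (x @ [Gf, GK] @ y)"
      unfolding M T2 by (simp only: sum_list_const_mult)
    show "fmult f g (x @ [Ge, Gf] @ y) - fmult f g (x @ [Gf, Ge] @ y) =
        (fmult f g (x @ [GK, GK] @ y) - fmult f g (x @ [GKinv, GKinv] @ y)) / complex_of_real (q - 1 / q)"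
      unfolding M T3
      by (simp only: sum_list_addf sum_list_subtractf divide_inverse sum_list_mult_const
          add_diff_cancel_left')
    show "fmult f g (x @ [GK, GKinv] @ y) = fmult f g (x @ y)"
      unfolding M[of x "[GK, GKinv]" y] M0[of x y] T4 ..
    show "fmult f g (x @ [GKinv, GK] @ y) = fmult f g (x @ y)"
      unfolding M[of x "[GKinv, GK]" y] M0[of x y] T4 ..
  qed
qed

lemma fstar_in_Uq_dual:
  assumes "f \<in> Uq_dual q" "q \<noteq> 0"
  shows "fstar q f \<in> Uq_dual q"
proof -
  define \<sigma> where "\<sigma> = map (\<lambda>g. star_gen (antipode_gen g))"
  define P where "P = antipode_word_coeff q"
  have sig: "star_word (antipode_word w) = \<sigma> w" for w
    by (simp add: star_word_def antipode_word_def \<sigma>_def rev_map o_def)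
  have M: "fstar q f (x @ w @ y) = P x * P y * (P w * cnj (f (\<sigma> x @ \<sigma> w @ \<sigma> y)))" for x w y
    by (simp add: fstar_def sig P_def antipode_word_coeff_def \<sigma>_def mult_ac)
  have M0: "fstar q f (x @ y) = P x * P y * cnj (f (\<sigma> x @ \<sigma> y))" for x y
    using M[of x "[]" y] by (simp add: P_def antipode_word_coeff_def \<sigma>_def)
  have S: "\<sigma> [a, b] = [star_gen (antipode_gen a), star_gen (antipode_gen b)]"
    "P [a, b] = antipode_coeff q a * antipode_coeff q b" for a b
    by (simp_all add: \<sigma>_def P_def antipode_word_coeff_def)
  note R = Uq_dualD[OF assms(1)] Uq_dual_Kinv[OF assms]
  have qq: "complex_of_real q * complex_of_real (inverse q) = 1"
    using assms(2) by (simp flip: of_real_mult)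
  show ?thesis
    unfolding Uq_dual_def mem_Collect_eq
  proof (intro allI conjI)
    fix x y
    show "fstar q f (x @ [GK, Ge] @ y) = complex_of_real q * fstar q f (x @ [Ge, GK] @ y)"
      unfolding M S by (simp add: R)
    show "fstar q f (x @ [GK, Gf] @ y) = complex_of_real (inverse q) * fstar q f (x @ [Gf, GK] @ y)"
      unfolding M S by (simp add: R)
    show "fstar q f (x @ [GK, GKinv] @ y) = fstar q f (x @ y)"
      "fstar q f (x @ [GKinv, GK] @ y) = fstar q f (x @ y)"
      unfolding M[of x "[GK, GKinv]" y] M[of x "[GKinv, GK]" y] M0[of x y] S by (simp_all add: R)
    define X where "X = \<sigma> x"
    define Y where "Y = \<sigma> y"
    define r where "r = complex_of_real (q - 1 / q)"
    have r: "cnj r = r" by (simp add: r_def)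
    have "P [Ge, Gf] = 1" "P [Gf, Ge] = 1" "P [GK, GK] = 1" "P [GKinv, GKinv] = 1"
      unfolding S using qq by (simp_all add: mult.commute)
    then show "fstar q f (x @ [Ge, Gf] @ y) - fstar q f (x @ [Gf, Ge] @ y) =
        (fstar q f (x @ [GK, GK] @ y) - fstar q f (x @ [GKinv, GKinv] @ y)) / complex_of_real (q - 1 / q)"
      unfolding M S(1) X_def[symmetric] Y_def[symmetric]
      using R(3)[of X Y] unfolding r_def[symmetric]
      by (simp add: r right_diff_distrib diff_divide_distrib distrib_left)
  qed
qed

definition SU2q :: "real \<Rightarrow> functional star_algebra" where
  "SU2q q =
     \<lparr>carrier = functional.span
        {tcoef q s m n | s m n. s \<in> half_nats \<and> m \<in> weights s \<and> n \<in> weights s},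
      monoid.mult = fmult, one = tcoef q 0 0 0, zero = 0, add = (+),
      smult = fscale, star = fstar q\<rparr>"

definition alpha :: "real \<Rightarrow> functional" where
  "alpha q = tcoef q (1/2) (1/2) (1/2)"

definition beta :: "real \<Rightarrow> functional" where
  "beta q = tcoef q (1/2) (1/2) (- 1/2)"

definition haar :: "real \<Rightarrow> functional \<Rightarrow> complex" where
  "haar q = (SOME h.
     (\<forall>a\<in>carrier (SU2q q). \<forall>b\<in>carrier (SU2q q). h (a + b) = h a + h b) \<and>
     (\<forall>c. \<forall>a\<in>carrier (SU2q q). h (fscale c a) = c * h a) \<and>
     h \<one>\<^bsub>SU2q q\<^esub> = 1 \<and>
     (\<forall>s\<in>half_nats. s > 0 \<longrightarrow> (\<forall>m\<in>weights s. \<forall>n\<in>weights s. h (tcoef q s m n) = 0)))"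


section \<open>Coaction and weighted projective spaces\<close>

text \<open>
  The tensor product with the Laurent polynomials in the unitary \<open>u\<close>: the function \<open>P\<close> stands for
  the sum over \<open>i\<close> of \<open>P i \<otimes> u\<^sup>i\<close>, and \<open>umono p x\<close> for \<open>x \<otimes> u\<^sup>p\<close>.
\<close>

definition umono :: "int \<Rightarrow> 'a::zero \<Rightarrow> int \<Rightarrow> 'a" where
  "umono p x = (\<lambda>i. if i = p then x else 0)"

definition SU2q_B :: "real \<Rightarrow> (int \<Rightarrow> functional) star_algebra" where
  "SU2q_B q =
     \<lparr>carrier = {P. finite {i. P i \<noteq> 0} \<and> (\<forall>i. P i \<in> carrier (SU2q q))},
      monoid.mult = (\<lambda>P R i. \<Sum>j | P j \<noteq> 0. fmult (P j) (R (i - j))),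
      one = umono 0 \<one>\<^bsub>SU2q q\<^esub>, zero = 0, add = (+),
      smult = (\<lambda>c P i. fscale c (P i)), star = (\<lambda>P i. fstar q (P (- i)))\<rparr>"

text \<open>Unique on the carrier, as \<open>alpha q\<close> and \<open>beta q\<close> generate the star-algebra \<open>SU2q q\<close>.\<close>

definition coaction :: "real \<Rightarrow> nat \<Rightarrow> nat \<Rightarrow> functional \<Rightarrow> int \<Rightarrow> functional" where
  "coaction q k l = (SOME \<theta>.
     star_hom (SU2q q) (SU2q_B q) \<theta> \<and>
     \<theta> (alpha q) = umono (- int k) (alpha q) \<and>
     \<theta> (beta q) = umono (int l) (beta q))"

definition WPq :: "real \<Rightarrow> nat \<Rightarrow> nat \<Rightarrow> functional star_algebra" where
  "WPq q k l = (SU2q q)\<lparr>carrier := {t \<in> carrier (SU2q q). coaction q k l t = umono 0 t}\<rparr>"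

text \<open>
  Tensor products with the spin one half module are pairs: \<open>(a, b)\<close> stands for
  \<open>a \<otimes> e\<^sub>+ + b \<otimes> e\<^sub>-\<close>.  The shifts of \<open>i\<close> are the multiplications by \<open>u\<^sup>-\<^sup>k\<close> and \<open>u\<^sup>l\<close>.
\<close>

definition spinor_coaction ::
  "real \<Rightarrow> nat \<Rightarrow> nat \<Rightarrow> functional \<times> functional \<Rightarrow> int \<Rightarrow> functional \<times> functional" where
  "spinor_coaction q k l = (\<lambda>(a, b) i. (coaction q k l a (i + int k), coaction q k l b (i - int l)))"

definition coinvariant_spinors :: "real \<Rightarrow> nat \<Rightarrow> nat \<Rightarrow> (functional \<times> functional) set" where
  "coinvariant_spinors q k l =
     {w \<in> carrier (SU2q q) \<times> carrier (SU2q q). spinor_coaction q k l w = umono 0 w}"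


section \<open>Hilbert spaces and Dirac operator\<close>

text \<open>
  \<open>\<eta>\<close> exhibits the type \<open>'h\<close> as a Hilbert space completion of \<open>SU2q q\<close> in the inner product given
  by the Haar state; a completion is unique up to unitary equivalence.
\<close>

definition is_L2_completion :: "real \<Rightarrow> (functional \<Rightarrow> 'h::complex_hilbert) \<Rightarrow> bool" where
  "is_L2_completion q \<eta> \<longleftrightarrow>
     (\<forall>a\<in>carrier (SU2q q). \<forall>b\<in>carrier (SU2q q). \<eta> (a + b) = \<eta> a + \<eta> b) \<and>
     (\<forall>c. \<forall>a\<in>carrier (SU2q q). \<eta> (fscale c a) = scaleC c (\<eta> a)) \<and>
     (\<forall>a\<in>carrier (SU2q q). \<forall>b\<in>carrier (SU2q q).
        cinner (\<eta> a) (\<eta> b) = haar q (fmult (fstar q a) b)) \<and>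
     closure (\<eta> ` carrier (SU2q q)) = UNIV"

text \<open>The continuous extension of \<open>\<eta> b \<mapsto> \<eta> (a b)\<close>.\<close>

definition gns :: "real \<Rightarrow> (functional \<Rightarrow> 'h::complex_hilbert) \<Rightarrow> functional \<Rightarrow> 'h \<Rightarrow> 'h" where
  "gns q \<eta> a = (THE T. continuous_on UNIV T \<and> (\<forall>b\<in>carrier (SU2q q). T (\<eta> b) = \<eta> (fmult a b)))"

definition spinor_rep ::
  "real \<Rightarrow> (functional \<Rightarrow> 'h::complex_hilbert) \<Rightarrow> functional \<Rightarrow> 'h \<times> 'h \<Rightarrow> 'h \<times> 'h" where
  "spinor_rep q \<eta> a = (\<lambda>(x, y). (gns q \<eta> a x, gns q \<eta> a y))"

definition H_theta ::
  "real \<Rightarrow> nat \<Rightarrow> nat \<Rightarrow> (functional \<Rightarrow> 'h::complex_hilbert) \<Rightarrow> ('h \<times> 'h) set" where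
  "H_theta q k l \<eta> = closure (map_prod \<eta> \<eta> ` coinvariant_spinors q k l)"

definition CGC :: "real \<Rightarrow> real \<Rightarrow> real \<Rightarrow> real" where
  "CGC q j \<mu> = q powr (- (j + \<mu>) / 2) * (sqrt (qnum q (j - \<mu>)) / sqrt (qnum q (2 * j)))"

definition CGS :: "real \<Rightarrow> real \<Rightarrow> real \<Rightarrow> real" where
  "CGS q j \<mu> = q powr ((j - \<mu>) / 2) * (sqrt (qnum q (j + \<mu>)) / sqrt (qnum q (2 * j)))"

definition ket_down ::
  "real \<Rightarrow> (functional \<Rightarrow> 'h::complex_hilbert) \<Rightarrow> real \<Rightarrow> real \<Rightarrow> real \<Rightarrow> 'h \<times> 'h" where
  "ket_down q \<eta> j m \<mu> =
     (q powr m * sqrt (qnum q (2 * (j - 1/2) + 1))) *\<^sub>R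
       (CGS q j \<mu> *\<^sub>R \<eta> (tcoef q (j - 1/2) m (\<mu> - 1/2)),
        CGC q j \<mu> *\<^sub>R \<eta> (tcoef q (j - 1/2) m (\<mu> + 1/2)))"

definition ket_up ::
  "real \<Rightarrow> (functional \<Rightarrow> 'h::complex_hilbert) \<Rightarrow> real \<Rightarrow> real \<Rightarrow> real \<Rightarrow> 'h \<times> 'h" where
  "ket_up q \<eta> j m \<mu> =
     (q powr m * sqrt (qnum q (2 * (j + 1/2) + 1))) *\<^sub>R
       (CGC q (j + 1) \<mu> *\<^sub>R \<eta> (tcoef q (j + 1/2) m (\<mu> - 1/2)),
        (- CGS q (j + 1) \<mu>) *\<^sub>R \<eta> (tcoef q (j + 1/2) m (\<mu> + 1/2)))"

definition dirac :: "real \<Rightarrow> (functional \<Rightarrow> 'h::complex_hilbert) \<Rightarrow> (('h \<times> 'h) \<times> ('h \<times> 'h)) set" where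
  "dirac q \<eta> = (THE D.
     self_adjoint_on UNIV D \<and>
     (\<forall>j\<in>half_nats. \<forall>m\<in>weights (j + 1/2). \<forall>\<mu>\<in>weights j.
        (ket_up q \<eta> j m \<mu>, (2 * j + 3/2) *\<^sub>R ket_up q \<eta> j m \<mu>) \<in> D) \<and>
     (\<forall>j\<in>half_nats. j > 0 \<longrightarrow> (\<forall>m\<in>weights (j - 1/2). \<forall>\<mu>\<in>weights j.
        (ket_down q \<eta> j m \<mu>, - (2 * j + 1/2) *\<^sub>R ket_down q \<eta> j m \<mu>) \<in> D)))"

definition dirac_theta ::
  "real \<Rightarrow> nat \<Rightarrow> nat \<Rightarrow> (functional \<Rightarrow> 'h::complex_hilbert) \<Rightarrow> (('h \<times> 'h) \<times> ('h \<times> 'h)) set" where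
  "dirac_theta q k l \<eta> =
     {(x, y + (1/2) *\<^sub>R x) | x y. (x, y) \<in> dirac q \<eta> \<and> x \<in> H_theta q k l \<eta>}"

end

theory Submission
  imports Defs
begin

text \<open>
  The algebra is generated by the four coefficients \<open>T 1 a b\<close> of spin one half. Multiplication
  by one of them changes the spin of a matrix coefficient by one half, up or down, with
  explicit Clebsch-Gordan numbers (\<open>product_T\<close>). The properties of the algebra follow from
  this rule: closure under products and generation (\<open>QA_mult\<close>, \<open>QA_induct\<close>), orthogonality of
  the matrix coefficients for the Haar state (\<open>IP_T\<close>), and, with the unitarity of the spin one
  half matrix, boundedness of the GNS representation (\<open>T1_contraction\<close>, \<open>left_mult_bounded\<close>).

  The coaction is a \<open>\<int>\<close>-grading for which every matrix coefficient is homogeneous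
  (\<open>coaction_comp\<close>). The algebra of the weighted projective space is the part of degree zero,
  and the coinvariant spinors are the pairs with components of degrees \<open>k\<close> and \<open>- l\<close>
  (\<open>WPq_eq\<close>, \<open>coinvariant_spinors_eq\<close>). The eigenvectors \<open>ket\<close> of the Dirac operator are
  homogeneous for the coaction on spinors, and those of degree zero form an orthonormal basis
  of \<open>H_theta\<close> (\<open>coinv_image_span\<close>). In this basis \<open>D + 1/2\<close> is diagonal with eigenvalues
  \<open>\<plusminus>(n + 1)\<close>, where \<open>n/2\<close> is the spin, and with finite multiplicities (\<open>dirac_theta_diag\<close>).
  Hence it is self-adjoint and invertible with compact inverse, by general facts on diagonal
  operators.

  By the Leibniz rule, the commutators need to be bounded for the generators only. Let \<open>F\<close> be
  the sign of \<open>D + 1/2\<close>. A generator changes \<open>\<bar>D + 1/2\<bar> = n + 1\<close> by one, so what matters is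
  that \<open>(n + 1) [F, a]\<close> is bounded. For each spin and row the columns \<open>c\<close> of the
  \<open>e\<^sub>+\<close>-component and \<open>c + 1\<close> of the \<open>e\<^sub>-\<close>-component form a pair that is stable under \<open>F\<close>, and
  \<open>F\<close> acts on it as a reflection, which is the identity on \<open>e\<^sub>+\<close> and minus the identity on
  \<open>e\<^sub>-\<close> up to an error of order \<open>q\<^sup>n\<^sup>-\<^sup>c\<close>. The matrix entries of \<open>a\<close> in the column index
  either keep \<open>n - c\<close>, and then differ from one by order \<open>q\<^sup>c\<close>, or change it, and then are of
  order \<open>q\<^sup>c\<close>. In both cases \<open>[F, a]\<close> has entries of order \<open>q\<^sup>n\<close> (\<open>same_position_bound\<close>,
  \<open>moved_position_bound\<close>), which outweighs the factor \<open>n + 1\<close>. A commutator is a sum of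
  finitely many weighted shifts of an orthonormal basis, so bounded entries suffice
  (\<open>shift_family_bound\<close>, \<open>T1_commutator\<close>).

  The representation is faithful since the coinvariant spinor with components \<open>T 1 0 0\<close> and
  \<open>T 1 0 1\<close> determines an element of the algebra through its quantum determinant
  (\<open>U0_left_cancel\<close>).

  Finally, vanishing of the degree is a linear equation for row and column. For each of the
  \<open>n + 1\<close> rows it has at most one column as solution, so the multiplicity of an eigenvalue \<open>e\<close>
  is at most \<open>\<bar>e\<bar>\<close>; and for \<open>e = 2 p\<close> an explicit line of solutions gives at least
  \<open>p / (k + l)\<close>. The sum of multiplicities over \<open>e\<^sup>2\<close> therefore lies between two multiples of
  harmonic sums, that is, of the logarithm (\<open>eigenvalue_sum_bigtheta\<close>).
\<close>

section \<open>Functionals on words as a star-algebra\<close>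

definition lshift :: "generator \<Rightarrow> functional \<Rightarrow> functional" where
  "lshift g f = (\<lambda>w. f (g # w))"

lemma fscale_apply [simp]: "fscale c f w = c * f w"
  by (simp add: fscale_def)

lemma lshift_linear [simp]:
  "lshift g (a + b) = lshift g a + lshift g b"
  "lshift g (fscale c a) = fscale c (lshift g a)"
  "lshift g 0 = 0"
  by (auto simp: lshift_def fscale_def)

lemma fmult_Nil: "fmult f g [] = f [] * g []"
  by (simp add: fmult_def)

lemma lshift_fmult:
  "lshift Ge (fmult f g) = fmult (lshift Ge f) (lshift GK g) + fmult (lshift GKinv f) (lshift Ge g)"
  "lshift Gf (fmult f g) = fmult (lshift Gf f) (lshift GK g) + fmult (lshift GKinv f) (lshift Gf g)"
  "lshift GK (fmult f g) = fmult (lshift GK f) (lshift GK g)"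
  "lshift GKinv (fmult f g) = fmult (lshift GKinv f) (lshift GKinv g)"
  unfolding lshift_def fmult_def sum_coprod_Cons by (simp_all add: fun_eq_iff)

lemma fmult_add_left: "fmult (f + g) h = fmult f h + fmult g h"
  by (simp add: fmult_def fun_eq_iff split_def distrib_right sum_list_addf)

lemma fmult_add_right: "fmult h (f + g) = fmult h f + fmult h g"
  by (simp add: fmult_def fun_eq_iff split_def distrib_left sum_list_addf)

lemma fmult_scale_left: "fmult (fscale c f) g = fscale c (fmult f g)"
  by (simp add: fmult_def fun_eq_iff split_def fscale_def sum_list_const_mult[symmetric] mult.assoc)

lemma fmult_scale_right: "fmult f (fscale c g) = fscale c (fmult f g)"
  by (simp add: fmult_def fun_eq_iff split_def fscale_def sum_list_const_mult[symmetric] mult.left_commute)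

lemma fmult_zero [simp]: "fmult 0 f = 0" "fmult f 0 = 0"
  by (simp_all add: fmult_def fun_eq_iff split_def)

lemma fmult_sum_left: "fmult (\<Sum>i\<in>I. f i) g = (\<Sum>i\<in>I. fmult (f i) g)"
  by (induction I rule: infinite_finite_induct) (simp_all only: sum.infinite sum.empty sum.insert fmult_zero fmult_add_left not_False_eq_True)

lemma fmult_sum_right: "fmult g (\<Sum>i\<in>I. f i) = (\<Sum>i\<in>I. fmult g (f i))"
  by (induction I rule: infinite_finite_induct) (simp_all only: sum.infinite sum.empty sum.insert fmult_zero fmult_add_right not_False_eq_True)

text \<open>
  The coproduct of a word splits off the coproduct of its first letter, so identities between
  products of functionals follow by induction on the word from their instances on generators,
  as long as the functionals are allowed to vary.
\<close>

lemma fmult_assoc: "fmult (fmult f g) h = fmult f (fmult g h)"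
proof
  show "fmult (fmult f g) h w = fmult f (fmult g h) w" for w
  proof (induction w arbitrary: f g h)
    case Nil
    then show ?case by (simp add: fmult_Nil)
  next
    case (Cons x w)
    have "lshift x (fmult (fmult f g) h) w = lshift x (fmult f (fmult g h)) w"
      by (cases x) (simp_all add: lshift_fmult fmult_add_left fmult_add_right Cons.IH add_ac)
    then show ?case by (simp add: lshift_def)
  qed
qed

text \<open>
  The unit for the product of functionals; it is the coefficient of the trivial module
  (\<open>T_000\<close> below).
\<close>

definition counit :: functional where
  "counit w = (if set w \<subseteq> {GK, GKinv} then 1 else 0)"

lemma lshift_counit:
  "lshift GK counit = counit" "lshift GKinv counit = counit"
  "lshift Ge counit = 0" "lshift Gf counit = 0"
  by (auto simp: lshift_def counit_def fun_eq_iff)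

lemma fmult_counit [simp]: "fmult counit f = f" "fmult f counit = f"
proof -
  have "fmult counit f w = f w \<and> fmult f counit w = f w" for w
  proof (induction w arbitrary: f)
    case Nil
    then show ?case by (simp add: fmult_Nil counit_def)
  next
    case (Cons x w)
    have "lshift x (fmult counit f) w = lshift x f w \<and> lshift x (fmult f counit) w = lshift x f w"
      by (cases x) (simp_all add: lshift_fmult lshift_counit Cons.IH)
    then show ?case by (simp add: lshift_def)
  qed
  then show "fmult counit f = f" "fmult f counit = f" by auto
qed

lemma fstar_add: "fstar q (f + g) = fstar q f + fstar q g"
  by (simp add: fstar_def fun_eq_iff distrib_left)

lemma fstar_scale: "fstar q (fscale c f) = fscale (cnj c) (fstar q f)"
  by (simp add: fstar_def fun_eq_iff fscale_def)

lemma fstar_zero [simp]: "fstar q 0 = 0"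
  by (simp add: fstar_def fun_eq_iff)

text \<open>
  The map \<open>x \<mapsto> S(x)\<^sup>*\<close> reverses the order of letters twice, so on functionals the star acts
  letter by letter.
\<close>

lemma lshift_fstar:
  "lshift g (fstar q f) =
     fscale (antipode_coeff q g) (fstar q (lshift (star_gen (antipode_gen g)) f))"
  by (cases g) (simp_all add: lshift_def fstar_def fscale_def fun_eq_iff antipode_word_coeff_def
      antipode_word_def star_word_def rev_map)

lemma fstar_Nil: "fstar q f [] = cnj (f [])"
  by (simp add: fstar_def antipode_word_coeff_def antipode_word_def star_word_def)

lemma fstar_fmult: "fstar q (fmult f g) = fmult (fstar q g) (fstar q f)"
proof
  show "fstar q (fmult f g) w = fmult (fstar q g) (fstar q f) w" for w
  proof (induction w arbitrary: f g)
    case Nil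
    then show ?case by (simp add: fmult_Nil fstar_Nil)
  next
    case (Cons x w)
    have "lshift x (fstar q (fmult f g)) w = lshift x (fmult (fstar q g) (fstar q f)) w"
      by (cases x) (simp_all add: lshift_fmult lshift_fstar fmult_scale_left fmult_scale_right
          fstar_add Cons.IH algebra_simps
          del: functional.scale_minus_left)
    then show ?case by (simp add: lshift_def)
  qed
qed

lemma fstar_fstar:
  assumes "q \<noteq> 0"
  shows "fstar q (fstar q f) = f"
proof
  show "fstar q (fstar q f) w = f w" for w
  proof (induction w arbitrary: f)
    case Nil
    then show ?case by (simp add: fstar_Nil)
  next
    case (Cons x w)
    have "lshift x (fstar q (fstar q f)) w = lshift x f w"
      using assms by (cases x) (simp_all add: lshift_fstar fstar_scale Cons.IH
          del: functional.scale_minus_left)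
    then show ?case by (simp add: lshift_def)
  qed
qed

text \<open>
  The algebraic laws hold for all functionals on words, so for a subspace only closure under
  the operations has to be checked.
\<close>

lemma unital_star_algebra_subspace:
  assumes sub: "functional.subspace C" and "counit \<in> C" "q \<noteq> 0"
    and mult: "\<And>x y. x \<in> C \<Longrightarrow> y \<in> C \<Longrightarrow> fmult x y \<in> C"
    and star: "\<And>x. x \<in> C \<Longrightarrow> fstar q x \<in> C"
  shows "unital_star_algebra \<lparr>carrier = C, monoid.mult = fmult, one = counit, zero = 0, add = (+),
      smult = fscale, star = fstar q\<rparr>"
proof -
  let ?A = "\<lparr>carrier = C, monoid.mult = fmult, one = counit, zero = 0, add = (+),
      smult = fscale, star = fstar q\<rparr>"
  have add: "x + y \<in> C" if "x \<in> C" "y \<in> C" for x y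
    using sub that by (simp add: functional.subspace_add)
  have scale: "fscale c x \<in> C" if "x \<in> C" for x c
    using sub that by (simp add: functional.subspace_scale)
  have zero: "0 \<in> C"
    using sub by (simp add: functional.subspace_0)
  have ab: "abelian_group ?A"
  proof (rule abelian_groupI)
    show "\<exists>y\<in>carrier ?A. y \<oplus>\<^bsub>?A\<^esub> x = \<zero>\<^bsub>?A\<^esub>" if "x \<in> carrier ?A" for x
      using that scale[of x "-1"] by (intro bexI[of _ "fscale (-1) x"]) (auto simp: fun_eq_iff)
  qed (use add zero in \<open>auto simp: add_ac\<close>)
  have "monoid ?A"
    by (rule monoidI) (use mult assms(2) in \<open>auto simp: fmult_assoc\<close>)
  then have ring: "Ring.ring ?A"
    by (intro ringI[OF ab]) (auto simp: fmult_add_left fmult_add_right)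
  have ab_c: "abelian_group complex_ring"
  proof (rule abelian_groupI)
    show "\<exists>y\<in>carrier complex_ring. y \<oplus>\<^bsub>complex_ring\<^esub> x = \<zero>\<^bsub>complex_ring\<^esub>" for x
      by (intro bexI[of _ "- x"]) (auto simp: complex_ring_def)
  qed (auto simp: complex_ring_def)
  have cr: "cring complex_ring"
    by (rule cringI[OF ab_c]) (auto simp: complex_ring_def algebra_simps
        intro!: comm_monoidI)
  have mod: "module complex_ring ?A"
    by (rule moduleI[OF cr ab]) (auto simp: complex_ring_def scale fun_eq_iff algebra_simps)
  show ?thesis
    by (intro unital_star_algebra.intro ring mod unital_star_algebra_axioms.intro)
      (auto simp: star fmult_scale_left fmult_scale_right fstar_fstar[OF assms(3)] fstar_add
        fstar_scale fstar_fmult)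
qed

section \<open>Matrix coefficients in integer coordinates\<close>

locale quantum_su2 =
  fixes q :: real
  assumes q_pos: "0 < q" and q_less_1: "q < 1"
begin

text \<open>
  Spins and weights are half-integers. They are replaced by integers throughout: spin \<open>n/2\<close>,
  and the weight \<open>i - n/2\<close> for \<open>i\<close> from \<open>0\<close> to \<open>n\<close>. The powers \<open>q\<^sup>i\<^sup>/\<^sup>2\<close>, the quantum integers
  \<open>[i]\<close> and their square roots become functions of integers.
\<close>

definition hp :: "int \<Rightarrow> real" where "hp i = q powr (of_int i / 2)"

definition qi :: "int \<Rightarrow> real" where "qi i = qnum q (of_int i)"

definition rt :: "int \<Rightarrow> real" where "rt i = sqrt (qi i)"

lemma hp_add: "hp (i + j) = hp i * hp j"
  by (simp add: hp_def add_divide_distrib powr_add)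

lemma hp_0 [simp]: "hp 0 = 1"
  using q_pos by (simp add: hp_def)

lemma hp_pos [simp]: "0 < hp i"
  using q_pos by (simp add: hp_def)

lemma hp_nonzero [simp]: "hp i \<noteq> 0"
  using hp_pos[of i] by linarith

lemma hp_minus: "hp (- i) = 1 / hp i"
  by (simp add: hp_def powr_minus_divide)

lemma hp_diff: "hp (i - j) = hp i / hp j"
  by (simp add: hp_def diff_divide_distrib powr_diff)

lemma hp_2: "hp 2 = q"
  using q_pos by (simp add: hp_def)

lemma hp_double: "hp (2 * i) = hp i * hp i" "hp (i * 2) = hp i * hp i" "hp 2 = hp 1 * hp 1"
  using hp_add[of i i] hp_add[of 1 1] by (simp_all add: mult.commute)

lemmas hp_simps = hp_add hp_diff hp_minus hp_double

lemma q_denom: "q - 1 / q < 0"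
proof -
  have "q * q < 1 * 1" using q_pos q_less_1 by (intro mult_strict_mono) auto
  then show ?thesis using q_pos by (simp add: field_simps)
qed

lemma qi_hp: "qi i = (hp (2 * i) - hp (- 2 * i)) / (q - 1 / q)"
  by (simp add: qi_def qnum_def hp_def)

lemma qi_add: "qi (i + j) = hp (2 * j) * qi i + hp (- 2 * i) * qi j"
proof -
  have "hp (2 * j) * (hp (2 * i) - hp (- 2 * i)) + hp (- 2 * i) * (hp (2 * j) - hp (- 2 * j))
     = hp (2 * (i + j)) - hp (- 2 * (i + j))"
    by (simp add: algebra_simps flip: hp_add)
  then show ?thesis
    unfolding qi_hp by (simp add: add_divide_distrib[symmetric] del: mult_minus_left)
qed

lemma qi_0 [simp]: "qi 0 = 0" by (simp add: qi_hp)

lemma qi_1 [simp]: "qi 1 = 1"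
  using q_denom q_pos hp_minus[of 2] by (simp add: qi_hp hp_2)

lemma qi_nonneg: "0 \<le> i \<Longrightarrow> 0 \<le> qi i"
  using qnum_nonneg[OF q_pos q_less_1] by (simp add: qi_def)

lemma qi_pos:
  assumes "0 < i" shows "0 < qi i"
proof -
  have "qi ((i - 1) + 1) = hp (2 * 1) * qi (i - 1) + hp (- 2 * (i - 1)) * qi 1"
    by (rule qi_add)
  then have "qi i = hp 2 * qi (i - 1) + hp (- 2 * (i - 1))" by simp
  moreover have "0 \<le> hp 2 * qi (i - 1)" using assms qi_nonneg[of "i - 1"] hp_pos[of 2]
    by (intro mult_nonneg_nonneg) linarith+
  ultimately show ?thesis using hp_pos[of "- 2 * (i - 1)"] by linarith
qed

lemma qi_strict_mono:
  assumes "0 \<le> i" "i < j" shows "qi i < qi j"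
proof -
  have e: "qi ((j - i) + i) = hp (2 * i) * qi (j - i) + hp (- 2 * (j - i)) * qi i"
    by (rule qi_add)
  have "1 * qi i \<le> hp (- 2 * (j - i)) * qi i"
  proof (rule mult_right_mono)
    show "1 \<le> hp (- 2 * (j - i))" 
      using assms q_pos q_less_1 powr_mono'[of "of_int (- 2 * (j - i)) / 2" 0 q] by (simp add: hp_def)
  qed (use assms qi_nonneg in auto)
  moreover have "0 < hp (2 * i) * qi (j - i)" using assms qi_pos by simp
  ultimately show ?thesis using e by simp
qed

lemma rt_0 [simp]: "rt 0 = 0" by (simp add: rt_def)

lemma rt_1 [simp]: "rt 1 = 1" by (simp add: rt_def)

lemma rt_pos: "0 < i \<Longrightarrow> 0 < rt i" by (simp add: rt_def qi_pos)

lemma rt_nonneg: "0 \<le> i \<Longrightarrow> 0 \<le> rt i" by (simp add: rt_def qi_nonneg)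

lemma rt_sq: "0 \<le> i \<Longrightarrow> rt i * rt i = qi i"
  by (simp add: rt_def qi_nonneg)

text \<open>
  Outside the range of weights \<open>T\<close> is zero, so that recurrences in \<open>i\<close> and \<open>j\<close> need no case
  distinction at the ends.
\<close>

definition T :: "int \<Rightarrow> int \<Rightarrow> int \<Rightarrow> functional" where
  "T n i j = tcoef q (of_int n / 2) (of_int i - of_int n / 2) (of_int j - of_int n / 2)"

lemma weight_iff:
  "of_int i - of_int n / 2 \<in> weights (of_int n / 2) \<longleftrightarrow> 0 \<le> i \<and> i \<le> n"
proof
  assume "of_int i - of_int n / 2 \<in> weights (of_int n / 2)"
  then obtain k :: nat where k: "of_int i - of_int n / 2 = - (of_int n / 2) + real k"
    "of_int i - of_int n / 2 \<le> (of_int n / 2 :: real)"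
    by (auto simp: weights_def)
  then have "real_of_int i = real k" by simp
  then have "i = int k" by linarith
  moreover have "real_of_int i \<le> of_int n" using k(2) by simp
  ultimately show "0 \<le> i \<and> i \<le> n" by simp
next
  assume a: "0 \<le> i \<and> i \<le> n"
  then show "of_int i - of_int n / 2 \<in> weights (of_int n / 2)"
    unfolding weights_def by (auto intro!: exI[of _ "nat i"])
qed

lemma T_out: "\<not> (0 \<le> i \<and> i \<le> n \<and> 0 \<le> j \<and> j \<le> n) \<Longrightarrow> T n i j = 0"
  using rep_out[of "of_int i - of_int n / 2" "of_int n / 2" "of_int j - of_int n / 2" q]
  unfolding T_def tcoef_def weight_iff by (auto simp: fun_eq_iff)

lemma T_Nil: "T n i j [] = (if i = j \<and> 0 \<le> i \<and> i \<le> n then 1 else 0)"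
  by (auto simp: T_def tcoef_def weight_iff)

lemma rep_Cons_single:
  assumes "\<And>p. p \<in> weights s \<Longrightarrow> p \<noteq> c \<Longrightarrow> rep_gen q s g m p = 0"
  shows "rep q s (g # w) m n = rep_gen q s g m c * rep q s w c n"
proof -
  have "rep q s (g # w) m n =
      (\<Sum>p\<in>weights s. if p = c then rep_gen q s g m c * rep q s w c n else 0)"
    unfolding rep.simps by (rule sum.cong) (use assms in auto)
  then show ?thesis by (simp add: sum.delta[OF finite_weights] rep_gen_def)
qed

text \<open>
  Evaluating on a word that begins with a generator applies this generator after all others,
  so it moves the row index only.
\<close>

lemma lshift_T:
  "lshift Ge (T n i j) = fscale (of_real (rt i * rt (n - i + 1))) (T n (i - 1) j)"
  "lshift Gf (T n i j) = fscale (of_real (rt (i + 1) * rt (n - i))) (T n (i + 1) j)"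
  "lshift GK (T n i j) = fscale (of_real (hp (2 * i - n))) (T n i j)"
  "lshift GKinv (T n i j) = fscale (of_real (hp (n - 2 * i))) (T n i j)"
proof -
  let ?s = "of_int n / 2 :: real" and ?m = "\<lambda>i. of_int i - of_int n / 2 :: real"
  have W: "?m i \<in> weights ?s \<longleftrightarrow> 0 \<le> i \<and> i \<le> n" for i
    by (rule weight_iff)
  have R: "rep q ?s (g # w) (?m i) (?m j) = rep_gen q ?s g (?m i) (?m c) * rep q ?s w (?m c) (?m j)"
    if "\<And>p. p \<noteq> ?m c \<Longrightarrow> rep_gen q ?s g (?m i) p = 0" for g w c
    using that by (intro rep_Cons_single) auto
  show "lshift Ge (T n i j) = fscale (of_real (rt i * rt (n - i + 1))) (T n (i - 1) j)"
  proof (cases "0 \<le> i \<and> i \<le> n \<and> 0 \<le> i - 1 \<and> i - 1 \<le> n")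
    case True
    then have w: "?m i \<in> weights ?s" "?m (i - 1) \<in> weights ?s" using W by blast+
    have "rep_gen q ?s Ge (?m i) (?m (i - 1)) = rt i * rt (n - i + 1)"
      using w by (simp add: rep_gen_def rt_def qi_def real_sqrt_mult algebra_simps)
    then show ?thesis
      using R[of "i - 1" Ge]
      by (auto simp: lshift_def T_def tcoef_def fun_eq_iff rep_gen_def algebra_simps)
  next
    case False
    have "rep q ?s (Ge # w) (?m i) (?m j) = 0" for w
      using R[of "i - 1" Ge w] W[of i] W[of "i - 1"] False by (auto simp: rep_gen_def)
    moreover have "fscale (of_real (rt i * rt (n - i + 1))) (T n (i - 1) j) = 0"
    proof (cases "i = 0 \<or> i = n + 1")
      case False': False
      then have "T n (i - 1) j = 0" using False by (intro T_out) auto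
      then show ?thesis by simp
    qed auto
    ultimately show ?thesis by (auto simp: lshift_def T_def tcoef_def fun_eq_iff)
  qed
  show "lshift Gf (T n i j) = fscale (of_real (rt (i + 1) * rt (n - i))) (T n (i + 1) j)"
  proof (cases "0 \<le> i \<and> i \<le> n \<and> 0 \<le> i + 1 \<and> i + 1 \<le> n")
    case True
    then have w: "?m i \<in> weights ?s" "?m (i + 1) \<in> weights ?s" using W by blast+
    have "rep_gen q ?s Gf (?m i) (?m (i + 1)) = rt (i + 1) * rt (n - i)"
      using w by (simp add: rep_gen_def rt_def qi_def real_sqrt_mult algebra_simps)
    then show ?thesis
      using R[of "i + 1" Gf]
      by (auto simp: lshift_def T_def tcoef_def fun_eq_iff rep_gen_def algebra_simps)
  next
    case False
    have "rep q ?s (Gf # w) (?m i) (?m j) = 0" for w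
      using R[of "i + 1" Gf w] W[of i] W[of "i + 1"] False by (auto simp: rep_gen_def)
    moreover have "fscale (of_real (rt (i + 1) * rt (n - i))) (T n (i + 1) j) = 0"
    proof (cases "i = - 1 \<or> i = n")
      case False': False
      then have "T n (i + 1) j = 0" using False by (intro T_out) auto
      then show ?thesis by simp
    qed auto
    ultimately show ?thesis by (auto simp: lshift_def T_def tcoef_def fun_eq_iff)
  qed
  show "lshift GK (T n i j) = fscale (of_real (hp (2 * i - n))) (T n i j)"
  proof (cases "0 \<le> i \<and> i \<le> n")
    case True
    then have "rep_gen q ?s GK (?m i) (?m i) = hp (2 * i - n)"
      using W[of i] by (simp add: rep_gen_def hp_def diff_divide_distrib)
    then show ?thesis using R[of i GK]
      by (auto simp: lshift_def T_def tcoef_def fun_eq_iff rep_gen_def)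
  next
    case False
    then have "T n i j = 0" by (intro T_out) auto
    then show ?thesis by simp
  qed
  show "lshift GKinv (T n i j) = fscale (of_real (hp (n - 2 * i))) (T n i j)"
  proof (cases "0 \<le> i \<and> i \<le> n")
    case True
    then have "rep_gen q ?s GKinv (?m i) (?m i) = hp (n - 2 * i)"
      using W[of i] by (simp add: rep_gen_def hp_def diff_divide_distrib)
    then show ?thesis using R[of i GKinv]
      by (auto simp: lshift_def T_def tcoef_def fun_eq_iff rep_gen_def)
  next
    case False
    then have "T n i j = 0" by (intro T_out) auto
    then show ?thesis by simp
  qed
qed

lemma T_Cons:
  "T n i j (Ge # w) = of_real (rt i * rt (n - i + 1)) * T n (i - 1) j w"
  "T n i j (Gf # w) = of_real (rt (i + 1) * rt (n - i)) * T n (i + 1) j w"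
  "T n i j (GK # w) = of_real (hp (2 * i - n)) * T n i j w"
  "T n i j (GKinv # w) = of_real (hp (n - 2 * i)) * T n i j w"
  using lshift_T[of n i j, THEN fun_cong, of w] by (simp_all add: lshift_def)

lemma T_000: "T 0 0 0 = counit"
proof
  show "T 0 0 0 w = counit w" for w
  proof (induction w)
    case (Cons g w)
    have "counit (g # w) = lshift g counit w" by (simp add: lshift_def)
    then show ?case using Cons by (cases g) (simp_all add: T_Cons lshift_counit)
  qed (simp add: T_Nil counit_def)
qed

lemma T_snoc_GK: "T n i j (w @ [GK]) = of_real (hp (2 * j - n)) * T n i j w"
proof (induction w arbitrary: i)
  case (Cons g w)
  then show ?case by (cases g) (simp_all add: T_Cons)
qed (auto simp: T_Cons T_Nil)

section \<open>Clebsch-Gordan decomposition of products with spin one half\<close>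

text \<open>
  Clebsch-Gordan coefficients: \<open>cgA a n i\<close> and \<open>cgB a n i\<close> are the components of the tensor
  product of the basis vectors with indices \<open>a\<close> in spin one half and \<open>i\<close> in spin \<open>n/2\<close> along
  the basis vector with index \<open>i + a\<close> in spin \<open>(n+1)/2\<close> and with index \<open>i + a - 1\<close> in spin
  \<open>(n-1)/2\<close>.
\<close>

definition cgA :: "int \<Rightarrow> int \<Rightarrow> int \<Rightarrow> real" where
  "cgA a n i = (if a = 0 then hp i * rt (n + 1 - i) else hp (i - n) * rt (i + 1)) / rt (n + 1)"

definition cgB :: "int \<Rightarrow> int \<Rightarrow> int \<Rightarrow> real" where
  "cgB a n i = (if a = 0 then hp (i - 1 - n) * rt i else - hp (i + 1) * rt (n - i)) / rt (n + 1)"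

lemma qi_Suc: "qi (i + 1) = hp (2 * i) + hp (- 2) * qi i"
  using qi_add[of 1 i] by (simp add: add.commute)

lemma qi_Suc': "qi (i + 1) = hp 2 * qi i + hp (- 2 * i)"
  using qi_add[of i 1] by simp

lemma cg_e:
  assumes "0 \<le> i" "i \<le> n"
  shows "hp (2 * i - n) * cgA 0 n i + hp (- 1) * (rt i * rt (n - i + 1)) * cgA 1 n (i - 1) =
         cgA 1 n i * (rt (i + 1) * rt (n + 1 - i))"
    and "hp (2 * i - n) * cgB 0 n i + hp (- 1) * (rt i * rt (n - i + 1)) * cgB 1 n (i - 1) =
         cgB 1 n i * (rt i * rt (n - i))"
    and "hp 1 * (rt i * rt (n - i + 1)) * cgA 0 n (i - 1) = cgA 0 n i * (rt i * rt (n + 2 - i))"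
    and "hp 1 * (rt i * rt (n - i + 1)) * cgB 0 n (i - 1) = cgB 0 n i * (rt (i - 1) * rt (n - i + 1))"
proof -
  have e: "n + 1 - i = n - i + 1" "n - (i - 1) = n - i + 1" by simp_all
  define x y where "x = rt (n - i + 1)" and "y = rt i"
  have s: "rt (i + 1) * rt (i + 1) = hp (2 * i) + hp (- 2) * (y * y)"
    using assms qi_Suc[of i] by (simp add: y_def rt_sq)
  have "hp (2 * i - n) * (hp i * x) + hp (- 1) * (y * x) * (hp (i - 1 - n) * y) =
      hp (i - n) * x * (hp (2 * i) + hp (- 2) * (y * y))"
    by (simp add: hp_simps field_simps)
  then show "hp (2 * i - n) * cgA 0 n i + hp (- 1) * (rt i * rt (n - i + 1)) * cgA 1 n (i - 1) =
         cgA 1 n i * (rt (i + 1) * rt (n + 1 - i))"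
    unfolding s[symmetric] unfolding cgA_def x_def y_def
    by (simp add: add_divide_distrib[symmetric] mult_ac e)
  have x: "x * x = hp 2 * (rt (n - i) * rt (n - i)) + hp (- 2 * (n - i))"
    using assms qi_Suc'[of "n - i"] by (simp add: x_def rt_sq)
  have "hp (2 * i - n) * (hp (i - 1 - n) * y) - hp (- 1) * y * hp i * (x * x) =
      - (hp (i + 1) * y * (rt (n - i) * rt (n - i)))"
    unfolding x by (simp add: hp_simps field_simps)
  then show "hp (2 * i - n) * cgB 0 n i + hp (- 1) * (rt i * rt (n - i + 1)) * cgB 1 n (i - 1) =
         cgB 1 n i * (rt i * rt (n - i))"
    unfolding cgB_def x_def y_def
    by (simp add: add_divide_distrib[symmetric] diff_divide_distrib[symmetric] mult_ac e)
  have "hp 1 * hp (i - 1) = hp i" "hp 1 * hp (i - 2 - n) = hp (i - 1 - n)"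
    by (simp_all add: algebra_simps flip: hp_add)
  then show "hp 1 * (rt i * rt (n - i + 1)) * cgA 0 n (i - 1) = cgA 0 n i * (rt i * rt (n + 2 - i))"
    "hp 1 * (rt i * rt (n - i + 1)) * cgB 0 n (i - 1) = cgB 0 n i * (rt (i - 1) * rt (n - i + 1))"
    unfolding cgA_def cgB_def by (simp_all add: field_simps)
qed

lemma cg_f:
  assumes "0 \<le> i" "i \<le> n"
  shows "hp (2 * i - n) * cgA 1 n i + hp 1 * (rt (i + 1) * rt (n - i)) * cgA 0 n (i + 1) =
         cgA 0 n i * (rt (i + 1) * rt (n + 1 - i))"
    and "hp (2 * i - n) * cgB 1 n i + hp 1 * (rt (i + 1) * rt (n - i)) * cgB 0 n (i + 1) =
         cgB 0 n i * (rt i * rt (n - i))"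
    and "hp (- 1) * (rt (i + 1) * rt (n - i)) * cgA 1 n (i + 1) = cgA 1 n i * (rt (i + 2) * rt (n - i))"
    and "hp (- 1) * (rt (i + 1) * rt (n - i)) * cgB 1 n (i + 1) = cgB 1 n i * (rt (i + 1) * rt (n - 1 - i))"
proof -
  have e: "n + 1 - i = n - i + 1" "n - (i - 1) = n - i + 1" by simp_all
  define x y where "x = rt (n - i)" and "y = rt (i + 1)"
  have s: "rt (n - i + 1) * rt (n - i + 1) = hp 2 * (x * x) + hp (- 2 * (n - i))"
    using assms qi_Suc'[of "n - i"] by (simp add: x_def rt_sq)
  have "hp (2 * i - n) * (hp (i - n) * y) + hp 1 * (y * x) * (hp (i + 1) * x) =
      hp i * y * (hp 2 * (x * x) + hp (- 2 * (n - i)))"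
    by (simp add: hp_simps field_simps)
  then show "hp (2 * i - n) * cgA 1 n i + hp 1 * (rt (i + 1) * rt (n - i)) * cgA 0 n (i + 1) =
         cgA 0 n i * (rt (i + 1) * rt (n + 1 - i))"
    unfolding s[symmetric] unfolding cgA_def x_def y_def
    by (simp add: add_divide_distrib[symmetric] mult_ac e)
  have y: "y * y = hp (2 * i) + hp (- 2) * (rt i * rt i)"
    using assms qi_Suc[of i] by (simp add: y_def rt_sq)
  have "- (hp (2 * i - n) * (hp (i + 1) * x)) + hp 1 * x * hp (i - n) * (y * y) =
      hp (i - 1 - n) * x * (rt i * rt i)"
    unfolding y by (simp add: hp_simps field_simps)
  then show "hp (2 * i - n) * cgB 1 n i + hp 1 * (rt (i + 1) * rt (n - i)) * cgB 0 n (i + 1) =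
         cgB 0 n i * (rt i * rt (n - i))"
    unfolding cgB_def x_def y_def
    by (simp add: add_divide_distrib[symmetric] diff_divide_distrib[symmetric] mult_ac e)
  have "hp (- 1) * hp (i + 1 - n) = hp (i - n)" "hp (- 1) * hp (i + 2) = hp (i + 1)"
    by (simp_all add: add.commute flip: hp_add)
  then show "hp (- 1) * (rt (i + 1) * rt (n - i)) * cgA 1 n (i + 1) = cgA 1 n i * (rt (i + 2) * rt (n - i))"
    "hp (- 1) * (rt (i + 1) * rt (n - i)) * cgB 1 n (i + 1) = cgB 1 n i * (rt (i + 1) * rt (n - 1 - i))"
    unfolding cgA_def cgB_def by (simp_all add: field_simps)
qed

lemma cg_orthogonal:
  assumes "0 \<le> i" "i \<le> n"
  shows "cgA 0 n i * cgA 0 n i + cgB 0 n i * cgB 0 n i = 1"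
    and "cgA 1 n i * cgA 1 n i + cgB 1 n i * cgB 1 n i = 1"
    and "cgA 1 n i * cgA 0 n (i + 1) + cgB 1 n i * cgB 0 n (i + 1) = 0"
proof -
  have d: "rt (n + 1) * rt (n + 1) = qi (n + 1)" "0 < qi (n + 1)" "rt (n + 1) \<noteq> 0"
    using assms rt_pos[of "n + 1"] by (auto simp: rt_sq qi_pos)
  have "hp i * hp i * qi (n + 1 - i) + hp (i - 1 - n) * hp (i - 1 - n) * qi i = qi (n + 1)"
    using qi_add[of "n + 1 - i" i] by (simp add: algebra_simps flip: hp_add)
  then have "hp i * hp i * (rt (n + 1 - i) * rt (n + 1 - i)) +
      hp (i - 1 - n) * hp (i - 1 - n) * (rt i * rt i) = rt (n + 1) * rt (n + 1)"
    using assms by (simp add: rt_sq)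
  then show "cgA 0 n i * cgA 0 n i + cgB 0 n i * cgB 0 n i = 1"
    using d(3) unfolding cgA_def cgB_def by (simp add: divide_simps mult_ac)
  have "hp (i - n) * hp (i - n) * qi (i + 1) + hp (i + 1) * hp (i + 1) * qi (n - i) = qi (n + 1)"
    using qi_add[of "n - i" "i + 1"] by (simp add: algebra_simps flip: hp_add)
  then have "hp (i - n) * hp (i - n) * (rt (i + 1) * rt (i + 1)) +
      hp (i + 1) * hp (i + 1) * (rt (n - i) * rt (n - i)) = rt (n + 1) * rt (n + 1)"
    using assms by (simp add: rt_sq)
  then show "cgA 1 n i * cgA 1 n i + cgB 1 n i * cgB 1 n i = 1"
    using d(3) unfolding cgA_def cgB_def by (simp add: divide_simps mult_ac)
  show "cgA 1 n i * cgA 0 n (i + 1) + cgB 1 n i * cgB 0 n (i + 1) = 0"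
    unfolding cgA_def cgB_def by (simp add: field_simps)
qed

text \<open>
  Where \<open>i\<close> leaves its range but the target index does not, the coefficient \<open>cgA\<close> vanishes;
  everywhere else the target is zero.
\<close>

lemma product_T_out:
  assumes "a = 0 \<or> a = 1" "\<not> (0 \<le> i \<and> i \<le> n)" "n \<ge> 0"
  shows "fscale (of_real (cgA a n i * x)) (T (n + 1) (i + a) j) = 0"
    and "fscale (of_real (cgB a n i * x)) (T (n - 1) (i + a - 1) j) = 0"
proof -
  show "fscale (of_real (cgA a n i * x)) (T (n + 1) (i + a) j) = 0"
  proof (cases "(a = 0 \<and> i = n + 1) \<or> (a = 1 \<and> i = - 1)")
    case False
    then have "T (n + 1) (i + a) j = 0" using assms by (intro T_out) auto
    then show ?thesis by simp
  qed (auto simp: cgA_def)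
  have "T (n - 1) (i + a - 1) j = 0" using assms by (intro T_out) auto
  then show "fscale (of_real (cgB a n i * x)) (T (n - 1) (i + a - 1) j) = 0" by simp
qed

text \<open>
  The Clebsch-Gordan rule. The numbers \<open>cgA\<close> and \<open>cgB\<close> are the entries of the isometries from
  the modules of spins \<open>(n+1)/2\<close> and \<open>(n-1)/2\<close> into the tensor product of spins one half and
  \<open>n/2\<close>. That these intertwine the generators is the content of \<open>cg_e\<close> and \<open>cg_f\<close>; that their
  images together are everything is \<open>cg_orthogonal\<close>, which settles the empty word.
\<close>

lemma product_T:
  assumes ab: "a = 0 \<or> a = 1" "b = 0 \<or> b = 1" and n: "n \<ge> 0"
  shows "fmult (T 1 a b) (T n i j) =
    fscale (of_real (cgA a n i * cgA b n j)) (T (n + 1) (i + a) (j + b)) +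
    fscale (of_real (cgB a n i * cgB b n j)) (T (n - 1) (i + a - 1) (j + b - 1))"
proof (cases "0 \<le> j \<and> j \<le> n")
  case False
  have z: "T n i j = 0" using False by (intro T_out) auto
  have "fscale (of_real (cgA b n j * x)) (T (n + 1) i' (j + b)) = 0"
    "fscale (of_real (cgB b n j * x)) (T (n - 1) i' (j + b - 1)) = 0" for x i'
  proof -
    show "fscale (of_real (cgA b n j * x)) (T (n + 1) i' (j + b)) = 0"
    proof (cases "(b = 0 \<and> j = n + 1) \<or> (b = 1 \<and> j = - 1)")
      case F: False
      then have "T (n + 1) i' (j + b) = 0" using assms False by (intro T_out) auto
      then show ?thesis by simp
    qed (auto simp: cgA_def)
    have "T (n - 1) i' (j + b - 1) = 0" using assms False by (intro T_out) auto
    then show "fscale (of_real (cgB b n j * x)) (T (n - 1) i' (j + b - 1)) = 0" by simp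
  qed
  then have "fscale (of_real (cgA b n j * cgA a n i)) (T (n + 1) (i + a) (j + b)) = 0"
    "fscale (of_real (cgB b n j * cgB a n i)) (T (n - 1) (i + a - 1) (j + b - 1)) = 0"
    by blast+
  then show ?thesis unfolding z mult.commute[of "cgA a n i"] mult.commute[of "cgB a n i"]
    by (simp only: fmult_zero add_0_left)
next
  case j: True
  have "fmult (T 1 a b) (T n i j) w =
    of_real (cgA a n i * cgA b n j) * T (n + 1) (i + a) (j + b) w +
    of_real (cgB a n i * cgB b n j) * T (n - 1) (i + a - 1) (j + b - 1) w"
    if "a = 0 \<or> a = 1" for w a i
    using that
  proof (induction w arbitrary: a i)
    case (Nil a i)
    show ?case
    proof (cases "0 \<le> i \<and> i \<le> n")
      case False
      then have "T n i j = 0" by (intro T_out) auto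
      then have "fmult (T 1 a b) (T n i j) = 0" by (simp only: fmult_zero)
      moreover have "fscale (of_real (cgA a n i * cgA b n j)) (T (n + 1) (i + a) (j + b)) = 0"
        "fscale (of_real (cgB a n i * cgB b n j)) (T (n - 1) (i + a - 1) (j + b - 1)) = 0"
        using product_T_out[OF Nil False n] by blast+
      ultimately show ?thesis
        by (simp only: fscale_apply[symmetric] zero_fun_apply add_0_left)
    next
      case True
      note o = cg_orthogonal[of i n] cg_orthogonal[of j n]
      show ?thesis
      proof (cases "i + a = j + b")
        case False
        then show ?thesis by (auto simp: fmult_Nil T_Nil)
      next
        case e: True
        consider "a = 0" "b = 0" "i = j" | "a = 1" "b = 1" "i = j" | "a = 1" "b = 0" "j = i + 1" |
          "a = 0" "b = 1" "i = j + 1" using e Nil ab by auto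
        then show ?thesis
        proof cases
          case 1
          have h: "cgB 0 n i * cgB 0 n i * (if 1 \<le> i then 1 else 0) = cgB 0 n i * cgB 0 n i"
            using True by (cases "i = 0") (auto simp: cgB_def)
          have "1 = cgA 0 n i * cgA 0 n i + cgB 0 n i * cgB 0 n i * (if 1 \<le> i then 1 else 0)"
            unfolding h using o True by simp
          then have "complex_of_real 1 = of_real (cgA 0 n i * cgA 0 n i +
              cgB 0 n i * cgB 0 n i * (if 1 \<le> i then 1 else 0))" by metis
          then show ?thesis using 1 True by (auto simp: fmult_Nil T_Nil)
        next
          case 2
          have h: "cgB 1 n i * cgB 1 n i * (if i \<le> n - 1 then 1 else 0) = cgB 1 n i * cgB 1 n i"
            using True by (cases "i = n") (auto simp: cgB_def)
          have "1 = cgA 1 n i * cgA 1 n i + cgB 1 n i * cgB 1 n i * (if i \<le> n - 1 then 1 else 0)"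
            unfolding h using o True by simp
          then have "complex_of_real 1 = of_real (cgA 1 n i * cgA 1 n i +
              cgB 1 n i * cgB 1 n i * (if i \<le> n - 1 then 1 else 0))" by metis
          then show ?thesis using 2 True by (auto simp: fmult_Nil T_Nil)
        next
          case 3
          have "complex_of_real 0 = of_real (cgA 1 n i * cgA 0 n (i + 1) + cgB 1 n i * cgB 0 n (i + 1))"
            using o True by metis
          then show ?thesis using 3 True j by (auto simp: fmult_Nil T_Nil)
        next
          case 4
          have "complex_of_real 0 = of_real (cgA 0 n (j + 1) * cgA 1 n j + cgB 0 n (j + 1) * cgB 1 n j)"
            using o j by (metis mult.commute)
          then show ?thesis using 4 True j by (auto simp: fmult_Nil T_Nil)
        qed
      qed
    qed
  next
    case (Cons g w a i)
    show ?case
    proof (cases "0 \<le> i \<and> i \<le> n")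
      case False
      then have "T n i j = 0" by (intro T_out) auto
      then have "fmult (T 1 a b) (T n i j) = 0" by (simp only: fmult_zero)
      moreover have "fscale (of_real (cgA a n i * cgA b n j)) (T (n + 1) (i + a) (j + b)) = 0"
        "fscale (of_real (cgB a n i * cgB b n j)) (T (n - 1) (i + a - 1) (j + b - 1)) = 0"
        using product_T_out[OF Cons.prems False n] by blast+
      ultimately show ?thesis
        by (simp only: fscale_apply[symmetric] zero_fun_apply add_0_left)
    next
      case True
      then have i: "0 \<le> i" "i \<le> n" by auto
      have L: "fmult (T 1 a b) (T n i j) (g # w) = lshift g (fmult (T 1 a b) (T n i j)) w"
        by (simp add: lshift_def)
      have z: "T 1 (-1) b = 0" "T 1 2 b = 0" by (simp_all add: T_out)
      \<comment> \<open>With the column fixed, the claim is linear in the row coefficients, and only these change with the letter.\<close>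
      define X where "X r = T (n + 1) r (j + b) w" for r
      define Y where "Y r = T (n - 1) r (j + b - 1) w" for r
      define A where "A = complex_of_real (cgA b n j)"
      define B where "B = complex_of_real (cgB b n j)"
      note D = X_def[symmetric] Y_def[symmetric] A_def[symmetric] B_def[symmetric]
      have IH: "fmult (T 1 a' b) (T n i' j) w =
          of_real (cgA a' n i') * A * X (i' + a') + of_real (cgB a' n i') * B * Y (i' + a' - 1)"
        if "a' = 0 \<or> a' = 1" for a' i'
        using Cons.IH[OF that, of i'] unfolding X_def Y_def A_def B_def by (simp add: mult.assoc)
      have comb: "c * (p * A * x + r * B * y) + d * (p' * A * x + r' * B * y) =
          (c * p + d * p') * A * x + (c * r + d * r') * B * y" for c d p r p' r' x y :: complex
        by (simp add: algebra_simps)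
      have comb1: "c * (p * A * x + r * B * y) = (c * p) * A * x + (c * r) * B * y"
        for c p r x y :: complex
        by (simp add: algebra_simps)
      have step: ?thesis if "lshift g (fmult (T 1 a b) (T n i j)) w =
          of_real (cgA a n i) * A * T (n + 1) (i + a) (j + b) (g # w) +
          of_real (cgB a n i) * B * T (n - 1) (i + a - 1) (j + b - 1) (g # w)"
        using that unfolding L A_def B_def by (simp add: mult.assoc)
      show ?thesis
      proof (rule step, cases g)
        case Ge
        from Cons.prems
        show "lshift g (fmult (T 1 a b) (T n i j)) w =
          of_real (cgA a n i) * A * T (n + 1) (i + a) (j + b) (g # w) +
          of_real (cgB a n i) * B * T (n - 1) (i + a - 1) (j + b - 1) (g # w)"
        proof
          assume a: "a = 0"
          have "lshift g (fmult (T 1 a b) (T n i j)) w =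
              of_real (hp 1 * (rt i * rt (n - i + 1))) * fmult (T 1 0 b) (T n (i - 1) j) w"
            by (simp add: Ge a lshift_fmult lshift_T fmult_scale_left fmult_scale_right z)
          also have "\<dots> = of_real (hp 1 * (rt i * rt (n - i + 1)) * cgA 0 n (i - 1)) * A * X (i - 1) +
              of_real (hp 1 * (rt i * rt (n - i + 1)) * cgB 0 n (i - 1)) * B * Y (i - 2)"
            by (subst IH) (simp_all add: algebra_simps)
          finally show ?thesis
            unfolding cg_e[OF i] by (simp add: Ge a T_Cons X_def Y_def algebra_simps)
        next
          assume a: "a = 1"
          have "lshift g (fmult (T 1 a b) (T n i j)) w =
              of_real (hp (2 * i - n)) * fmult (T 1 0 b) (T n i j) w +
              of_real (hp (- 1) * (rt i * rt (n - i + 1))) * fmult (T 1 1 b) (T n (i - 1) j) w"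
            by (simp add: Ge a lshift_fmult lshift_T fmult_scale_left fmult_scale_right)
          also have "\<dots> = of_real (hp (2 * i - n) * cgA 0 n i +
                hp (- 1) * (rt i * rt (n - i + 1)) * cgA 1 n (i - 1)) * A * X i +
              of_real (hp (2 * i - n) * cgB 0 n i +
                hp (- 1) * (rt i * rt (n - i + 1)) * cgB 1 n (i - 1)) * B * Y (i - 1)"
            by (simp add: IH algebra_simps)
          finally show ?thesis
            unfolding cg_e[OF i] by (simp add: Ge a T_Cons X_def Y_def algebra_simps)
        qed
      next
        case Gf
        from Cons.prems
        show "lshift g (fmult (T 1 a b) (T n i j)) w =
          of_real (cgA a n i) * A * T (n + 1) (i + a) (j + b) (g # w) +
          of_real (cgB a n i) * B * T (n - 1) (i + a - 1) (j + b - 1) (g # w)"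
        proof
          assume a: "a = 0"
          have "lshift g (fmult (T 1 a b) (T n i j)) w =
              of_real (hp (2 * i - n)) * fmult (T 1 1 b) (T n i j) w +
              of_real (hp 1 * (rt (i + 1) * rt (n - i))) * fmult (T 1 0 b) (T n (i + 1) j) w"
            by (simp add: Gf a lshift_fmult lshift_T fmult_scale_left fmult_scale_right)
          also have "\<dots> = of_real (hp (2 * i - n) * cgA 1 n i +
                hp 1 * (rt (i + 1) * rt (n - i)) * cgA 0 n (i + 1)) * A * X (i + 1) +
              of_real (hp (2 * i - n) * cgB 1 n i +
                hp 1 * (rt (i + 1) * rt (n - i)) * cgB 0 n (i + 1)) * B * Y i"
            by (simp add: IH algebra_simps)
          finally show ?thesis
            unfolding cg_f[OF i] by (simp add: Gf a T_Cons X_def Y_def algebra_simps)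
        next
          assume a: "a = 1"
          have "lshift g (fmult (T 1 a b) (T n i j)) w =
              of_real (hp (- 1) * (rt (i + 1) * rt (n - i))) * fmult (T 1 1 b) (T n (i + 1) j) w"
            by (simp add: Gf a lshift_fmult lshift_T fmult_scale_left fmult_scale_right z)
          also have "\<dots> = of_real (hp (- 1) * (rt (i + 1) * rt (n - i)) * cgA 1 n (i + 1)) * A * X (i + 2) +
              of_real (hp (- 1) * (rt (i + 1) * rt (n - i)) * cgB 1 n (i + 1)) * B * Y (i + 1)"
            by (subst IH) (simp_all add: algebra_simps)
          finally show ?thesis
            unfolding cg_f[OF i] by (simp add: Gf a T_Cons X_def Y_def algebra_simps)
        qed
      next
        case GK
        have e: "hp (2 * (i + a) - (n + 1)) = hp (2 * a - 1) * hp (2 * i - n)" "hp (2 * (i + a - 1) - (n - 1)) = hp (2 * a - 1) * hp (2 * i - n)"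
          by (simp_all add: algebra_simps flip: hp_add)
        have "lshift g (fmult (T 1 a b) (T n i j)) w =
            of_real (hp (2 * a - 1) * hp (2 * i - n)) * fmult (T 1 a b) (T n i j) w"
          by (simp add: GK lshift_fmult lshift_T fmult_scale_left fmult_scale_right)
        then show "lshift g (fmult (T 1 a b) (T n i j)) w =
          of_real (cgA a n i) * A * T (n + 1) (i + a) (j + b) (g # w) +
          of_real (cgB a n i) * B * T (n - 1) (i + a - 1) (j + b - 1) (g # w)"
          unfolding GK T_Cons e IH[OF Cons.prems] X_def Y_def by (simp add: algebra_simps)
      next
        case GKinv
        have e: "hp (n + 1 - 2 * (i + a)) = hp (1 - 2 * a) * hp (n - 2 * i)" "hp (n - 1 - 2 * (i + a - 1)) = hp (1 - 2 * a) * hp (n - 2 * i)"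
          by (simp_all add: algebra_simps flip: hp_add)
        have "lshift g (fmult (T 1 a b) (T n i j)) w =
            of_real (hp (1 - 2 * a) * hp (n - 2 * i)) * fmult (T 1 a b) (T n i j) w"
          by (simp add: GKinv lshift_fmult lshift_T fmult_scale_left fmult_scale_right)
        then show "lshift g (fmult (T 1 a b) (T n i j)) w =
          of_real (cgA a n i) * A * T (n + 1) (i + a) (j + b) (g # w) +
          of_real (cgB a n i) * B * T (n - 1) (i + a - 1) (j + b - 1) (g # w)"
          unfolding GKinv T_Cons e IH[OF Cons.prems] X_def Y_def by (simp add: algebra_simps)
      qed
    qed
  qed
  then show ?thesis using ab by (auto simp: fun_eq_iff)
qed

end

lemmas pointwise = plus_fun_apply zero_fun_apply fscale_apply

text \<open>
  From here on functionals are vectors, and simplification must not evaluate them on words.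
\<close>

declare pointwise [simp del]

context quantum_su2
begin

section \<open>The involution on matrix coefficients\<close>

text \<open>
  The powers of \<open>- q\<close> that the antipode of \<open>e\<close> and \<open>f\<close> produces.
\<close>

definition mq :: "int \<Rightarrow> real" where "mq i = (- q) powi i"

lemma mq_add: "mq (i + j) = mq i * mq j"
  using q_pos by (simp add: mq_def power_int_add)

lemma mq_0 [simp]: "mq 0 = 1" and mq_1: "mq 1 = - q" and mq_m1: "mq (- 1) = - inverse q"
  using q_pos by (simp_all add: mq_def power_int_minus)

lemma mq_inverse: "mq i * mq (- i) = 1"
  using mq_add[of i "- i"] by simp

lemma fstar_T: "fstar q (T n i j) = fscale (of_real (mq (j - i))) (T n (n - i) (n - j))"
proof
  show "fstar q (T n i j) w = fscale (of_real (mq (j - i))) (T n (n - i) (n - j)) w" for w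
  proof (induction w arbitrary: i)
    case Nil
    then show ?case by (auto simp: fstar_Nil T_Nil pointwise)
  next
    case (Cons g w)
    have m: "mq (j - i) = - (q * mq (j - (i + 1)))" "mq (j - i) = - (inverse q * mq (j - (i - 1)))"
      using mq_add[of "j - (i + 1)" 1] mq_add[of "j - (i - 1)" "- 1"] mq_1 mq_m1
      by (simp_all only: mult.commute) (simp_all add: algebra_simps)
    have e: "n - i + 1 = n - (i - 1)" "n - i - 1 = n - (i + 1)" "n - (n - i) = i" for i by simp_all
    have L: "fstar q (T n i j) (g # w) = lshift g (fstar q (T n i j)) w"
      by (simp add: lshift_def)
    show ?case
    proof (cases g)
      case Ge
      have "fstar q (T n i j) (g # w) =
          of_real (- q) * (of_real (rt (i + 1) * rt (n - i)) *
            (of_real (mq (j - (i + 1))) * T n (n - (i + 1)) (n - j) w))"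
        unfolding L using Cons.IH[of "i + 1"]
        by (simp add: Ge lshift_fstar lshift_T fstar_scale pointwise e)
      then show ?thesis unfolding m(1) by (simp add: Ge T_Cons pointwise mult_ac e(2))
    next
      case Gf
      have "fstar q (T n i j) (g # w) =
          of_real (- inverse q) * (of_real (rt i * rt (n - i + 1)) *
            (of_real (mq (j - (i - 1))) * T n (n - (i - 1)) (n - j) w))"
        unfolding L using Cons.IH[of "i - 1"]
        by (simp add: Gf lshift_fstar lshift_T fstar_scale pointwise e)
      then show ?thesis unfolding m(2) by (simp add: Gf T_Cons pointwise mult_ac e(1))
    next
      case GK
      then show ?thesis unfolding L using Cons.IH[of i]
        by (simp add: lshift_fstar lshift_T fstar_scale T_Cons pointwise mult_ac)
    next
      case GKinv
      then show ?thesis unfolding L using Cons.IH[of i]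
        by (simp add: lshift_fstar lshift_T fstar_scale T_Cons pointwise mult_ac)
    qed
  qed
qed

section \<open>Linear independence of matrix coefficients\<close>

definition ix :: "(int \<times> int \<times> int) set" where
  "ix = {(n, i, j). 0 \<le> i \<and> i \<le> n \<and> 0 \<le> j \<and> j \<le> n}"

definition Tk :: "int \<times> int \<times> int \<Rightarrow> functional" where
  "Tk = (\<lambda>(n, i, j). T n i j)"

text \<open>
  A power of \<open>e\<close> or of \<open>f\<close> joins any two weight vectors with a nonzero coefficient.
\<close>

lemma Tk_nonzero:
  assumes "\<kappa> \<in> ix" shows "Tk \<kappa> \<noteq> 0"
proof -
  obtain n i j where k: "\<kappa> = (n, i, j)" "0 \<le> i" "i \<le> n" "0 \<le> j" "j \<le> n"
    using assms by (auto simp: ix_def)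
  have "T n (j + int k) j (replicate k Ge) \<noteq> 0" if "j + int k \<le> n" for k
    using that
  proof (induction k)
    case (Suc k)
    have "rt (j + int (Suc k)) \<noteq> 0" "rt (n - (j + int (Suc k)) + 1) \<noteq> 0"
      using Suc.prems k rt_pos by (intro less_imp_neq[symmetric] rt_pos; simp)+
    moreover have e: "j + int (Suc k) - 1 = j + int k" by simp
    ultimately show ?case
      using Suc unfolding replicate_Suc T_Cons e by simp
  qed (use k in \<open>simp add: T_Nil\<close>)
  moreover have "T n (j - int k) j (replicate k Gf) \<noteq> 0" if "0 \<le> j - int k" for k
    using that
  proof (induction k)
    case (Suc k)
    have "rt (j - int (Suc k) + 1) \<noteq> 0" "rt (n - (j - int (Suc k))) \<noteq> 0"
      using Suc.prems k rt_pos by (intro less_imp_neq[symmetric] rt_pos; simp)+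
    moreover have e: "j - int (Suc k) + 1 = j - int k" by simp
    ultimately show ?case
      using Suc unfolding replicate_Suc T_Cons e by simp
  qed (use k in \<open>simp add: T_Nil\<close>)
  moreover have "i = j + int (nat (i - j)) \<or> i = j - int (nat (j - i))" by linarith
  ultimately have "\<exists>w. T n i j w \<noteq> 0" using k by (metis)
  then show ?thesis by (auto simp: k Tk_def pointwise)
qed

lemma hp_inject: "hp i = hp j \<longleftrightarrow> i = j"
  using q_pos q_less_1 by (simp add: hp_def powr_inj)

text \<open>
  Putting \<open>K\<close> at either end of the word, or \<open>fe\<close> in front of it, multiplies every matrix
  coefficient by a number. The first two numbers determine the two weights, and then the third
  determines the spin.
\<close>

lemma Tk_separate:
  assumes "\<kappa> \<in> ix" "\<kappa>' \<in> ix" "\<kappa> \<noteq> \<kappa>'"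
  shows "\<exists>u v ev. (\<forall>\<mu> w. Tk \<mu> (u @ w @ v) = complex_of_real (ev \<mu>) * Tk \<mu> w) \<and> ev \<kappa> \<noteq> ev \<kappa>'"
proof -
  obtain n i j where k: "\<kappa> = (n, i, j)" "0 \<le> i" "i \<le> n" "0 \<le> j" "j \<le> n"
    using assms by (auto simp: ix_def)
  obtain n' i' j' where k': "\<kappa>' = (n', i', j')" "0 \<le> i'" "i' \<le> n'" "0 \<le> j'" "j' \<le> n'"
    using assms by (auto simp: ix_def)
  consider "2 * i - n \<noteq> 2 * i' - n'" | "2 * j - n \<noteq> 2 * j' - n'"
    | "2 * i - n = 2 * i' - n'" "2 * j - n = 2 * j' - n'" by blast
  then show ?thesis
  proof cases
    case 1
    show ?thesis
      by (rule exI[of _ "[GK]"], rule exI[of _ "[]"], rule exI[of _ "\<lambda>(n, i, j). hp (2 * i - n)"])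
        (use 1 in \<open>auto simp: Tk_def T_Cons hp_inject k k'\<close>)
  next
    case 2
    show ?thesis
      by (rule exI[of _ "[]"], rule exI[of _ "[GK]"], rule exI[of _ "\<lambda>(n, i, j). hp (2 * j - n)"])
        (use 2 in \<open>auto simp: Tk_def T_snoc_GK hp_inject k k'\<close>)
  next
    case 3
    have neq: "n \<noteq> n'" using 3 assms k k' by auto
    \<comment> \<open>Equal weights force the spins to differ, and the eigenvalue of \<open>fe\<close> is strictly monotone in the spin for fixed weight.\<close>
    have sq: "(rt (i + 1) * rt (n - i)) * (rt (i + 1) * rt (n - i)) = qi (i + 1) * qi (n - i)"
      if "0 \<le> i" "i \<le> n" for i n
    proof -
      have "(rt (i + 1) * rt (n - i)) * (rt (i + 1) * rt (n - i)) =
          (rt (i + 1) * rt (i + 1)) * (rt (n - i) * rt (n - i))" by (simp add: mult_ac)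
      then show ?thesis using that by (simp add: rt_sq)
    qed
    have less: "qi (i + 1) * qi (n - i) < qi (i' + 1) * qi (n' - i')"
      if "n < n'" "2 * i - n = 2 * i' - n'" "0 \<le> i" "i \<le> n" for i n i' n'
      using that by (intro mult_strict_mono qi_strict_mono qi_pos qi_nonneg) auto
    have "qi (i + 1) * qi (n - i) \<noteq> qi (i' + 1) * qi (n' - i')"
      using less[of n n' i i'] less[of n' n i' i] neq 3 k k' by fastforce
    define ev where "ev = (\<lambda>(n, i, j :: int). (rt (i + 1) * rt (n - i)) * (rt (i + 1) * rt (n - i)))"
    have "Tk \<mu> ([Gf, Ge] @ w @ []) = complex_of_real (ev \<mu>) * Tk \<mu> w" for \<mu> w
      by (cases \<mu>) (simp add: Tk_def T_Cons ev_def)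
    moreover have "ev \<kappa> \<noteq> ev \<kappa>'"
      using \<open>qi (i + 1) * qi (n - i) \<noteq> qi (i' + 1) * qi (n' - i')\<close> k k'
      by (simp only: ev_def prod.case sq not_False_eq_True)
    ultimately show ?thesis by blast
  qed
qed

text \<open>
  The usual argument for eigenvectors with different eigenvalues: an operation that separates
  \<open>\<kappa>\<close> from \<open>\<mu>\<^sub>0\<close>, minus its eigenvalue at \<open>\<mu>\<^sub>0\<close>, removes \<open>\<mu>\<^sub>0\<close> from a linear relation and
  keeps \<open>\<kappa>\<close>.
\<close>

lemma Tk_coeff_zero:
  assumes "finite S" "S \<subseteq> ix" "\<kappa> \<in> ix" "\<kappa> \<notin> S"
    and "(\<Sum>\<mu>\<in>insert \<kappa> S. fscale (c \<mu>) (Tk \<mu>)) = 0"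
  shows "c \<kappa> = 0"
  using assms
proof (induction S arbitrary: c rule: finite_induct)
  case empty
  then have "fscale (c \<kappa>) (Tk \<kappa>) = 0" by simp
  then show ?case using Tk_nonzero[OF empty(2)] by (simp only: functional.scale_eq_0_iff) simp
next
  case (insert \<mu>\<^sub>0 S)
  have eval: "(\<Sum>\<mu>\<in>insert \<kappa> (insert \<mu>\<^sub>0 S). c \<mu> * Tk \<mu> w) = 0" for w
  proof -
    have "(\<Sum>\<mu>\<in>M. fscale (c \<mu>) (Tk \<mu>)) w = (\<Sum>\<mu>\<in>M. c \<mu> * Tk \<mu> w)" for M
      by (induction M rule: infinite_finite_induct) (auto simp: pointwise)
    then show ?thesis using insert.prems(4) by (metis zero_fun_apply)
  qed
  obtain u v ev where ev: "\<And>\<mu> w. Tk \<mu> (u @ w @ v) = complex_of_real (ev \<mu>) * Tk \<mu> w"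
    "ev \<kappa> \<noteq> ev \<mu>\<^sub>0"
    using Tk_separate[of \<kappa> \<mu>\<^sub>0] insert.prems by auto
  have "(\<Sum>\<mu>\<in>insert \<kappa> S. fscale (c \<mu> * complex_of_real (ev \<mu> - ev \<mu>\<^sub>0)) (Tk \<mu>)) = 0"
  proof
    fix w
    have app: "(\<Sum>\<mu>\<in>M. fscale (d \<mu>) (Tk \<mu>)) w = (\<Sum>\<mu>\<in>M. d \<mu> * Tk \<mu> w)" for M d
      by (induction M rule: infinite_finite_induct) (auto simp: pointwise)
    have "0 = (\<Sum>\<mu>\<in>insert \<kappa> (insert \<mu>\<^sub>0 S). c \<mu> * Tk \<mu> (u @ w @ v)) -
        complex_of_real (ev \<mu>\<^sub>0) * (\<Sum>\<mu>\<in>insert \<kappa> (insert \<mu>\<^sub>0 S). c \<mu> * Tk \<mu> w)"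
      unfolding eval by simp
    also have "\<dots> = (\<Sum>\<mu>\<in>insert \<mu>\<^sub>0 (insert \<kappa> S). (c \<mu> * complex_of_real (ev \<mu> - ev \<mu>\<^sub>0)) * Tk \<mu> w)"
      unfolding ev sum_distrib_left sum_subtractf[symmetric] insert_commute[of \<kappa>]
      by (rule sum.cong) (auto simp: algebra_simps)
    also have "\<dots> = (\<Sum>\<mu>\<in>insert \<kappa> S. (c \<mu> * complex_of_real (ev \<mu> - ev \<mu>\<^sub>0)) * Tk \<mu> w)"
      using insert.hyps insert.prems by (subst sum.insert) auto
    finally show "(\<Sum>\<mu>\<in>insert \<kappa> S. fscale (c \<mu> * complex_of_real (ev \<mu> - ev \<mu>\<^sub>0)) (Tk \<mu>)) w = 0 w"
      unfolding app by (simp add: pointwise)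
  qed
  then have "c \<kappa> * complex_of_real (ev \<kappa> - ev \<mu>\<^sub>0) = 0"
    using insert.prems by (intro insert.IH) auto
  then show ?case using ev(2) by simp
qed

lemma Tk_inj: "inj_on Tk ix"
proof (rule inj_onI, rule ccontr)
  fix \<kappa> \<mu> assume a: "\<kappa> \<in> ix" "\<mu> \<in> ix" "Tk \<kappa> = Tk \<mu>" "\<kappa> \<noteq> \<mu>"
  have "(1 :: complex) = 0"
    using Tk_coeff_zero[of "{\<mu>}" \<kappa> "\<lambda>\<nu>. if \<nu> = \<kappa> then 1 else - 1"] a by auto
  then show False by simp
qed

lemma Tk_independent: "functional.independent (Tk ` ix)"
proof
  assume "functional.dependent (Tk ` ix)"
  then obtain t u v where t: "finite t" "t \<subseteq> Tk ` ix" "(\<Sum>v\<in>t. fscale (u v) v) = 0"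
      "v \<in> t" "u v \<noteq> 0"
    unfolding functional.dependent_explicit by auto
  obtain S where S: "S \<subseteq> ix" "finite S" "t = Tk ` S"
    using finite_subset_image[OF t(1,2)] by auto
  then obtain \<kappa> where k: "\<kappa> \<in> S" "v = Tk \<kappa>" using t by auto
  have "inj_on Tk S" using Tk_inj S inj_on_subset by blast
  then have "(\<Sum>\<mu>\<in>insert \<kappa> (S - {\<kappa>}). fscale (u (Tk \<mu>)) (Tk \<mu>)) = 0"
    using t(3) k S by (simp add: sum.reindex insert_absorb insert_Diff)
  then have "u (Tk \<kappa>) = 0"
    using k S Tk_coeff_zero[of "S - {\<kappa>}" \<kappa> "\<lambda>\<mu>. u (Tk \<mu>)"] by auto
  then show False using t k by simp
qed

section \<open>The coordinate algebra\<close>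

abbreviation QA :: "functional set" where "QA \<equiv> carrier (SU2q q)"

lemma QA_span: "QA = functional.span (Tk ` ix)"
proof -
  have "{tcoef q s m n | s m n. s \<in> half_nats \<and> m \<in> weights s \<and> n \<in> weights s} = Tk ` ix"
  proof (intro equalityI subsetI)
    fix x assume "x \<in> {tcoef q s m n | s m n. s \<in> half_nats \<and> m \<in> weights s \<and> n \<in> weights s}"
    then obtain s m n where x: "x = tcoef q s m n" "s \<in> half_nats" "m \<in> weights s" "n \<in> weights s"
      by auto
    then obtain N a b :: nat where N: "s = real N / 2" "m = - s + real a" "n = - s + real b" "m \<le> s" "n \<le> s"
      by (auto simp: half_nats_def weights_def)
    then have "real a \<le> real N" "real b \<le> real N" by auto
    then have "(int N, int a, int b) \<in> ix" by (simp add: ix_def)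
    moreover have "x = Tk (int N, int a, int b)"
      using N by (simp only: x(1) Tk_def T_def prod.case) simp
    ultimately show "x \<in> Tk ` ix" by blast
  next
    fix x assume "x \<in> Tk ` ix"
    then obtain n i j where x: "x = T n i j" "0 \<le> i" "i \<le> n" "0 \<le> j" "j \<le> n"
      by (auto simp: Tk_def ix_def)
    have "of_int n / 2 \<in> half_nats"
      unfolding half_nats_def using x by (intro image_eqI[of _ _ "nat n"]) auto
    then show "x \<in> {tcoef q s m n | s m n. s \<in> half_nats \<and> m \<in> weights s \<and> n \<in> weights s}"
      using x weight_iff unfolding T_def by blast
  qed
  then show ?thesis by (simp add: SU2q_def)
qed

lemma QA_subspace: "functional.subspace QA"
  unfolding QA_span by (rule functional.subspace_span)

lemma QA_add: "x \<in> QA \<Longrightarrow> y \<in> QA \<Longrightarrow> x + y \<in> QA"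
  using QA_subspace functional.subspace_add by blast

lemma QA_scale: "x \<in> QA \<Longrightarrow> fscale c x \<in> QA"
  using QA_subspace functional.subspace_scale by blast

lemma QA_0: "0 \<in> QA"
  using QA_subspace functional.subspace_0 by blast

lemma QA_sum: "(\<And>i. i \<in> I \<Longrightarrow> f i \<in> QA) \<Longrightarrow> sum f I \<in> QA"
  using QA_subspace functional.subspace_sum by blast

lemma T_QA: "T n i j \<in> QA"
proof (cases "(n, i, j) \<in> ix")
  case True
  then have "Tk (n, i, j) \<in> QA" unfolding QA_span by (intro functional.span_base imageI)
  then show ?thesis by (simp add: Tk_def)
next
  case False
  then have "T n i j = 0" by (intro T_out) (auto simp: ix_def)
  then show ?thesis by (simp only: QA_0)
qed

lemma counit_QA: "counit \<in> QA"
  using T_QA[of 0 0 0] by (simp add: T_000)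

lemma QA_span_induct:
  assumes "x \<in> QA" "P 0"
    and "\<And>x y. x \<in> QA \<Longrightarrow> y \<in> QA \<Longrightarrow> P x \<Longrightarrow> P y \<Longrightarrow> P (x + y)"
    and "\<And>c x. x \<in> QA \<Longrightarrow> P x \<Longrightarrow> P (fscale c x)"
    and "\<And>n i j. 0 \<le> i \<Longrightarrow> i \<le> n \<Longrightarrow> 0 \<le> j \<Longrightarrow> j \<le> n \<Longrightarrow> P (T n i j)"
  shows "P x"
proof -
  have "x \<in> functional.span (Tk ` ix)" using assms(1) by (simp add: QA_span)
  then have "x \<in> QA \<and> P x"
  proof (rule functional.span_induct)
    show "functional.subspace {x. x \<in> QA \<and> P x}"
      using assms(2-4) QA_0 QA_add QA_scale by (auto simp: functional.subspace_def)
    show "y \<in> QA \<and> P y" if "y \<in> Tk ` ix" for y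
      using that assms(5) T_QA by (auto simp: Tk_def ix_def)
  qed
  then show ?thesis ..
qed

lemma cgA_nonzero:
  assumes "0 \<le> i" "i \<le> n + 1" "0 \<le> n"
  obtains a where "a = 0 \<or> a = 1" "0 \<le> i - a" "i - a \<le> n" "cgA a n (i - a) \<noteq> 0"
proof (cases "i = 0")
  case True
  then show ?thesis using assms rt_pos[of "n + 1"] that[of 0] by (auto simp: cgA_def)
next
  case False
  then show ?thesis using assms rt_pos[of "n + 1"] rt_pos[of i] that[of 1] by (auto simp: cgA_def)
qed

text \<open>
  The Clebsch-Gordan rule is a recurrence of three terms in the spin; the index \<open>- 1\<close>, where
  all matrix coefficients vanish, serves as second initial value.
\<close>

lemma int_two_step_induct [consumes 1]:
  assumes "0 \<le> n" "P (- 1)" "P (0::int)" "\<And>n. 0 \<le> n \<Longrightarrow> P n \<Longrightarrow> P (n - 1) \<Longrightarrow> P (n + 1)"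
  shows "P n"
proof -
  have "P n \<and> P (n - 1)" using assms(1)
  proof (induction n rule: int_ge_induct)
    case (step n)
    then show ?case using assms(4)[of n] by simp
  qed (use assms in auto)
  then show ?thesis ..
qed

text \<open>
  The top component of \<open>T 1 a b\<close> times a coefficient of spin \<open>n/2\<close> reaches every coefficient
  of the next spin, so the coordinate algebra is generated by the coefficients of spin one
  half.
\<close>

lemma T_Suc:
  assumes "0 \<le> n" "0 \<le> i" "i \<le> n + 1" "0 \<le> j" "j \<le> n + 1"
  obtains a b c d where "a = 0 \<or> a = 1" "b = 0 \<or> b = 1"
    and "T (n + 1) i j = fscale c (fmult (T 1 a b) (T n (i - a) (j - b))) +
      fscale d (T (n - 1) (i - 1) (j - 1))"
proof -
  obtain a where a: "a = 0 \<or> a = 1" "cgA a n (i - a) \<noteq> 0" using cgA_nonzero[of i n] assms by metis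
  obtain b where b: "b = 0 \<or> b = 1" "cgA b n (j - b) \<noteq> 0" using cgA_nonzero[of j n] assms by metis
  define c d where "c = complex_of_real (cgA a n (i - a) * cgA b n (j - b))"
    and "d = complex_of_real (cgB a n (i - a) * cgB b n (j - b))"
  have c: "c \<noteq> 0" using a b by (simp add: c_def)
  have "fmult (T 1 a b) (T n (i - a) (j - b)) =
      fscale c (T (n + 1) i j) + fscale d (T (n - 1) (i - 1) (j - 1))"
    using product_T[OF a(1) b(1) assms(1), of "i - a" "j - b"] by (simp add: c_def d_def)
  then have "T (n + 1) i j = fscale (1 / c) (fmult (T 1 a b) (T n (i - a) (j - b))) +
      fscale (- d / c) (T (n - 1) (i - 1) (j - 1))"
    using c by (auto simp: fun_eq_iff pointwise field_simps)
  with a b show ?thesis using that by blast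
qed

lemma QA_induct:
  assumes "x \<in> QA" "P 0"
    and add: "\<And>x y. x \<in> QA \<Longrightarrow> y \<in> QA \<Longrightarrow> P x \<Longrightarrow> P y \<Longrightarrow> P (x + y)"
    and scale: "\<And>c x. x \<in> QA \<Longrightarrow> P x \<Longrightarrow> P (fscale c x)"
    and one: "P counit"
    and mult: "\<And>a b x. a = 0 \<or> a = 1 \<Longrightarrow> b = 0 \<or> b = 1 \<Longrightarrow> x \<in> QA \<Longrightarrow> P x \<Longrightarrow> P (fmult (T 1 a b) x)"
  shows "P x"
proof (rule QA_span_induct[OF assms(1-2) add scale])
  fix n i j :: int assume "0 \<le> i" "i \<le> n" "0 \<le> j" "j \<le> n"
  have P_out: "P (T n i j)" if "\<not> (0 \<le> i \<and> i \<le> n \<and> 0 \<le> j \<and> j \<le> n)" for n i j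
    using T_out[OF that] assms(2) by (simp only:)
  have "0 \<le> n" using \<open>0 \<le> i\<close> \<open>i \<le> n\<close> by simp
  then have "\<forall>i j. P (T n i j)"
  proof (induction n rule: int_two_step_induct)
    case 1
    then show ?case by (auto intro: P_out)
  next
    case 2
    have "P (T 0 i j)" for i j
      using P_out[of i 0 j] one by (cases "i = 0 \<and> j = 0") (auto simp: T_000)
    then show ?case by blast
  next
    case (3 n)
    have "P (T (n + 1) i j)" if ij: "0 \<le> i" "i \<le> n + 1" "0 \<le> j" "j \<le> n + 1" for i j
    proof -
      obtain a b c d where ab: "a = 0 \<or> a = 1" "b = 0 \<or> b = 1"
        and T: "T (n + 1) i j = fscale c (fmult (T 1 a b) (T n (i - a) (j - b))) +
          fscale d (T (n - 1) (i - 1) (j - 1))"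
        using T_Suc[OF 3(1) ij] by metis
      have "fmult (T 1 a b) (T n (i - a) (j - b)) \<in> QA"
        unfolding product_T[OF ab 3(1)] by (intro QA_add QA_scale T_QA)
      then show ?thesis
        unfolding T using 3 ab by (intro add scale mult QA_scale T_QA; blast)
    qed
    then show ?case using P_out[of _ "n + 1"] by blast
  qed
  then show "P (T n i j)" by blast
qed

lemma QA_mult_T1:
  assumes "a = 0 \<or> a = 1" "b = 0 \<or> b = 1" "x \<in> QA"
  shows "fmult (T 1 a b) x \<in> QA"
  using assms(3)
proof (rule QA_span_induct)
  show "fmult (T 1 a b) (T n i j) \<in> QA" if "0 \<le> i" "i \<le> n" for n i j
    using that by (subst product_T[OF assms(1,2)]) (auto intro!: QA_add QA_scale T_QA)
qed (auto simp: fmult_add_right fmult_scale_right QA_0 intro!: QA_add QA_scale)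

lemma QA_mult:
  assumes "x \<in> QA" "y \<in> QA"
  shows "fmult x y \<in> QA"
  using assms(1)
proof (rule QA_induct)
qed (use assms(2) in \<open>auto simp: fmult_add_left fmult_scale_left fmult_assoc QA_0 intro: QA_add QA_scale QA_mult_T1\<close>)

lemma QA_star:
  assumes "x \<in> QA" shows "fstar q x \<in> QA"
  using assms
  by (rule QA_span_induct) (auto simp: fstar_add fstar_scale fstar_T QA_0 intro!: QA_add QA_scale T_QA)

text \<open>
  Matrix coefficients are linearly independent, so a linear map can be prescribed on them.
\<close>

lemma T_extend:
  obtains g :: "functional \<Rightarrow> functional"
  where "\<And>x y. g (x + y) = g x + g y" "\<And>c x. g (fscale c x) = fscale c (g x)"
    and "\<And>n i j. 0 \<le> i \<Longrightarrow> i \<le> n \<Longrightarrow> 0 \<le> j \<Longrightarrow> j \<le> n \<Longrightarrow> g (T n i j) = F n i j"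
proof -
  interpret ff: vector_space_pair fscale fscale ..
  obtain g where g: "Vector_Spaces.linear fscale fscale g"
    "\<And>x. x \<in> Tk ` ix \<Longrightarrow> g x = (\<lambda>(n, i, j). F n i j) (the_inv_into ix Tk x)"
    using ff.linear_independent_extend[OF Tk_independent, of "\<lambda>x. (\<lambda>(n, i, j). F n i j) (the_inv_into ix Tk x)"]
    by blast
  show ?thesis
  proof (rule that)
    show "g (x + y) = g x + g y" "g (fscale c x) = fscale c (g x)" for x y c
      using g(1) by (simp_all only: ff.linear_add ff.linear_scale)
    fix n i j :: int assume "0 \<le> i" "i \<le> n" "0 \<le> j" "j \<le> n"
    then have k: "(n, i, j) \<in> ix" by (simp add: ix_def)
    have "T n i j = Tk (n, i, j)" by (simp add: Tk_def)
    then show "g (T n i j) = F n i j"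
      using g(2)[of "T n i j"] k the_inv_into_f_f[OF Tk_inj k] by auto
  qed
qed

section \<open>The Haar functional\<close>

text \<open>
  The defining properties of the Haar functional can be satisfied, because matrix coefficients
  are linearly independent; the functional that maps an element to the value of its spin zero
  part at the empty word is a witness. So the chosen functional has these properties.
\<close>

lemma haar_properties:
  shows haar_add: "a \<in> QA \<Longrightarrow> b \<in> QA \<Longrightarrow> haar q (a + b) = haar q a + haar q b"
    and haar_scale: "a \<in> QA \<Longrightarrow> haar q (fscale c a) = c * haar q a"
    and haar_one: "haar q counit = 1"
    and haar_T: "0 \<le> n \<Longrightarrow> (n, i, j) \<noteq> (0, 0, 0) \<Longrightarrow> haar q (T n i j) = 0"
proof -
  define spec where "spec h \<longleftrightarrow>
     (\<forall>a\<in>QA. \<forall>b\<in>QA. h (a + b) = h a + h b) \<and>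
     (\<forall>c. \<forall>a\<in>QA. h (fscale c a) = c * h a) \<and>
     h \<one>\<^bsub>SU2q q\<^esub> = 1 \<and>
     (\<forall>s\<in>half_nats. s > 0 \<longrightarrow> (\<forall>m\<in>weights s. \<forall>n\<in>weights s. h (tcoef q s m n) = (0::complex)))" for h
  obtain g :: "functional \<Rightarrow> functional"
  where g: "\<And>x y. g (x + y) = g x + g y" "\<And>c x. g (fscale c x) = fscale c (g x)"
    "\<And>n i j. 0 \<le> i \<Longrightarrow> i \<le> n \<Longrightarrow> 0 \<le> j \<Longrightarrow> j \<le> n \<Longrightarrow> g (T n i j) = (if n = 0 then counit else 0)"
    using T_extend[of "\<lambda>n i j. if n = 0 then counit else 0"] by metis
  have one: "\<one>\<^bsub>SU2q q\<^esub> = counit" "tcoef q 0 0 0 = counit"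
    using T_000 by (simp_all add: SU2q_def T_def)
  have pos: "h (T n i j) = 0"
    if h: "\<forall>s\<in>half_nats. s > 0 \<longrightarrow> (\<forall>m\<in>weights s. \<forall>n\<in>weights s. h (tcoef q s m n) = (0::complex))"
      and n: "0 < n" "0 \<le> i" "i \<le> n" "0 \<le> j" "j \<le> n" for h n i j
  proof -
    have "of_int n / 2 \<in> half_nats"
      unfolding half_nats_def using n by (intro image_eqI[of _ _ "nat n"]) auto
    then show ?thesis using h n weight_iff[of i n] weight_iff[of j n] by (simp add: T_def)
  qed
  have "spec (\<lambda>x. g x [])"
    unfolding spec_def
  proof (intro conjI ballI allI impI)
    show "g \<one>\<^bsub>SU2q q\<^esub> [] = 1"
      using g(3)[of 0 0 0] by (simp add: one T_000 counit_def)
    fix s m n :: real assume s: "s \<in> half_nats" "s > 0" "m \<in> weights s" "n \<in> weights s"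
    then obtain N a b :: nat where N: "s = real N / 2" "m = - s + real a" "n = - s + real b" "m \<le> s" "n \<le> s"
      by (auto simp: half_nats_def weights_def)
    then have ab: "real a \<le> real N" "real b \<le> real N" by auto
    have "tcoef q s m n = T (int N) (int a) (int b)" using N by (simp only: T_def) simp
    moreover have "g (T (int N) (int a) (int b)) = 0"
      using g(3)[of "int a" "int N" "int b"] ab N s by simp
    ultimately show "g (tcoef q s m n) [] = 0" by (simp only: zero_fun_apply)
  qed (auto simp: g pointwise)
  moreover have "haar q = (SOME h. spec h)"
    unfolding haar_def spec_def ..
  ultimately have h: "spec (haar q)"
    using someI[of spec "\<lambda>x. g x []"] by simp
  then show "a \<in> QA \<Longrightarrow> b \<in> QA \<Longrightarrow> haar q (a + b) = haar q a + haar q b"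
    "a \<in> QA \<Longrightarrow> haar q (fscale c a) = c * haar q a" "haar q counit = 1"
    unfolding spec_def one by blast+
  assume n: "0 \<le> n" "(n, i, j) \<noteq> (0, 0, 0)"
  show "haar q (T n i j) = 0"
  proof (cases "0 \<le> i \<and> i \<le> n \<and> 0 \<le> j \<and> j \<le> n")
    case True
    then have "0 < n" using n by auto
    then show ?thesis using pos[of "haar q" n i j] h True unfolding spec_def by blast
  next
    case False
    have "haar q (fscale 0 counit) = 0 * haar q counit"
      using h counit_QA unfolding spec_def by blast
    then have "haar q 0 = 0" by simp
    then show ?thesis using T_out[OF False] by (simp only:)
  qed
qed

definition IP :: "functional \<Rightarrow> functional \<Rightarrow> complex" where
  "IP x y = haar q (fmult (fstar q x) y)"

lemma haar_0: "haar q 0 = 0"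
  using haar_scale[OF counit_QA, of 0] by simp

lemma IP_add_right: "x \<in> QA \<Longrightarrow> y \<in> QA \<Longrightarrow> z \<in> QA \<Longrightarrow> IP x (y + z) = IP x y + IP x z"
  by (simp add: IP_def fmult_add_right haar_add QA_mult QA_star)

lemma IP_scale_right: "x \<in> QA \<Longrightarrow> y \<in> QA \<Longrightarrow> IP x (fscale c y) = c * IP x y"
  by (simp add: IP_def fmult_scale_right haar_scale QA_mult QA_star)

lemma IP_add_left: "x \<in> QA \<Longrightarrow> y \<in> QA \<Longrightarrow> z \<in> QA \<Longrightarrow> IP (x + y) z = IP x z + IP y z"
  by (simp add: IP_def fmult_add_left fstar_add haar_add QA_mult QA_star)

lemma IP_scale_left: "x \<in> QA \<Longrightarrow> y \<in> QA \<Longrightarrow> IP (fscale c x) y = cnj c * IP x y"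
  by (simp add: IP_def fmult_scale_left fstar_scale haar_scale QA_mult QA_star)

lemma IP_mult: "IP (fmult a x) y = IP x (fmult (fstar q a) y)"
  by (simp add: IP_def fstar_fmult fmult_assoc)

text \<open>
  The squared length of \<open>T n i j\<close>. It varies with the row \<open>i\<close> because the Haar state is not a
  trace.
\<close>

definition nrm :: "int \<Rightarrow> int \<Rightarrow> real" where
  "nrm n i = hp (2 * n - 4 * i) / qi (n + 1)"

lemma nrm_pos: "0 \<le> n \<Longrightarrow> 0 < nrm n i"
  by (simp add: nrm_def qi_pos)

text \<open>
  Raising by \<open>T 1 a b\<close> and lowering by its adjoint are adjoint to each other for the inner
  product in which the matrix coefficients are orthogonal with squared lengths \<open>nrm\<close>.
\<close>

lemma cg_adjoint:
  assumes ab: "a = 0 \<or> a = 1" "b = 0 \<or> b = 1" and n: "0 \<le> n"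
  shows "cgA a n (i - a) * cgA b n (j - b) * nrm (n + 1) i =
    mq (b - a) * (cgB (1 - a) (n + 1) i * cgB (1 - b) (n + 1) j) * nrm n (i - a)"
proof -
  \<comment> \<open>The lowering coefficients at \<open>n + 1\<close> are multiples of the raising ones at \<open>n\<close>, by a factor independent of \<open>i\<close>.\<close>
  define r where "r a = (if a = 0 then - hp 1 else 1 / hp 1) * (rt (n + 1) / rt (n + 2))" for a :: int
  have rt: "rt (n + 1) \<noteq> 0" "rt (n + 2) \<noteq> 0"
    using n rt_pos[of "n + 1"] rt_pos[of "n + 2"] by auto
  have B: "cgB (1 - a) (n + 1) i = r a * cgA a n (i - a)" if "a = 0 \<or> a = 1" for a i
    using that rt by (auto simp: cgA_def cgB_def r_def hp_simps field_simps)
  have s: "rt (n + 1) * rt (n + 1) = qi (n + 1)" "rt (n + 2) * rt (n + 2) = qi (n + 2)"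
    using n by (auto simp: rt_sq)
  have qi: "0 < qi (n + 1)" "0 < qi (n + 2)" using n by (auto intro: qi_pos)
  have "r a * r b = (if a = b then hp (2 - 4 * a) else - 1) * (qi (n + 1) / qi (n + 2))"
    unfolding r_def s[symmetric] using ab hp_add[of 1 1] hp_add[of 2 2] hp_minus[of 2] by (auto simp: field_simps)
  then have "mq (b - a) * (r a * r b) = hp (2 - 4 * a) * (qi (n + 1) / qi (n + 2))"
    using ab q_pos by (auto simp: mq_1 mq_m1 hp_minus hp_2 field_simps)
  moreover have "nrm (n + 1) i = hp (2 - 4 * a) * (qi (n + 1) / qi (n + 2)) * nrm n (i - a)"
  proof -
    have "2 * (n + 1) - 4 * i = (2 - 4 * a) + (2 * n - 4 * (i - a))" by simp
    then have "hp (2 * (n + 1) - 4 * i) = hp (2 - 4 * a) * hp (2 * n - 4 * (i - a))"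
      by (metis hp_add)
    then show ?thesis using qi unfolding nrm_def by (simp add: field_simps)
  qed
  ultimately have "nrm (n + 1) i = mq (b - a) * (r a * r b) * nrm n (i - a)" by simp
  then show ?thesis unfolding B[OF ab(1)] B[OF ab(2)] by simp
qed

text \<open>
  By induction on the spin of the left argument: \<open>T (n + 1) i j\<close> is essentially a product with
  some \<open>T 1 a b\<close>, which moves to the right argument as its adjoint, again a multiple of a
  coefficient of spin one half. By the Clebsch-Gordan rule on both sides the claim is reduced
  to smaller spin, and \<open>cg_adjoint\<close> compares the constants.
\<close>

lemma IP_T:
  assumes "0 \<le> i" "i \<le> n" "0 \<le> j" "j \<le> n" "0 \<le> n'"
  shows "IP (T n i j) (T n' i' j') = (if (n', i', j') = (n, i, j) then of_real (nrm n i) else 0)"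
proof -
  have z: "T (- 1) i' j' = 0" for i' j' by (rule T_out) auto
  have IP0: "IP x 0 = 0" "IP 0 x = 0" for x by (simp_all add: IP_def haar_0)
  have "\<forall>i j n' i' j'. 0 \<le> i \<and> i \<le> n \<and> 0 \<le> j \<and> j \<le> n \<and> - 1 \<le> n' \<longrightarrow>
     IP (T n i j) (T n' i' j') = (if (n', i', j') = (n, i, j) then of_real (nrm n i) else 0)"
    (is "?P n")
  proof (rule int_two_step_induct[of n])
    show "0 \<le> n" using assms by simp
    show "?P (- 1)" by auto
    show "?P 0"
    proof (intro allI impI)
      fix i j n' i' j' :: int assume a: "0 \<le> i \<and> i \<le> 0 \<and> 0 \<le> j \<and> j \<le> 0 \<and> - 1 \<le> n'"
      then have ij: "i = 0" "j = 0" by auto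
      have "fstar q counit = counit" using fstar_T[of 0 0 0] by (simp add: T_000)
      then have "IP (T 0 0 0) x = haar q x" for x by (simp add: IP_def T_000)
      moreover have "haar q (T n' i' j') = (if (n', i', j') = (0, 0, 0) then 1 else 0)"
      proof (cases "n' = - 1")
        case True
        then show ?thesis using z by (simp only: haar_0) auto
      next
        case False
        then show ?thesis using haar_one haar_T[of n' i' j'] a by (auto simp: T_000)
      qed
      ultimately show "IP (T 0 i j) (T n' i' j') = (if (n', i', j') = (0, i, j) then of_real (nrm 0 i) else 0)"
        by (simp add: ij nrm_def)
    qed
    fix n :: int assume n: "0 \<le> n" and IH: "?P n" "?P (n - 1)"
    show "?P (n + 1)"
    proof (intro allI impI)
      fix i j n' i' j' :: int assume ij: "0 \<le> i \<and> i \<le> n + 1 \<and> 0 \<le> j \<and> j \<le> n + 1 \<and> - 1 \<le> n'"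
      show "IP (T (n + 1) i j) (T n' i' j') =
          (if (n', i', j') = (n + 1, i, j) then of_real (nrm (n + 1) i) else 0)"
      proof (cases "0 \<le> i' \<and> i' \<le> n' \<and> 0 \<le> j' \<and> j' \<le> n'")
        case False
        then show ?thesis using T_out[OF False] ij by (simp only: IP0) auto
      next
        case True
        then have n': "0 \<le> n'" by simp
        obtain a where a: "a = 0 \<or> a = 1" "0 \<le> i - a" "i - a \<le> n" "cgA a n (i - a) \<noteq> 0"
          using cgA_nonzero[of i n] n ij by metis
        obtain b where b: "b = 0 \<or> b = 1" "0 \<le> j - b" "j - b \<le> n" "cgA b n (j - b) \<noteq> 0"
          using cgA_nonzero[of j n] n ij by metis
        have ab': "1 - a = 0 \<or> 1 - a = 1" "1 - b = 0 \<or> 1 - b = 1" using a b by auto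
        define c d where "c = cgA a n (i - a) * cgA b n (j - b)"
          and "d = cgB a n (i - a) * cgB b n (j - b)"
        have prod: "fmult (T 1 a b) (T n (i - a) (j - b)) =
            fscale (of_real c) (T (n + 1) i j) + fscale (of_real d) (T (n - 1) (i - 1) (j - 1))"
          using product_T[OF a(1) b(1) n, of "i - a" "j - b"] by (simp add: c_def d_def)
        define u where "u = IP (T (n + 1) i j) (T n' i' j')"
        define v where "v = IP (T (n - 1) (i - 1) (j - 1)) (T n' i' j')"
        have v: "v = (if (n', i', j') = (n - 1, i - 1, j - 1) then of_real (nrm (n - 1) (i - 1)) else 0)"
        proof (cases "0 \<le> i - 1 \<and> i - 1 \<le> n - 1 \<and> 0 \<le> j - 1 \<and> j - 1 \<le> n - 1")
          case True
          then show ?thesis unfolding v_def using IH(2) n' by (intro IH(2)[rule_format]) auto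
        next
          case F: False
          then have "v = 0" unfolding v_def using T_out[OF F] by (simp only: IP0)
          then show ?thesis using F True by auto
        qed
        have cu: "of_real c * u + of_real d * v =
          IP (T n (i - a) (j - b)) (fmult (fstar q (T 1 a b)) (T n' i' j'))"
          unfolding IP_mult[symmetric] prod u_def v_def
          by (simp add: IP_add_left IP_scale_left T_QA QA_scale)
        define c' d' where "c' = cgA (1 - a) n' i' * cgA (1 - b) n' j'"
          and "d' = cgB (1 - a) n' i' * cgB (1 - b) n' j'"
        have "fmult (fstar q (T 1 a b)) (T n' i' j') =
            fscale (of_real (mq (b - a))) (fscale (of_real c') (T (n' + 1) (i' + 1 - a) (j' + 1 - b)) +
            fscale (of_real d') (T (n' - 1) (i' - a) (j' - b)))"
          using product_T[OF ab' n', of i' j']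
          by (simp add: fstar_T fmult_scale_left c'_def d'_def algebra_simps)
        then have "of_real c * u + of_real d * v = of_real (mq (b - a)) *
            (of_real c' * IP (T n (i - a) (j - b)) (T (n' + 1) (i' + 1 - a) (j' + 1 - b)) +
             of_real d' * IP (T n (i - a) (j - b)) (T (n' - 1) (i' - a) (j' - b)))"
          unfolding cu by (simp add: IP_add_right IP_scale_right T_QA QA_scale QA_add)
        also have "IP (T n (i - a) (j - b)) (T (n' + 1) (i' + 1 - a) (j' + 1 - b)) =
            (if (n', i', j') = (n - 1, i - 1, j - 1) then of_real (nrm n (i - a)) else 0)"
          using IH(1)[rule_format, of "i - a" "j - b" "n' + 1" "i' + 1 - a" "j' + 1 - b"] a b n' by auto
        also have "IP (T n (i - a) (j - b)) (T (n' - 1) (i' - a) (j' - b)) =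
            (if (n', i', j') = (n + 1, i, j) then of_real (nrm n (i - a)) else 0)"
          using IH(1)[rule_format, of "i - a" "j - b" "n' - 1" "i' - a" "j' - b"] a b n' by auto
        finally have eq: "of_real c * u + of_real d * v = of_real (mq (b - a)) *
            (of_real c' * (if (n', i', j') = (n - 1, i - 1, j - 1) then of_real (nrm n (i - a)) else 0) +
             of_real d' * (if (n', i', j') = (n + 1, i, j) then of_real (nrm n (i - a)) else 0))" .
        have c: "c \<noteq> 0" using a b by (simp add: c_def)
        \<comment> \<open>Both sides of \<open>eq\<close> are nonzero in two cases at most: the diagonal one, and the lower component of the left product.\<close>
        consider (up) "(n', i', j') = (n + 1, i, j)" | (down) "(n', i', j') = (n - 1, i - 1, j - 1)"
          | (other) "(n', i', j') \<noteq> (n + 1, i, j)" "(n', i', j') \<noteq> (n - 1, i - 1, j - 1)" by blast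
        then show ?thesis
        proof cases
          case up
          then have "of_real c * u = complex_of_real (mq (b - a) * d' * nrm n (i - a))"
            using eq v by simp
          also have "mq (b - a) * d' * nrm n (i - a) = c * nrm (n + 1) i"
            using cg_adjoint[OF a(1) b(1) n, of i j] up by (simp add: c_def d'_def)
          finally have "u = of_real (nrm (n + 1) i)" using c by simp
          then show ?thesis using up by (simp add: u_def)
        next
          case down
          have e: "1 - b - (1 - a) = - (b - a)" by simp
          have "c' * nrm n (i - a) = mq (- (b - a)) * d * nrm (n - 1) (i - 1)"
          proof -
            have e': "n - 1 + 1 = n" "i - a - (1 - a) = i - 1" "j - b - (1 - b) = j - 1"
              "1 - (1 - a) = a" "1 - (1 - b) = b" by simp_all
            have "n' = n - 1" "i' = i - 1" "j' = j - 1" using down by auto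
            then show ?thesis
              using cg_adjoint[OF ab', of "n - 1" "i - a" "j - b"] n'
              unfolding e e' c'_def d_def by simp
          qed
          then have "mq (b - a) * c' * nrm n (i - a) = d * nrm (n - 1) (i - 1)"
            using mq_inverse[of "b - a"] by (simp add: mult.assoc[symmetric]) (simp add: mult.assoc)
          then have "complex_of_real (mq (b - a) * c' * nrm n (i - a)) = of_real (d * nrm (n - 1) (i - 1))"
            by (rule arg_cong)
          then have "of_real c * u = 0" using eq v down by (simp add: mult.assoc)
          then show ?thesis using c down by (simp add: u_def)
        next
          case other
          then have "of_real c * u = 0"
            using eq v by (simp only: if_not_P) simp
          then have "u = 0" using c by simp
          then show ?thesis unfolding if_not_P[OF other(1)] u_def .
        qed
      qed
    qed
  qed
  then show ?thesis using assms by auto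
qed

end

section \<open>The coaction as a grading\<close>

context quantum_su2
begin

lemma SU2q_simps [simp]:
  "monoid.mult (SU2q q) = fmult" "one (SU2q q) = counit" "zero (SU2q q) = 0" "add (SU2q q) = (+)"
  "smult (SU2q q) = fscale" "star (SU2q q) = fstar q"
  using T_000 by (simp_all add: SU2q_def T_def)

lemma alpha_T: "alpha q = T 1 1 1" and beta_T: "beta q = T 1 1 0"
  by (simp_all add: alpha_def beta_def T_def)

lemma rt_2: "rt 2 * rt 2 = q + 1 / q"
  using qi_Suc[of 1] by (simp add: rt_sq hp_2 hp_minus)

text \<open>
  Used with \<open>x\<close> of spin one, which cancels, and \<open>y\<close> the unit.
\<close>

lemma fscale_combination:
  assumes "c\<^sub>1 + m * c\<^sub>2 = 0" "d\<^sub>1 + m * d\<^sub>2 = 1"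
  shows "(fscale (complex_of_real c\<^sub>1) x + fscale (complex_of_real d\<^sub>1) y) + fscale (complex_of_real m)
      (fscale (complex_of_real c\<^sub>2) x + fscale (complex_of_real d\<^sub>2) y) = y"
proof
  fix w
  have "((fscale (complex_of_real c\<^sub>1) x + fscale (complex_of_real d\<^sub>1) y) + fscale (complex_of_real m)
      (fscale (complex_of_real c\<^sub>2) x + fscale (complex_of_real d\<^sub>2) y)) w =
      of_real (c\<^sub>1 + m * c\<^sub>2) * x w + of_real (d\<^sub>1 + m * d\<^sub>2) * y w"
    by (simp add: pointwise algebra_simps)
  then show "((fscale (complex_of_real c\<^sub>1) x + fscale (complex_of_real d\<^sub>1) y) + fscale (complex_of_real m)
      (fscale (complex_of_real c\<^sub>2) x + fscale (complex_of_real d\<^sub>2) y)) w = y w"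
    unfolding assms by simp
qed

lemma cg_one:
  "cgA 0 1 1 * cgA 0 1 1 = q / (q + 1 / q)" "cgA 1 1 0 * cgA 1 1 0 = (1 / q) / (q + 1 / q)"
  "cgA 0 1 1 * cgA 1 1 0 = 1 / (q + 1 / q)" "cgA 1 1 0 * cgA 0 1 1 = 1 / (q + 1 / q)"
  "cgB 0 1 1 * cgB 0 1 1 = (1 / q) / (q + 1 / q)" "cgB 1 1 0 * cgB 1 1 0 = q / (q + 1 / q)"
  "cgB 0 1 1 * cgB 1 1 0 = - 1 / (q + 1 / q)" "cgB 1 1 0 * cgB 0 1 1 = - 1 / (q + 1 / q)"
proof -
  have q2: "hp 1 * hp 1 = q" using hp_double(3) hp_2 by simp
  have m: "1 / hp 1 * (1 / hp 1) = 1 / q" using q2 by simp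
  show "cgA 0 1 1 * cgA 0 1 1 = q / (q + 1 / q)" "cgA 1 1 0 * cgA 1 1 0 = (1 / q) / (q + 1 / q)"
    "cgA 0 1 1 * cgA 1 1 0 = 1 / (q + 1 / q)" "cgA 1 1 0 * cgA 0 1 1 = 1 / (q + 1 / q)"
    "cgB 0 1 1 * cgB 0 1 1 = (1 / q) / (q + 1 / q)" "cgB 1 1 0 * cgB 1 1 0 = q / (q + 1 / q)"
    "cgB 0 1 1 * cgB 1 1 0 = - 1 / (q + 1 / q)" "cgB 1 1 0 * cgB 0 1 1 = - 1 / (q + 1 / q)"
    unfolding rt_2[symmetric] using q2 m by (simp_all add: cgA_def cgB_def hp_minus)
qed

lemma q_fractions: "q / (q + 1 / q) + (1 / q) / (q + 1 / q) = 1"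
proof -
  have "q + 1 / q \<noteq> 0" using q_pos by (simp add: add_pos_pos less_imp_neq[symmetric])
  then show ?thesis by (subst add_divide_distrib[symmetric]) simp
qed

text \<open>
  Orthonormality of the columns of the spin one half matrix. In each product only the
  components \<open>T 2 1 1\<close> and \<open>counit\<close> occur.
\<close>

lemma T1_unitary:
  assumes "b = 0 \<or> b = 1"
  shows "fmult (fstar q (T 1 0 b)) (T 1 0 b) + fmult (fstar q (T 1 1 b)) (T 1 1 b) = counit"
  using assms
proof
  assume b: "b = 0"
  have "fmult (fstar q (T 1 0 b)) (T 1 0 b) =
      fscale (of_real (cgA 1 1 0 * cgA 1 1 0)) (T 2 1 1) + fscale (of_real (cgB 1 1 0 * cgB 1 1 0)) counit"
    using product_T[of 1 1 1 0 0] by (simp add: b fstar_T T_000 del: of_real_mult)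
  moreover have "fmult (fstar q (T 1 1 b)) (T 1 1 b) = fscale (of_real (mq (- 1)))
      (fscale (of_real (cgA 0 1 1 * cgA 1 1 0)) (T 2 1 1) + fscale (of_real (cgB 0 1 1 * cgB 1 1 0)) counit)"
    using product_T[of 0 1 1 1 0] by (simp add: b fstar_T T_000 fmult_scale_left del: of_real_mult)
  moreover have "cgA 1 1 0 * cgA 1 1 0 + mq (- 1) * (cgA 0 1 1 * cgA 1 1 0) = 0"
    "cgB 1 1 0 * cgB 1 1 0 + mq (- 1) * (cgB 0 1 1 * cgB 1 1 0) = 1"
    using q_fractions unfolding cg_one by (simp_all add: mq_m1 divide_inverse)
  ultimately show ?thesis using fscale_combination by (simp only:)
next
  assume b: "b = 1"
  have "fmult (fstar q (T 1 0 b)) (T 1 0 b) = fscale (of_real (mq 1))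
      (fscale (of_real (cgA 1 1 0 * cgA 0 1 1)) (T 2 1 1) + fscale (of_real (cgB 1 1 0 * cgB 0 1 1)) counit)"
    using product_T[of 1 0 1 0 1] by (simp add: b fstar_T T_000 fmult_scale_left del: of_real_mult)
  moreover have "fmult (fstar q (T 1 1 b)) (T 1 1 b) =
      fscale (of_real (cgA 0 1 1 * cgA 0 1 1)) (T 2 1 1) + fscale (of_real (cgB 0 1 1 * cgB 0 1 1)) counit"
    using product_T[of 0 0 1 1 1] by (simp add: b fstar_T T_000 del: of_real_mult)
  moreover have "cgA 0 1 1 * cgA 0 1 1 + mq 1 * (cgA 1 1 0 * cgA 0 1 1) = 0"
    "cgB 0 1 1 * cgB 0 1 1 + mq 1 * (cgB 1 1 0 * cgB 0 1 1) = 1"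
    using q_fractions unfolding cg_one by (simp_all add: mq_1 divide_inverse)
  ultimately show ?thesis
    unfolding add.commute[of "fmult (fstar q (T 1 0 b)) (T 1 0 b)"] using fscale_combination by (simp only:)
qed

text \<open>
  The quantum determinant. Right multiplication by \<open>T 1 1 1\<close> and \<open>- q T 1 1 0\<close> turns the
  coefficients \<open>T 1 0 0\<close> and \<open>T 1 0 1\<close> into the unit, so an element is determined by its
  products with these two.
\<close>

lemma T1_determinant:
  "fmult (T 1 0 0) (T 1 1 1) + fscale (of_real (- q)) (fmult (T 1 0 1) (T 1 1 0)) = counit"
proof -
  have "fmult (T 1 0 0) (T 1 1 1) =
      fscale (of_real (cgA 0 1 1 * cgA 0 1 1)) (T 2 1 1) + fscale (of_real (cgB 0 1 1 * cgB 0 1 1)) counit"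
    using product_T[of 0 0 1 1 1] by (simp add: T_000 del: of_real_mult)
  moreover have "fmult (T 1 0 1) (T 1 1 0) =
      fscale (of_real (cgA 0 1 1 * cgA 1 1 0)) (T 2 1 1) + fscale (of_real (cgB 0 1 1 * cgB 1 1 0)) counit"
    using product_T[of 0 1 1 1 0] by (simp add: T_000 del: of_real_mult)
  moreover have "cgA 0 1 1 * cgA 0 1 1 + (- q) * (cgA 0 1 1 * cgA 1 1 0) = 0"
    "cgB 0 1 1 * cgB 0 1 1 + (- q) * (cgB 0 1 1 * cgB 1 1 0) = 1"
    using q_fractions unfolding cg_one by (simp_all add: divide_inverse)
  ultimately show ?thesis using fscale_combination by (simp only:)
qed

end

locale weighted_projective = quantum_su2 q for q :: real +
  fixes k l :: nat
  assumes k_pos: "0 < k" and l_pos: "0 < l"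
begin

text \<open>
  The exponent of \<open>u\<close> in the image of \<open>T n i j\<close> under the coaction: the only affine function
  that is \<open>- k\<close> for \<open>\<alpha>\<close>, \<open>l\<close> for \<open>\<beta>\<close>, changes sign under the star, and is the sum of the
  degrees of the factors for both terms in the Clebsch-Gordan rule.
\<close>

definition deg :: "int \<Rightarrow> int \<Rightarrow> int \<Rightarrow> int" where
  "deg n i j = (int l - int k) * i - (int k + int l) * j + int k * n"

text \<open>The homogeneous elements of degree \<open>p\<close>.\<close>

definition U :: "int \<Rightarrow> functional set" where
  "U p = functional.span {T n i j | n i j. deg n i j = p}"

lemma U_subspace: "functional.subspace (U p)"
  unfolding U_def by (rule functional.subspace_span)

lemma U_add: "x \<in> U p \<Longrightarrow> y \<in> U p \<Longrightarrow> x + y \<in> U p"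
  using U_subspace functional.subspace_add by blast

lemma U_scale: "x \<in> U p \<Longrightarrow> fscale c x \<in> U p"
  using U_subspace functional.subspace_scale by blast

lemma U_0: "0 \<in> U p"
  using U_subspace functional.subspace_0 by blast

lemma T_U: "deg n i j = p \<Longrightarrow> T n i j \<in> U p"
  unfolding U_def by (intro functional.span_base) blast

lemma U_induct:
  assumes "x \<in> U p" "P 0" "\<And>x y. P x \<Longrightarrow> P y \<Longrightarrow> P (x + y)" "\<And>c x. P x \<Longrightarrow> P (fscale c x)"
    and "\<And>n i j. deg n i j = p \<Longrightarrow> P (T n i j)"
  shows "P x"
  using assms(1) unfolding U_def
proof (rule functional.span_induct)
  show "functional.subspace {x. P x}"
    using assms(2-4) by (auto simp: functional.subspace_def)
qed (use assms(5) in auto)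

lemma U_QA: "x \<in> U p \<Longrightarrow> x \<in> QA"
  by (erule U_induct) (auto intro: QA_0 QA_add QA_scale T_QA)

lemma U_mult_T1:
  assumes "a = 0 \<or> a = 1" "b = 0 \<or> b = 1" "x \<in> U p" "r = deg 1 a b + p"
  shows "fmult (T 1 a b) x \<in> U r"
  using assms(3)
proof (rule U_induct)
  fix n i j assume d: "deg n i j = p"
  show "fmult (T 1 a b) (T n i j) \<in> U r"
  proof (cases "0 \<le> n")
    case True
    have "deg (n + 1) (i + a) (j + b) = r" "deg (n - 1) (i + a - 1) (j + b - 1) = r"
      using d assms(4) by (simp_all add: deg_def algebra_simps)
    then show ?thesis
      unfolding product_T[OF assms(1,2) True] by (intro U_add U_scale T_U)
  next
    case False
    then have "T n i j = 0" by (intro T_out) auto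
    then show ?thesis by (simp only: fmult_zero U_0)
  qed
qed (auto simp: fmult_add_right fmult_scale_right intro: U_0 U_add U_scale)

text \<open>
  By \<open>product_T\<close> for the factors of spin one half, and by \<open>T_Suc\<close> for the others.
\<close>

lemma U_mult_T:
  assumes "0 \<le> n" "y \<in> U r"
  shows "\<forall>i j. fmult (T n i j) y \<in> U (deg n i j + r)"
  using assms(1)
proof (induction n rule: int_two_step_induct)
  case 1
  have "T (- 1) i j = 0" for i j by (rule T_out) auto
  then show ?case by (simp only: fmult_zero U_0) simp
next
  case 2
  have "fmult (T 0 i j) y \<in> U (deg 0 i j + r)" for i j
  proof (cases "i = 0 \<and> j = 0")
    case True
    then show ?thesis using assms(2) by (simp add: T_000 deg_def)
  next
    case False
    then have "T 0 i j = 0" by (intro T_out) auto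
    then show ?thesis by (simp only: fmult_zero U_0)
  qed
  then show ?case by blast
next
  case (3 n)
  have "fmult (T (n + 1) i j) y \<in> U (deg (n + 1) i j + r)" for i j
  proof (cases "0 \<le> i \<and> i \<le> n + 1 \<and> 0 \<le> j \<and> j \<le> n + 1")
    case True
    then obtain a b c d where ab: "a = 0 \<or> a = 1" "b = 0 \<or> b = 1"
      and T: "T (n + 1) i j = fscale c (fmult (T 1 a b) (T n (i - a) (j - b))) +
        fscale d (T (n - 1) (i - 1) (j - 1))"
      using T_Suc[of n i j] 3(1) by metis
    have "deg (n + 1) i j + r = deg (n - 1) (i - 1) (j - 1) + r"
      by (simp add: deg_def algebra_simps)
    moreover have "deg (n + 1) i j + r = deg 1 a b + (deg n (i - a) (j - b) + r)"
      by (simp add: deg_def algebra_simps)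
    ultimately have "fmult (T 1 a b) (fmult (T n (i - a) (j - b)) y) \<in> U (deg (n + 1) i j + r)"
      "fmult (T (n - 1) (i - 1) (j - 1)) y \<in> U (deg (n + 1) i j + r)"
      using 3 U_mult_T1[OF ab] by metis+
    then show ?thesis
      unfolding T fmult_add_left fmult_scale_left fmult_assoc by (intro U_add U_scale)
  next
    case False
    show ?thesis using T_out[OF False] by (simp only: fmult_zero U_0)
  qed
  then show ?case by blast
qed

lemma U_mult:
  assumes "x \<in> U p" "y \<in> U r"
  shows "fmult x y \<in> U (p + r)"
  using assms(1)
proof (rule U_induct)
  fix n i j assume d: "deg n i j = p"
  show "fmult (T n i j) y \<in> U (p + r)"
  proof (cases "0 \<le> n")
    case True
    then show ?thesis using U_mult_T[OF _ assms(2)] d by blast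
  next
    case False
    then have "T n i j = 0" by (intro T_out) auto
    then show ?thesis by (simp only: fmult_zero U_0)
  qed
qed (auto simp: fmult_add_left fmult_scale_left intro: U_0 U_add U_scale)

lemma U_star:
  assumes "x \<in> U p" shows "fstar q x \<in> U (- p)"
  using assms
proof (rule U_induct)
  fix n i j assume "deg n i j = p"
  then have "deg n (n - i) (n - j) = - p" by (auto simp: deg_def algebra_simps)
  then show "fstar q (T n i j) \<in> U (- p)" unfolding fstar_T by (intro U_scale T_U)
qed (auto simp: fstar_add fstar_scale intro: U_0 U_add U_scale)

lemma counit_U: "counit \<in> U 0"
  using T_U[of 0 0 0 0] by (simp add: T_000 deg_def)

definition is_comp :: "int \<Rightarrow> (functional \<Rightarrow> functional) \<Rightarrow> bool" where
  "is_comp p g \<longleftrightarrow> (\<forall>x y. g (x + y) = g x + g y) \<and> (\<forall>c x. g (fscale c x) = fscale c (g x)) \<and>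
     (\<forall>n i j. 0 \<le> i \<and> i \<le> n \<and> 0 \<le> j \<and> j \<le> n \<longrightarrow> g (T n i j) = (if deg n i j = p then T n i j else 0))"

text \<open>The homogeneous component of degree \<open>p\<close>.\<close>

definition comp :: "int \<Rightarrow> functional \<Rightarrow> functional" where
  "comp p = (SOME g. is_comp p g)"

lemma comp_spec: "is_comp p (comp p)"
proof -
  obtain g where g: "\<And>x y. g (x + y) = g x + g y" "\<And>c x. g (fscale c x) = fscale c (g x)"
    "\<And>n i j. 0 \<le> i \<Longrightarrow> i \<le> n \<Longrightarrow> 0 \<le> j \<Longrightarrow> j \<le> n \<Longrightarrow> g (T n i j) = (if deg n i j = p then T n i j else 0)"
    by (rule T_extend[of "\<lambda>n i j. if deg n i j = p then T n i j else 0"]) (rule that)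
  have "is_comp p g" unfolding is_comp_def using g by blast
  then show ?thesis unfolding comp_def by (rule someI[of "is_comp p"])
qed

lemma comp_add: "comp p (x + y) = comp p x + comp p y"
  and comp_scale: "comp p (fscale c x) = fscale c (comp p x)"
  using comp_spec unfolding is_comp_def by blast+

lemma comp_0: "comp p 0 = 0"
  using comp_scale[of p 0 0] by simp

lemma comp_sum: "comp p (\<Sum>i\<in>I. f i) = (\<Sum>i\<in>I. comp p (f i))"
  by (induction I rule: infinite_finite_induct) (auto simp: comp_0 comp_add)

lemma comp_T: "comp p (T n i j) = (if deg n i j = p then T n i j else 0)"
proof (cases "0 \<le> i \<and> i \<le> n \<and> 0 \<le> j \<and> j \<le> n")
  case True
  then show ?thesis using comp_spec unfolding is_comp_def by blast
next
  case False
  show ?thesis using T_out[OF False] comp_0 by simp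
qed

lemma comp_U:
  assumes "x \<in> U p" shows "comp r x = (if r = p then x else 0)"
  using assms by (rule U_induct) (auto simp: comp_0 comp_add comp_scale comp_T)

lemma comp_in_U:
  assumes "x \<in> QA" shows "comp p x \<in> U p"
  using assms by (rule QA_span_induct) (auto simp: comp_0 comp_add comp_scale comp_T intro: U_0 U_add U_scale T_U)

lemma U_iff: "x \<in> U p \<longleftrightarrow> x \<in> QA \<and> comp p x = x"
  using comp_U U_QA comp_in_U by metis

lemma comp_decomposition:
  assumes "x \<in> QA"
  shows "finite {p. comp p x \<noteq> 0} \<and> x = (\<Sum>p | comp p x \<noteq> 0. comp p x)"
proof -
  have "\<exists>F. finite F \<and> (\<forall>p. p \<notin> F \<longrightarrow> comp p x = 0) \<and> x = (\<Sum>p\<in>F. comp p x)"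
    using assms
  proof (rule QA_span_induct)
    show "\<exists>F. finite F \<and> (\<forall>p. p \<notin> F \<longrightarrow> comp p 0 = 0) \<and> 0 = (\<Sum>p\<in>F. comp p 0)"
      by (intro exI[of _ "{}"]) (auto simp: comp_0)
  next
    fix x y assume "\<exists>F. finite F \<and> (\<forall>p. p \<notin> F \<longrightarrow> comp p x = 0) \<and> x = (\<Sum>p\<in>F. comp p x)"
      "\<exists>F. finite F \<and> (\<forall>p. p \<notin> F \<longrightarrow> comp p y = 0) \<and> y = (\<Sum>p\<in>F. comp p y)"
    then obtain F G where F: "finite F" "\<forall>p. p \<notin> F \<longrightarrow> comp p x = 0" "x = (\<Sum>p\<in>F. comp p x)"
      and G: "finite G" "\<forall>p. p \<notin> G \<longrightarrow> comp p y = 0" "y = (\<Sum>p\<in>G. comp p y)" by blast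
    have "x = (\<Sum>p\<in>F \<union> G. comp p x)"
      using F(1,2) G(1,2) by (subst F(3), intro sum.mono_neutral_left) auto
    moreover have "y = (\<Sum>p\<in>F \<union> G. comp p y)"
      using F(1,2) G(1,2) by (subst G(3), intro sum.mono_neutral_left) auto
    ultimately have "x + y = (\<Sum>p\<in>F \<union> G. comp p (x + y))"
      unfolding comp_add sum.distrib by (rule arg_cong2)
    moreover have "finite (F \<union> G)" "\<forall>p. p \<notin> F \<union> G \<longrightarrow> comp p (x + y) = 0"
      using F(1,2) G(1,2) by (auto simp: comp_add)
    ultimately show "\<exists>F. finite F \<and> (\<forall>p. p \<notin> F \<longrightarrow> comp p (x + y) = 0) \<and> x + y = (\<Sum>p\<in>F. comp p (x + y))"
      by blast
  next
    fix c x assume "\<exists>F. finite F \<and> (\<forall>p. p \<notin> F \<longrightarrow> comp p x = 0) \<and> x = (\<Sum>p\<in>F. comp p x)"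
    then obtain F where F: "finite F" "\<forall>p. p \<notin> F \<longrightarrow> comp p x = 0" "x = (\<Sum>p\<in>F. comp p x)" by blast
    have "fscale c x = (\<Sum>p\<in>F. comp p (fscale c x))"
      by (subst F(3)) (simp add: comp_scale functional.scale_sum_right)
    moreover have "\<forall>p. p \<notin> F \<longrightarrow> comp p (fscale c x) = 0"
      using F(2) by (auto simp: comp_scale)
    ultimately show "\<exists>F. finite F \<and> (\<forall>p. p \<notin> F \<longrightarrow> comp p (fscale c x) = 0) \<and> fscale c x = (\<Sum>p\<in>F. comp p (fscale c x))"
      using F(1) by blast
  next
    fix n i j
    show "\<exists>F. finite F \<and> (\<forall>p. p \<notin> F \<longrightarrow> comp p (T n i j) = 0) \<and> T n i j = (\<Sum>p\<in>F. comp p (T n i j))"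
      by (intro exI[of _ "{deg n i j}"]) (auto simp: comp_T)
  qed
  then obtain F where F: "finite F" "\<forall>p. p \<notin> F \<longrightarrow> comp p x = 0" "x = (\<Sum>p\<in>F. comp p x)" by blast
  have sub: "{p. comp p x \<noteq> 0} \<subseteq> F" using F(2) by auto
  have "(\<Sum>p | comp p x \<noteq> 0. comp p x) = (\<Sum>p\<in>F. comp p x)"
    using sub F(1) by (intro sum.mono_neutral_left) auto
  from trans[OF F(3) this[symmetric]] show ?thesis
    using finite_subset[OF sub F(1)] by blast
qed

lemma comp_fmult:
  assumes "x \<in> QA" "y \<in> QA"
  shows "comp i (fmult x y) = (\<Sum>j | comp j x \<noteq> 0. fmult (comp j x) (comp (i - j) y))"
proof -
  have c: "comp i (fmult (comp j x) (comp m y)) = (if m = i - j then fmult (comp j x) (comp m y) else 0)" for j m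
    using comp_U[OF U_mult[OF comp_in_U[OF assms(1), of j] comp_in_U[OF assms(2), of m]], of i] by auto
  have "comp i (fmult (comp j x) y) = fmult (comp j x) (comp (i - j) y)" for j
  proof -
    have "comp i (fmult (comp j x) y) =
        comp i (fmult (comp j x) (\<Sum>m | comp m y \<noteq> 0. comp m y))"
      using comp_decomposition[OF assms(2)] by metis
    also have "\<dots> = (\<Sum>m | comp m y \<noteq> 0. if m = i - j then fmult (comp j x) (comp m y) else 0)"
      by (simp only: fmult_sum_right comp_sum c)
    also have "\<dots> = fmult (comp j x) (comp (i - j) y)"
      using comp_decomposition[OF assms(2)] by (auto simp: sum.delta)
    finally show ?thesis .
  qed
  then have "comp i (fmult (\<Sum>j | comp j x \<noteq> 0. comp j x) y) =
      (\<Sum>j | comp j x \<noteq> 0. fmult (comp j x) (comp (i - j) y))"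
    by (simp only: fmult_sum_left comp_sum)
  then show ?thesis using comp_decomposition[OF assms(1)] by metis
qed

lemma comp_fstar:
  assumes "x \<in> QA" shows "comp i (fstar q x) = fstar q (comp (- i) x)"
  using assms
proof (rule QA_span_induct)
  fix n i' j
  have "deg n (n - i') (n - j) = i \<longleftrightarrow> deg n i' j = - i"
    by (auto simp: deg_def algebra_simps)
  then show "comp i (fstar q (T n i' j)) = fstar q (comp (- i) (T n i' j))"
    by (auto simp: fstar_T comp_scale comp_T)
qed (auto simp: comp_0 comp_add comp_scale fstar_add fstar_scale)

lemma SU2q_B_simps:
  "monoid.mult (SU2q_B q) = (\<lambda>P R i. \<Sum>j | P j \<noteq> 0. fmult (P j) (R (i - j)))"
  "one (SU2q_B q) = umono 0 counit" "add (SU2q_B q) = (+)"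
  "smult (SU2q_B q) = (\<lambda>c P i. fscale c (P i))" "star (SU2q_B q) = (\<lambda>P i. fstar q (P (- i)))"
  "carrier (SU2q_B q) = {P. finite {i. P i \<noteq> 0} \<and> (\<forall>i. P i \<in> QA)}"
  by (simp_all add: SU2q_B_def)

lemma comp_star_hom:
  "star_hom (SU2q q) (SU2q_B q) (\<lambda>x p. comp p x)"
proof -
  have "(\<lambda>x p. comp p x) \<in> ring_hom (SU2q q) (SU2q_B q)"
  proof (rule ring_hom_memI)
    show "(\<lambda>p. comp p x) \<in> carrier (SU2q_B q)" if "x \<in> QA" for x
      unfolding SU2q_B_simps using comp_decomposition[OF that] comp_in_U[OF that] U_QA by auto
    show "(\<lambda>p. comp p (x \<otimes>\<^bsub>SU2q q\<^esub> y)) = (\<lambda>p. comp p x) \<otimes>\<^bsub>SU2q_B q\<^esub> (\<lambda>p. comp p y)"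
      if "x \<in> QA" "y \<in> QA" for x y
      using that by (simp add: SU2q_B_simps comp_fmult)
    show "(\<lambda>p. comp p (x \<oplus>\<^bsub>SU2q q\<^esub> y)) = (\<lambda>p. comp p x) \<oplus>\<^bsub>SU2q_B q\<^esub> (\<lambda>p. comp p y)" for x y
      by (rule ext) (simp add: SU2q_B_simps comp_add plus_fun_apply)
    show "(\<lambda>p. comp p \<one>\<^bsub>SU2q q\<^esub>) = \<one>\<^bsub>SU2q_B q\<^esub>"
      by (auto simp: SU2q_B_simps umono_def comp_U[OF counit_U])
  qed
  then show ?thesis
    unfolding star_hom_def by (auto simp: SU2q_B_simps comp_scale comp_fstar)
qed

text \<open>
  Taking homogeneous components is a star-homomorphism with the prescribed values on \<open>\<alpha>\<close> and
  \<open>\<beta>\<close>. Two such star-homomorphisms agree on the adjoints of \<open>\<alpha>\<close> and \<open>\<beta>\<close>, that is, on all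
  coefficients of spin one half, and hence everywhere.
\<close>

lemma coaction_comp:
  assumes "x \<in> QA" shows "coaction q k l x = (\<lambda>p. comp p x)"
proof -
  define spec where "spec \<theta> \<longleftrightarrow> star_hom (SU2q q) (SU2q_B q) \<theta> \<and>
     \<theta> (alpha q) = umono (- int k) (alpha q) \<and> \<theta> (beta q) = umono (int l) (beta q)" for \<theta>
  have "spec (\<lambda>x p. comp p x)"
    using comp_star_hom by (auto simp: spec_def alpha_T beta_T comp_T umono_def deg_def fun_eq_iff)
  moreover have "coaction q k l = (SOME \<theta>. spec \<theta>)"
    unfolding coaction_def spec_def ..
  ultimately have sp: "spec (coaction q k l)"
    using someI[of spec "\<lambda>x p. comp p x"] by simp
  define \<theta> where "\<theta> = coaction q k l"
  have gen: "\<theta> (T 1 a b) = (\<lambda>p. comp p (T 1 a b))" if "a = 0 \<or> a = 1" "b = 0 \<or> b = 1" for a b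
  proof -
    have ab: "\<theta> (T 1 1 c) = (\<lambda>p. comp p (T 1 1 c))" if "c = 0 \<or> c = 1" for c
      using that sp by (auto simp: spec_def alpha_T beta_T comp_T umono_def deg_def fun_eq_iff \<theta>_def)
    have hom: "\<theta> (fscale c x) = (\<lambda>i. fscale c (\<theta> x i))" "\<theta> (fstar q x) = (\<lambda>i. fstar q (\<theta> x (- i)))" if "x \<in> QA" for c x
      using sp that unfolding spec_def star_hom_def by (auto simp: SU2q_B_simps \<theta>_def)
    show ?thesis using that(1)
    proof
      assume a: "a = 0"
      have c: "1 - b = 0 \<or> 1 - b = 1" using that by auto
      have T: "T 1 a b = fscale (of_real (mq b)) (fstar q (T 1 1 (1 - b)))"
        using mq_inverse[of b] by (simp add: a fstar_T flip: of_real_mult)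
      show ?thesis
        unfolding T by (simp add: hom T_QA QA_star ab[OF c] comp_scale comp_fstar)
    qed (use ab that in auto)
  qed
  have "\<theta> x = (\<lambda>p. comp p x)"
    using assms
  proof (rule QA_induct)
    have rh: "\<theta> \<in> ring_hom (SU2q q) (SU2q_B q)" using sp by (simp add: spec_def star_hom_def \<theta>_def)
    have rh': "(\<lambda>x p. comp p x) \<in> ring_hom (SU2q q) (SU2q_B q)" using comp_star_hom by (simp add: star_hom_def)
    have scale: "\<theta> (fscale c x) = (\<lambda>i. fscale c (\<theta> x i))" if "x \<in> QA" for c x
      using sp that unfolding spec_def star_hom_def by (auto simp: SU2q_B_simps \<theta>_def)
    show one: "\<theta> counit = (\<lambda>p. comp p counit)"
      using ring_hom_one[OF rh] ring_hom_one[OF rh'] by simp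
    show "\<theta> 0 = (\<lambda>p. comp p 0)"
      using scale[OF counit_QA, of 0] by (simp add: comp_0)
    show "\<theta> (x + y) = (\<lambda>p. comp p (x + y))" if "x \<in> QA" "y \<in> QA" "\<theta> x = (\<lambda>p. comp p x)" "\<theta> y = (\<lambda>p. comp p y)" for x y
      using ring_hom_add[OF rh, of x y] ring_hom_add[OF rh', of x y] that by simp
    show "\<theta> (fscale c x) = (\<lambda>p. comp p (fscale c x))" if "x \<in> QA" "\<theta> x = (\<lambda>p. comp p x)" for c x
      using scale that by (simp add: comp_scale)
    show "\<theta> (fmult (T 1 a b) x) = (\<lambda>p. comp p (fmult (T 1 a b) x))"
      if "a = 0 \<or> a = 1" "b = 0 \<or> b = 1" "x \<in> QA" "\<theta> x = (\<lambda>p. comp p x)" for a b x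
      using ring_hom_mult[OF rh, of "T 1 a b" x] ring_hom_mult[OF rh', of "T 1 a b" x] that gen T_QA by simp
  qed
  then show ?thesis by (simp add: \<theta>_def)
qed

lemma coaction_iff:
  assumes "x \<in> QA" shows "coaction q k l x = umono p x \<longleftrightarrow> x \<in> U p"
proof
  assume "coaction q k l x = umono p x"
  then have "comp p x = umono p x p" using coaction_comp[OF assms] by metis
  then show "x \<in> U p" using assms by (simp add: U_iff umono_def)
next
  assume "x \<in> U p"
  then show "coaction q k l x = umono p x"
    using coaction_comp[OF assms] comp_U by (auto simp: umono_def fun_eq_iff)
qed

lemma WPq_eq:
  "WPq q k l = \<lparr>carrier = U 0, monoid.mult = fmult, one = counit, zero = 0, add = (+),
      smult = fscale, star = fstar q\<rparr>"
proof -
  have "{t \<in> QA. coaction q k l t = umono 0 t} = U 0"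
    using coaction_iff U_QA by auto
  moreover have "tcoef q 0 0 0 = counit" using T_000 by (simp add: T_def)
  ultimately show ?thesis unfolding WPq_def by (simp add: SU2q_def)
qed

lemma WPq_star_algebra: "unital_star_algebra (WPq q k l)"
  unfolding WPq_eq
proof (rule unital_star_algebra_subspace)
  show "fmult x y \<in> U 0" if "x \<in> U 0" "y \<in> U 0" for x y
    using U_mult[OF that] by simp
  show "fstar q x \<in> U 0" if "x \<in> U 0" for x
    using U_star[OF that] by simp
qed (use U_subspace counit_U q_pos in auto)

text \<open>
  The coaction on \<open>e\<^sub>+\<close> and \<open>e\<^sub>-\<close> contributes \<open>- k\<close> and \<open>l\<close> to the degree, which the
  coefficients must compensate.
\<close>

lemma coinvariant_spinors_eq: "coinvariant_spinors q k l = U (int k) \<times> U (- int l)"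
proof (intro equalityI subsetI)
  fix w assume w: "w \<in> coinvariant_spinors q k l"
  obtain a b where ab: "w = (a, b)" by (cases w)
  have qa: "a \<in> QA" "b \<in> QA" using w by (auto simp: ab coinvariant_spinors_def)
  have "spinor_coaction q k l w 0 = umono 0 w 0"
    using w by (simp add: coinvariant_spinors_def)
  then have "comp (int k) a = a" "comp (- int l) b = b"
    using qa by (simp_all add: ab spinor_coaction_def coaction_comp umono_def)
  then show "w \<in> U (int k) \<times> U (- int l)" using qa by (simp add: ab U_iff)
next
  fix w assume w: "w \<in> U (int k) \<times> U (- int l)"
  obtain a b where ab: "w = (a, b)" "a \<in> U (int k)" "b \<in> U (- int l)" using w by auto
  then show "w \<in> coinvariant_spinors q k l"
    by (auto simp: coinvariant_spinors_def spinor_coaction_def U_QA coaction_comp comp_U umono_def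
        fun_eq_iff zero_prod_def)
qed

end

section \<open>Orthonormal families in complex Hilbert spaces\<close>

lemma cinner_add_left: "cinner (x + y) z = cinner x z + cinner y z"
  for x y z :: "'h::complex_hilbert"
  using cinner_commute[of "x + y" z] cinner_commute[of x z] cinner_commute[of y z]
  by (simp add: cinner_add_right)

lemma cinner_scaleC_left: "cinner (scaleC c x) y = cnj c * cinner x y"
  for x y :: "'h::complex_hilbert"
  using cinner_commute[of "scaleC c x" y] cinner_commute[of x y]
  by (simp add: cinner_scaleC_right)

lemma cinner_zero [simp]: "cinner x 0 = 0" "cinner 0 x = 0"
  for x :: "'h::complex_hilbert"
  using cinner_scaleC_right[of x 0 x] cinner_scaleC_left[of 0 x x] by simp_all

lemma cinner_minus: "cinner x (- y) = - cinner x y" "cinner (- x) y = - cinner x y"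
  for x y :: "'h::complex_hilbert"
  using cinner_add_right[of x y "- y"] cinner_add_left[of x "- x" y]
  by (simp_all add: eq_neg_iff_add_eq_0 add.commute)

lemma cinner_diff_right: "cinner x (y - z) = cinner x y - cinner x z"
  for x y z :: "'h::complex_hilbert"
  using cinner_add_right[of x y "- z"] by (simp add: cinner_minus)

lemma cinner_diff_left: "cinner (x - y) z = cinner x z - cinner y z"
  for x y z :: "'h::complex_hilbert"
  using cinner_add_left[of x "- y" z] by (simp add: cinner_minus)

lemma cinner_scaleR_right: "cinner x (r *\<^sub>R y) = of_real r * cinner x y"
  for x y :: "'h::complex_hilbert"
  by (simp add: cinner_scaleC_right flip: scaleC_of_real)

lemma cinner_scaleR_left: "cinner (r *\<^sub>R x) y = of_real r * cinner x y"
  for x y :: "'h::complex_hilbert"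
  by (simp add: cinner_scaleC_left flip: scaleC_of_real)

lemma cinner_sum_right: "cinner x (\<Sum>i\<in>S. f i) = (\<Sum>i\<in>S. cinner x (f i))"
  for x :: "'h::complex_hilbert"
  by (induction S rule: infinite_finite_induct) (simp_all add: cinner_add_right)

lemma cinner_sum_left: "cinner (\<Sum>i\<in>S. f i) x = (\<Sum>i\<in>S. cinner (f i) x)"
  for x :: "'h::complex_hilbert"
  by (induction S rule: infinite_finite_induct) (simp_all add: cinner_add_left)

lemma norm_sq_cinner: "(norm x)\<^sup>2 = Re (cinner x x)" for x :: "'h::complex_hilbert"
  by (simp add: cinner_self)

lemma norm_scaleC: "norm (scaleC c x) = cmod c * norm x" for x :: "'h::complex_hilbert"
proof -
  have "complex_of_real ((norm (scaleC c x))\<^sup>2) = (c * cnj c) * complex_of_real ((norm x)\<^sup>2)"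
    by (simp only: cinner_self[symmetric] cinner_scaleC_left cinner_scaleC_right) (simp add: mult_ac)
  also have "\<dots> = complex_of_real ((cmod c * norm x)\<^sup>2)"
    by (simp add: complex_norm_square[symmetric] power_mult_distrib)
  finally have "(norm (scaleC c x))\<^sup>2 = (cmod c * norm x)\<^sup>2" by (simp only: of_real_eq_iff)
  then show ?thesis by (simp add: power2_eq_iff_nonneg)
qed

lemma norm_add_orthogonal:
  fixes x y :: "'h::complex_hilbert"
  assumes "cinner x y = 0"
  shows "(norm (x + y))\<^sup>2 = (norm x)\<^sup>2 + (norm y)\<^sup>2"
  using assms cinner_commute[of y x] by (simp add: norm_sq_cinner cinner_add_left cinner_add_right)

lemma Cauchy_Schwarz: "cmod (cinner x y) \<le> norm x * norm y" for x y :: "'h::complex_hilbert"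
proof (cases "x = 0")
  case False
  define c where "c = cinner x y / of_real ((norm x)\<^sup>2)"
  have "cinner x (y - scaleC c x) = 0"
    using False by (simp add: cinner_diff_right cinner_scaleC_right c_def cinner_self)
  then have "cinner (scaleC c x) (y - scaleC c x) = 0" by (simp add: cinner_scaleC_left)
  from norm_add_orthogonal[OF this] have "(norm (scaleC c x))\<^sup>2 \<le> (norm y)\<^sup>2" by simp
  then have "cmod c * norm x \<le> norm y" by (simp add: norm_scaleC power2_le_iff_abs_le)
  moreover have "cmod c * norm x = cmod (cinner x y) / norm x"
    using False by (simp add: c_def norm_divide norm_mult power2_eq_square)
  ultimately have "cmod (cinner x y) / norm x \<le> norm y" by simp
  then show ?thesis using False by (simp add: pos_divide_le_eq mult.commute)
qed simp

lemma continuous_cinner_right [continuous_intros]: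
  "continuous_on A f \<Longrightarrow> continuous_on A (\<lambda>x. cinner a (f x))" for a :: "'h::complex_hilbert"
proof -
  have "bounded_linear (cinner a)"
    by (rule bounded_linear_intro[of _ "norm a"])
      (simp_all add: cinner_add_right cinner_scaleR_right scaleR_conv_of_real Cauchy_Schwarz mult.commute[of _ "norm a"])
  then show "continuous_on A f \<Longrightarrow> continuous_on A (\<lambda>x. cinner a (f x))"
    by (rule bounded_linear.continuous_on)
qed

lemma continuous_scaleC [continuous_intros]:
  "continuous_on A f \<Longrightarrow> continuous_on A (\<lambda>x. scaleC c (f x))" for f :: "_ \<Rightarrow> 'h::complex_hilbert"
proof -
  have "bounded_linear (scaleC c :: 'h \<Rightarrow> 'h)"
  proof (rule bounded_linear_intro[of _ "cmod c"])
    show "scaleC c (r *\<^sub>R x) = r *\<^sub>R scaleC c x" for r and x :: 'h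
      by (simp add: scaleC_scaleC mult.commute flip: scaleC_of_real)
  qed (simp_all add: scaleC_add_right norm_scaleC mult.commute)
  then show "continuous_on A f \<Longrightarrow> continuous_on A (\<lambda>x. scaleC c (f x))"
    by (rule bounded_linear.continuous_on)
qed

lemma closed_csubspace_closure:
  assumes "complex_vector.subspace (A :: 'h::complex_hilbert set)"
  shows "closed_csubspace (closure A)"
  unfolding closed_csubspace_def complex_vector.subspace_def
proof (intro conjI ballI allI)
  show "0 \<in> closure A"
    using assms closure_subset complex_vector.subspace_0 by blast
  show "x + y \<in> closure A" if xy: "x \<in> closure A" "y \<in> closure A" for x y
  proof -
    obtain f g where fg: "\<And>n. f n \<in> A" "\<And>n. g n \<in> A" "f \<longlonglongrightarrow> x" "g \<longlonglongrightarrow> y"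
      using xy unfolding closure_sequential by blast
    have "\<And>n. f n + g n \<in> A" using fg assms complex_vector.subspace_add by blast
    then show ?thesis
      unfolding closure_sequential using tendsto_add[OF fg(3,4)]
      by (intro exI[of _ "\<lambda>n. f n + g n"]) auto
  qed
  show "scaleC c x \<in> closure A" if "x \<in> closure A" for c x
  proof -
    have "continuous_on (closure A) (scaleC c)" by (intro continuous_intros)
    then have "scaleC c ` closure A \<subseteq> closure A"
      by (rule image_closure_subset)
        (use assms complex_vector.subspace_scale closure_subset in blast)+
    then show ?thesis using that by blast
  qed
qed simp

lemma span_eq_comb:
  fixes v :: "'i \<Rightarrow> 'h::complex_hilbert"
  assumes "x \<in> complex_vector.span (v ` I)"
  obtains S c where "finite S" "S \<subseteq> I" "x = (\<Sum>i\<in>S. scaleC (c i) (v i))"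
proof -
  have "\<exists>S c. finite S \<and> S \<subseteq> I \<and> x = (\<Sum>i\<in>S. scaleC (c i) (v i))"
    using assms
  proof (induction rule: complex_vector.span_induct_alt)
    case base
    then show ?case by (intro exI[of _ "{}"]) auto
  next
    case (step a w y)
    then obtain i S c where i: "i \<in> I" "w = v i" and S: "finite S" "S \<subseteq> I" "y = (\<Sum>i\<in>S. scaleC (c i) (v i))"
      by auto
    define c' where "c' j = (if j \<in> S then c j else 0) + (if j = i then a else 0)" for j
    have "(\<Sum>j\<in>insert i S. scaleC (c' j) (v j)) =
        (\<Sum>j\<in>insert i S. scaleC (if j \<in> S then c j else 0) (v j)) +
        (\<Sum>j\<in>insert i S. scaleC (if j = i then a else 0) (v j))"
      by (simp only: c'_def scaleC_add_left sum.distrib)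
    also have "(\<Sum>j\<in>insert i S. scaleC (if j \<in> S then c j else 0) (v j)) = (\<Sum>j\<in>S. scaleC (c j) (v j))"
      using S by (intro sum.mono_neutral_cong_right) auto
    also have "(\<Sum>j\<in>insert i S. scaleC (if j = i then a else 0) (v j)) = (\<Sum>j\<in>{i}. scaleC a (v j))"
      using S by (intro sum.mono_neutral_cong_right) auto
    finally have "scaleC a w + y = (\<Sum>j\<in>insert i S. scaleC (c' j) (v j))"
      using i S by (simp add: add.commute)
    then show ?case using i S by (intro exI[of _ "insert i S"]) auto
  qed
  then show ?thesis using that by blast
qed

locale orthonormal =
  fixes I :: "'i set" and v :: "'i \<Rightarrow> 'h::complex_hilbert"
  assumes orth: "\<And>i j. i \<in> I \<Longrightarrow> j \<in> I \<Longrightarrow> cinner (v i) (v j) = (if i = j then 1 else 0)"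
begin

definition Hs :: "'h set" where
  "Hs = closure (complex_vector.span (v ` I))"

definition proj :: "'i set \<Rightarrow> 'h \<Rightarrow> 'h" where
  "proj S x = (\<Sum>i\<in>S. scaleC (cinner (v i) x) (v i))"

lemma Hs_closed_csubspace: "closed_csubspace Hs"
  unfolding Hs_def by (intro closed_csubspace_closure complex_vector.subspace_span)

lemma Hs_subspace: "complex_vector.subspace Hs" and Hs_closed: "closed Hs"
  using Hs_closed_csubspace by (auto simp: closed_csubspace_def)

lemma span_Hs: "complex_vector.span (v ` I) \<subseteq> Hs"
  by (simp add: Hs_def closure_subset)

lemma v_Hs: "i \<in> I \<Longrightarrow> v i \<in> Hs"
  using span_Hs complex_vector.span_base by blast

lemma comb_Hs: "S \<subseteq> I \<Longrightarrow> (\<Sum>i\<in>S. scaleC (c i) (v i)) \<in> Hs"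
  using Hs_subspace v_Hs
  by (intro complex_vector.subspace_sum complex_vector.subspace_scale) auto

lemma cinner_comb:
  assumes "finite S" "S \<subseteq> I" "j \<in> I"
  shows "cinner (v j) (\<Sum>i\<in>S. scaleC (c i) (v i)) = (if j \<in> S then c j else 0)"
proof -
  have "cinner (v j) (\<Sum>i\<in>S. scaleC (c i) (v i)) = (\<Sum>i\<in>S. if j = i then c i else 0)"
    unfolding cinner_sum_right by (rule sum.cong) (use assms in \<open>auto simp: cinner_scaleC_right orth\<close>)
  then show ?thesis using assms by (simp add: sum.delta)
qed

lemma norm_comb:
  assumes "finite S" "S \<subseteq> I"
  shows "(norm (\<Sum>i\<in>S. scaleC (c i) (v i)))\<^sup>2 = (\<Sum>i\<in>S. (cmod (c i))\<^sup>2)"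
proof -
  have "complex_of_real ((norm (\<Sum>i\<in>S. scaleC (c i) (v i)))\<^sup>2) =
      (\<Sum>i\<in>S. cnj (c i) * cinner (v i) (\<Sum>i\<in>S. scaleC (c i) (v i)))"
    by (simp only: cinner_self[symmetric] cinner_sum_left cinner_scaleC_left)
  also have "\<dots> = (\<Sum>i\<in>S. complex_of_real ((cmod (c i))\<^sup>2))"
  proof (rule sum.cong)
    fix i assume "i \<in> S"
    then have "cinner (v i) (\<Sum>i\<in>S. scaleC (c i) (v i)) = c i"
      using assms by (subst cinner_comb) auto
    then show "cnj (c i) * cinner (v i) (\<Sum>i\<in>S. scaleC (c i) (v i)) = complex_of_real ((cmod (c i))\<^sup>2)"
      using complex_norm_square[of "c i"] by (simp only: mult.commute)
  qed simp
  finally show ?thesis by (simp only: of_real_sum[symmetric] of_real_eq_iff)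
qed

lemma proj_orthogonal:
  assumes "finite S" "S \<subseteq> I"
  shows "cinner (x - proj S x) (\<Sum>i\<in>S. scaleC (c i) (v i)) = 0"
proof -
  have "cinner (x - proj S x) (v i) = 0" if "i \<in> S" for i
  proof -
    have "i \<in> I" using assms that by auto
    then have "cinner (v i) (x - proj S x) = 0"
      using assms that by (simp add: cinner_diff_right proj_def cinner_comb)
    then show ?thesis using cinner_commute[of "x - proj S x" "v i"] by simp
  qed
  then show ?thesis by (simp add: cinner_sum_right cinner_scaleC_right)
qed

lemma proj_best:
  assumes "finite S" "S \<subseteq> I"
  shows "norm (x - proj S x) \<le> norm (x - (\<Sum>i\<in>S. scaleC (c i) (v i)))"
proof -
  let ?u = "\<Sum>i\<in>S. scaleC (c i) (v i)"
  have "proj S x - ?u = (\<Sum>i\<in>S. scaleC (cinner (v i) x - c i) (v i))"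
    by (simp add: proj_def complex_vector.scale_left_diff_distrib sum_subtractf)
  then have "cinner (x - proj S x) (proj S x - ?u) = 0"
    using proj_orthogonal[OF assms] by simp
  from norm_add_orthogonal[OF this]
  have "(norm (x - proj S x))\<^sup>2 \<le> (norm (x - ?u))\<^sup>2" by simp
  then show ?thesis by (simp add: power2_le_iff_abs_le)
qed

lemma bessel:
  assumes "finite S" "S \<subseteq> I"
  shows "(\<Sum>i\<in>S. (cmod (cinner (v i) x))\<^sup>2) \<le> (norm x)\<^sup>2"
proof -
  have "cinner (x - proj S x) (proj S x) = 0"
    using proj_orthogonal[OF assms, of x "\<lambda>i. cinner (v i) x"] by (simp add: proj_def)
  from norm_add_orthogonal[OF this] have "(norm (proj S x))\<^sup>2 \<le> (norm x)\<^sup>2" by simp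
  then show ?thesis using norm_comb[OF assms] by (simp add: proj_def)
qed

lemma proj_approx:
  assumes "x \<in> Hs" "0 < e"
  obtains S where "finite S" "S \<subseteq> I"
    "\<And>S'. finite S' \<Longrightarrow> S \<subseteq> S' \<Longrightarrow> S' \<subseteq> I \<Longrightarrow> norm (x - proj S' x) < e"
proof -
  obtain u where u: "u \<in> complex_vector.span (v ` I)" "dist u x < e"
    using assms unfolding Hs_def closure_approachable by blast
  obtain S c where S: "finite S" "S \<subseteq> I" "u = (\<Sum>i\<in>S. scaleC (c i) (v i))"
    by (rule span_eq_comb[OF u(1)]) (rule that)
  have "norm (x - proj S' x) < e" if "finite S'" "S \<subseteq> S'" "S' \<subseteq> I" for S'
  proof -
    have "u = (\<Sum>i\<in>S'. scaleC (if i \<in> S then c i else 0) (v i))"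
      unfolding S(3) using that by (intro sum.mono_neutral_cong_left) auto
    then have "norm (x - proj S' x) \<le> norm (x - u)" using proj_best[OF that(1,3), of x] by simp
    then show ?thesis using u(2) by (simp add: dist_norm norm_minus_commute)
  qed
  then show ?thesis using that S by blast
qed

lemma Hs_norm_le:
  assumes "x \<in> Hs" "\<And>S. finite S \<Longrightarrow> S \<subseteq> I \<Longrightarrow> norm (proj S x) \<le> B"
  shows "norm x \<le> B"
proof (rule field_le_epsilon)
  fix e :: real assume e: "0 < e"
  obtain S where S: "finite S" "S \<subseteq> I"
    "\<And>S'. finite S' \<Longrightarrow> S \<subseteq> S' \<Longrightarrow> S' \<subseteq> I \<Longrightarrow> norm (x - proj S' x) < e"
    by (rule proj_approx[OF assms(1) e]) (rule that)
  have "norm x \<le> norm (proj S x) + norm (x - proj S x)"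
    using norm_triangle_ineq[of "proj S x" "x - proj S x"] by simp
  then show "norm x \<le> B + e" using S(3)[of S] assms(2)[OF S(1,2)] S(1,2) by simp
qed

lemma Hs_eq_0:
  assumes "x \<in> Hs" "\<And>i. i \<in> I \<Longrightarrow> cinner (v i) x = 0"
  shows "x = 0"
proof -
  have "proj S x = 0" if "S \<subseteq> I" for S
    unfolding proj_def by (rule sum.neutral) (use that assms in auto)
  then have "norm x \<le> 0" using assms(1) by - (rule Hs_norm_le, auto)
  then show ?thesis by simp
qed

lemma Hs_eqI:
  assumes "x \<in> Hs" "y \<in> Hs" "\<And>i. i \<in> I \<Longrightarrow> cinner (v i) x = cinner (v i) y"
  shows "x = y"
  using Hs_eq_0[of "x - y"] assms Hs_subspace
  by (simp add: cinner_diff_right complex_vector.subspace_diff)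

lemma orthonormal_subfamily: "J \<subseteq> I \<Longrightarrow> orthonormal J v"
  unfolding orthonormal_def using orth by (simp add: subset_iff)

text \<open>
  If \<open>x\<close> is orthogonal to the remaining vectors, its partial sums lie in the span of the
  subfamily.
\<close>

lemma Hs_subfamily:
  assumes "J \<subseteq> I"
  shows "closure (complex_vector.span (v ` J)) = {x \<in> Hs. \<forall>i\<in>I - J. cinner (v i) x = 0}"
proof (intro equalityI subsetI)
  fix x assume x: "x \<in> closure (complex_vector.span (v ` J))"
  have "closure (complex_vector.span (v ` J)) \<subseteq> Hs"
    unfolding Hs_def using assms by (intro closure_mono complex_vector.span_mono) auto
  moreover have "cinner (v i) x = 0" if i: "i \<in> I - J" for i
  proof -
    have "closed {y. cinner (v i) y = 0}"
      by (intro closed_Collect_eq continuous_intros)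
    moreover have "complex_vector.span (v ` J) \<subseteq> {y. cinner (v i) y = 0}"
    proof (rule complex_vector.span_minimal)
      show "complex_vector.subspace {y. cinner (v i) y = 0}"
        by (simp add: complex_vector.subspace_def cinner_add_right cinner_scaleC_right)
      show "v ` J \<subseteq> {y. cinner (v i) y = 0}" using i assms orth by auto
    qed
    ultimately show ?thesis using x closure_minimal by blast
  qed
  ultimately show "x \<in> {x \<in> Hs. \<forall>i\<in>I - J. cinner (v i) x = 0}" using x by blast
next
  fix x assume "x \<in> {x \<in> Hs. \<forall>i\<in>I - J. cinner (v i) x = 0}"
  then have x: "x \<in> Hs" "\<And>i. i \<in> I - J \<Longrightarrow> cinner (v i) x = 0" by auto
  show "x \<in> closure (complex_vector.span (v ` J))"
    unfolding closure_approachable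
  proof (intro allI impI)
    fix e :: real assume e: "0 < e"
    obtain S where S: "finite S" "S \<subseteq> I"
      "\<And>S'. finite S' \<Longrightarrow> S \<subseteq> S' \<Longrightarrow> S' \<subseteq> I \<Longrightarrow> norm (x - proj S' x) < e"
      by (rule proj_approx[OF x(1) e]) (rule that)
    have "proj S x \<in> complex_vector.span (v ` J)"
      unfolding proj_def
    proof (rule complex_vector.span_sum)
      fix i assume "i \<in> S"
      show "scaleC (cinner (v i) x) (v i) \<in> complex_vector.span (v ` J)"
      proof (cases "i \<in> J")
        case True
        then show ?thesis by (intro complex_vector.span_scale complex_vector.span_base) auto
      next
        case False
        then have "cinner (v i) x = 0" using x(2) \<open>i \<in> S\<close> S by auto
        then show ?thesis by (simp add: complex_vector.span_zero)
      qed
    qed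
    moreover have "dist (proj S x) x < e"
      using S(3)[OF S(1) subset_refl S(2)] by (simp add: dist_norm norm_minus_commute)
    ultimately show "\<exists>y\<in>complex_vector.span (v ` J). dist y x < e" by blast
  qed
qed

section \<open>Diagonal operators\<close>

text \<open>
  The maximal operator that multiplies the coefficient at \<open>v i\<close> by \<open>ev i\<close>: its domain contains
  every vector for which the product is again the coefficient family of a vector.
\<close>

definition diag :: "('i \<Rightarrow> real) \<Rightarrow> ('h \<times> 'h) set" where
  "diag ev = {(x, y). x \<in> Hs \<and> y \<in> Hs \<and> (\<forall>i\<in>I. cinner (v i) y = of_real (ev i) * cinner (v i) x)}"

lemma diag_v: "i \<in> I \<Longrightarrow> (v i, ev i *\<^sub>R v i) \<in> diag ev"
  using v_Hs complex_vector.subspace_scale[OF Hs_subspace, of "v i" "of_real (ev i)"]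
  by (auto simp: diag_def cinner_scaleR_right orth scaleC_of_real)

lemma diag_subspace: "complex_vector.subspace (diag ev)"
  using Hs_subspace
  by (auto simp: complex_vector.subspace_def diag_def cinner_add_right cinner_scaleC_right
      scaleC_prod_def zero_prod_def algebra_simps)

lemma diag_single_valued: "single_valued (diag ev)"
  by (rule single_valuedI) (auto simp: diag_def intro: Hs_eqI)

lemma diag_closed: "closed (diag ev)"
proof -
  have "diag ev = (Hs \<times> Hs) \<inter> (\<Inter>i\<in>I. {z. cinner (v i) (snd z) = of_real (ev i) * cinner (v i) (fst z)})"
    by (auto simp: diag_def)
  moreover have "closed {z. cinner (v i) (snd z) = of_real (ev i) * cinner (v i) (fst z)}" for i
    by (intro closed_Collect_eq continuous_intros)
  ultimately show ?thesis using Hs_closed by (auto intro!: closed_Int closed_Times closed_INT)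
qed

lemma diag_proj:
  assumes "(x, y) \<in> diag ev" "S \<subseteq> I"
  shows "proj S y = (\<Sum>i\<in>S. scaleC (of_real (ev i) * cinner (v i) x) (v i))"
  unfolding proj_def using assms by (intro sum.cong) (auto simp: diag_def)

lemma diag_approx:
  assumes "(x, y) \<in> diag ev" "0 < e"
  obtains S where "finite S" "S \<subseteq> I" "norm (x - proj S x) < e" "norm (y - proj S y) < e"
proof -
  have xy: "x \<in> Hs" "y \<in> Hs" using assms by (auto simp: diag_def)
  obtain S where S: "finite S" "S \<subseteq> I"
    "\<And>S'. finite S' \<Longrightarrow> S \<subseteq> S' \<Longrightarrow> S' \<subseteq> I \<Longrightarrow> norm (x - proj S' x) < e"
    by (rule proj_approx[OF xy(1) assms(2)]) (rule that)
  obtain R where R: "finite R" "R \<subseteq> I"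
    "\<And>S'. finite S' \<Longrightarrow> R \<subseteq> S' \<Longrightarrow> S' \<subseteq> I \<Longrightarrow> norm (y - proj S' y) < e"
    by (rule proj_approx[OF xy(2) assms(2)]) (rule that)
  show ?thesis using that[of "S \<union> R"] S R by auto
qed

text \<open>
  For partial sums the two sides agree coefficient by coefficient; partial sums approximate
  both components of an element of the graph at the same time.
\<close>

lemma diag_in_adjoint:
  assumes "(x, w) \<in> diag ev" "(y, z) \<in> diag ev"
  shows "cinner w y = cinner x z"
proof -
  have P: "cinner w (proj S y) = cinner x (proj S z)" if "S \<subseteq> I" for S
  proof -
    have "cinner w (v i) = of_real (ev i) * cinner x (v i)" if "i \<in> I" for i
      using assms(1) that cinner_commute[of w "v i"] cinner_commute[of x "v i"] by (auto simp: diag_def)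
    then have "cinner w (proj S y) = (\<Sum>i\<in>S. cinner (v i) y * (of_real (ev i) * cinner x (v i)))"
      unfolding proj_def cinner_sum_right cinner_scaleC_right using that by (intro sum.cong) auto
    moreover have "cinner x (proj S z) = (\<Sum>i\<in>S. cinner (v i) y * (of_real (ev i) * cinner x (v i)))"
      unfolding diag_proj[OF assms(2) that] cinner_sum_right cinner_scaleC_right
      by (intro sum.cong) auto
    ultimately show ?thesis by simp
  qed
  have bound: "cmod (cinner w y - cinner x z) \<le> 0 + e" if e: "0 < e" for e
  proof -
    define M where "M = norm w + norm x + 1"
    have M: "0 < M" by (simp add: M_def add_nonneg_pos)
    obtain S where S: "finite S" "S \<subseteq> I" "norm (y - proj S y) < e / M" "norm (z - proj S z) < e / M"
      using diag_approx[OF assms(2), of "e / M"] M e by auto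
    have "cinner w y - cinner x z = cinner w (y - proj S y) - cinner x (z - proj S z)"
      using P[OF S(2)] by (simp add: cinner_diff_right)
    also have "cmod \<dots> \<le> cmod (cinner w (y - proj S y)) + cmod (cinner x (z - proj S z))"
      by (rule norm_triangle_ineq4)
    also have "\<dots> \<le> norm w * norm (y - proj S y) + norm x * norm (z - proj S z)"
      by (intro add_mono Cauchy_Schwarz)
    also have "\<dots> \<le> norm w * (e / M) + norm x * (e / M)"
      using S by (intro add_mono mult_left_mono) auto
    also have "\<dots> \<le> M * (e / M)"
      using M e unfolding M_def by (simp add: distrib_right[symmetric] del: times_divide_eq_right)
    finally show ?thesis using M by simp
  qed
  then have "cmod (cinner w y - cinner x z) \<le> 0" by (rule field_le_epsilon)
  then show ?thesis by simp
qed

lemma diag_domain_dense: "Hs \<subseteq> closure (Domain (diag ev))"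
proof -
  have "complex_vector.subspace (Domain (diag ev))"
    unfolding complex_vector.subspace_def
  proof (intro conjI ballI allI)
    show "0 \<in> Domain (diag ev)"
      using complex_vector.subspace_0[OF diag_subspace] by (auto simp: zero_prod_def)
    show "x + y \<in> Domain (diag ev)" if xy: "x \<in> Domain (diag ev)" "y \<in> Domain (diag ev)" for x y
    proof -
      obtain x' y' where "(x, x') \<in> diag ev" "(y, y') \<in> diag ev" using xy by blast
      then show ?thesis using complex_vector.subspace_add[OF diag_subspace, of "(x, x')" _ "(y, y')"] by auto
    qed
    show "scaleC c x \<in> Domain (diag ev)" if x: "x \<in> Domain (diag ev)" for c x
    proof -
      obtain x' where "(x, x') \<in> diag ev" using x by blast
      then show ?thesis
        using complex_vector.subspace_scale[OF diag_subspace, of "(x, x')" _ c] by (auto simp: scaleC_prod_def)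
    qed
  qed
  moreover have "v ` I \<subseteq> Domain (diag ev)" using diag_v by blast
  ultimately have "complex_vector.span (v ` I) \<subseteq> Domain (diag ev)"
    by (intro complex_vector.span_minimal)
  then show ?thesis unfolding Hs_def by (rule closure_mono)
qed

lemma adjoint_subset_diag:
  assumes "\<And>i. i \<in> I \<Longrightarrow> (v i, ev i *\<^sub>R v i) \<in> D"
  shows "adjoint_on Hs D \<subseteq> diag ev"
proof clarify
  fix y z assume "(y, z) \<in> adjoint_on Hs D"
  then have yz: "y \<in> Hs" "z \<in> Hs" "\<And>x w. (x, w) \<in> D \<Longrightarrow> cinner w y = cinner x z"
    by (auto simp: adjoint_on_def)
  have "cinner (v i) z = of_real (ev i) * cinner (v i) y" if "i \<in> I" for i
    using yz(3)[OF assms[OF that]] by (simp add: cinner_scaleR_left)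
  then show "(y, z) \<in> diag ev" using yz by (simp add: diag_def)
qed

lemma diag_self_adjoint: "self_adjoint_on Hs (diag ev)"
proof -
  have "diag ev \<subseteq> adjoint_on Hs (diag ev)"
  proof clarify
    fix y z assume yz: "(y, z) \<in> diag ev"
    then have "y \<in> Hs" "z \<in> Hs" by (simp_all add: diag_def)
    moreover have "\<forall>(x, w)\<in>diag ev. cinner w y = cinner x z"
      using diag_in_adjoint[OF _ yz] by blast
    ultimately show "(y, z) \<in> adjoint_on Hs (diag ev)" by (simp add: adjoint_on_def)
  qed
  moreover have "operator_on Hs (diag ev)"
    unfolding operator_on_def using diag_subspace diag_single_valued by (auto simp: diag_def)
  ultimately show ?thesis
    unfolding self_adjoint_on_def using diag_domain_dense adjoint_subset_diag[of ev, OF diag_v] by blast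
qed

text \<open>
  A self-adjoint operator that is right on the basis is contained in the maximal one, and
  passing to adjoints reverses this inclusion.
\<close>

lemma diag_unique:
  assumes "self_adjoint_on Hs D" "\<And>i. i \<in> I \<Longrightarrow> (v i, ev i *\<^sub>R v i) \<in> D"
  shows "D = diag ev"
proof
  have D: "adjoint_on Hs D = D" using assms(1) by (simp add: self_adjoint_on_def)
  then show sub: "D \<subseteq> diag ev" using adjoint_subset_diag[OF assms(2)] by simp
  have "adjoint_on Hs (diag ev) \<subseteq> adjoint_on Hs D"
    using sub by (auto simp: adjoint_on_def)
  then show "diag ev \<subseteq> D" using D diag_self_adjoint[of ev] by (simp add: self_adjoint_on_def)
qed

end

text \<open>
  A commutator bound on a core extends to the whole domain: along a sequence from the core the
  commutators form a Cauchy sequence, and the graph is closed.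
\<close>

lemma bounded_commutator_core:
  fixes D :: "('h::complex_hilbert \<times> 'h) set"
  assumes D: "complex_vector.subspace D" "single_valued D" "closed D"
    and D0: "D\<^sub>0 \<subseteq> D" "complex_vector.subspace D\<^sub>0" "D \<subseteq> closure D\<^sub>0"
    and T: "\<And>x y. T (x + y) = T x + T y" "\<And>x. norm (T x) \<le> B * norm x"
    and C: "\<And>x y. (x, y) \<in> D\<^sub>0 \<Longrightarrow> \<exists>z. (T x, z) \<in> D \<and> norm (z - T y) \<le> C * norm x"
  shows "bounded_commutator D T"
  unfolding bounded_commutator_def
proof (intro exI[of _ C] ballI, clarify)
  fix x y assume xy: "(x, y) \<in> D"
  have Tdiff: "T (a - b) = T a - T b" for a b using T(1)[of "a - b" b] by (simp add: algebra_simps)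
  have Tcont: "(\<lambda>n. T (f n)) \<longlonglongrightarrow> T a" if "f \<longlonglongrightarrow> a" for f :: "nat \<Rightarrow> 'h" and a
  proof -
    have "(\<lambda>n. B * norm (f n - a)) \<longlonglongrightarrow> B * 0"
      using that by (intro tendsto_intros tendsto_norm_zero) (simp add: LIM_zero_iff)
    then have null: "(\<lambda>n. B * norm (f n - a)) \<longlonglongrightarrow> 0" by simp
    have "norm (T (f n) - T a) \<le> B * norm (f n - a)" for n
      using T(2)[of "f n - a"] by (simp only: Tdiff)
    then have "(\<lambda>n. T (f n) - T a) \<longlonglongrightarrow> 0"
      by (intro Lim_null_comparison[OF _ null] always_eventually) blast
    then show ?thesis by (simp add: LIM_zero_iff)
  qed
  obtain f where f: "\<And>n. f n \<in> D\<^sub>0" "f \<longlonglongrightarrow> (x, y)"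
    using xy D0(3) unfolding closure_sequential subset_iff by blast
  define X Y where "X = (\<lambda>n. fst (f n))" and "Y = (\<lambda>n. snd (f n))"
  have XY: "(X n, Y n) \<in> D\<^sub>0" for n using f by (simp add: X_def Y_def)
  have lim: "X \<longlonglongrightarrow> x" "Y \<longlonglongrightarrow> y"
    using tendsto_fst[OF f(2)] tendsto_snd[OF f(2)] by (simp_all add: X_def Y_def)
  obtain Z where Z: "\<And>n. (T (X n), Z n) \<in> D" "\<And>n. norm (Z n - T (Y n)) \<le> C * norm (X n)"
    using C[OF XY] by metis
  \<comment> \<open>The values of the commutator along the approximating sequence.\<close>
  define W where "W n = Z n - T (Y n)" for n
  have W: "norm (W n - W m) \<le> C * norm (X n - X m)" for n m
  proof -
    have "(X n, Y n) - (X m, Y m) \<in> D\<^sub>0"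
      using XY D0(2) complex_vector.subspace_diff by blast
    then obtain z where z: "(T (X n - X m), z) \<in> D" "norm (z - T (Y n - Y m)) \<le> C * norm (X n - X m)"
      using C by auto
    have "(T (X n), Z n) - (T (X m), Z m) \<in> D"
      using Z(1) D(1) complex_vector.subspace_diff by blast
    then have zeq: "z = Z n - Z m" using z(1) D(2) by (simp add: Tdiff single_valued_def)
    have "W n - W m = z - T (Y n - Y m)" unfolding zeq W_def Tdiff by (simp add: algebra_simps)
    then show ?thesis using z(2) by simp
  qed
  have "Cauchy W"
  proof (rule metric_CauchyI)
    fix e :: real assume e: "0 < e"
    define C' where "C' = \<bar>C\<bar> + 1"
    have C': "0 < C'" "C \<le> C'" by (auto simp: C'_def)
    obtain M where M: "\<And>m n. m \<ge> M \<Longrightarrow> n \<ge> M \<Longrightarrow> dist (X m) (X n) < e / C'"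
      using metric_CauchyD[OF LIMSEQ_imp_Cauchy[OF lim(1)], of "e / C'"] e C' by auto
    have "dist (W m) (W n) < e" if "m \<ge> M" "n \<ge> M" for m n
    proof -
      have "dist (W m) (W n) \<le> C * norm (X m - X n)" using W by (simp add: dist_norm)
      also have "\<dots> \<le> C' * norm (X m - X n)" using C' by (intro mult_right_mono) auto
      also have "\<dots> < C' * (e / C')" using M[OF that] C' by (intro mult_strict_left_mono) (auto simp: dist_norm)
      finally show ?thesis using C' by simp
    qed
    then show "\<exists>M. \<forall>m\<ge>M. \<forall>n\<ge>M. dist (W m) (W n) < e" by blast
  qed
  then obtain w where w: "W \<longlonglongrightarrow> w" using Cauchy_convergent convergent_def by blast
  have "(\<lambda>n. W n + T (Y n)) \<longlonglongrightarrow> w + T y" using w Tcont[OF lim(2)] by (rule tendsto_add)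
  then have Zlim: "Z \<longlonglongrightarrow> w + T y" by (simp add: W_def)
  have "(\<lambda>n. (T (X n), Z n)) \<longlonglongrightarrow> (T x, w + T y)"
    using Tcont[OF lim(1)] Zlim by (rule tendsto_Pair)
  from closed_sequentially[OF D(3) Z(1) this] have "(T x, w + T y) \<in> D" .
  moreover have "norm w \<le> C * norm x"
  proof (rule LIMSEQ_le)
    show "(\<lambda>n. norm (W n)) \<longlonglongrightarrow> norm w" using w by (rule tendsto_norm)
    show "(\<lambda>n. C * norm (X n)) \<longlonglongrightarrow> C * norm x" using lim by (intro tendsto_intros)
    show "\<exists>N. \<forall>n\<ge>N. norm (W n) \<le> C * norm (X n)" using Z by (auto simp: W_def)
  qed
  ultimately show "\<exists>z. (T x, z) \<in> D \<and> norm (z - T y) \<le> C * norm x"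
    by (intro exI[of _ "w + T y"]) auto
qed

text \<open>By the Leibniz rule \<open>[D, S T] = [D, S] T + S [D, T]\<close>.\<close>

lemma bounded_commutator_compose:
  assumes "bounded_commutator D S" "bounded_commutator D T"
    and S: "\<And>x y. S (x - y) = S x - S y" "\<And>x. norm (S x) \<le> B * norm x"
    and T: "\<And>x. norm (T x) \<le> B' * norm x" and "0 \<le> B"
  shows "bounded_commutator D (\<lambda>x. S (T x))"
proof -
  obtain C where C: "\<forall>(x, y)\<in>D. \<exists>z. (S x, z) \<in> D \<and> norm (z - S y) \<le> C * norm x"
    using assms(1) unfolding bounded_commutator_def by blast
  obtain C' where C': "\<forall>(x, y)\<in>D. \<exists>z. (T x, z) \<in> D \<and> norm (z - T y) \<le> C' * norm x"
    using assms(2) unfolding bounded_commutator_def by blast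
  show ?thesis
    unfolding bounded_commutator_def
  proof (intro exI[of _ "\<bar>C\<bar> * B' + B * C'"] ballI, clarify)
    fix x y assume "(x, y) \<in> D"
    then obtain z where z: "(T x, z) \<in> D" "norm (z - T y) \<le> C' * norm x" using C' by blast
    then obtain z' where z': "(S (T x), z') \<in> D" "norm (z' - S z) \<le> C * norm (T x)" using C by blast
    have "norm (z' - S (T y)) \<le> norm (z' - S z) + norm (S (z - T y))"
      using norm_triangle_ineq[of "z' - S z" "S (z - T y)"] by (simp add: S)
    also have "norm (z' - S z) \<le> \<bar>C\<bar> * (B' * norm x)"
      using z'(2) mult_mono[OF abs_ge_self[of C] T[of x]] by (smt (verit) norm_ge_zero abs_ge_zero)
    also have "norm (S (z - T y)) \<le> B * (C' * norm x)"
      using S(2)[of "z - T y"] mult_left_mono[OF z(2) \<open>0 \<le> B\<close>] by simp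
    finally show "\<exists>z. (S (T x), z) \<in> D \<and> norm (z - S (T y)) \<le> (\<bar>C\<bar> * B' + B * C') * norm x"
      using z'(1) by (intro exI[of _ z']) (simp add: algebra_simps)
  qed
qed

lemma bounded_commutator_add:
  assumes "bounded_commutator D S" "bounded_commutator D T" "complex_vector.subspace D"
  shows "bounded_commutator D (\<lambda>x. S x + T x)"
proof -
  obtain C where C: "\<forall>(x, y)\<in>D. \<exists>z. (S x, z) \<in> D \<and> norm (z - S y) \<le> C * norm x"
    using assms(1) unfolding bounded_commutator_def by blast
  obtain C' where C': "\<forall>(x, y)\<in>D. \<exists>z. (T x, z) \<in> D \<and> norm (z - T y) \<le> C' * norm x"
    using assms(2) unfolding bounded_commutator_def by blast
  show ?thesis
    unfolding bounded_commutator_def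
  proof (intro exI[of _ "C + C'"] ballI, clarify)
    fix x y assume "(x, y) \<in> D"
    then obtain z z' where z: "(S x, z) \<in> D" "norm (z - S y) \<le> C * norm x"
      and z': "(T x, z') \<in> D" "norm (z' - T y) \<le> C' * norm x" using C C' by blast
    have "(S x, z) + (T x, z') \<in> D" using z z' assms(3) complex_vector.subspace_add by blast
    moreover have "norm (z + z' - (S y + T y)) \<le> norm (z - S y) + norm (z' - T y)"
      using norm_triangle_ineq[of "z - S y" "z' - T y"] by (simp add: algebra_simps)
    ultimately show "\<exists>z. (S x + T x, z) \<in> D \<and> norm (z - (S y + T y)) \<le> (C + C') * norm x"
      using z z' by (intro exI[of _ "z + z'"]) (auto simp: algebra_simps)
  qed
qed

lemma bounded_commutator_scale:
  assumes "bounded_commutator D T" "complex_vector.subspace D"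
  shows "bounded_commutator D (\<lambda>x. scaleC c (T x))"
proof -
  obtain C where C: "\<forall>(x, y)\<in>D. \<exists>z. (T x, z) \<in> D \<and> norm (z - T y) \<le> C * norm x"
    using assms(1) unfolding bounded_commutator_def by blast
  show ?thesis
    unfolding bounded_commutator_def
  proof (intro exI[of _ "cmod c * C"] ballI, clarify)
    fix x y assume "(x, y) \<in> D"
    then obtain z where z: "(T x, z) \<in> D" "norm (z - T y) \<le> C * norm x" using C by blast
    have "scaleC c (T x, z) \<in> D" using z assms(2) complex_vector.subspace_scale by blast
    moreover have "norm (scaleC c z - scaleC c (T y)) \<le> cmod c * C * norm x"
      using mult_left_mono[OF z(2), of "cmod c"]
      by (simp add: complex_vector.scale_right_diff_distrib[symmetric] norm_scaleC mult.assoc)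
    ultimately show "\<exists>z. (scaleC c (T x), z) \<in> D \<and> norm (z - scaleC c (T y)) \<le> cmod c * C * norm x"
      by (auto simp: scaleC_prod_def)
  qed
qed

section \<open>Diagonal operators with discrete spectrum\<close>

text \<open>
  Total boundedness passes from the compact approximants to the set and to its closure.
\<close>

lemma compact_closure_approx:
  fixes A :: "'a::banach set"
  assumes "\<And>e. 0 < e \<Longrightarrow> \<exists>K. compact K \<and> (\<forall>x\<in>A. \<exists>z\<in>K. norm (x - z) \<le> e)"
  shows "compact (closure A)"
  unfolding compact_eq_totally_bounded
proof (intro conjI allI impI)
  show "complete (closure A)" by (simp add: complete_eq_closed)
  fix e :: real assume e: "0 < e"
  obtain K where K: "compact K" "\<forall>x\<in>A. \<exists>z\<in>K. norm (x - z) \<le> e / 4"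
    using assms[of "e / 4"] e by auto
  then obtain F where F: "finite F" "K \<subseteq> (\<Union>x\<in>F. ball x (e / 4))"
    using e unfolding compact_eq_totally_bounded by (metis zero_less_divide_iff zero_less_numeral)
  have "closure A \<subseteq> (\<Union>x\<in>F. ball x e)"
  proof
    fix x assume "x \<in> closure A"
    then obtain y where y: "y \<in> A" "dist y x < e / 4" using e closure_approachable
      by (metis zero_less_divide_iff zero_less_numeral)
    obtain z where z: "z \<in> K" "norm (y - z) \<le> e / 4" using K y by blast
    obtain w where w: "w \<in> F" "dist w z < e / 4" using F z by auto
    have "dist w x \<le> dist w z + dist z y + dist y x"
      using dist_triangle[of w x z] dist_triangle[of z x y] by simp
    also have "\<dots> < e" using w z y e by (simp add: dist_norm norm_minus_commute)
    finally show "x \<in> (\<Union>x\<in>F. ball x e)" using w by auto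
  qed
  then show "\<exists>k. finite k \<and> closure A \<subseteq> (\<Union>x\<in>k. ball x e)" using F by blast
qed

lemma compact_coefficient_box:
  fixes v :: "'i \<Rightarrow> 'h::complex_hilbert"
  assumes "finite S"
  shows "compact {\<Sum>i\<in>S. scaleC (c i) (v i) | c. \<forall>i\<in>S. cmod (c i) \<le> 1}"
  using assms
proof (induction S rule: finite_induct)
  case empty
  have "{\<Sum>i\<in>{}. scaleC (c i) (v i) | c. \<forall>i\<in>{}. cmod (c i) \<le> 1} = {0}" by auto
  then show ?case by (metis compact_sing)
next
  case (insert j S)
  have "continuous_on (cball 0 1) (\<lambda>z. scaleC z (v j))"
  proof -
    have "bounded_linear (\<lambda>z. scaleC z (v j))"
    proof (rule bounded_linear_intro[of _ "norm (v j)"])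
      show "scaleC (r *\<^sub>R z) (v j) = r *\<^sub>R scaleC z (v j)" for r z
        by (simp add: scaleC_scaleC scaleR_conv_of_real flip: scaleC_of_real)
    qed (simp_all add: scaleC_add_left norm_scaleC)
    then show ?thesis by (rule bounded_linear.continuous_on[OF _ continuous_on_id])
  qed
  then have "compact ((\<lambda>z. scaleC z (v j)) ` cball 0 1)"
    by (rule compact_continuous_image) simp
  from compact_sums[OF this insert.IH]
  have "compact {x + y | x y. x \<in> (\<lambda>z. scaleC z (v j)) ` cball 0 1 \<and>
      y \<in> {\<Sum>i\<in>S. scaleC (c i) (v i) | c. \<forall>i\<in>S. cmod (c i) \<le> 1}}" .
  also have "{x + y | x y. x \<in> (\<lambda>z. scaleC z (v j)) ` cball 0 1 \<and>
      y \<in> {\<Sum>i\<in>S. scaleC (c i) (v i) | c. \<forall>i\<in>S. cmod (c i) \<le> 1}} =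
      {\<Sum>i\<in>insert j S. scaleC (c i) (v i) | c. \<forall>i\<in>insert j S. cmod (c i) \<le> 1}"
  proof (intro equalityI subsetI)
    fix u assume "u \<in> {x + y | x y. x \<in> (\<lambda>z. scaleC z (v j)) ` cball 0 1 \<and>
      y \<in> {\<Sum>i\<in>S. scaleC (c i) (v i) | c. \<forall>i\<in>S. cmod (c i) \<le> 1}}"
    then obtain z c where u: "u = scaleC z (v j) + (\<Sum>i\<in>S. scaleC (c i) (v i))"
      "cmod z \<le> 1" "\<forall>i\<in>S. cmod (c i) \<le> 1" by auto
    have "(\<Sum>i\<in>S. scaleC (c i) (v i)) = (\<Sum>i\<in>S. scaleC ((c(j := z)) i) (v i))"
      using insert.hyps by (intro sum.cong) auto
    then have "u = (\<Sum>i\<in>insert j S. scaleC ((c(j := z)) i) (v i))"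
      using insert.hyps u(1) by simp
    moreover have "\<forall>i\<in>insert j S. cmod ((c(j := z)) i) \<le> 1" using u by auto
    ultimately show "u \<in> {\<Sum>i\<in>insert j S. scaleC (c i) (v i) | c. \<forall>i\<in>insert j S. cmod (c i) \<le> 1}"
      by blast
  next
    fix u assume "u \<in> {\<Sum>i\<in>insert j S. scaleC (c i) (v i) | c. \<forall>i\<in>insert j S. cmod (c i) \<le> 1}"
    then obtain c where u: "u = (\<Sum>i\<in>insert j S. scaleC (c i) (v i))" "\<forall>i\<in>insert j S. cmod (c i) \<le> 1"
      by auto
    have "u = scaleC (c j) (v j) + (\<Sum>i\<in>S. scaleC (c i) (v i))" using u insert.hyps by simp
    moreover have "scaleC (c j) (v j) \<in> (\<lambda>z. scaleC z (v j)) ` cball 0 1" using u by auto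
    moreover have "(\<Sum>i\<in>S. scaleC (c i) (v i)) \<in> {\<Sum>i\<in>S. scaleC (c i) (v i) | c. \<forall>i\<in>S. cmod (c i) \<le> 1}"
      using u by auto
    ultimately show "u \<in> {x + y | x y. x \<in> (\<lambda>z. scaleC z (v j)) ` cball 0 1 \<and>
      y \<in> {\<Sum>i\<in>S. scaleC (c i) (v i) | c. \<forall>i\<in>S. cmod (c i) \<le> 1}}" by blast
  qed
  finally show ?case .
qed

text \<open>
  The gap at zero makes the operator invertible, and finiteness of the spectrum in bounded
  sets makes the inverse a norm limit of operators of finite rank.
\<close>

locale discrete_diagonal = orthonormal I v for I :: "'i set" and v :: "'i \<Rightarrow> 'h::complex_hilbert" +
  fixes ev :: "'i \<Rightarrow> real"
  assumes gap: "\<And>i. i \<in> I \<Longrightarrow> 1 \<le> \<bar>ev i\<bar>"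
    and discrete: "\<And>r. finite {i \<in> I. \<bar>ev i\<bar> \<le> r}"
begin

lemma ev_nonzero: "i \<in> I \<Longrightarrow> ev i \<noteq> 0"
  using gap[of i] by auto

definition low :: "nat \<Rightarrow> 'i set" where
  "low n = {i \<in> I. \<bar>ev i\<bar> \<le> real n}"

lemma low: "finite (low n)" "low n \<subseteq> I"
  using discrete by (auto simp: low_def)

text \<open>
  By Bessel's inequality, as the coefficients are divided by numbers of modulus at least \<open>r\<close>.
\<close>

lemma tail_bound:
  assumes "finite S" "S \<subseteq> I" "\<And>i. i \<in> S \<Longrightarrow> r \<le> \<bar>ev i\<bar>" "0 < r"
  shows "norm (\<Sum>i\<in>S. scaleC (cinner (v i) y / of_real (ev i)) (v i)) \<le> norm y / r"
proof -
  have "(norm (\<Sum>i\<in>S. scaleC (cinner (v i) y / of_real (ev i)) (v i)))\<^sup>2 =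
      (\<Sum>i\<in>S. (cmod (cinner (v i) y) / \<bar>ev i\<bar>)\<^sup>2)"
    by (simp add: norm_comb[OF assms(1,2)] norm_divide)
  also have "\<dots> \<le> (\<Sum>i\<in>S. (cmod (cinner (v i) y) / r)\<^sup>2)"
    using assms by (intro sum_mono power_mono divide_left_mono mult_pos_pos) (auto, fastforce)
  also have "\<dots> = (\<Sum>i\<in>S. (cmod (cinner (v i) y))\<^sup>2) / r\<^sup>2"
    by (simp add: power_divide sum_divide_distrib)
  also have "\<dots> \<le> (norm y)\<^sup>2 / r\<^sup>2"
    using bessel[OF assms(1,2)] by (intro divide_right_mono) auto
  finally have "(norm (\<Sum>i\<in>S. scaleC (cinner (v i) y / of_real (ev i)) (v i)))\<^sup>2 \<le> (norm y / r)\<^sup>2"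
    by (simp add: power_divide)
  then show ?thesis using assms(4) by (simp add: power2_le_iff_abs_le)
qed

lemma diag_coefficient:
  assumes "(x, y) \<in> diag ev" "i \<in> I"
  shows "cinner (v i) x = cinner (v i) y / of_real (ev i)"
  using assms ev_nonzero by (auto simp: diag_def)

lemma diag_proj_inverse:
  assumes "(x, y) \<in> diag ev" "S \<subseteq> I"
  shows "proj S x = (\<Sum>i\<in>S. scaleC (cinner (v i) y / of_real (ev i)) (v i))"
  unfolding proj_def using assms by (intro sum.cong) (auto simp: diag_coefficient)

lemma diag_norm_le:
  assumes "(x, y) \<in> diag ev"
  shows "norm x \<le> norm y"
proof (rule Hs_norm_le)
  show "x \<in> Hs" using assms by (simp add: diag_def)
  show "norm (proj S x) \<le> norm y" if "finite S" "S \<subseteq> I" for S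
    using tail_bound[OF that, of 1 y] gap that unfolding diag_proj_inverse[OF assms that(2)] by auto
qed

lemma diag_low_approx:
  assumes "(x, y) \<in> diag ev" "0 < n"
  shows "norm (x - proj (low n) x) \<le> norm y / real n"
proof (rule field_le_epsilon)
  fix e :: real assume e: "0 < e"
  have x: "x \<in> Hs" using assms by (simp add: diag_def)
  obtain S where S: "finite S" "S \<subseteq> I"
    "\<And>S'. finite S' \<Longrightarrow> S \<subseteq> S' \<Longrightarrow> S' \<subseteq> I \<Longrightarrow> norm (x - proj S' x) < e"
    by (rule proj_approx[OF x e]) (rule that)
  let ?S = "S \<union> low n"
  have fin: "finite ?S" "?S \<subseteq> I" using S low by auto
  have "proj ?S x = proj (low n) x + proj (?S - low n) x"
    unfolding proj_def using fin by (intro sum.subset_diff[THEN trans[OF _ add.commute]]) auto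
  then have "x - proj (low n) x = (x - proj ?S x) + proj (?S - low n) x" by simp
  then have "norm (x - proj (low n) x) \<le> norm (x - proj ?S x) + norm (proj (?S - low n) x)"
    by (metis norm_triangle_ineq)
  also have "norm (x - proj ?S x) \<le> e" using S(3)[OF fin(1) _ fin(2)] by simp
  also have "norm (proj (?S - low n) x) \<le> norm y / real n"
  proof -
    have sub: "finite (?S - low n)" "?S - low n \<subseteq> I" using fin by auto
    show ?thesis
      unfolding diag_proj_inverse[OF assms(1) sub(2)]
      using sub assms(2) by (intro tail_bound) (auto simp: low_def)
  qed
  finally show "norm (x - proj (low n) x) \<le> norm y / real n + e" by simp
qed

text \<open>
  The preimage is the limit of the partial sums over \<open>low n\<close>, which form a Cauchy sequence by
  \<open>tail_bound\<close>.
\<close>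

lemma diag_surjective:
  assumes y: "y \<in> Hs"
  shows "\<exists>x. (x, y) \<in> diag ev"
proof -
  define X where "X n = (\<Sum>i\<in>low n. scaleC (cinner (v i) y / of_real (ev i)) (v i))" for n
  have X: "norm (X n - X m) \<le> norm y / real m" if "0 < m" "m \<le> n" for m n
  proof -
    have "low m \<subseteq> low n" using that by (auto simp: low_def)
    then have "X n = (\<Sum>i\<in>low n - low m. scaleC (cinner (v i) y / of_real (ev i)) (v i)) + X m"
      unfolding X_def using low by (intro sum.subset_diff) auto
    then have "X n - X m = (\<Sum>i\<in>low n - low m. scaleC (cinner (v i) y / of_real (ev i)) (v i))" by simp
    moreover have "norm (\<Sum>i\<in>low n - low m. scaleC (cinner (v i) y / of_real (ev i)) (v i)) \<le> norm y / real m"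
      using low(1)[of n] that by (intro tail_bound) (auto simp: low_def)
    ultimately show ?thesis by simp
  qed
  have "Cauchy X"
  proof (rule metric_CauchyI)
    fix e :: real assume e: "0 < e"
    obtain M :: nat where "norm y / e < real M" using reals_Archimedean2 by blast
    then have M: "norm y < e * real (Suc M)"
      using e by (simp add: pos_divide_less_eq algebra_simps add_strict_increasing)
    have *: "dist (X m) (X n) < e" if "Suc M \<le> m" "m \<le> n" for m n
    proof -
      have "norm (X n - X m) \<le> norm y / real m" using that by (intro X) auto
      also have "\<dots> \<le> norm y / real (Suc M)" using that by (intro divide_left_mono) auto
      also have "\<dots> < e" using M by (simp add: pos_divide_less_eq del: of_nat_Suc)
      finally show ?thesis by (simp add: dist_norm norm_minus_commute)
    qed
    show "\<exists>M. \<forall>m\<ge>M. \<forall>n\<ge>M. dist (X m) (X n) < e"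
      using * by (intro exI[of _ "Suc M"]) (metis dist_commute nle_le)
  qed
  then obtain x where x: "X \<longlonglongrightarrow> x" using Cauchy_convergent convergent_def by blast
  have "X n \<in> Hs" for n unfolding X_def by (rule comb_Hs[OF low(2)])
  from closed_sequentially[OF Hs_closed this x] have "x \<in> Hs" .
  moreover have "cinner (v i) y = of_real (ev i) * cinner (v i) x" if i: "i \<in> I" for i
  proof -
    have "continuous_on UNIV (\<lambda>x. cinner (v i) x)" by (intro continuous_intros)
    then have lim: "(\<lambda>n. cinner (v i) (X n)) \<longlonglongrightarrow> cinner (v i) x"
      using x by (simp add: continuous_on_def tendsto_compose)
    obtain M :: nat where M: "\<bar>ev i\<bar> \<le> real M" using real_arch_simple by blast
    have "cinner (v i) (X n) = cinner (v i) y / of_real (ev i)" if "M \<le> n" for n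
      using i M that low unfolding X_def by (subst cinner_comb) (auto simp: low_def)
    then have "(\<lambda>n. cinner (v i) (X n)) \<longlonglongrightarrow> cinner (v i) y / of_real (ev i)"
      by (intro tendsto_eventually eventually_sequentiallyI[of M])
    then have "cinner (v i) x = cinner (v i) y / of_real (ev i)"
      using lim LIMSEQ_unique by blast
    then show ?thesis using ev_nonzero[OF i] by simp
  qed
  ultimately have "(x, y) \<in> diag ev" using y by (simp add: diag_def)
  then show ?thesis by blast
qed

lemma resolvent_0: "resolvent (diag ev) 0 = {(y, x). (x, y) \<in> diag ev}"
  by (auto simp: resolvent_def)

lemma zero_in_resolvent_set: "0 \<in> resolvent_set Hs (diag ev)"
proof -
  have inj: "x = x'" if xy: "(x, y) \<in> diag ev" "(x', y) \<in> diag ev" for x x' y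
  proof (rule Hs_eqI)
    show "x \<in> Hs" "x' \<in> Hs" using xy by (simp_all add: diag_def)
    show "cinner (v i) x = cinner (v i) x'" if i: "i \<in> I" for i
      unfolding diag_coefficient[OF xy(1) i] diag_coefficient[OF xy(2) i] ..
  qed
  have "single_valued (resolvent (diag ev) 0)"
    unfolding resolvent_0 by (rule single_valuedI) (clarsimp, erule (1) inj)
  moreover have "Domain (resolvent (diag ev) 0) = Hs"
  proof
    show "Domain (resolvent (diag ev) 0) \<subseteq> Hs" 
      unfolding resolvent_0 by (auto simp: diag_def)
    show "Hs \<subseteq> Domain (resolvent (diag ev) 0)"
      using diag_surjective unfolding resolvent_0 by blast
  qed
  moreover have "\<forall>(u, w)\<in>resolvent (diag ev) 0. norm w \<le> 1 * norm u"
    unfolding resolvent_0 using diag_norm_le by auto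
  ultimately show ?thesis unfolding resolvent_set_def by blast
qed

lemma diag_compact_resolvent: "compact_resolvent Hs (diag ev)"
  unfolding compact_resolvent_def
proof (rule bexI[OF _ zero_in_resolvent_set], rule compact_closure_approx)
  fix e :: real assume e: "0 < e"
  obtain n :: nat where "1 / e < real n" using reals_Archimedean2 by blast
  moreover from this have "0 < real n" using e by (smt (verit) zero_less_divide_1_iff)
  ultimately have n: "0 < n" "1 / real n \<le> e" using e by (auto simp: field_simps)
  let ?K = "{\<Sum>i\<in>low n. scaleC (c i) (v i) | c. \<forall>i\<in>low n. cmod (c i) \<le> 1}"
  have "\<exists>z\<in>?K. norm (x - z) \<le> e" if x: "x \<in> resolvent (diag ev) 0 `` (Hs \<inter> cball 0 1)" for x
  proof -
    obtain y where y: "(x, y) \<in> diag ev" "norm y \<le> 1"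
      using x unfolding resolvent_0 by auto
    have "cmod (cinner (v i) x) \<le> 1" if i: "i \<in> low n" for i
    proof -
      have "i \<in> I" using i low(2) by blast
      then have "(norm (v i))\<^sup>2 = 1" using orth[of i i] by (simp add: norm_sq_cinner)
      then have "norm (v i) = 1" using norm_ge_zero[of "v i"] by (auto simp: power2_eq_1_iff)
      then show ?thesis
        using Cauchy_Schwarz[of "v i" x] diag_norm_le[OF y(1)] y(2) by simp
    qed
    then have "proj (low n) x \<in> ?K"
      unfolding proj_def mem_Collect_eq by (intro exI[of _ "\<lambda>i. cinner (v i) x"]) auto
    moreover have "norm (x - proj (low n) x) \<le> norm y / real n" by (rule diag_low_approx[OF y(1) n(1)])
    moreover have "norm y / real n \<le> 1 / real n" using y by (intro divide_right_mono) auto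
    ultimately show ?thesis using n(2) by fastforce
  qed
  then show "\<exists>K. compact K \<and> (\<forall>x\<in>resolvent (diag ev) 0 `` (Hs \<inter> cball 0 1). \<exists>z\<in>K. norm (x - z) \<le> e)"
    using compact_coefficient_box[OF low(1)] by blast
qed

lemma v_inj: "inj_on v I"
  using orth by (intro inj_onI) (metis zero_neq_one)

text \<open>
  In an eigenvector only the basis vectors with the same eigenvalue have nonzero coefficients.
\<close>

lemma eigenspace_span: "eigenspace (diag ev) e = complex_vector.span (v ` {i \<in> I. ev i = e})"
proof (intro equalityI subsetI)
  let ?S = "{i \<in> I. ev i = e}"
  have fin: "finite ?S" using discrete[of "\<bar>e\<bar>"] by (rule finite_subset[rotated]) auto
  fix x assume "x \<in> eigenspace (diag ev) e"
  then have x: "x \<in> Hs" "\<And>i. i \<in> I \<Longrightarrow> of_real e * cinner (v i) x = of_real (ev i) * cinner (v i) x"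
    by (auto simp: eigenspace_def diag_def cinner_scaleR_right)
  have "x = proj ?S x"
  proof (rule Hs_eqI[OF x(1)])
    show "proj ?S x \<in> Hs" unfolding proj_def by (rule comb_Hs) auto
    show "cinner (v i) x = cinner (v i) (proj ?S x)" if i: "i \<in> I" for i
      using x(2)[OF i] i fin unfolding proj_def by (subst cinner_comb) auto
  qed
  moreover have "proj ?S x \<in> complex_vector.span (v ` ?S)"
    unfolding proj_def by (intro complex_vector.span_sum complex_vector.span_scale complex_vector.span_base) auto
  ultimately show "x \<in> complex_vector.span (v ` ?S)" by simp
next
  fix x assume "x \<in> complex_vector.span (v ` {i \<in> I. ev i = e})"
  then show "x \<in> eigenspace (diag ev) e"
  proof (rule complex_vector.span_induct)
    show "complex_vector.subspace {x. x \<in> eigenspace (diag ev) e}"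
    proof -
      have "(0, e *\<^sub>R 0) \<in> diag ev" using complex_vector.subspace_0[OF diag_subspace] by (simp add: zero_prod_def)
      moreover have "(x + y, e *\<^sub>R (x + y)) \<in> diag ev" if "(x, e *\<^sub>R x) \<in> diag ev" "(y, e *\<^sub>R y) \<in> diag ev" for x y
        using complex_vector.subspace_add[OF diag_subspace that] by (simp add: scaleR_add_right)
      moreover have "(scaleC c x, e *\<^sub>R scaleC c x) \<in> diag ev" if "(x, e *\<^sub>R x) \<in> diag ev" for c x
        using complex_vector.subspace_scale[OF diag_subspace that, of c]
        by (simp add: scaleC_prod_def scaleC_scaleC mult.commute flip: scaleC_of_real)
      ultimately show ?thesis by (simp add: complex_vector.subspace_def eigenspace_def)
    qed
    show "x \<in> eigenspace (diag ev) e" if "x \<in> v ` {i \<in> I. ev i = e}" for x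
      using that diag_v by (auto simp: eigenspace_def)
  qed
qed

lemma eigenvalues_eq: "eigenvalues (diag ev) = ev ` I"
proof (intro equalityI subsetI)
  fix e assume "e \<in> eigenvalues (diag ev)"
  then obtain x where x: "x \<in> complex_vector.span (v ` {i \<in> I. ev i = e})" "x \<noteq> 0"
    by (auto simp: eigenvalues_def eigenspace_span)
  show "e \<in> ev ` I"
  proof (rule ccontr)
    assume "e \<notin> ev ` I"
    then have "{i \<in> I. ev i = e} = {}" by auto
    then show False using x by (simp only: image_empty complex_vector.span_empty) simp
  qed
next
  fix e assume "e \<in> ev ` I"
  then obtain i where i: "i \<in> I" "e = ev i" by blast
  have "v i \<in> eigenspace (diag ev) e" using diag_v[OF i(1)] i by (simp add: eigenspace_def)
  moreover have "v i \<noteq> 0" using orth[OF i(1) i(1)] by auto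
  ultimately show "e \<in> eigenvalues (diag ev)" by (auto simp: eigenvalues_def)
qed

lemma dim_eigenspace: "complex_vector.dim (eigenspace (diag ev) e) = card {i \<in> I. ev i = e}"
proof -
  let ?S = "{i \<in> I. ev i = e}"
  have inj: "inj_on v ?S" using v_inj by (rule inj_on_subset) auto
  have "complex_vector.independent (v ` ?S)"
  proof
    assume "complex_vector.dependent (v ` ?S)"
    then obtain t u w where t: "finite t" "t \<subseteq> v ` ?S" "(\<Sum>x\<in>t. scaleC (u x) x) = 0" "w \<in> t" "u w \<noteq> 0"
      unfolding complex_vector.dependent_explicit by auto
    obtain R where R: "R \<subseteq> ?S" "finite R" "t = v ` R"
      using finite_subset_image[OF t(1,2)] by auto
    have "inj_on v R" using inj R inj_on_subset by blast
    then have "(\<Sum>i\<in>R. scaleC (u (v i)) (v i)) = 0"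
      using t(3) by (simp add: R(3) sum.reindex)
    moreover obtain i where i: "i \<in> R" "w = v i" using t R by auto
    ultimately have "u w = 0"
      using cinner_comb[of R i "\<lambda>i. u (v i)"] R by auto
    then show False using t by simp
  qed
  then show ?thesis
    unfolding eigenspace_span by (simp add: complex_vector.dim_span complex_vector.dim_eq_card_independent card_image[OF inj])
qed

lemma two_summableI:
  assumes "(\<lambda>\<Lambda>::real. \<Sum>e | e \<in> ev ` I \<and> \<bar>e\<bar> \<le> \<Lambda>. real (card {i \<in> I. ev i = e}) / e\<^sup>2) \<in> \<Theta>(\<lambda>\<Lambda>. ln \<Lambda>)"
  shows "two_summable Hs (diag ev)"
  unfolding two_summable_def eigenvalues_eq dim_eigenspace
  using assms zero_in_resolvent_set by blast

end

section \<open>The GNS representation\<close>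

lemma bounded_bilinear_cinner: "bounded_bilinear (cinner :: 'h \<Rightarrow> 'h::complex_hilbert \<Rightarrow> complex)"
proof
  show "\<exists>K. \<forall>a b :: 'h. norm (cinner a b) \<le> norm a * norm b * K"
    using Cauchy_Schwarz by (intro exI[of _ 1]) auto
qed (simp_all add: cinner_add_left cinner_add_right cinner_scaleR_left cinner_scaleR_right scaleR_conv_of_real)

locale L2_completion = quantum_su2 q for q :: real +
  fixes \<eta> :: "functional \<Rightarrow> 'h::complex_hilbert"
  assumes completion: "is_L2_completion q \<eta>"
begin

lemma eta_add: "a \<in> QA \<Longrightarrow> b \<in> QA \<Longrightarrow> \<eta> (a + b) = \<eta> a + \<eta> b"
  and eta_scale: "a \<in> QA \<Longrightarrow> \<eta> (fscale c a) = scaleC c (\<eta> a)"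
  and eta_inner: "a \<in> QA \<Longrightarrow> b \<in> QA \<Longrightarrow> cinner (\<eta> a) (\<eta> b) = IP a b"
  and eta_dense: "closure (\<eta> ` QA) = UNIV"
  using completion unfolding is_L2_completion_def IP_def by blast+

lemma eta_0: "\<eta> 0 = 0"
  using eta_scale[OF counit_QA, of 0] by simp

lemma eta_diff:
  assumes "a \<in> QA" "b \<in> QA" shows "\<eta> (a + fscale (- 1) b) = \<eta> a - \<eta> b"
  using assms by (simp only: eta_add eta_scale QA_scale) simp

lemma eta_norm: "a \<in> QA \<Longrightarrow> (norm (\<eta> a))\<^sup>2 = Re (IP a a)"
  by (simp add: norm_sq_cinner eta_inner)

lemma dense_induct:
  assumes "closed {x. P x}" "\<And>a. a \<in> QA \<Longrightarrow> P (\<eta> a)"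
  shows "P x"
proof -
  have "\<eta> ` QA \<subseteq> {x. P x}" using assms(2) by auto
  then have "closure (\<eta> ` QA) \<subseteq> {x. P x}" using assms(1) by (rule closure_minimal)
  then show ?thesis using eta_dense by auto
qed

lemma dense_induct2:
  assumes "closed {z. P (fst z) (snd z)}" "\<And>a b. a \<in> QA \<Longrightarrow> b \<in> QA \<Longrightarrow> P (\<eta> a) (\<eta> b)"
  shows "P x y"
proof -
  have "\<eta> ` QA \<times> \<eta> ` QA \<subseteq> {z. P (fst z) (snd z)}" using assms(2) by auto
  then have "closure (\<eta> ` QA \<times> \<eta> ` QA) \<subseteq> {z. P (fst z) (snd z)}" using assms(1) by (rule closure_minimal)
  then have "(x, y) \<in> {z. P (fst z) (snd z)}" unfolding closure_Times eta_dense by blast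
  then show ?thesis by simp
qed

text \<open>
  Unitarity of the spin one half matrix bounds its coefficients; products and sums inherit
  boundedness.
\<close>

lemma T1_contraction:
  assumes a: "a = 0 \<or> a = 1" and b: "b = 0 \<or> b = 1" and x: "x \<in> QA"
  shows "norm (\<eta> (fmult (T 1 a b) x)) \<le> norm (\<eta> x)"
proof -
  have sq: "(norm (\<eta> (fmult (T 1 a' b) x)))\<^sup>2 = Re (IP x (fmult (fmult (fstar q (T 1 a' b)) (T 1 a' b)) x))" for a'
    by (simp add: eta_norm QA_mult T_QA x IP_mult fmult_assoc)
  have "IP x (fmult (fmult (fstar q (T 1 0 b)) (T 1 0 b)) x) + IP x (fmult (fmult (fstar q (T 1 1 b)) (T 1 1 b)) x) =
      IP x (fmult (fmult (fstar q (T 1 0 b)) (T 1 0 b) + fmult (fstar q (T 1 1 b)) (T 1 1 b)) x)"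
    unfolding fmult_add_left by (simp add: IP_add_right x QA_mult QA_star T_QA)
  also have "\<dots> = IP x x" unfolding T1_unitary[OF b] by simp
  finally have "(norm (\<eta> (fmult (T 1 0 b) x)))\<^sup>2 + (norm (\<eta> (fmult (T 1 1 b) x)))\<^sup>2 = (norm (\<eta> x))\<^sup>2"
    unfolding sq eta_norm[OF x] by (metis plus_complex.simps(1))
  moreover have "0 \<le> (norm (\<eta> (fmult (T 1 0 b) x)))\<^sup>2" "0 \<le> (norm (\<eta> (fmult (T 1 1 b) x)))\<^sup>2" by simp_all
  ultimately have "(norm (\<eta> (fmult (T 1 a b) x)))\<^sup>2 \<le> (norm (\<eta> x))\<^sup>2"
    using a by (elim disjE; simp only:; linarith)
  then show ?thesis by (simp add: power2_le_iff_abs_le)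
qed

lemma left_mult_bounded:
  assumes "a \<in> QA"
  shows "\<exists>C\<ge>0. \<forall>x\<in>QA. norm (\<eta> (fmult a x)) \<le> C * norm (\<eta> x)"
  using assms
proof (rule QA_induct)
  show "\<exists>C\<ge>0. \<forall>x\<in>QA. norm (\<eta> (fmult 0 x)) \<le> C * norm (\<eta> x)"
    by (intro exI[of _ 0]) (simp add: eta_0)
  show "\<exists>C\<ge>0. \<forall>x\<in>QA. norm (\<eta> (fmult counit x)) \<le> C * norm (\<eta> x)"
    by (intro exI[of _ 1]) simp
next
  fix a b assume ab: "a \<in> QA" "b \<in> QA"
    and "\<exists>C\<ge>0. \<forall>x\<in>QA. norm (\<eta> (fmult a x)) \<le> C * norm (\<eta> x)"
    "\<exists>C\<ge>0. \<forall>x\<in>QA. norm (\<eta> (fmult b x)) \<le> C * norm (\<eta> x)"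
  then obtain C C' where C: "0 \<le> C" "\<And>x. x \<in> QA \<Longrightarrow> norm (\<eta> (fmult a x)) \<le> C * norm (\<eta> x)"
    "0 \<le> C'" "\<And>x. x \<in> QA \<Longrightarrow> norm (\<eta> (fmult b x)) \<le> C' * norm (\<eta> x)" by blast
  have "norm (\<eta> (fmult (a + b) x)) \<le> (C + C') * norm (\<eta> x)" if x: "x \<in> QA" for x
  proof -
    have "norm (\<eta> (fmult (a + b) x)) \<le> norm (\<eta> (fmult a x)) + norm (\<eta> (fmult b x))"
      using ab x by (simp add: fmult_add_left eta_add QA_mult norm_triangle_ineq)
    then show ?thesis using C(2)[OF x] C(4)[OF x] by (simp add: distrib_right)
  qed
  then show "\<exists>C\<ge>0. \<forall>x\<in>QA. norm (\<eta> (fmult (a + b) x)) \<le> C * norm (\<eta> x)"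
    using C by (intro exI[of _ "C + C'"]) auto
next
  fix c a assume a: "a \<in> QA" and "\<exists>C\<ge>0. \<forall>x\<in>QA. norm (\<eta> (fmult a x)) \<le> C * norm (\<eta> x)"
  then obtain C where C: "0 \<le> C" "\<And>x. x \<in> QA \<Longrightarrow> norm (\<eta> (fmult a x)) \<le> C * norm (\<eta> x)" by blast
  have "norm (\<eta> (fmult (fscale c a) x)) \<le> (cmod c * C) * norm (\<eta> x)" if x: "x \<in> QA" for x
    using mult_left_mono[OF C(2)[OF x], of "cmod c"] a x
    by (simp add: fmult_scale_left eta_scale QA_mult norm_scaleC mult.assoc)
  then show "\<exists>C\<ge>0. \<forall>x\<in>QA. norm (\<eta> (fmult (fscale c a) x)) \<le> C * norm (\<eta> x)"
    using C by (intro exI[of _ "cmod c * C"]) auto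
next
  fix a b :: int and x assume ab: "a = 0 \<or> a = 1" "b = 0 \<or> b = 1" and x: "x \<in> QA"
    and "\<exists>C\<ge>0. \<forall>y\<in>QA. norm (\<eta> (fmult x y)) \<le> C * norm (\<eta> y)"
  then obtain C where C: "0 \<le> C" "\<And>y. y \<in> QA \<Longrightarrow> norm (\<eta> (fmult x y)) \<le> C * norm (\<eta> y)" by blast
  have "norm (\<eta> (fmult (fmult (T 1 a b) x) y)) \<le> C * norm (\<eta> y)" if y: "y \<in> QA" for y
    using T1_contraction[OF ab QA_mult[OF x y]] C(2)[OF y] by (simp add: fmult_assoc)
  then show "\<exists>C\<ge>0. \<forall>y\<in>QA. norm (\<eta> (fmult (fmult (T 1 a b) x) y)) \<le> C * norm (\<eta> y)"
    using C by blast
qed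

text \<open>
  A bounded map on the dense image of the algebra extends in exactly one way to a continuous
  map.
\<close>

lemma gns_spec:
  assumes a: "a \<in> QA"
  shows "continuous_on UNIV (gns q \<eta> a) \<and> (\<forall>b\<in>QA. gns q \<eta> a (\<eta> b) = \<eta> (fmult a b))"
proof -
  obtain C where C: "0 \<le> C" "\<And>x. x \<in> QA \<Longrightarrow> norm (\<eta> (fmult a x)) \<le> C * norm (\<eta> x)"
    using left_mult_bounded[OF a] by blast
  have diff: "norm (\<eta> (fmult a x) - \<eta> (fmult a y)) \<le> C * norm (\<eta> x - \<eta> y)" if xy: "x \<in> QA" "y \<in> QA" for x y
  proof -
    have "fmult a (x + fscale (- 1) y) = fmult a x + fscale (- 1) (fmult a y)"
      by (simp only: fmult_add_right fmult_scale_right)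
    then show ?thesis
      using C(2)[of "x + fscale (- 1) y"] xy a by (simp add: eta_diff QA_add QA_scale QA_mult del: functional.scale_minus_left)
  qed
  define f where "f z = \<eta> (fmult a (inv_into QA \<eta> z))" for z
  have f: "f (\<eta> b) = \<eta> (fmult a b)" if b: "b \<in> QA" for b
  proof -
    have i: "inv_into QA \<eta> (\<eta> b) \<in> QA" "\<eta> (inv_into QA \<eta> (\<eta> b)) = \<eta> b"
      using b by (auto intro: inv_into_into simp: f_inv_into_f)
    show ?thesis using diff[OF i(1) b] unfolding f_def i(2) by simp
  qed
  have "C-lipschitz_on (\<eta> ` QA) f"
    by (rule lipschitz_onI) (use f diff C in \<open>auto simp: dist_norm\<close>)
  then have "uniformly_continuous_on (\<eta> ` QA) f" by (rule lipschitz_on_uniformly_continuous)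
  then obtain g where g: "uniformly_continuous_on (closure (\<eta> ` QA)) g"
    "\<And>x. x \<in> \<eta> ` QA \<Longrightarrow> f x = g x"
    by (rule uniformly_continuous_on_extension_on_closure) (rule that)
  have cont: "continuous_on UNIV g"
    using g(1) unfolding eta_dense by (rule uniformly_continuous_imp_continuous)
  have ex: "continuous_on UNIV g \<and> (\<forall>b\<in>QA. g (\<eta> b) = \<eta> (fmult a b))"
    using cont g(2) f by auto
  have unique: "h = g" if h: "continuous_on UNIV h \<and> (\<forall>b\<in>QA. h (\<eta> b) = \<eta> (fmult a b))" for h
  proof
    fix x
    show "h x = g x"
      by (rule dense_induct[where P = "\<lambda>x. h x = g x"])
        (use h ex in \<open>auto intro!: closed_Collect_eq\<close>)
  qed
  show ?thesis
    unfolding gns_def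
    by (rule theI[where a = g and P = "\<lambda>T. continuous_on UNIV T \<and> (\<forall>b\<in>QA. T (\<eta> b) = \<eta> (fmult a b))"])
      (fact ex, rule unique)
qed

lemma gns_eta: "a \<in> QA \<Longrightarrow> b \<in> QA \<Longrightarrow> gns q \<eta> a (\<eta> b) = \<eta> (fmult a b)"
  using gns_spec by blast

lemma gns_continuous [continuous_intros]:
  "a \<in> QA \<Longrightarrow> continuous_on S f \<Longrightarrow> continuous_on S (\<lambda>x. gns q \<eta> a (f x))"
  using continuous_on_compose2[of UNIV "gns q \<eta> a" S f] gns_spec by auto

lemma gns_add: "a \<in> QA \<Longrightarrow> gns q \<eta> a (x + y) = gns q \<eta> a x + gns q \<eta> a y"
proof (rule dense_induct2[where P = "\<lambda>x y. gns q \<eta> a (x + y) = gns q \<eta> a x + gns q \<eta> a y"])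
  assume a: "a \<in> QA"
  then show "closed {z. gns q \<eta> a (fst z + snd z) = gns q \<eta> a (fst z) + gns q \<eta> a (snd z)}"
    by (intro closed_Collect_eq continuous_intros)
  show "gns q \<eta> a (\<eta> x + \<eta> y) = gns q \<eta> a (\<eta> x) + gns q \<eta> a (\<eta> y)" if "x \<in> QA" "y \<in> QA" for x y
    using a that gns_eta[OF a QA_add[OF that]] by (simp add: eta_add gns_eta fmult_add_right QA_mult)
qed

lemma gns_scaleC: "a \<in> QA \<Longrightarrow> gns q \<eta> a (scaleC c x) = scaleC c (gns q \<eta> a x)"
proof (rule dense_induct[where P = "\<lambda>x. gns q \<eta> a (scaleC c x) = scaleC c (gns q \<eta> a x)"])
  assume a: "a \<in> QA"
  then show "closed {x. gns q \<eta> a (scaleC c x) = scaleC c (gns q \<eta> a x)}"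
    by (intro closed_Collect_eq continuous_intros)
  show "gns q \<eta> a (scaleC c (\<eta> x)) = scaleC c (gns q \<eta> a (\<eta> x))" if "x \<in> QA" for x
    using a that gns_eta[OF a QA_scale[OF that, of c]] by (simp add: eta_scale gns_eta fmult_scale_right QA_mult)
qed

lemma gns_bounded:
  assumes "a \<in> QA"
  shows "\<exists>C\<ge>0. \<forall>x. norm (gns q \<eta> a x) \<le> C * norm x"
proof -
  obtain C where C: "0 \<le> C" "\<And>x. x \<in> QA \<Longrightarrow> norm (\<eta> (fmult a x)) \<le> C * norm (\<eta> x)"
    using left_mult_bounded[OF assms] by blast
  have "norm (gns q \<eta> a x) \<le> C * norm x" for x
  proof (rule dense_induct[where P = "\<lambda>x. norm (gns q \<eta> a x) \<le> C * norm x"])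
    show "closed {x. norm (gns q \<eta> a x) \<le> C * norm x}"
      using assms by (intro closed_Collect_le continuous_intros)
  qed (use C gns_eta[OF assms] in auto)
  then show ?thesis using C by blast
qed

lemma gns_algebra:
  assumes a: "a \<in> QA"
  shows gns_plus: "b \<in> QA \<Longrightarrow> gns q \<eta> (a + b) x = gns q \<eta> a x + gns q \<eta> b x"
    and gns_fscale: "gns q \<eta> (fscale c a) x = scaleC c (gns q \<eta> a x)"
    and gns_fmult: "b \<in> QA \<Longrightarrow> gns q \<eta> (fmult a b) x = gns q \<eta> a (gns q \<eta> b x)"
proof -
  show "gns q \<eta> (a + b) x = gns q \<eta> a x + gns q \<eta> b x" if b: "b \<in> QA"
  proof (rule dense_induct[where P = "\<lambda>x. gns q \<eta> (a + b) x = gns q \<eta> a x + gns q \<eta> b x"])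
    show "closed {x. gns q \<eta> (a + b) x = gns q \<eta> a x + gns q \<eta> b x}"
      using a b by (intro closed_Collect_eq continuous_intros QA_add)
  qed (use a b in \<open>simp add: gns_eta QA_add fmult_add_left eta_add QA_mult\<close>)
  show "gns q \<eta> (fscale c a) x = scaleC c (gns q \<eta> a x)"
  proof (rule dense_induct[where P = "\<lambda>x. gns q \<eta> (fscale c a) x = scaleC c (gns q \<eta> a x)"])
    show "closed {x. gns q \<eta> (fscale c a) x = scaleC c (gns q \<eta> a x)}"
      using a by (intro closed_Collect_eq continuous_intros QA_scale)
  qed (use a in \<open>simp add: gns_eta QA_scale fmult_scale_left eta_scale QA_mult\<close>)
  show "gns q \<eta> (fmult a b) x = gns q \<eta> a (gns q \<eta> b x)" if b: "b \<in> QA"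
  proof (rule dense_induct[where P = "\<lambda>x. gns q \<eta> (fmult a b) x = gns q \<eta> a (gns q \<eta> b x)"])
    show "closed {x. gns q \<eta> (fmult a b) x = gns q \<eta> a (gns q \<eta> b x)}"
      using a b by (intro closed_Collect_eq continuous_intros QA_mult)
  qed (use a b in \<open>simp add: gns_eta QA_mult fmult_assoc\<close>)
qed

lemma gns_counit: "gns q \<eta> counit x = x"
proof (rule dense_induct[where P = "\<lambda>x. gns q \<eta> counit x = x"])
  show "closed {x. gns q \<eta> counit x = x}"
    using counit_QA by (intro closed_Collect_eq continuous_intros)
qed (simp add: gns_eta counit_QA)

lemma gns_adjoint:
  assumes a: "a \<in> QA"
  shows "cinner (gns q \<eta> (fstar q a) x) y = cinner x (gns q \<eta> a y)"
proof (rule dense_induct2[where P = "\<lambda>x y. cinner (gns q \<eta> (fstar q a) x) y = cinner x (gns q \<eta> a y)"])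
  show "closed {z. cinner (gns q \<eta> (fstar q a) (fst z)) (snd z) = cinner (fst z) (gns q \<eta> a (snd z))}"
    using a QA_star[OF a]
    by (intro closed_Collect_eq bounded_bilinear.continuous_on[OF bounded_bilinear_cinner] continuous_intros)
next
  fix b c assume bc: "b \<in> QA" "c \<in> QA"
  have "IP (fmult (fstar q a) b) c = IP b (fmult a c)"
    using q_pos by (simp add: IP_mult fstar_fstar)
  then show "cinner (gns q \<eta> (fstar q a) (\<eta> b)) (\<eta> c) = cinner (\<eta> b) (gns q \<eta> a (\<eta> c))"
    using a bc by (simp add: gns_eta QA_star QA_mult eta_inner)
qed

section \<open>Orthonormal bases\<close>

text \<open>The matrix coefficients divided by their lengths \<open>sqrt (nrm n i)\<close>.\<close>

definition eps :: "int \<Rightarrow> int \<Rightarrow> int \<Rightarrow> 'h" where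
  "eps n i c = (hp (2 * i - n) * rt (n + 1)) *\<^sub>R \<eta> (T n i c)"

lemma eps_out: "\<not> (0 \<le> i \<and> i \<le> n \<and> 0 \<le> c \<and> c \<le> n) \<Longrightarrow> eps n i c = 0"
  using T_out[of i n c] eta_0 by (simp add: eps_def)

lemma eps_inner:
  assumes "0 \<le> i" "i \<le> n" "0 \<le> c" "c \<le> n"
  shows "cinner (eps n i c) (eps n' i' c') = (if (n', i', c') = (n, i, c) then 1 else 0)"
proof (cases "0 \<le> i' \<and> i' \<le> n' \<and> 0 \<le> c' \<and> c' \<le> n'")
  case False
  then have "eps n' i' c' = 0" by (rule eps_out)
  then show ?thesis using False assms by auto
next
  case True
  then have IP: "IP (T n i c) (T n' i' c') = (if (n', i', c') = (n, i, c) then of_real (nrm n i) else 0)"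
    using assms by (intro IP_T) auto
  have "(hp (2 * i - n) * rt (n + 1)) * (hp (2 * i - n) * rt (n + 1)) * nrm n i = 1"
  proof -
    have "hp (2 * i - n) * hp (2 * i - n) * hp (2 * n - 4 * i) = 1"
      by (simp flip: hp_add)
    moreover have "rt (n + 1) * rt (n + 1) / qi (n + 1) = 1"
      using assms rt_sq[of "n + 1"] qi_pos[of "n + 1"] by simp
    moreover have "(hp (2 * i - n) * rt (n + 1)) * (hp (2 * i - n) * rt (n + 1)) * nrm n i =
        (hp (2 * i - n) * hp (2 * i - n) * hp (2 * n - 4 * i)) * (rt (n + 1) * rt (n + 1) / qi (n + 1))"
      by (simp add: nrm_def)
    ultimately show ?thesis by (simp only: mult_1)
  qed
  then have "complex_of_real ((hp (2 * i - n) * rt (n + 1)) * (hp (2 * i - n) * rt (n + 1)) * nrm n i) = 1"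
    by simp
  then show ?thesis
    unfolding eps_def cinner_scaleR_left cinner_scaleR_right eta_inner[OF T_QA T_QA] IP
    by (auto simp: mult_ac)
qed

lemma T_eps:
  assumes "0 \<le> n" shows "\<eta> (T n i c) = (1 / (hp (2 * i - n) * rt (n + 1))) *\<^sub>R eps n i c"
  using assms rt_pos[of "n + 1"] by (simp add: eps_def)

text \<open>
  Up to factors that depend on the spin and on \<open>a\<close>, both matrix entries are products of one
  Clebsch-Gordan number for the row and one for the column.
\<close>

lemma gns_eps:
  assumes ab: "a = 0 \<or> a = 1" "b = 0 \<or> b = 1" and n: "0 \<le> n"
  shows "gns q \<eta> (T 1 a b) (eps n i c) =
    (hp (1 - 2 * a) * (rt (n + 1) / rt (n + 2)) * cgA a n i * cgA b n c) *\<^sub>R eps (n + 1) (i + a) (c + b) +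
    (hp (1 - 2 * a) * (rt (n + 1) / rt n) * cgB a n i * cgB b n c) *\<^sub>R eps (n - 1) (i + a - 1) (c + b - 1)"
proof -
  have sR: "gns q \<eta> (T 1 a b) (r *\<^sub>R x) = r *\<^sub>R gns q \<eta> (T 1 a b) x" for r x
    using gns_scaleC[OF T_QA, of 1 a b "of_real r" x] by (simp add: scaleC_of_real)
  have "gns q \<eta> (T 1 a b) (eps n i c) = (hp (2 * i - n) * rt (n + 1)) *\<^sub>R
      ((cgA a n i * cgA b n c) *\<^sub>R \<eta> (T (n + 1) (i + a) (c + b)) +
       (cgB a n i * cgB b n c) *\<^sub>R \<eta> (T (n - 1) (i + a - 1) (c + b - 1)))"
    unfolding eps_def sR gns_eta[OF T_QA T_QA] product_T[OF ab n]
    by (simp only: eta_add eta_scale QA_scale T_QA scaleC_of_real)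
  also have "(cgA a n i * cgA b n c) *\<^sub>R \<eta> (T (n + 1) (i + a) (c + b)) =
      (cgA a n i * cgA b n c / (hp (2 * (i + a) - (n + 1)) * rt (n + 2))) *\<^sub>R eps (n + 1) (i + a) (c + b)"
    using n by (simp add: T_eps add.commute)
  also have "(cgB a n i * cgB b n c) *\<^sub>R \<eta> (T (n - 1) (i + a - 1) (c + b - 1)) =
      (cgB a n i * cgB b n c / (hp (2 * (i + a - 1) - (n - 1)) * rt n)) *\<^sub>R eps (n - 1) (i + a - 1) (c + b - 1)"
  proof (cases "n = 0")
    case True
    have "eps (- 1) i' c' = 0" for i' c' by (rule eps_out) auto
    moreover have "\<eta> (T (- 1) i' c') = 0" for i' c'
      using T_out[of i' "- 1" c'] eta_0 by auto
    ultimately show ?thesis using True by simp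
  next
    case False
    then show ?thesis using n T_eps[of "n - 1"] by simp
  qed
  finally have "gns q \<eta> (T 1 a b) (eps n i c) =
      (hp (2 * i - n) * rt (n + 1) * (cgA a n i * cgA b n c / (hp (2 * (i + a) - (n + 1)) * rt (n + 2)))) *\<^sub>R eps (n + 1) (i + a) (c + b) +
      (hp (2 * i - n) * rt (n + 1) * (cgB a n i * cgB b n c / (hp (2 * (i + a - 1) - (n - 1)) * rt n))) *\<^sub>R eps (n - 1) (i + a - 1) (c + b - 1)"
    by (simp add: scaleR_add_right)
  moreover have "hp (2 * i - n) = hp (1 - 2 * a) * hp (2 * (i + a) - (n + 1))"
    "hp (2 * i - n) = hp (1 - 2 * a) * hp (2 * (i + a - 1) - (n - 1))"
    by (simp_all add: algebra_simps flip: hp_add)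
  then have "hp (2 * i - n) * rt (n + 1) * (cgA a n i * cgA b n c / (hp (2 * (i + a) - (n + 1)) * rt (n + 2))) =
      hp (1 - 2 * a) * (rt (n + 1) / rt (n + 2)) * cgA a n i * cgA b n c"
    "hp (2 * i - n) * rt (n + 1) * (cgB a n i * cgB b n c / (hp (2 * (i + a - 1) - (n - 1)) * rt n)) =
      hp (1 - 2 * a) * (rt (n + 1) / rt n) * cgB a n i * cgB b n c"
    by (simp_all only:) (simp_all add: field_simps)
  ultimately show ?thesis by simp
qed

end

section \<open>Decay of the Clebsch-Gordan coefficients\<close>

context quantum_su2
begin

text \<open>
  Sine and cosine of an angle: up to signs, the Clebsch-Gordan numbers and also the
  coefficients of the Dirac eigenvectors are values of these two functions. For large \<open>x\<close> the
  angle is close to zero.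
\<close>

definition sn :: "int \<Rightarrow> int \<Rightarrow> real" where
  "sn n x = hp x * rt (n + 1 - x) / rt (n + 1)"

definition cn :: "int \<Rightarrow> int \<Rightarrow> real" where
  "cn n x = hp (x - n - 1) * rt x / rt (n + 1)"

lemma cg_sn:
  "cgA 0 n i = sn n i" "cgA 1 n i = cn n (i + 1)" "cgB 0 n i = cn n i" "cgB 1 n i = - sn n (i + 1)"
  by (simp_all add: cgA_def cgB_def sn_def cn_def algebra_simps)

lemma sn_top [simp]: "sn n (n + 1) = 0" and cn_0 [simp]: "cn n 0 = 0"
  by (simp_all add: sn_def cn_def)

lemma hp_nonneg [simp]: "0 \<le> hp i"
  using hp_pos[of i] by linarith

lemma sn_nonneg: "0 \<le> n \<Longrightarrow> x \<le> n + 1 \<Longrightarrow> 0 \<le> sn n x"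
  unfolding sn_def using rt_nonneg[of "n + 1 - x"] rt_nonneg[of "n + 1"] hp_pos[of x]
  by (intro divide_nonneg_nonneg mult_nonneg_nonneg) auto

lemma cn_nonneg: "0 \<le> n \<Longrightarrow> 0 \<le> x \<Longrightarrow> 0 \<le> cn n x"
  unfolding cn_def using rt_nonneg[of x] rt_nonneg[of "n + 1"] hp_pos[of "x - n - 1"]
  by (intro divide_nonneg_nonneg mult_nonneg_nonneg) auto

lemma sn_cn:
  assumes "0 \<le> n" "0 \<le> x" "x \<le> n + 1"
  shows "(sn n x)\<^sup>2 + (cn n x)\<^sup>2 = 1"
proof (cases "x = n + 1")
  case True
  then show ?thesis using assms rt_pos[of "n + 1"] by (simp add: cn_def sn_def)
next
  case False
  then show ?thesis using cg_orthogonal(1)[of x n] assms by (simp add: cg_sn power2_eq_square)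
qed

lemma sn_le_1: "0 \<le> n \<Longrightarrow> 0 \<le> x \<Longrightarrow> x \<le> n + 1 \<Longrightarrow> sn n x \<le> 1"
  and cn_le_1: "0 \<le> n \<Longrightarrow> 0 \<le> x \<Longrightarrow> x \<le> n + 1 \<Longrightarrow> cn n x \<le> 1"
proof -
  assume a: "0 \<le> n" "0 \<le> x" "x \<le> n + 1"
  have "(sn n x)\<^sup>2 \<le> 1\<^sup>2" "(cn n x)\<^sup>2 \<le> 1\<^sup>2" using sn_cn[OF a] by (simp_all add: sum_power2_ge_zero) 
      (metis add_increasing2 add_le_cancel_left zero_le_power2 sn_cn[OF a] order_refl le_add_same_cancel1 le_add_same_cancel2)+
  then show "sn n x \<le> 1" "cn n x \<le> 1" by (auto intro: power2_le_imp_le)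
qed

lemma hp_antimono: "i \<le> j \<Longrightarrow> hp j \<le> hp i"
  using q_pos q_less_1 by (simp add: hp_def powr_mono')

text \<open>
  In this form it is visible that \<open>cn n x\<close> depends on \<open>n\<close> only through a term of order
  \<open>q\<^sup>2\<^sup>n\<close>.
\<close>

lemma cn_sq:
  assumes "0 \<le> n" "0 \<le> x"
  shows "(cn n x)\<^sup>2 = (1 - hp (4 * x)) / (1 - hp (4 * n + 4))"
proof -
  have qi: "qi x / qi (n + 1) = (hp (2 * x) - hp (- 2 * x)) / (hp (2 * (n + 1)) - hp (- 2 * (n + 1)))"
    unfolding qi_hp using q_denom by simp
  have "(cn n x)\<^sup>2 = hp (x - n - 1) * hp (x - n - 1) * ((rt x * rt x) / (rt (n + 1) * rt (n + 1)))"
    by (simp add: cn_def power2_eq_square)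
  also have "\<dots> = hp (2 * x - 2 * n - 2) * (qi x / qi (n + 1))"
    using assms by (simp add: rt_sq algebra_simps flip: hp_add)
  also have "\<dots> = (hp (2 * x - 2 * n - 2) * (hp (2 * x) - hp (- 2 * x))) / (hp (2 * (n + 1)) - hp (- 2 * (n + 1)))"
    unfolding qi by simp
  also have "hp (2 * x - 2 * n - 2) * (hp (2 * x) - hp (- 2 * x)) = - (hp (- 2 * (n + 1)) * (1 - hp (4 * x)))"
    by (simp add: right_diff_distrib algebra_simps flip: hp_add)
  also have "hp (2 * (n + 1)) - hp (- 2 * (n + 1)) = - (hp (- 2 * (n + 1)) * (1 - hp (4 * n + 4)))"
    by (simp add: right_diff_distrib algebra_simps flip: hp_add)
  finally show ?thesis by simp
qed

text \<open>
  A bound, independent of \<open>n\<close>, for the inverses of the denominators in \<open>cn_sq\<close>.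
\<close>

definition KK :: real where "KK = 1 / (1 - q\<^sup>2)"

lemma q_sq: "q\<^sup>2 < 1" "0 < q\<^sup>2"
  using q_pos q_less_1 by (simp_all add: power_less_one_iff)

lemma KK_ge_1: "1 \<le> KK"
  using q_sq by (simp add: KK_def)

lemma hp_4: "hp 4 = q\<^sup>2"
  using q_pos by (simp add: hp_def powr_numeral)

lemma gap_bound:
  assumes "0 \<le> n" shows "0 < 1 - hp (4 * n + 4)" "1 / (1 - hp (4 * n + 4)) \<le> KK"
proof -
  have "hp (4 * n + 4) \<le> q\<^sup>2" unfolding hp_4[symmetric] using assms by (intro hp_antimono) simp
  then show "0 < 1 - hp (4 * n + 4)" "1 / (1 - hp (4 * n + 4)) \<le> KK"
    using q_sq unfolding KK_def by (auto intro!: divide_left_mono mult_pos_pos)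
qed

lemma sn_sq_le:
  assumes "0 \<le> n" "0 \<le> x" "x \<le> n + 1"
  shows "(sn n x)\<^sup>2 \<le> KK * hp (4 * x)"
proof -
  note g = gap_bound[OF assms(1)]
  have "(sn n x)\<^sup>2 = 1 - (1 - hp (4 * x)) / (1 - hp (4 * n + 4))"
    using sn_cn[OF assms] cn_sq[OF assms(1,2)] by simp
  also have "\<dots> = (hp (4 * x) - hp (4 * n + 4)) / (1 - hp (4 * n + 4))"
    using g by (simp add: field_simps)
  also have "\<dots> \<le> hp (4 * x) / (1 - hp (4 * n + 4))"
    using g(1) hp_pos[of "4 * n + 4"] by (intro divide_right_mono) auto
  also have "\<dots> \<le> KK * hp (4 * x)"
    using mult_right_mono[OF g(2), of "hp (4 * x)"] hp_pos[of "4 * x"] by simp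
  finally show ?thesis .
qed

lemma sn_decay:
  assumes "0 \<le> n" "0 \<le> x" "x \<le> n + 1"
  shows "sn n x \<le> KK * hp (2 * x)"
proof (rule power2_le_imp_le)
  have "KK * hp (4 * x) \<le> KK * (KK * hp (4 * x))"
    using KK_ge_1 hp_pos[of "4 * x"] by (simp add: mult_left_mono)
  also have "\<dots> = (KK * hp (2 * x))\<^sup>2"
    by (simp add: power2_eq_square algebra_simps flip: hp_add)
  finally show "(sn n x)\<^sup>2 \<le> (KK * hp (2 * x))\<^sup>2" using sn_sq_le[OF assms] by simp
  show "0 \<le> KK * hp (2 * x)" using KK_ge_1 hp_pos[of "2 * x"] by simp
qed

lemma cn_near_1:
  assumes "0 \<le> n" "0 \<le> x" "x \<le> n + 1"
  shows "\<bar>1 - cn n x\<bar> \<le> KK * hp (2 * x)"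
proof -
  have c: "0 \<le> cn n x" "cn n x \<le> 1" using cn_nonneg cn_le_1 assms by auto
  have s: "0 \<le> sn n x" "sn n x \<le> 1" using sn_nonneg sn_le_1 assms by auto
  have "(cn n x)\<^sup>2 \<le> cn n x" "(sn n x)\<^sup>2 \<le> sn n x"
    using c s by (simp_all add: power2_eq_square mult_left_le)
  then show ?thesis using sn_cn[OF assms] sn_decay[OF assms] c by auto
qed

lemma cn_sq_diff:
  assumes "0 \<le> n" "0 \<le> m" "0 \<le> x" "x \<le> n + 1" "r \<le> n" "r \<le> m"
  shows "\<bar>(cn n x)\<^sup>2 - (cn m x)\<^sup>2\<bar> \<le> (KK * hp (2 * r))\<^sup>2"
proof -
  define t where "t n = hp (4 * n + 4)" for n
  define y where "y = hp (4 * x)"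
  have y: "0 \<le> 1 - y" "1 - y \<le> 1"
    using hp_antimono[of 0 "4 * x"] hp_pos[of "4 * x"] assms by (auto simp: y_def)
  note g = gap_bound[OF assms(1), folded t_def] gap_bound[OF assms(2), folded t_def]
  have t: "0 < t n" "t n \<le> hp (4 * r)" "0 < t m" "t m \<le> hp (4 * r)"
    using assms by (auto simp: t_def intro: hp_antimono)
  have "(cn n x)\<^sup>2 - (cn m x)\<^sup>2 = (1 - y) * ((t n - t m) * (1 / (1 - t n)) * (1 / (1 - t m)))"
    using g unfolding cn_sq[OF assms(1,3)] cn_sq[OF assms(2,3)] t_def[symmetric] y_def[symmetric]
    by (simp add: field_simps)
  also have "\<bar>\<dots>\<bar> = (1 - y) * (\<bar>t n - t m\<bar> * (1 / (1 - t n)) * (1 / (1 - t m)))"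
    using y g by (simp add: abs_mult)
  also have "\<dots> \<le> 1 * (hp (4 * r) * KK * KK)"
    using y g t KK_ge_1 by (intro mult_mono mult_nonneg_nonneg) auto
  also have "\<dots> = (KK * hp (2 * r))\<^sup>2"
    by (simp add: power2_eq_square algebra_simps flip: hp_add)
  finally show ?thesis .
qed

lemma abs_diff_le_sq:
  fixes a b k :: real
  assumes "0 \<le> a" "0 \<le> b" "0 \<le> k" "\<bar>a\<^sup>2 - b\<^sup>2\<bar> \<le> k\<^sup>2"
  shows "\<bar>a - b\<bar> \<le> k"
proof (rule power2_le_imp_le)
  have "\<bar>a - b\<bar>\<^sup>2 = \<bar>a - b\<bar> * \<bar>a - b\<bar>" by (simp add: power2_eq_square)
  also have "\<dots> \<le> \<bar>a - b\<bar> * (a + b)" using assms by (intro mult_left_mono) auto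
  also have "\<dots> = \<bar>a - b\<bar> * \<bar>a + b\<bar>" using assms by simp
  also have "\<dots> = \<bar>a\<^sup>2 - b\<^sup>2\<bar>" by (simp add: abs_mult[symmetric] power2_eq_square algebra_simps)
  finally show "\<bar>a - b\<bar>\<^sup>2 \<le> k\<^sup>2" using assms by simp
qed (use assms in simp)

lemma sn_cn_diff:
  assumes "0 \<le> n" "0 \<le> m" "0 \<le> x" "x \<le> n + 1" "x \<le> m + 1" "r \<le> n" "r \<le> m"
  shows "\<bar>cn n x - cn m x\<bar> \<le> KK * hp (2 * r)" "\<bar>sn n x - sn m x\<bar> \<le> KK * hp (2 * r)"
proof -
  have k: "0 \<le> KK * hp (2 * r)" using KK_ge_1 hp_pos[of "2 * r"] by simp
  have "(sn n x)\<^sup>2 - (sn m x)\<^sup>2 = - ((cn n x)\<^sup>2 - (cn m x)\<^sup>2)"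
    using sn_cn[of n x] sn_cn[of m x] assms by simp
  then have "\<bar>(sn n x)\<^sup>2 - (sn m x)\<^sup>2\<bar> \<le> (KK * hp (2 * r))\<^sup>2"
    using cn_sq_diff[of n m x r] assms by (simp only: abs_minus_cancel)
  then show "\<bar>cn n x - cn m x\<bar> \<le> KK * hp (2 * r)" "\<bar>sn n x - sn m x\<bar> \<le> KK * hp (2 * r)"
    using cn_sq_diff[of n m x r] k assms by (auto intro!: abs_diff_le_sq sn_nonneg cn_nonneg)
qed

text \<open>
  On each pair of basis spinors the sign of the shifted Dirac operator is the reflection with
  diagonal entries \<open>rdiag\<close> and \<open>- rdiag\<close> and with off-diagonal entry \<open>roff\<close>.
\<close>

definition rdiag :: "int \<Rightarrow> int \<Rightarrow> real" where "rdiag n x = (cn n x)\<^sup>2 - (sn n x)\<^sup>2"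

definition roff :: "int \<Rightarrow> int \<Rightarrow> real" where "roff n x = - 2 * sn n x * cn n x"

lemma reflection_le_1:
  assumes "0 \<le> n" "0 \<le> x" "x \<le> n + 1"
  shows "\<bar>rdiag n x\<bar> \<le> 1" "\<bar>roff n x\<bar> \<le> 1"
proof -
  have s: "0 \<le> (sn n x)\<^sup>2" "0 \<le> (cn n x)\<^sup>2" by simp_all
  then show "\<bar>rdiag n x\<bar> \<le> 1" using sn_cn[OF assms] unfolding rdiag_def by (simp only: abs_le_iff) linarith
  have "0 \<le> (sn n x + cn n x)\<^sup>2" "0 \<le> (sn n x - cn n x)\<^sup>2" by simp_all
  then show "\<bar>roff n x\<bar> \<le> 1"
    using sn_cn[OF assms] unfolding roff_def power2_sum power2_diff by (simp only: abs_le_iff) linarith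
qed

lemma rdiag_near_1:
  assumes "0 \<le> n" "0 \<le> x" "x \<le> n + 1"
  shows "\<bar>rdiag n x - 1\<bar> \<le> 2 * KK * hp (2 * x)"
proof -
  have s: "0 \<le> sn n x" "sn n x \<le> 1" using sn_nonneg sn_le_1 assms by auto
  have "(sn n x)\<^sup>2 \<le> sn n x" using s by (simp add: power2_eq_square mult_left_le)
  moreover have "rdiag n x - 1 = - 2 * (sn n x)\<^sup>2" using sn_cn[OF assms] by (simp add: rdiag_def)
  ultimately show ?thesis using sn_decay[OF assms] by simp
qed

lemma roff_decay:
  assumes "0 \<le> n" "0 \<le> x" "x \<le> n + 1"
  shows "\<bar>roff n x\<bar> \<le> 2 * KK * hp (2 * x)"
proof -
  have c: "0 \<le> cn n x" "cn n x \<le> 1" using cn_nonneg cn_le_1 assms by auto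
  have s: "0 \<le> sn n x" using sn_nonneg assms by auto
  have "sn n x * cn n x \<le> sn n x" using s c by (simp add: mult_left_le)
  then show ?thesis using sn_decay[OF assms] s c by (simp add: roff_def abs_mult)
qed

lemma reflection_diff:
  assumes "0 \<le> n" "0 \<le> m" "0 \<le> x" "x \<le> n + 1" "x \<le> m + 1" "r \<le> n" "r \<le> m"
  shows "\<bar>rdiag n x - rdiag m x\<bar> \<le> 4 * KK * hp (2 * r)" "\<bar>roff n x - roff m x\<bar> \<le> 4 * KK * hp (2 * r)"
proof -
  note d = sn_cn_diff[OF assms]
  have c: "0 \<le> cn n x" "cn n x \<le> 1" "0 \<le> cn m x" "cn m x \<le> 1" using cn_nonneg cn_le_1 assms by auto
  have s: "0 \<le> sn n x" "sn n x \<le> 1" "0 \<le> sn m x" "sn m x \<le> 1" using sn_nonneg sn_le_1 assms by auto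
  have "rdiag n x - rdiag m x = (cn n x - cn m x) * (2 * (cn n x + cn m x))"
    using sn_cn[of n x] sn_cn[of m x] assms by (simp add: rdiag_def power2_eq_square algebra_simps)
  then have "\<bar>rdiag n x - rdiag m x\<bar> = \<bar>cn n x - cn m x\<bar> * (2 * (cn n x + cn m x))"
    using c by (simp only: abs_mult)
  also have "\<dots> \<le> (KK * hp (2 * r)) * 4"
    using d c by (intro mult_mono) auto
  finally show "\<bar>rdiag n x - rdiag m x\<bar> \<le> 4 * KK * hp (2 * r)" by simp
  have "roff n x - roff m x = - 2 * (sn n x * (cn n x - cn m x)) - 2 * ((sn n x - sn m x) * cn m x)"
    by (simp add: roff_def algebra_simps)
  also have "\<bar>\<dots>\<bar> \<le> 2 * (sn n x * \<bar>cn n x - cn m x\<bar>) + 2 * (\<bar>sn n x - sn m x\<bar> * cn m x)"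
    using s c by (intro order_trans[OF abs_triangle_ineq4]) (simp add: abs_mult)
  also have "\<dots> \<le> 2 * (KK * hp (2 * r)) + 2 * (KK * hp (2 * r))"
    using d s c mult_left_le_one_le[of "\<bar>cn n x - cn m x\<bar>" "sn n x"]
      mult_right_le_one_le[of "\<bar>sn n x - sn m x\<bar>" "cn m x"] by (intro add_mono) auto
  finally show "\<bar>roff n x - roff m x\<bar> \<le> 4 * KK * hp (2 * r)" by simp
qed

lemma hp_product: "n - 2 \<le> u + y \<Longrightarrow> hp (2 * u) * hp (2 * y) \<le> hp (2 * (n - 2))"
  unfolding hp_add[symmetric] by (rule hp_antimono) simp

text \<open>
  One of the two estimates behind the bounded commutators. Here \<open>x\<close> is the position of a pair,
  which is \<open>n - c\<close> up to one for the column \<open>c\<close>; the arguments \<open>u\<close> and \<open>w\<close> are \<open>c\<close> up to one,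
  for the two members of the pair. If the position does not change, the reflections at \<open>n\<close> and
  \<open>m\<close> agree up to order \<open>q\<^sup>n\<close>. The numbers \<open>cn n u\<close> and \<open>cn n w\<close> differ by order \<open>q\<^sup>c\<close> only,
  but their difference is multiplied by \<open>roff n x\<close>, which is of order \<open>q\<^sup>n\<^sup>-\<^sup>c\<close>.
\<close>

lemma same_position_bound:
  assumes "0 \<le> n" "0 \<le> m" "0 \<le> x" "x \<le> n + 1" "x \<le> m + 1" "n - 1 \<le> m"
    and g: "0 \<le> u" "u \<le> n + 1" "n - 2 \<le> u + x"
    and h: "roff n x = 0 \<or> 0 \<le> w \<and> w \<le> n + 1 \<and> n - 2 \<le> w + x"
  shows "\<bar>cn n u * rdiag m x - rdiag n x * cn n u\<bar> \<le> 8 * KK * KK * hp (2 * (n - 2))"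
    and "\<bar>cn n u * roff m x - roff n x * cn n w\<bar> \<le> 8 * KK * KK * hp (2 * (n - 2))"
proof -
  define B where "B = hp (2 * (n - 2))"
  have B: "0 < B" by (simp add: B_def)
  have K2: "0 \<le> KK * KK * B" using B KK_ge_1 by simp
  have "1 * (KK * B) \<le> KK * (KK * B)" using B KK_ge_1 by (intro mult_right_mono) auto
  then have KB: "4 * KK * B \<le> 4 * KK * KK * B" by simp
  have c: "0 \<le> cn n u" "cn n u \<le> 1" using cn_nonneg cn_le_1 assms by auto
  have d: "\<bar>rdiag m x - rdiag n x\<bar> \<le> 4 * KK * B" "\<bar>roff m x - roff n x\<bar> \<le> 4 * KK * B"
    unfolding B_def using assms reflection_diff[of m n x "n - 2"] by simp_all
  have mult: "\<bar>cn n u * z\<bar> \<le> 4 * KK * B" if "\<bar>z\<bar> \<le> 4 * KK * B" for z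
    using c that mult_left_le_one_le[of "\<bar>z\<bar>" "cn n u"] by (simp add: abs_mult)
  have "cn n u * rdiag m x - rdiag n x * cn n u = cn n u * (rdiag m x - rdiag n x)" by (simp add: algebra_simps)
  then show "\<bar>cn n u * rdiag m x - rdiag n x * cn n u\<bar> \<le> 8 * KK * KK * hp (2 * (n - 2))"
    using mult[OF d(1)] KB K2 unfolding B_def[symmetric] by linarith
  have "\<bar>roff n x * (cn n u - cn n w)\<bar> \<le> 4 * KK * KK * B"
  proof (cases "roff n x = 0")
    case True
    then show ?thesis using K2 by (simp add: mult_ac)
  next
    case False
    then have w: "0 \<le> w" "w \<le> n + 1" "n - 2 \<le> w + x" using h by auto
    have "\<bar>cn n u - cn n w\<bar> \<le> KK * hp (2 * u) + KK * hp (2 * w)"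
      using cn_near_1[of n u] cn_near_1[of n w] assms w by linarith
    then have "\<bar>roff n x * (cn n u - cn n w)\<bar> \<le> (2 * KK * hp (2 * x)) * (KK * hp (2 * u) + KK * hp (2 * w))"
      unfolding abs_mult using roff_decay[of n x] assms by (intro mult_mono) auto
    also have "\<dots> = 2 * KK * KK * (hp (2 * u) * hp (2 * x)) + 2 * KK * KK * (hp (2 * w) * hp (2 * x))"
      by (simp add: algebra_simps)
    also have "\<dots> \<le> 2 * KK * KK * B + 2 * KK * KK * B"
      unfolding B_def using KK_ge_1 g w by (intro add_mono mult_left_mono hp_product) auto
    finally show ?thesis by (simp add: mult_ac)
  qed
  moreover have "cn n u * roff m x - roff n x * cn n w = cn n u * (roff m x - roff n x) + roff n x * (cn n u - cn n w)"
    by (simp add: algebra_simps)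
  ultimately show "\<bar>cn n u * roff m x - roff n x * cn n w\<bar> \<le> 8 * KK * KK * hp (2 * (n - 2))"
    using mult[OF d(2)] KB unfolding B_def[symmetric] by linarith
qed

text \<open>
  If the position changes, the coefficient \<open>sn n u\<close> itself is of order \<open>q\<^sup>c\<close>, and it
  multiplies differences of order \<open>q\<^sup>n\<^sup>-\<^sup>c\<close>.
\<close>

lemma moved_position_bound:
  assumes "0 \<le> n" "0 \<le> m" "0 \<le> x" "x \<le> n + 1" "0 \<le> y" "y \<le> m + 1"
    and g: "0 \<le> u" "u \<le> n + 1" "n - 2 \<le> u + x" "n - 2 \<le> u + y"
    and h: "roff n x = 0 \<or> 0 \<le> w \<and> w \<le> n + 1 \<and> n - 2 \<le> w + x"
  shows "\<bar>sn n u * rdiag m y - rdiag n x * sn n u\<bar> \<le> 8 * KK * KK * hp (2 * (n - 2))"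
    and "\<bar>sn n u * roff m y - roff n x * sn n w\<bar> \<le> 8 * KK * KK * hp (2 * (n - 2))"
proof -
  define B where "B = hp (2 * (n - 2))"
  have B: "0 < B" by (simp add: B_def)
  have KB: "0 < KK * KK * B" using B KK_ge_1 by simp
  have s: "0 \<le> sn n u" "sn n u \<le> KK * hp (2 * u)" using sn_nonneg sn_decay assms by auto
  have f: "\<bar>rdiag m y - rdiag n x\<bar> \<le> 2 * KK * hp (2 * y) + 2 * KK * hp (2 * x)"
    using rdiag_near_1[of m y] rdiag_near_1[of n x] assms by linarith
  have "\<bar>sn n u * rdiag m y - rdiag n x * sn n u\<bar> = sn n u * \<bar>rdiag m y - rdiag n x\<bar>"
  proof -
    have "sn n u * rdiag m y - rdiag n x * sn n u = sn n u * (rdiag m y - rdiag n x)" by (simp add: algebra_simps)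
    then show ?thesis using s by (simp add: abs_mult)
  qed
  also have "\<dots> \<le> (KK * hp (2 * u)) * (2 * KK * hp (2 * y) + 2 * KK * hp (2 * x))"
    using s f KK_ge_1 hp_pos[of "2 * u"] by (intro mult_mono) auto
  also have "\<dots> = 2 * KK * KK * (hp (2 * u) * hp (2 * y)) + 2 * KK * KK * (hp (2 * u) * hp (2 * x))"
    by (simp add: algebra_simps)
  also have "\<dots> \<le> 2 * KK * KK * B + 2 * KK * KK * B"
    unfolding B_def using KK_ge_1 g by (intro add_mono mult_left_mono hp_product) auto
  finally show "\<bar>sn n u * rdiag m y - rdiag n x * sn n u\<bar> \<le> 8 * KK * KK * hp (2 * (n - 2))"
    using KB unfolding B_def[symmetric] by linarith
  have 1: "\<bar>sn n u * roff m y\<bar> \<le> 2 * KK * KK * B"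
  proof -
    have "\<bar>sn n u * roff m y\<bar> \<le> (KK * hp (2 * u)) * (2 * KK * hp (2 * y))"
      unfolding abs_mult using s roff_decay[of m y] assms KK_ge_1 hp_pos[of "2 * u"] by (intro mult_mono) auto
    also have "\<dots> = 2 * KK * KK * (hp (2 * u) * hp (2 * y))" by simp
    also have "\<dots> \<le> 2 * KK * KK * B"
      unfolding B_def using KK_ge_1 g by (intro mult_left_mono hp_product) auto
    finally show ?thesis .
  qed
  have 2: "\<bar>roff n x * sn n w\<bar> \<le> 2 * KK * KK * B"
  proof (cases "roff n x = 0")
    case True
    then show ?thesis using KB by (simp add: mult_ac)
  next
    case False
    then have w: "0 \<le> w" "w \<le> n + 1" "n - 2 \<le> w + x" using h by auto
    have "\<bar>sn n w\<bar> \<le> KK * hp (2 * w)" using sn_nonneg[of n w] sn_decay[of n w] assms w by simp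
    then have "\<bar>roff n x * sn n w\<bar> \<le> (2 * KK * hp (2 * x)) * (KK * hp (2 * w))"
      unfolding abs_mult using roff_decay[of n x] assms by (intro mult_mono) auto
    also have "\<dots> = 2 * KK * KK * (hp (2 * w) * hp (2 * x))" by simp
    also have "\<dots> \<le> 2 * KK * KK * B"
      unfolding B_def using KK_ge_1 w by (intro mult_left_mono hp_product) auto
    finally show ?thesis .
  qed
  show "\<bar>sn n u * roff m y - roff n x * sn n w\<bar> \<le> 8 * KK * KK * hp (2 * (n - 2))"
    using 1 2 KB unfolding B_def[symmetric] by linarith
qed

text \<open>By Bernoulli's inequality for \<open>1/q > 1\<close>.\<close>

lemma linear_times_decay: "\<exists>M. \<forall>n\<ge>0. real_of_int (n + 1) * hp (2 * (n - 2)) \<le> M"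
proof (intro exI allI impI)
  fix n :: int assume n: "0 \<le> n"
  define r where "r = 1 / q - 1"
  have r: "0 < r" using q_pos q_less_1 by (simp add: r_def)
  have e: "hp (2 * n) = q ^ nat n"
    using n q_pos by (simp add: hp_def powr_realpow[symmetric])
  have "1 + real (nat n) * r \<le> (1 + r) ^ nat n" using r by (intro Bernoulli_inequality) simp
  then have "(1 + real (nat n) * r) * q ^ nat n \<le> (1 + r) ^ nat n * q ^ nat n"
    using q_pos by (intro mult_right_mono) auto
  also have "\<dots> = 1" using q_pos by (simp add: r_def flip: power_mult_distrib)
  finally have "real (nat n) * q ^ nat n * r \<le> 1" using q_pos
    by (simp add: algebra_simps) (smt (verit) zero_le_power)
  then have "real (nat n) * q ^ nat n \<le> 1 / r" using r by (simp add: pos_le_divide_eq)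
  moreover have "q ^ nat n \<le> 1" using q_pos q_less_1 by (simp add: power_le_one)
  ultimately have "real_of_int (n + 1) * hp (2 * n) \<le> 1 / r + 1"
    using n unfolding e by (simp add: distrib_right)
  then have "real_of_int (n + 1) * hp (2 * n) * hp (- 4) \<le> (1 / r + 1) * hp (- 4)"
    using hp_pos[of "- 4"] by (intro mult_right_mono) auto
  then show "real_of_int (n + 1) * hp (2 * (n - 2)) \<le> (1 / r + 1) * hp (- 4)"
    by (simp add: mult.assoc algebra_simps flip: hp_add)
qed

end

section \<open>Spinors\<close>

context L2_completion
begin

text \<open>
  The truth value tells whether the vector is in the \<open>e\<^sub>+\<close>- or in the \<open>e\<^sub>-\<close>-component.
\<close>

definition tensor :: "bool \<times> int \<times> int \<times> int \<Rightarrow> 'h \<times> 'h" where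
  "tensor = (\<lambda>(t, n, i, c). if t then (eps n i c, 0) else (0, eps n i c))"

definition tensor_index :: "(bool \<times> int \<times> int \<times> int) set" where
  "tensor_index = {(t, n, i, c). 0 \<le> i \<and> i \<le> n \<and> 0 \<le> c \<and> c \<le> n}"

lemma tensor_out: "\<not> (0 \<le> i \<and> i \<le> n \<and> 0 \<le> c \<and> c \<le> n) \<Longrightarrow> tensor (t, n, i, c) = 0"
  by (auto simp: tensor_def eps_out zero_prod_def)

lemma tensor_orthonormal: "orthonormal tensor_index tensor"
  by unfold_locales (auto simp: tensor_index_def tensor_def cinner_prod_def eps_inner split: if_splits)

text \<open>
  The eigenvectors of the Dirac operator, with \<open>s\<close> true for the positive part of the spectrum.
  The pair with columns \<open>c\<close> and \<open>c + 1\<close> carries one eigenvector of each sign; at the ends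
  \<open>c = - 1\<close> and \<open>c = n\<close> one of the columns is missing, and the other member of the pair is
  itself an eigenvector, with a negative eigenvalue.
\<close>

definition ket :: "bool \<times> int \<times> int \<times> int \<Rightarrow> 'h \<times> 'h" where
  "ket = (\<lambda>(s, n, i, c). if s
     then cn n (n - c) *\<^sub>R tensor (True, n, i, c) - sn n (n - c) *\<^sub>R tensor (False, n, i, c + 1)
     else sn n (n - c) *\<^sub>R tensor (True, n, i, c) + cn n (n - c) *\<^sub>R tensor (False, n, i, c + 1))"

definition ket_index :: "(bool \<times> int \<times> int \<times> int) set" where
  "ket_index = {(s, n, i, c). 0 \<le> i \<and> i \<le> n \<and> (if s then 0 \<le> c \<and> c \<le> n - 1 else - 1 \<le> c \<and> c \<le> n)}"

text \<open>The eigenvalues of \<open>D + 1/2\<close>.\<close>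

definition ket_ev :: "bool \<times> int \<times> int \<times> int \<Rightarrow> real" where
  "ket_ev = (\<lambda>(s, n, i, c). if s then of_int (n + 1) else - of_int (n + 1))"

lemma tensor_inner:
  assumes "0 \<le> i" "i \<le> n"
  shows "cinner (tensor (t, n, i, c)) (tensor (t', n', i', c')) =
    (if (t, n, i, c) = (t', n', i', c') \<and> 0 \<le> c \<and> c \<le> n then 1 else 0)"
proof (cases "0 \<le> c \<and> c \<le> n")
  case True
  then show ?thesis using assms by (auto simp: tensor_def cinner_prod_def eps_inner)
next
  case False
  then show ?thesis using tensor_out[of i n c t] by auto
qed

lemma ket_orthonormal: "orthonormal ket_index ket"
proof
  fix \<kappa> \<kappa>' assume "\<kappa> \<in> ket_index" "\<kappa>' \<in> ket_index"
  then obtain s n i c s' n' i' c' where k: "\<kappa> = (s, n, i, c)" "\<kappa>' = (s', n', i', c')"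
    and r: "0 \<le> i" "i \<le> n" "0 \<le> i'" "i' \<le> n'" "if s then 0 \<le> c \<and> c \<le> n - 1 else - 1 \<le> c \<and> c \<le> n"
    by (auto simp: ket_index_def)
  have sq: "complex_of_real (sn n (n - c)) * of_real (sn n (n - c)) + of_real (cn n (n - c)) * of_real (cn n (n - c)) = 1"
  proof -
    have "sn n (n - c) * sn n (n - c) + cn n (n - c) * cn n (n - c) = 1"
      using sn_cn[of n "n - c"] r by (auto simp: power2_eq_square split: if_splits)
    then show ?thesis by (simp only: of_real_mult[symmetric] of_real_add[symmetric] of_real_1)
  qed
  \<comment> \<open>At the ends of the weight diagram the coefficient of the missing tensor vanishes.\<close>
  have edge: "sn n (n - c) = 0" if "c = - 1" using that by simp
  have edge': "cn n (n - c) = 0" if "c = n" using that by simp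
  show "cinner (ket \<kappa>) (ket \<kappa>') = (if \<kappa> = \<kappa>' then 1 else 0)"
  proof (cases "(n, i, c) = (n', i', c')")
    case False
    then show ?thesis
      unfolding k ket_def
      by (simp add: cinner_add_left cinner_add_right cinner_diff_left cinner_diff_right
          cinner_scaleR_left cinner_scaleR_right tensor_inner r) auto
  next
    case True
    then have e: "n' = n" "i' = i" "c' = c" by auto
    consider "c = - 1" "\<not> s" | "c = n" "\<not> s" "0 \<le> c" | "0 \<le> c" "c \<le> n - 1" using r by (smt (verit))
    then show ?thesis
    proof cases
      case 1
      then have "complex_of_real (cn n (n + 1)) * of_real (cn n (n + 1)) = 1" using sq by simp
      then show ?thesis using 1 r unfolding k ket_def e
        by (simp add: cinner_add_left cinner_add_right cinner_diff_left cinner_diff_right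
          cinner_scaleR_left cinner_scaleR_right cinner_minus tensor_inner)
    next
      case 2
      then have "complex_of_real (sn n 0) * of_real (sn n 0) = 1" using sq by simp
      then show ?thesis using 2 r unfolding k ket_def e
        by (simp add: cinner_add_left cinner_add_right cinner_diff_left cinner_diff_right
          cinner_scaleR_left cinner_scaleR_right cinner_minus tensor_inner)
    next
      case 3
      then show ?thesis using r sq unfolding k ket_def e
        by (simp add: cinner_add_left cinner_add_right cinner_diff_left cinner_diff_right
          cinner_scaleR_left cinner_scaleR_right tensor_inner algebra_simps)
    qed
  qed
qed

sublocale all_kets: orthonormal ket_index ket
  by (rule ket_orthonormal)

lemma ket_out:
  assumes "0 \<le> i" "i \<le> n" "- 1 \<le> c" "c \<le> n" "(s, n, i, c) \<notin> ket_index"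
  shows "ket (s, n, i, c) = 0"
proof -
  have "s" "c = - 1 \<or> c = n" using assms by (auto simp: ket_index_def split: if_splits)
  then show ?thesis using tensor_out[of i n "- 1" True] tensor_out[of i n "n + 1" False]
    by (auto simp: ket_def)
qed

lemma tensor_ket:
  assumes "0 \<le> n" "- 1 \<le> c" "c \<le> n"
  shows "tensor (True, n, i, c) = sn n (n - c) *\<^sub>R ket (False, n, i, c) + cn n (n - c) *\<^sub>R ket (True, n, i, c)"
    and "tensor (False, n, i, c + 1) = cn n (n - c) *\<^sub>R ket (False, n, i, c) - sn n (n - c) *\<^sub>R ket (True, n, i, c)"
proof -
  define s k where "s = sn n (n - c)" and "k = cn n (n - c)"
  have sq: "s * s + k * k = 1" using sn_cn[of n "n - c"] assms by (simp add: power2_eq_square s_def k_def)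
  have "s *\<^sub>R ket (False, n, i, c) + k *\<^sub>R ket (True, n, i, c) = (s * s + k * k) *\<^sub>R tensor (True, n, i, c)"
    by (simp add: ket_def s_def[symmetric] k_def[symmetric] algebra_simps)
  then show "tensor (True, n, i, c) = sn n (n - c) *\<^sub>R ket (False, n, i, c) + cn n (n - c) *\<^sub>R ket (True, n, i, c)"
    unfolding sq unfolding s_def k_def by simp
  have "k *\<^sub>R ket (False, n, i, c) - s *\<^sub>R ket (True, n, i, c) = (s * s + k * k) *\<^sub>R tensor (False, n, i, c + 1)"
    by (simp add: ket_def s_def[symmetric] k_def[symmetric] algebra_simps)
  then show "tensor (False, n, i, c + 1) = cn n (n - c) *\<^sub>R ket (False, n, i, c) - sn n (n - c) *\<^sub>R ket (True, n, i, c)"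
    unfolding sq unfolding s_def k_def by simp
qed

lemma ket_diag:
  assumes "0 \<le> i" "i \<le> n" "- 1 \<le> c" "c \<le> n"
  shows "(ket (s, n, i, c), ev (s, n, i, c) *\<^sub>R ket (s, n, i, c)) \<in> all_kets.diag ev"
proof (cases "(s, n, i, c) \<in> ket_index")
  case True
  then show ?thesis by (rule all_kets.diag_v)
next
  case False
  then show ?thesis
    using ket_out[OF assms False] complex_vector.subspace_0[OF all_kets.diag_subspace] by (simp add: zero_prod_def)
qed

text \<open>
  The value of \<open>D + 1/2\<close> at \<open>tensor\<close>. The vectors \<open>tensor\<close> rather than the eigenvectors are
  used for the commutators, because on them the algebra acts by plain weighted shifts.
\<close>

definition dirac_tensor :: "bool \<times> int \<times> int \<times> int \<Rightarrow> 'h \<times> 'h" where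
  "dirac_tensor = (\<lambda>(t, n, i, c). of_int (n + 1) *\<^sub>R (if t
     then rdiag n (n - c) *\<^sub>R tensor (True, n, i, c) + roff n (n - c) *\<^sub>R tensor (False, n, i, c + 1)
     else roff n (n - c + 1) *\<^sub>R tensor (True, n, i, c - 1) - rdiag n (n - c + 1) *\<^sub>R tensor (False, n, i, c)))"

lemma scaleR_subspace:
  assumes "complex_vector.subspace (D :: ('x::complex_hilbert) set)" "x \<in> D"
  shows "r *\<^sub>R x \<in> D"
  using complex_vector.subspace_scale[OF assms, of "of_real r"] by (simp add: scaleC_of_real)

lemma tensor_diag: "(tensor (t, n, i, c), dirac_tensor (t, n, i, c)) \<in> all_kets.diag ket_ev"
proof (cases "0 \<le> i \<and> i \<le> n \<and> 0 \<le> c \<and> c \<le> n")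
  case True
  then have n: "0 \<le> n" by simp
  note D = all_kets.diag_subspace[of ket_ev]
  show ?thesis
  proof (cases t)
    case t: True
    define s k where "s = sn n (n - c)" and "k = cn n (n - c)"
    have "s *\<^sub>R (ket (False, n, i, c), ket_ev (False, n, i, c) *\<^sub>R ket (False, n, i, c)) +
        k *\<^sub>R (ket (True, n, i, c), ket_ev (True, n, i, c) *\<^sub>R ket (True, n, i, c)) \<in> all_kets.diag ket_ev"
      using True by (intro complex_vector.subspace_add[OF D] scaleR_subspace[OF D] ket_diag) auto
    moreover have "tensor (t, n, i, c) = s *\<^sub>R ket (False, n, i, c) + k *\<^sub>R ket (True, n, i, c)"
      using tensor_ket(1)[of n c i] True by (simp add: s_def k_def t)
    moreover have "dirac_tensor (t, n, i, c) = s *\<^sub>R ket_ev (False, n, i, c) *\<^sub>R ket (False, n, i, c) +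
        k *\<^sub>R ket_ev (True, n, i, c) *\<^sub>R ket (True, n, i, c)"
      by (simp add: dirac_tensor_def t ket_def ket_ev_def rdiag_def roff_def s_def[symmetric] k_def[symmetric]
          power2_eq_square algebra_simps) (simp add: scaleR_2[symmetric] algebra_simps)
    ultimately show ?thesis by simp
  next
    case t: False
    define s k where "s = sn n (n - (c - 1))" and "k = cn n (n - (c - 1))"
    have "k *\<^sub>R (ket (False, n, i, c - 1), ket_ev (False, n, i, c - 1) *\<^sub>R ket (False, n, i, c - 1)) -
        s *\<^sub>R (ket (True, n, i, c - 1), ket_ev (True, n, i, c - 1) *\<^sub>R ket (True, n, i, c - 1)) \<in> all_kets.diag ket_ev"
      using True by (intro complex_vector.subspace_diff[OF D] scaleR_subspace[OF D] ket_diag) auto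
    moreover have "tensor (t, n, i, c) = k *\<^sub>R ket (False, n, i, c - 1) - s *\<^sub>R ket (True, n, i, c - 1)"
      using tensor_ket(2)[of n "c - 1" i] True by (simp add: s_def k_def t)
    moreover have "dirac_tensor (t, n, i, c) = k *\<^sub>R ket_ev (False, n, i, c - 1) *\<^sub>R ket (False, n, i, c - 1) -
        s *\<^sub>R ket_ev (True, n, i, c - 1) *\<^sub>R ket (True, n, i, c - 1)"
    proof -
      have e: "n - c + 1 = n - (c - 1)" by simp
      have f: "sn n (1 + n - c) = s" "cn n (1 + n - c) = k" by (simp_all add: s_def k_def algebra_simps)
      show ?thesis unfolding dirac_tensor_def prod.case e rdiag_def roff_def s_def[symmetric] k_def[symmetric]
        by (simp add: t ket_def ket_ev_def f
          power2_eq_square algebra_simps) (simp add: scaleR_2[symmetric] algebra_simps)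
    qed
    ultimately show ?thesis by simp
  qed
next
  case False
  have "tensor (t, n, i, c) = 0" using False by (rule tensor_out)
  moreover have "dirac_tensor (t, n, i, c) = 0"
  proof (cases "0 \<le> i \<and> i \<le> n")
    case F: False
    then have "tensor (t', n, i, c') = 0" for t' c' by (intro tensor_out) auto
    then show ?thesis by (simp add: dirac_tensor_def)
  next
    case i: True
    show ?thesis
    proof (cases t)
      case t: True
      show ?thesis
      proof (cases "c = - 1")
        case True
        then show ?thesis using \<open>tensor (t, n, i, c) = 0\<close> t by (simp add: dirac_tensor_def roff_def)
      next
        case F: False
        then have "tensor (False, n, i, c + 1) = 0" using False i by (intro tensor_out) auto
        then show ?thesis using \<open>tensor (t, n, i, c) = 0\<close> t by (simp add: dirac_tensor_def)
      qed
    next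
      case t: False
      show ?thesis
      proof (cases "c = n + 1")
        case True
        then show ?thesis using \<open>tensor (t, n, i, c) = 0\<close> t by (simp add: dirac_tensor_def roff_def)
      next
        case F: False
        then have "tensor (True, n, i, c - 1) = 0" using False i by (intro tensor_out) auto
        then show ?thesis using \<open>tensor (t, n, i, c) = 0\<close> t by (simp add: dirac_tensor_def)
      qed
    qed
  qed
  ultimately show ?thesis
    using complex_vector.subspace_0[OF all_kets.diag_subspace] by (simp add: zero_prod_def)
qed

lemma scaleR_span: "x \<in> complex_vector.span S \<Longrightarrow> r *\<^sub>R x \<in> complex_vector.span S"
  by (intro scaleR_subspace complex_vector.subspace_span)

text \<open>A simple tensor is a combination of the two eigenvectors of its pair.\<close>

lemma tensor_span:
  assumes "\<And>s c'. (s, n, i, c') \<in> ket_index \<Longrightarrow> (if t then c' = c else c' = c - 1) \<Longrightarrow> (s, n, i, c') \<in> coinv_index" 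
  shows "tensor (t, n, i, c) \<in> complex_vector.span (ket ` coinv_index)"
proof (cases "0 \<le> i \<and> i \<le> n \<and> 0 \<le> c \<and> c \<le> n")
  case False
  show ?thesis using tensor_out[OF False] by (simp add: complex_vector.span_zero)
next
  case True
  define c' where "c' = (if t then c else c - 1)"
  have ket: "ket (s, n, i, c') \<in> complex_vector.span (ket ` coinv_index)" for s
  proof (cases "(s, n, i, c') \<in> ket_index")
    case T: True
    then show ?thesis using assms[of s c'] by (intro complex_vector.span_base imageI) (auto simp: c'_def)
  next
    case False
    then have "ket (s, n, i, c') = 0" using True by (intro ket_out) (auto simp: c'_def)
    then show ?thesis by (simp add: complex_vector.span_zero)
  qed
  have "tensor (t, n, i, c) = (if t then sn n (n - c') *\<^sub>R ket (False, n, i, c') + cn n (n - c') *\<^sub>R ket (True, n, i, c')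
      else cn n (n - c') *\<^sub>R ket (False, n, i, c') - sn n (n - c') *\<^sub>R ket (True, n, i, c'))"
    using tensor_ket[of n c' i] True by (auto simp: c'_def)
  then show ?thesis
    using ket by (auto intro!: complex_vector.span_add complex_vector.span_diff scaleR_span)
qed

lemma eta_T_tensor:
  assumes "0 \<le> n"
  shows "(\<eta> (T n i c), 0) = (1 / (hp (2 * i - n) * rt (n + 1))) *\<^sub>R tensor (True, n, i, c)"
    and "(0, \<eta> (T n i c)) = (1 / (hp (2 * i - n) * rt (n + 1))) *\<^sub>R tensor (False, n, i, c)"
  using assms by (simp_all add: tensor_def T_eps)

lemma all_kets_Hs: "all_kets.Hs = UNIV"
proof -
  let ?S = "complex_vector.span (ket ` ket_index)"
  have tensor: "tensor \<kappa> \<in> ?S" for \<kappa> by (cases \<kappa>) (auto intro: tensor_span)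
  have "(\<eta> a, 0) \<in> ?S \<and> (0, \<eta> a) \<in> ?S" if "a \<in> QA" for a
    using that
  proof (rule QA_span_induct)
    show "(\<eta> 0, 0) \<in> ?S \<and> (0, \<eta> 0) \<in> ?S"
      using complex_vector.span_zero[of "ket ` ket_index"] by (simp add: eta_0 zero_prod_def)
    show "(\<eta> (x + y), 0) \<in> ?S \<and> (0, \<eta> (x + y)) \<in> ?S"
      if "x \<in> QA" "y \<in> QA" "(\<eta> x, 0) \<in> ?S \<and> (0, \<eta> x) \<in> ?S" "(\<eta> y, 0) \<in> ?S \<and> (0, \<eta> y) \<in> ?S" for x y
      using that complex_vector.span_add[of "(\<eta> x, 0)" "ket ` ket_index" "(\<eta> y, 0)"]
        complex_vector.span_add[of "(0, \<eta> x)" "ket ` ket_index" "(0, \<eta> y)"] by (simp add: eta_add)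
    show "(\<eta> (fscale c x), 0) \<in> ?S \<and> (0, \<eta> (fscale c x)) \<in> ?S"
      if "x \<in> QA" "(\<eta> x, 0) \<in> ?S \<and> (0, \<eta> x) \<in> ?S" for c x
      using that complex_vector.span_scale[of "(\<eta> x, 0)" "ket ` ket_index" c]
        complex_vector.span_scale[of "(0, \<eta> x)" "ket ` ket_index" c] by (simp add: eta_scale scaleC_prod_def)
    show "(\<eta> (T n i j), 0) \<in> ?S \<and> (0, \<eta> (T n i j)) \<in> ?S" if "0 \<le> i" "i \<le> n" for n i j
      using that tensor eta_T_tensor[of n i j] by (auto intro: scaleR_span)
  qed
  then have "\<eta> ` QA \<times> \<eta> ` QA \<subseteq> ?S"
    using complex_vector.span_add[of "(\<eta> a, 0)" "ket ` ket_index" "(0, \<eta> b)" for a b] by fastforce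
  then have "closure (\<eta> ` QA \<times> \<eta> ` QA) \<subseteq> closure ?S" by (rule closure_mono)
  then show ?thesis unfolding closure_Times eta_dense all_kets.Hs_def by auto
qed

section \<open>The Dirac operator\<close>

lemma sqrt_qnum: "sqrt (qnum q (of_int i)) = rt i"
  by (simp add: rt_def qi_def)

lemma ket_up_ket:
  "ket_up q \<eta> ((of_int n - 1) / 2) (of_int i - of_int n / 2) (of_int c - (of_int n - 1) / 2) = ket (True, n, i, c)"
proof -
  let ?j = "(of_int n - 1) / 2 :: real" and ?m = "of_int i - of_int n / 2 :: real"
    and ?\<mu> = "of_int c - (of_int n - 1) / 2 :: real"
  have t: "tcoef q (?j + 1/2) ?m (?\<mu> - 1/2) = T n i c" "tcoef q (?j + 1/2) ?m (?\<mu> + 1/2) = T n i (c + 1)"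
  proof -
    have "?j + 1/2 = of_int n / 2" "?\<mu> - 1/2 = of_int c - of_int n / 2" "?\<mu> + 1/2 = of_int (c + 1) - of_int n / 2"
      by (simp_all add: field_simps)
    then show "tcoef q (?j + 1/2) ?m (?\<mu> - 1/2) = T n i c" "tcoef q (?j + 1/2) ?m (?\<mu> + 1/2) = T n i (c + 1)"
      by (simp_all only: T_def)
  qed
  have a: "q powr ?m = hp (2 * i - n)" by (simp add: hp_def diff_divide_distrib)
  have arg: "2 * (?j + 1/2) + 1 = of_int (n + 1)" "2 * (?j + 1) = of_int (n + 1)"
    "(?j + 1) - ?\<mu> = of_int (n - c)" "(?j + 1) + ?\<mu> = of_int (c + 1)"
    by (simp_all add: field_simps)
  have d: "q powr (- ((?j + 1) + ?\<mu>) / 2) = hp (- c - 1)" "q powr (((?j + 1) - ?\<mu>) / 2) = hp (n - c)"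
    unfolding arg hp_def by simp_all
  have C: "CGC q (?j + 1) ?\<mu> = cn n (n - c)" "CGS q (?j + 1) ?\<mu> = sn n (n - c)"
    unfolding CGC_def CGS_def d unfolding arg sqrt_qnum by (simp_all add: cn_def sn_def add.commute)
  show ?thesis
    unfolding ket_up_def t a C unfolding arg sqrt_qnum by (simp add: ket_def tensor_def eps_def algebra_simps)
qed

lemma ket_down_ket:
  "ket_down q \<eta> ((of_int n + 1) / 2) (of_int i - of_int n / 2) (of_int c - (of_int n - 1) / 2) = ket (False, n, i, c)"
proof -
  let ?j = "(of_int n + 1) / 2 :: real" and ?m = "of_int i - of_int n / 2 :: real"
    and ?\<mu> = "of_int c - (of_int n - 1) / 2 :: real"
  have t: "tcoef q (?j - 1/2) ?m (?\<mu> - 1/2) = T n i c" "tcoef q (?j - 1/2) ?m (?\<mu> + 1/2) = T n i (c + 1)"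
  proof -
    have "?j - 1/2 = of_int n / 2" "?\<mu> - 1/2 = of_int c - of_int n / 2" "?\<mu> + 1/2 = of_int (c + 1) - of_int n / 2"
      by (simp_all add: field_simps)
    then show "tcoef q (?j - 1/2) ?m (?\<mu> - 1/2) = T n i c" "tcoef q (?j - 1/2) ?m (?\<mu> + 1/2) = T n i (c + 1)"
      by (simp_all only: T_def)
  qed
  have a: "q powr ?m = hp (2 * i - n)" by (simp add: hp_def diff_divide_distrib)
  have arg: "2 * (?j - 1/2) + 1 = of_int (n + 1)" "2 * ?j = of_int (n + 1)"
    "?j - ?\<mu> = of_int (n - c)" "?j + ?\<mu> = of_int (c + 1)"
    by (simp_all add: field_simps)
  have d: "q powr (- (?j + ?\<mu>) / 2) = hp (- c - 1)" "q powr ((?j - ?\<mu>) / 2) = hp (n - c)"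
    unfolding arg hp_def by simp_all
  have C: "CGC q ?j ?\<mu> = cn n (n - c)" "CGS q ?j ?\<mu> = sn n (n - c)"
    unfolding CGC_def CGS_def d unfolding arg sqrt_qnum by (simp_all add: cn_def sn_def add.commute)
  show ?thesis
    unfolding ket_down_def t a C unfolding arg sqrt_qnum by (simp add: ket_def tensor_def eps_def algebra_simps)
qed

lemma weights_cases:
  assumes "m \<in> weights (of_int n / 2)"
  obtains i :: int where "m = of_int i - of_int n / 2" "0 \<le> i" "i \<le> n"
proof -
  obtain k :: nat where k: "m = - (of_int n / 2) + real k" "m \<le> of_int n / 2"
    using assms by (auto simp: weights_def)
  then have "real_of_int (int k) \<le> of_int n" by simp
  then have "int k \<le> n" by linarith
  then show ?thesis using that[of "int k"] k by simp
qed

text \<open>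
  The dictionary between half-integer and integer labels: a positive eigenvector of total spin
  \<open>j\<close> has \<open>n = 2 j + 1\<close>, a negative one has \<open>n = 2 j - 1\<close>.
\<close>

lemma dirac_spec_iff:
  "((\<forall>j\<in>half_nats. \<forall>m\<in>weights (j + 1/2). \<forall>\<mu>\<in>weights j.
        (ket_up q \<eta> j m \<mu>, (2 * j + 3/2) *\<^sub>R ket_up q \<eta> j m \<mu>) \<in> D) \<and>
     (\<forall>j\<in>half_nats. j > 0 \<longrightarrow> (\<forall>m\<in>weights (j - 1/2). \<forall>\<mu>\<in>weights j.
        (ket_down q \<eta> j m \<mu>, - (2 * j + 1/2) *\<^sub>R ket_down q \<eta> j m \<mu>) \<in> D))) \<longleftrightarrow>
   (\<forall>\<kappa>\<in>ket_index. (ket \<kappa>, (ket_ev \<kappa> - 1/2) *\<^sub>R ket \<kappa>) \<in> D)" (is "?up \<and> ?down \<longleftrightarrow> ?ket")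
proof
  assume spec: "?up \<and> ?down"
  show ?ket
  proof
    fix \<kappa> assume "\<kappa> \<in> ket_index"
    then obtain s n i c where k: "\<kappa> = (s, n, i, c)" "0 \<le> i" "i \<le> n"
      "if s then 0 \<le> c \<and> c \<le> n - 1 else - 1 \<le> c \<and> c \<le> n" by (auto simp: ket_index_def)
    have m: "of_int i - of_int n / 2 \<in> weights (of_int n / 2 :: real)" using k weight_iff by blast
    show "(ket \<kappa>, (ket_ev \<kappa> - 1/2) *\<^sub>R ket \<kappa>) \<in> D"
    proof (cases s)
      case True
      then have c: "0 \<le> c" "c \<le> n - 1" using k by auto
      let ?j = "(of_int n - 1) / 2 :: real"
      have j: "?j \<in> half_nats"
        unfolding half_nats_def using c by (intro image_eqI[of _ _ "nat (n - 1)"]) auto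
      have \<mu>: "of_int c - ?j \<in> weights ?j"
        using weight_iff[of c "n - 1"] c by simp
      have "(ket_up q \<eta> ?j (of_int i - of_int n / 2) (of_int c - ?j),
          (2 * ?j + 3/2) *\<^sub>R ket_up q \<eta> ?j (of_int i - of_int n / 2) (of_int c - ?j)) \<in> D"
        using spec j m \<mu> by (auto simp: add_divide_distrib diff_divide_distrib)
      moreover have "2 * ?j + 3/2 = ket_ev \<kappa> - 1/2"
        using True unfolding k(1) ket_ev_def by (simp add: diff_divide_distrib)
      ultimately show ?thesis unfolding ket_up_ket using k True by simp
    next
      case False
      then have c: "- 1 \<le> c" "c \<le> n" using k by auto
      let ?j = "(of_int n + 1) / 2 :: real"
      have j: "?j \<in> half_nats" "0 < ?j"
        unfolding half_nats_def using c k by (auto intro!: image_eqI[of _ _ "nat (n + 1)"])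
      have \<mu>: "of_int c - (of_int n - 1) / 2 \<in> weights ?j"
        using weight_iff[of "c + 1" "n + 1"] c by (simp add: field_simps)
      have "?j - 1/2 = of_int n / 2" by (simp add: field_simps)
      then have "(ket_down q \<eta> ?j (of_int i - of_int n / 2) (of_int c - (of_int n - 1) / 2),
          - (2 * ?j + 1/2) *\<^sub>R ket_down q \<eta> ?j (of_int i - of_int n / 2) (of_int c - (of_int n - 1) / 2)) \<in> D"
        using spec j m \<mu> by metis
      moreover have "- (2 * ?j + 1/2) = ket_ev \<kappa> - 1/2"
        using False unfolding k(1) ket_ev_def by (simp add: add_divide_distrib)
      ultimately show ?thesis unfolding ket_down_ket using k False by simp
    qed
  qed
next
  assume ket: ?ket
  show "?up \<and> ?down"
  proof (intro conjI ballI impI)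
    fix j m \<mu> assume j: "j \<in> half_nats" and m: "m \<in> weights (j + 1/2)" and \<mu>: "\<mu> \<in> weights j"
    obtain N :: nat where N: "j = real N / 2" using j by (auto simp: half_nats_def)
    define n where "n = int N + 1"
    have e: "j + 1/2 = of_int n / 2" "j = of_int (n - 1) / 2" using N by (simp_all add: n_def field_simps)
    obtain i where i: "m = of_int i - of_int n / 2" "0 \<le> i" "i \<le> n"
      by (rule weights_cases[OF m[unfolded e(1)]])
    obtain c where c: "\<mu> = of_int c - of_int (n - 1) / 2" "0 \<le> c" "c \<le> n - 1"
      by (rule weights_cases[OF \<mu>[unfolded e(2)]])
    have "(True, n, i, c) \<in> ket_index" using i c by (simp add: ket_index_def)
    then have "(ket (True, n, i, c), (ket_ev (True, n, i, c) - 1/2) *\<^sub>R ket (True, n, i, c)) \<in> D"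
      using ket by blast
    moreover have "ket_up q \<eta> j m \<mu> = ket (True, n, i, c)"
      using ket_up_ket[of n i c] unfolding i(1) c(1) e(2) by simp
    moreover have "ket_ev (True, n, i, c) - 1/2 = 2 * j + 3/2"
      unfolding ket_ev_def e(2) by (simp add: diff_divide_distrib)
    ultimately show "(ket_up q \<eta> j m \<mu>, (2 * j + 3/2) *\<^sub>R ket_up q \<eta> j m \<mu>) \<in> D" by simp
  next
    fix j m \<mu> assume j: "j \<in> half_nats" "0 < j" and m: "m \<in> weights (j - 1/2)" and \<mu>: "\<mu> \<in> weights j"
    obtain N :: nat where N: "j = real N / 2" using j by (auto simp: half_nats_def)
    define n where "n = int N - 1"
    have e: "j - 1/2 = of_int n / 2" "j = of_int (n + 1) / 2" using N by (simp_all add: n_def field_simps)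
    obtain i where i: "m = of_int i - of_int n / 2" "0 \<le> i" "i \<le> n"
      by (rule weights_cases[OF m[unfolded e(1)]])
    obtain c where c: "\<mu> = of_int c - of_int (n + 1) / 2" "0 \<le> c" "c \<le> n + 1"
      by (rule weights_cases[OF \<mu>[unfolded e(2)]])
    have "(False, n, i, c - 1) \<in> ket_index" using i c by (simp add: ket_index_def)
    then have "(ket (False, n, i, c - 1), (ket_ev (False, n, i, c - 1) - 1/2) *\<^sub>R ket (False, n, i, c - 1)) \<in> D"
      using ket by blast
    moreover have "ket_down q \<eta> j m \<mu> = ket (False, n, i, c - 1)"
    proof -
      have "of_int (c - 1) - (of_int n - 1) / 2 = \<mu>" unfolding c(1) by (simp add: field_simps)
      then show ?thesis using ket_down_ket[of n i "c - 1"] unfolding i(1) e(2) by simp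
    qed
    moreover have "ket_ev (False, n, i, c - 1) - 1/2 = - (2 * j + 1/2)"
      unfolding ket_ev_def e(2) by (simp add: add_divide_distrib)
    ultimately show "(ket_down q \<eta> j m \<mu>, - (2 * j + 1/2) *\<^sub>R ket_down q \<eta> j m \<mu>) \<in> D" by simp
  qed
qed

lemma dirac_diag: "dirac q \<eta> = all_kets.diag (\<lambda>\<kappa>. ket_ev \<kappa> - 1/2)"
  unfolding dirac_def dirac_spec_iff
proof (rule the_equality)
  show "self_adjoint_on UNIV (all_kets.diag (\<lambda>\<kappa>. ket_ev \<kappa> - 1/2)) \<and>
      (\<forall>\<kappa>\<in>ket_index. (ket \<kappa>, (ket_ev \<kappa> - 1/2) *\<^sub>R ket \<kappa>) \<in> all_kets.diag (\<lambda>\<kappa>. ket_ev \<kappa> - 1/2))"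
    using all_kets.diag_self_adjoint[of "\<lambda>\<kappa>. ket_ev \<kappa> - 1/2"] all_kets.diag_v[of _ "\<lambda>\<kappa>. ket_ev \<kappa> - 1/2"]
    unfolding all_kets_Hs by blast
  show "D = all_kets.diag (\<lambda>\<kappa>. ket_ev \<kappa> - 1/2)"
    if "self_adjoint_on UNIV D \<and> (\<forall>\<kappa>\<in>ket_index. (ket \<kappa>, (ket_ev \<kappa> - 1/2) *\<^sub>R ket \<kappa>) \<in> D)" for D
    using that by (intro all_kets.diag_unique) (auto simp: all_kets_Hs)
qed

lemma dirac_shift: "(x, y) \<in> dirac q \<eta> \<longleftrightarrow> (x, y + (1/2) *\<^sub>R x) \<in> all_kets.diag ket_ev"
  unfolding dirac_diag all_kets.diag_def all_kets_Hs
  by (auto simp: cinner_add_right cinner_scaleR_right algebra_simps)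

end

section \<open>Bounded commutators\<close>

lemma scaleC_Pair: "scaleC c (x, y) = (scaleC c x, scaleC c y)"
  by (simp add: scaleC_prod_def)

context quantum_su2
begin

text \<open>
  Consider the operator that moves column \<open>c\<close> of spin \<open>n/2\<close> to column \<open>c + \<gamma>\<close> of spin
  \<open>(n + \<delta>)/2\<close> with coefficient \<open>g n c\<close>, in both spinor components. The condition says that the
  coefficients are at most one and that its commutator with the sign of the Dirac operator has
  entries of order \<open>q\<^sup>n\<close>. The four differences are the entries that start from \<open>e\<^sub>+\<close> (first
  and third) and from \<open>e\<^sub>-\<close> (second and fourth), preserving or exchanging the components.
\<close>

definition almost_commuting :: "int \<Rightarrow> int \<Rightarrow> (int \<Rightarrow> int \<Rightarrow> real) \<Rightarrow> bool" where
  "almost_commuting \<delta> \<gamma> g \<longleftrightarrow> (\<forall>n c. 0 \<le> c \<longrightarrow> c \<le> n \<longrightarrow> 0 \<le> n + \<delta> \<longrightarrow> \<bar>g n c\<bar> \<le> 1 \<and>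
    (0 \<le> c + \<gamma> \<longrightarrow> c + \<gamma> \<le> n + \<delta> \<longrightarrow>
       \<bar>g n c * rdiag (n + \<delta>) (n + \<delta> - (c + \<gamma>)) - rdiag n (n - c) * g n c\<bar> \<le> 8 * KK * KK * hp (2 * (n - 2)) \<and>
       \<bar>g n c * rdiag (n + \<delta>) (n + \<delta> - (c + \<gamma>) + 1) - rdiag n (n - c + 1) * g n c\<bar> \<le> 8 * KK * KK * hp (2 * (n - 2))) \<and>
    (0 \<le> c + \<gamma> + 1 \<longrightarrow> c + \<gamma> + 1 \<le> n + \<delta> \<longrightarrow>
       \<bar>g n c * roff (n + \<delta>) (n + \<delta> - (c + \<gamma>)) - roff n (n - c) * g n (c + 1)\<bar> \<le> 8 * KK * KK * hp (2 * (n - 2))) \<and>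
    (0 \<le> c + \<gamma> - 1 \<longrightarrow> c + \<gamma> - 1 \<le> n + \<delta> \<longrightarrow>
       \<bar>g n c * roff (n + \<delta>) (n + \<delta> - (c + \<gamma>) + 1) - roff n (n - c + 1) * g n (c - 1)\<bar> \<le> 8 * KK * KK * hp (2 * (n - 2))))"

lemma roff_ends [simp]: "roff n 0 = 0" "roff n (n + 1) = 0"
  by (simp_all add: roff_def)

lemma abs_sn_cn_le_1:
  assumes "0 \<le> n" "0 \<le> x" "x \<le> n + 1"
  shows "\<bar>sn n x\<bar> \<le> 1" "\<bar>cn n x\<bar> \<le> 1"
  using sn_le_1[OF assms] cn_le_1[OF assms] sn_nonneg[of n x] cn_nonneg[of n x] assms by auto

lemma almost_commuting_raise:
  assumes "b = 0 \<or> b = 1"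
  shows "almost_commuting 1 b (cgA b)"
  using assms
proof
  assume b: "b = 0"
  show ?thesis
    unfolding almost_commuting_def b cg_sn
  proof (intro allI impI conjI)
    fix n c :: int assume c: "0 \<le> c" "c \<le> n"
    show "\<bar>sn n c\<bar> \<le> 1" using c by (intro abs_sn_cn_le_1) auto
    show "\<bar>sn n c * rdiag (n + 1) (n + 1 - (c + 0)) - rdiag n (n - c) * sn n c\<bar> \<le> 8 * KK * KK * hp (2 * (n - 2))"
      using c by (intro moved_position_bound(1)[where w = c]) auto
    show "\<bar>sn n c * rdiag (n + 1) (n + 1 - (c + 0) + 1) - rdiag n (n - c + 1) * sn n c\<bar> \<le> 8 * KK * KK * hp (2 * (n - 2))"
      using c by (intro moved_position_bound(1)[where w = c]) auto
    show "\<bar>sn n c * roff (n + 1) (n + 1 - (c + 0)) - roff n (n - c) * sn n (c + 1)\<bar> \<le> 8 * KK * KK * hp (2 * (n - 2))"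
      using c by (intro moved_position_bound(2)) auto
    show "\<bar>sn n c * roff (n + 1) (n + 1 - (c + 0) + 1) - roff n (n - c + 1) * sn n (c - 1)\<bar> \<le> 8 * KK * KK * hp (2 * (n - 2))"
      using c by (intro moved_position_bound(2)) auto
  qed
next
  assume b: "b = 1"
  show ?thesis
    unfolding almost_commuting_def b cg_sn
  proof (intro allI impI conjI)
    fix n c :: int assume c: "0 \<le> c" "c \<le> n"
    have e: "n + 1 - (c + 1) = n - c" by simp
    show "\<bar>cn n (c + 1)\<bar> \<le> 1" using c by (intro abs_sn_cn_le_1) auto
    show "\<bar>cn n (c + 1) * rdiag (n + 1) (n + 1 - (c + 1)) - rdiag n (n - c) * cn n (c + 1)\<bar> \<le> 8 * KK * KK * hp (2 * (n - 2))"
      unfolding e using c by (intro same_position_bound(1)[where w = "c + 1"]) auto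
    show "\<bar>cn n (c + 1) * rdiag (n + 1) (n + 1 - (c + 1) + 1) - rdiag n (n - c + 1) * cn n (c + 1)\<bar> \<le> 8 * KK * KK * hp (2 * (n - 2))"
      unfolding e using c by (intro same_position_bound(1)[where w = "c + 1"]) auto
    show "\<bar>cn n (c + 1) * roff (n + 1) (n + 1 - (c + 1)) - roff n (n - c) * cn n (c + 1 + 1)\<bar> \<le> 8 * KK * KK * hp (2 * (n - 2))"
      unfolding e using c by (cases "c = n"; intro same_position_bound(2); auto)
    show "\<bar>cn n (c + 1) * roff (n + 1) (n + 1 - (c + 1) + 1) - roff n (n - c + 1) * cn n (c - 1 + 1)\<bar> \<le> 8 * KK * KK * hp (2 * (n - 2))"
      unfolding e using c by (intro same_position_bound(2)) auto
  qed
qed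

lemma almost_commuting_lower:
  assumes "b = 0 \<or> b = 1"
  shows "almost_commuting (- 1) (b - 1) (cgB b)"
  using assms
proof
  assume b: "b = 0"
  show ?thesis
    unfolding almost_commuting_def b cg_sn
  proof (intro allI impI conjI)
    fix n c :: int assume c: "0 \<le> c" "c \<le> n" and n: "0 \<le> n + - 1"
    have e: "n + - 1 - (c + (0 - 1)) = n - c" by simp
    show "\<bar>cn n c\<bar> \<le> 1" using c by (intro abs_sn_cn_le_1) auto
    show "\<bar>cn n c * rdiag (n + - 1) (n + - 1 - (c + (0 - 1))) - rdiag n (n - c) * cn n c\<bar> \<le> 8 * KK * KK * hp (2 * (n - 2))"
      if "0 \<le> c + (0 - 1)"
      unfolding e using c n that by (intro same_position_bound(1)[where w = c]) auto
    show "\<bar>cn n c * rdiag (n + - 1) (n + - 1 - (c + (0 - 1)) + 1) - rdiag n (n - c + 1) * cn n c\<bar> \<le> 8 * KK * KK * hp (2 * (n - 2))"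
      if "0 \<le> c + (0 - 1)"
      unfolding e using c n that by (intro same_position_bound(1)[where w = c]) auto
    show "\<bar>cn n c * roff (n + - 1) (n + - 1 - (c + (0 - 1))) - roff n (n - c) * cn n (c + 1)\<bar> \<le> 8 * KK * KK * hp (2 * (n - 2))"
      unfolding e using c n by (intro same_position_bound(2)) auto
    show "\<bar>cn n c * roff (n + - 1) (n + - 1 - (c + (0 - 1)) + 1) - roff n (n - c + 1) * cn n (c - 1)\<bar> \<le> 8 * KK * KK * hp (2 * (n - 2))"
      if "0 \<le> c + (0 - 1) - 1"
      unfolding e using c n that by (intro same_position_bound(2)) auto
  qed
next
  assume b: "b = 1"
  have neg: "- s * x - y * - s' = - (s * x - y * s')" for s s' x y :: real by simp
  show ?thesis
    unfolding almost_commuting_def b cg_sn neg abs_minus_cancel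
  proof (intro allI impI conjI)
    fix n c :: int assume c: "0 \<le> c" "c \<le> n" and n: "0 \<le> n + - 1"
    have e: "n + - 1 - (c + (1 - 1)) = n - 1 - c" "n + - 1 - (c + (1 - 1)) + 1 = n - c" by simp_all
    show "\<bar>sn n (c + 1)\<bar> \<le> 1" using c by (intro abs_sn_cn_le_1) auto
    show "\<bar>sn n (c + 1) * rdiag (n + - 1) (n + - 1 - (c + (1 - 1))) - rdiag n (n - c) * sn n (c + 1)\<bar> \<le> 8 * KK * KK * hp (2 * (n - 2))"
      if "c + (1 - 1) \<le> n + - 1"
      using c n that by (intro moved_position_bound(1)[where w = "c + 1"]) auto
    show "\<bar>sn n (c + 1) * rdiag (n + - 1) (n + - 1 - (c + (1 - 1)) + 1) - rdiag n (n - c + 1) * sn n (c + 1)\<bar> \<le> 8 * KK * KK * hp (2 * (n - 2))"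
      if "c + (1 - 1) \<le> n + - 1"
      using c n that by (intro moved_position_bound(1)[where w = "c + 1"]) auto
    show "\<bar>sn n (c + 1) * roff (n + - 1) (n + - 1 - (c + (1 - 1))) - roff n (n - c) * sn n (c + 1 + 1)\<bar> \<le> 8 * KK * KK * hp (2 * (n - 2))"
      if "c + (1 - 1) + 1 \<le> n + - 1"
      using c n that by (intro moved_position_bound(2)) auto
    show "\<bar>sn n (c + 1) * roff (n + - 1) (n + - 1 - (c + (1 - 1)) + 1) - roff n (n - c + 1) * sn n (c - 1 + 1)\<bar> \<le> 8 * KK * KK * hp (2 * (n - 2))"
      if "c + (1 - 1) - 1 \<le> n + - 1"
      using c n that by (intro moved_position_bound(2)) auto
  qed
qed

lemma cg_le_1:
  assumes "a = 0 \<or> a = 1" "0 \<le> i" "i \<le> n"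
  shows "\<bar>cgA a n i\<bar> \<le> 1" "\<bar>cgB a n i\<bar> \<le> 1"
  using assms abs_sn_cn_le_1[of n i] abs_sn_cn_le_1[of n "i + 1"] by (auto simp: cg_sn)

lemma rt_ratio:
  assumes "0 \<le> n"
  shows "\<bar>rt (n + 1) / rt (n + 2)\<bar> \<le> 1" "\<bar>rt (n + 1) / rt n\<bar> \<le> sqrt (hp 2 + hp (- 2))"
proof -
  have "qi (n + 1) \<le> qi (n + 2)" using assms by (intro less_imp_le qi_strict_mono) auto
  then show "\<bar>rt (n + 1) / rt (n + 2)\<bar> \<le> 1"
    using assms rt_pos[of "n + 2"] rt_pos[of "n + 1"] by (simp add: rt_def)
  show "\<bar>rt (n + 1) / rt n\<bar> \<le> sqrt (hp 2 + hp (- 2))"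
  proof (cases "n = 0")
    case False
    then have n: "0 < n" using assms by simp
    have "qi n = hp 2 * qi (n - 1) + hp (- 2 * (n - 1))" using qi_Suc'[of "n - 1"] by simp
    then have "hp (- 2 * (n - 1)) \<le> qi n" using qi_nonneg[of "n - 1"] n by simp
    then have "hp (- 2) * hp (- 2 * (n - 1)) \<le> hp (- 2) * qi n" by (intro mult_left_mono) auto
    then have "qi (n + 1) \<le> (hp 2 + hp (- 2)) * qi n"
      using qi_Suc'[of n] by (simp add: distrib_right flip: hp_add)
    then have "qi (n + 1) / qi n \<le> hp 2 + hp (- 2)" using qi_pos[OF n] by (simp add: pos_divide_le_eq)
    then have "sqrt (qi (n + 1) / qi n) \<le> sqrt (hp 2 + hp (- 2))" by simp
    then show ?thesis using n rt_pos[of "n + 1"] rt_pos[of n] by (simp add: rt_def real_sqrt_divide)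
  qed (simp add: add_nonneg_nonneg)
qed

end

context L2_completion
begin

sublocale tensors: orthonormal tensor_index tensor
  by (rule tensor_orthonormal)

text \<open>
  Under the injective map \<open>\<sigma>\<close> of indices, orthogonal vectors go to orthogonal ones or to zero,
  so only the size of the weights matters.
\<close>

lemma shift_family_bound:
  assumes S: "finite S" "S \<subseteq> tensor_index" and inj: "inj_on \<sigma> S" and M: "0 \<le> M"
    and w: "\<And>\<kappa>. \<kappa> \<in> S \<Longrightarrow> \<sigma> \<kappa> \<in> tensor_index \<Longrightarrow> \<bar>w \<kappa>\<bar> \<le> M"
  shows "norm (\<Sum>\<kappa>\<in>S. scaleC (z \<kappa>) (w \<kappa> *\<^sub>R tensor (\<sigma> \<kappa>))) \<le> M * norm (\<Sum>\<kappa>\<in>S. scaleC (z \<kappa>) (tensor \<kappa>))"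
proof -
  define R where "R = {\<kappa> \<in> S. \<sigma> \<kappa> \<in> tensor_index}"
  have R: "finite R" "R \<subseteq> S" "inj_on \<sigma> R" using S inj by (auto simp: R_def inj_on_def)
  define c where "c \<mu> = (let \<kappa> = the_inv_into R \<sigma> \<mu> in z \<kappa> * of_real (w \<kappa>))" for \<mu>
  have c: "c (\<sigma> \<kappa>) = z \<kappa> * of_real (w \<kappa>)" if "\<kappa> \<in> R" for \<kappa>
    using that R(3) by (simp add: c_def the_inv_into_f_f)
  have "(\<Sum>\<kappa>\<in>S. scaleC (z \<kappa>) (w \<kappa> *\<^sub>R tensor (\<sigma> \<kappa>))) = (\<Sum>\<kappa>\<in>R. scaleC (z \<kappa>) (w \<kappa> *\<^sub>R tensor (\<sigma> \<kappa>)))"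
  proof (rule sum.mono_neutral_right[OF S(1) R(2)], rule ballI)
    fix \<kappa> assume "\<kappa> \<in> S - R"
    then have "\<sigma> \<kappa> \<notin> tensor_index" by (simp add: R_def)
    then have "tensor (\<sigma> \<kappa>) = 0" by (cases "\<sigma> \<kappa>") (auto simp: tensor_index_def intro!: tensor_out)
    then show "scaleC (z \<kappa>) (w \<kappa> *\<^sub>R tensor (\<sigma> \<kappa>)) = 0" by simp
  qed
  also have "\<dots> = (\<Sum>\<kappa>\<in>R. scaleC (c (\<sigma> \<kappa>)) (tensor (\<sigma> \<kappa>)))"
    by (rule sum.cong) (simp_all add: c scaleC_scaleC[symmetric] scaleC_of_real)
  also have "\<dots> = (\<Sum>\<mu>\<in>\<sigma> ` R. scaleC (c \<mu>) (tensor \<mu>))"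
    by (simp add: sum.reindex[OF R(3)])
  finally have eq: "(norm (\<Sum>\<kappa>\<in>S. scaleC (z \<kappa>) (w \<kappa> *\<^sub>R tensor (\<sigma> \<kappa>))))\<^sup>2 = (\<Sum>\<mu>\<in>\<sigma> ` R. (cmod (c \<mu>))\<^sup>2)"
    using R by (subst tensors.norm_comb[symmetric]) (auto simp: R_def)
  also have "\<dots> = (\<Sum>\<kappa>\<in>R. (cmod (c (\<sigma> \<kappa>)))\<^sup>2)" by (simp add: sum.reindex[OF R(3)])
  also have "\<dots> \<le> (\<Sum>\<kappa>\<in>R. (M * cmod (z \<kappa>))\<^sup>2)"
  proof (intro sum_mono power_mono)
    fix \<kappa> assume k: "\<kappa> \<in> R"
    then have "\<bar>w \<kappa>\<bar> \<le> M" using w by (auto simp: R_def)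
    then show "cmod (c (\<sigma> \<kappa>)) \<le> M * cmod (z \<kappa>)"
      using k mult_right_mono[of "\<bar>w \<kappa>\<bar>" M "cmod (z \<kappa>)"] by (simp add: c norm_mult mult.commute)
  qed simp
  also have "\<dots> \<le> (\<Sum>\<kappa>\<in>S. (M * cmod (z \<kappa>))\<^sup>2)"
    using S R by (intro sum_mono2) auto
  also have "\<dots> = (M * norm (\<Sum>\<kappa>\<in>S. scaleC (z \<kappa>) (tensor \<kappa>)))\<^sup>2"
    by (simp add: power_mult_distrib tensors.norm_comb[OF S] sum_distrib_left)
  finally show ?thesis using M by (auto intro: power2_le_imp_le)
qed

text \<open>
  The entries of the commutator of \<open>D + 1/2\<close> with a shift operator: \<open>kdiag\<close> those within a
  spinor component, moved by \<open>sdiag\<close>, and \<open>koff\<close> those that exchange the components, moved by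
  \<open>soff\<close>.
\<close>

definition kdiag :: "int \<Rightarrow> int \<Rightarrow> (int \<Rightarrow> int \<Rightarrow> real) \<Rightarrow> bool \<times> int \<times> int \<times> int \<Rightarrow> real" where
  "kdiag \<delta> \<gamma> g = (\<lambda>(t, n, i, c). if t
     then of_int (n + \<delta> + 1) * (g n c * rdiag (n + \<delta>) (n + \<delta> - (c + \<gamma>))) - of_int (n + 1) * (rdiag n (n - c) * g n c)
     else - (of_int (n + \<delta> + 1) * (g n c * rdiag (n + \<delta>) (n + \<delta> - (c + \<gamma>) + 1)) - of_int (n + 1) * (rdiag n (n - c + 1) * g n c)))"

definition koff :: "int \<Rightarrow> int \<Rightarrow> (int \<Rightarrow> int \<Rightarrow> real) \<Rightarrow> bool \<times> int \<times> int \<times> int \<Rightarrow> real" where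
  "koff \<delta> \<gamma> g = (\<lambda>(t, n, i, c). if t
     then of_int (n + \<delta> + 1) * (g n c * roff (n + \<delta>) (n + \<delta> - (c + \<gamma>))) - of_int (n + 1) * (roff n (n - c) * g n (c + 1))
     else of_int (n + \<delta> + 1) * (g n c * roff (n + \<delta>) (n + \<delta> - (c + \<gamma>) + 1)) - of_int (n + 1) * (roff n (n - c + 1) * g n (c - 1)))"

definition sdiag :: "int \<Rightarrow> int \<Rightarrow> int \<Rightarrow> bool \<times> int \<times> int \<times> int \<Rightarrow> bool \<times> int \<times> int \<times> int" where
  "sdiag \<delta> \<tau> \<gamma> = (\<lambda>(t, n, i, c). (t, n + \<delta>, i + \<tau>, c + \<gamma>))"

definition soff :: "int \<Rightarrow> int \<Rightarrow> int \<Rightarrow> bool \<times> int \<times> int \<times> int \<Rightarrow> bool \<times> int \<times> int \<times> int" where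
  "soff \<delta> \<tau> \<gamma> = (\<lambda>(t, n, i, c). (\<not> t, n + \<delta>, i + \<tau>, if t then c + \<gamma> + 1 else c + \<gamma> - 1))"

lemma shift_inj: "inj_on (sdiag \<delta> \<tau> \<gamma>) S" "inj_on (soff \<delta> \<tau> \<gamma>) S"
  by (auto simp: inj_on_def sdiag_def soff_def)

text \<open>
  The linear growth \<open>N\<close> of the eigenvalues meets only the small difference \<open>p - r\<close>: the
  expression is \<open>\<delta> p + N (p - r)\<close>.
\<close>

lemma coefficient_bound:
  fixes N :: int and p r :: real
  assumes "\<bar>\<delta>\<bar> = 1" "0 \<le> N" "\<bar>p\<bar> \<le> 1" "\<bar>p - r\<bar> \<le> B" "of_int N * B \<le> M"
  shows "\<bar>of_int (N + \<delta>) * p - of_int N * r\<bar> \<le> 1 + M"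
proof -
  have "of_int (N + \<delta>) * p - of_int N * r = of_int \<delta> * p + of_int N * (p - r)"
    by (simp add: algebra_simps)
  also have "\<bar>\<dots>\<bar> \<le> \<bar>of_int \<delta> * p\<bar> + \<bar>of_int N * (p - r)\<bar>" by (rule abs_triangle_ineq)
  also have "\<bar>of_int \<delta> * p\<bar> \<le> 1"
  proof -
    have "\<bar>real_of_int \<delta>\<bar> = 1" using assms(1) by linarith
    then show ?thesis using assms(3) by (simp add: abs_mult)
  qed
  also have "\<bar>of_int N * (p - r)\<bar> \<le> of_int N * B"
    using assms(2,4) by (simp add: abs_mult mult_left_mono)
  finally show ?thesis using assms(5) by simp
qed

lemma almost_commuting_bound:
  assumes ac: "almost_commuting \<delta> \<gamma> g" and \<delta>: "\<bar>\<delta>\<bar> = 1"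
  shows "\<exists>M\<ge>0. \<forall>\<kappa>\<in>tensor_index. (sdiag \<delta> \<tau> \<gamma> \<kappa> \<in> tensor_index \<longrightarrow> \<bar>kdiag \<delta> \<gamma> g \<kappa>\<bar> \<le> M) \<and>
    (soff \<delta> \<tau> \<gamma> \<kappa> \<in> tensor_index \<longrightarrow> \<bar>koff \<delta> \<gamma> g \<kappa>\<bar> \<le> M)"
proof -
  obtain M\<^sub>0 where M\<^sub>0: "\<And>n. 0 \<le> n \<Longrightarrow> real_of_int (n + 1) * hp (2 * (n - 2)) \<le> M\<^sub>0"
    using linear_times_decay by blast
  define M where "M = 8 * KK * KK * M\<^sub>0"
  have B: "real_of_int (n + 1) * (8 * KK * KK * hp (2 * (n - 2))) \<le> M" if "0 \<le> n" for n
    using mult_left_mono[OF M\<^sub>0[OF that], of "8 * KK * KK"] KK_ge_1 by (simp add: M_def mult_ac)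
  have M: "0 \<le> M" using order_trans[OF _ B[of 0]] KK_ge_1 by simp
  have comm: "n + \<delta> + 1 = n + 1 + \<delta>" for n by simp
  show ?thesis
  proof (intro exI[of _ "1 + M"] conjI ballI impI)
    show "0 \<le> 1 + M" using M by simp
    fix \<kappa> assume "\<kappa> \<in> tensor_index"
    then obtain t n i c where k: "\<kappa> = (t, n, i, c)" "0 \<le> i" "i \<le> n" "0 \<le> c" "c \<le> n"
      by (auto simp: tensor_index_def)
    have n: "0 \<le> n" using k by simp
    have p1: "\<bar>g n c * x\<bar> \<le> 1" if "\<bar>g n c\<bar> \<le> 1" "\<bar>x\<bar> \<le> 1" for x
      using mult_mono[OF that] by (simp add: abs_mult)
    { assume "sdiag \<delta> \<tau> \<gamma> \<kappa> \<in> tensor_index"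
      then have r: "0 \<le> n + \<delta>" "0 \<le> c + \<gamma>" "c + \<gamma> \<le> n + \<delta>" by (auto simp: k sdiag_def tensor_index_def)
      note gd = ac[unfolded almost_commuting_def, rule_format, OF k(4,5) r(1)]
      show "\<bar>kdiag \<delta> \<gamma> g \<kappa>\<bar> \<le> 1 + M"
      proof (cases t)
        case True
        show ?thesis
          unfolding k kdiag_def prod.case if_P[OF True] comm
          using gd r n by (intro coefficient_bound[OF \<delta> _ p1 _ B] reflection_le_1) auto
      next
        case False
        show ?thesis
          unfolding k kdiag_def prod.case if_not_P[OF False] comm abs_minus_cancel
          using gd r n by (intro coefficient_bound[OF \<delta> _ p1 _ B] reflection_le_1) auto
      qed }
    { assume "soff \<delta> \<tau> \<gamma> \<kappa> \<in> tensor_index"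
      then have r: "0 \<le> n + \<delta>" "if t then 0 \<le> c + \<gamma> + 1 \<and> c + \<gamma> + 1 \<le> n + \<delta> else 0 \<le> c + \<gamma> - 1 \<and> c + \<gamma> - 1 \<le> n + \<delta>"
        by (auto simp: k soff_def tensor_index_def split: if_splits)
      note gd = ac[unfolded almost_commuting_def, rule_format, OF k(4,5) r(1)]
      show "\<bar>koff \<delta> \<gamma> g \<kappa>\<bar> \<le> 1 + M"
      proof (cases t)
        case True
        show ?thesis
          unfolding k koff_def prod.case if_P[OF True] comm
          using gd r n True by (intro coefficient_bound[OF \<delta> _ p1 _ B] reflection_le_1) auto
      next
        case False
        show ?thesis
          unfolding k koff_def prod.case if_not_P[OF False] comm
          using gd r n False by (intro coefficient_bound[OF \<delta> _ p1 _ B] reflection_le_1) auto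
      qed }
  qed
qed

text \<open>
  The image of the vector \<open>dirac_tensor\<close> under the shift operator with coefficients \<open>u g\<close>. Its
  difference from \<open>dirac_tensor\<close> at the moved index, multiplied by the coefficient, is the
  value of the commutator.
\<close>

definition shifted_dirac :: "int \<Rightarrow> int \<Rightarrow> int \<Rightarrow> real \<Rightarrow> (int \<Rightarrow> int \<Rightarrow> real) \<Rightarrow> bool \<times> int \<times> int \<times> int \<Rightarrow> 'h \<times> 'h" where
  "shifted_dirac \<delta> \<tau> \<gamma> u g = (\<lambda>(t, n, i, c). of_int (n + 1) *\<^sub>R (if t
     then rdiag n (n - c) *\<^sub>R (u * g n c) *\<^sub>R tensor (True, n + \<delta>, i + \<tau>, c + \<gamma>) +
       roff n (n - c) *\<^sub>R (u * g n (c + 1)) *\<^sub>R tensor (False, n + \<delta>, i + \<tau>, c + 1 + \<gamma>)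
     else roff n (n - c + 1) *\<^sub>R (u * g n (c - 1)) *\<^sub>R tensor (True, n + \<delta>, i + \<tau>, c - 1 + \<gamma>) -
       rdiag n (n - c + 1) *\<^sub>R (u * g n c) *\<^sub>R tensor (False, n + \<delta>, i + \<tau>, c + \<gamma>)))"

lemma part_commutator:
  "(u * g n c) *\<^sub>R dirac_tensor (t, n + \<delta>, i + \<tau>, c + \<gamma>) - shifted_dirac \<delta> \<tau> \<gamma> u g (t, n, i, c) =
    (u * kdiag \<delta> \<gamma> g (t, n, i, c)) *\<^sub>R tensor (sdiag \<delta> \<tau> \<gamma> (t, n, i, c)) +
    (u * koff \<delta> \<gamma> g (t, n, i, c)) *\<^sub>R tensor (soff \<delta> \<tau> \<gamma> (t, n, i, c))"
proof -
  have e: "c + 1 + \<gamma> = c + \<gamma> + 1" "c - 1 + \<gamma> = c + \<gamma> - 1" by simp_all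
  have comb: "g' *\<^sub>R N' *\<^sub>R (a' *\<^sub>R X + b' *\<^sub>R Y) - N *\<^sub>R (a *\<^sub>R g' *\<^sub>R X + b *\<^sub>R h *\<^sub>R Y) =
      (N' * (g' * a') - N * (a * g')) *\<^sub>R X + (N' * (g' * b') - N * (b * h)) *\<^sub>R Y"
    for g' N' a' b' N a b h :: real and X Y :: "'h \<times> 'h"
    by (simp add: algebra_simps)
  have comb': "g' *\<^sub>R N' *\<^sub>R (b' *\<^sub>R Y - a' *\<^sub>R X) - N *\<^sub>R (b *\<^sub>R h *\<^sub>R Y - a *\<^sub>R g' *\<^sub>R X) =
      (- (N' * (g' * a') - N * (a * g'))) *\<^sub>R X + (N' * (g' * b') - N * (b * h)) *\<^sub>R Y"
    for g' N' a' b' N a b h :: real and X Y :: "'h \<times> 'h"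
    by (simp add: algebra_simps)
  show ?thesis
  proof (cases t)
    case True
    then show ?thesis
      unfolding dirac_tensor_def shifted_dirac_def kdiag_def koff_def sdiag_def soff_def prod.case e
      by (simp only: if_True comb not_True_eq_False) (simp add: algebra_simps)
  next
    case False
    then show ?thesis
      unfolding dirac_tensor_def shifted_dirac_def kdiag_def koff_def sdiag_def soff_def prod.case e
      by (simp only: if_False comb' not_False_eq_True) (simp add: algebra_simps)
  qed
qed

lemma spinor_rep_add: "a \<in> QA \<Longrightarrow> spinor_rep q \<eta> a (x + y) = spinor_rep q \<eta> a x + spinor_rep q \<eta> a y"
  by (cases x; cases y) (simp add: spinor_rep_def gns_add)

lemma spinor_rep_scaleC: "a \<in> QA \<Longrightarrow> spinor_rep q \<eta> a (scaleC c x) = scaleC c (spinor_rep q \<eta> a x)"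
  by (cases x) (simp add: spinor_rep_def scaleC_prod_def gns_scaleC)

lemma spinor_rep_scaleR: "a \<in> QA \<Longrightarrow> spinor_rep q \<eta> a (r *\<^sub>R x) = r *\<^sub>R spinor_rep q \<eta> a x"
  using spinor_rep_scaleC[of a "of_real r" x] by (simp add: scaleC_of_real)

lemma spinor_rep_diff: "a \<in> QA \<Longrightarrow> spinor_rep q \<eta> a (x - y) = spinor_rep q \<eta> a x - spinor_rep q \<eta> a y"
  using spinor_rep_add[of a "x - y" y] by (simp add: algebra_simps)

lemma spinor_rep_0: "a \<in> QA \<Longrightarrow> spinor_rep q \<eta> a 0 = 0"
  using spinor_rep_scaleR[of a 0 0] by simp

lemma spinor_rep_sum: "a \<in> QA \<Longrightarrow> spinor_rep q \<eta> a (\<Sum>i\<in>S. f i) = (\<Sum>i\<in>S. spinor_rep q \<eta> a (f i))"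
  by (induction S rule: infinite_finite_induct) (simp_all add: spinor_rep_0 spinor_rep_add)

lemma spinor_rep_bounded:
  assumes "a \<in> QA" shows "\<exists>C\<ge>0. \<forall>x. norm (spinor_rep q \<eta> a x) \<le> C * norm x"
proof -
  obtain C where C: "0 \<le> C" "\<And>x. norm (gns q \<eta> a x) \<le> C * norm x" using gns_bounded[OF assms] by blast
  have "norm (spinor_rep q \<eta> a x) \<le> C * norm x" for x
  proof (cases x)
    case (Pair y z)
    have "(norm (spinor_rep q \<eta> a x))\<^sup>2 = (norm (gns q \<eta> a y))\<^sup>2 + (norm (gns q \<eta> a z))\<^sup>2"
      by (simp add: Pair spinor_rep_def norm_prod_def)
    also have "\<dots> \<le> (C * norm y)\<^sup>2 + (C * norm z)\<^sup>2" by (intro add_mono power_mono C) auto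
    also have "\<dots> = (C * norm x)\<^sup>2"
      by (simp add: Pair norm_prod_def power_mult_distrib distrib_left)
    finally show ?thesis using C(1) by (auto intro: power2_le_imp_le)
  qed
  then show ?thesis using C by blast
qed

text \<open>
  The spin and row parts of the matrix entries in \<open>gns_eps\<close>. For the commutators they are mere
  bounded factors.
\<close>

definition cR :: "int \<Rightarrow> int \<Rightarrow> int \<Rightarrow> real" where
  "cR a n i = hp (1 - 2 * a) * (rt (n + 1) / rt (n + 2)) * cgA a n i"

definition cL :: "int \<Rightarrow> int \<Rightarrow> int \<Rightarrow> real" where
  "cL a n i = hp (1 - 2 * a) * (rt (n + 1) / rt n) * cgB a n i"

lemma cR_cL_bound:
  assumes "a = 0 \<or> a = 1" "0 \<le> i" "i \<le> n"
  shows "\<bar>cR a n i\<bar> \<le> hp (- 1)" "\<bar>cL a n i\<bar> \<le> hp (- 1) * sqrt (hp 2 + hp (- 2))"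
proof -
  have h: "\<bar>hp (1 - 2 * a)\<bar> \<le> hp (- 1)" using assms(1) hp_antimono[of "- 1" 1] by auto
  have n: "0 \<le> n" using assms by simp
  have "\<bar>cR a n i\<bar> \<le> hp (- 1) * 1 * 1"
    unfolding cR_def abs_mult[of "_ * _"] abs_mult[of "hp _"]
    using h rt_ratio[OF n] cg_le_1[OF assms] by (intro mult_mono) auto
  then show "\<bar>cR a n i\<bar> \<le> hp (- 1)" by simp
  have "\<bar>cL a n i\<bar> \<le> hp (- 1) * sqrt (hp 2 + hp (- 2)) * 1"
    unfolding cL_def abs_mult[of "_ * _"] abs_mult[of "hp _"]
    using h rt_ratio[OF n] cg_le_1[OF assms] by (intro mult_mono) (auto simp: add_nonneg_nonneg)
  then show "\<bar>cL a n i\<bar> \<le> hp (- 1) * sqrt (hp 2 + hp (- 2))" by simp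
qed

lemma spinor_rep_tensor:
  assumes "a = 0 \<or> a = 1" "b = 0 \<or> b = 1" "0 \<le> n"
  shows "spinor_rep q \<eta> (T 1 a b) (tensor (t, n, i, c)) =
    (cR a n i * cgA b n c) *\<^sub>R tensor (t, n + 1, i + a, c + b) +
    (cL a n i * cgB b n c) *\<^sub>R tensor (t, n + - 1, i + (a - 1), c + (b - 1))"
proof -
  have "gns q \<eta> (T 1 a b) 0 = 0" using gns_scaleC[OF T_QA, of 1 a b 0 0] by simp
  then show ?thesis
    using gns_eps[OF assms, of i c] by (simp add: spinor_rep_def tensor_def cR_def cL_def add_diff_eq)
qed

lemma spinor_rep_dirac_tensor:
  assumes ab: "a = 0 \<or> a = 1" "b = 0 \<or> b = 1" and n: "0 \<le> n"
  shows "spinor_rep q \<eta> (T 1 a b) (dirac_tensor (t, n, i, c)) =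
    shifted_dirac 1 a b (cR a n i) (cgA b) (t, n, i, c) + shifted_dirac (- 1) (a - 1) (b - 1) (cL a n i) (cgB b) (t, n, i, c)"
proof (cases t)
  case True
  then show ?thesis
    unfolding dirac_tensor_def shifted_dirac_def prod.case if_P[OF True] spinor_rep_scaleR[OF T_QA] spinor_rep_add[OF T_QA]
      spinor_rep_tensor[OF ab n] by (simp only: scaleR_add_right add_ac)
next
  case False
  then show ?thesis
    unfolding dirac_tensor_def shifted_dirac_def prod.case if_not_P[OF False] spinor_rep_scaleR[OF T_QA] spinor_rep_diff[OF T_QA]
      spinor_rep_tensor[OF ab n] by (simp only: scaleR_add_right scaleR_diff_right diff_add_eq add_diff_eq diff_diff_eq2 add_ac)
        (simp add: algebra_simps)
qed

text \<open>
  The restriction of the Dirac operator to finite combinations of simple tensors, where its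
  commutators with the algebra can be computed entry by entry.
\<close>

definition core :: "(('h \<times> 'h) \<times> ('h \<times> 'h)) set" where
  "core = complex_vector.span ((\<lambda>\<kappa>. (tensor \<kappa>, dirac_tensor \<kappa>)) ` tensor_index)"

lemma core_subset: "core \<subseteq> all_kets.diag ket_ev"
  unfolding core_def
proof (rule complex_vector.span_minimal)
  show "(\<lambda>\<kappa>. (tensor \<kappa>, dirac_tensor \<kappa>)) ` tensor_index \<subseteq> all_kets.diag ket_ev" using tensor_diag by auto
qed (rule all_kets.diag_subspace)

lemma core_subspace: "complex_vector.subspace core"
  unfolding core_def by (rule complex_vector.subspace_span)

lemma core_tensor: "\<exists>y. (tensor \<kappa>, y) \<in> core"
proof (cases "\<kappa> \<in> tensor_index")
  case True
  then have "(tensor \<kappa>, dirac_tensor \<kappa>) \<in> core" unfolding core_def by (intro complex_vector.span_base) auto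
  then show ?thesis ..
next
  case False
  then have "tensor \<kappa> = 0" by (cases \<kappa>) (auto simp: tensor_index_def intro!: tensor_out)
  then show ?thesis using complex_vector.subspace_0[OF core_subspace] by (auto simp: zero_prod_def)
qed

lemma core_ket:
  assumes "\<kappa> \<in> ket_index" shows "(ket \<kappa>, ket_ev \<kappa> *\<^sub>R ket \<kappa>) \<in> core"
proof -
  obtain s n i c where k: "\<kappa> = (s, n, i, c)" by (cases \<kappa>) auto
  obtain y z where yz: "(tensor (True, n, i, c), y) \<in> core" "(tensor (False, n, i, c + 1), z) \<in> core"
    using core_tensor by blast
  have "\<exists>w. (ket \<kappa>, w) \<in> core"
  proof (cases s)
    case True
    have "cn n (n - c) *\<^sub>R (tensor (True, n, i, c), y) - sn n (n - c) *\<^sub>R (tensor (False, n, i, c + 1), z) \<in> core"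
      using yz by (intro complex_vector.subspace_diff[OF core_subspace] scaleR_subspace[OF core_subspace])
    then show ?thesis
      using True by (intro exI[of _ "cn n (n - c) *\<^sub>R y - sn n (n - c) *\<^sub>R z"]) (simp add: k ket_def)
  next
    case False
    have "sn n (n - c) *\<^sub>R (tensor (True, n, i, c), y) + cn n (n - c) *\<^sub>R (tensor (False, n, i, c + 1), z) \<in> core"
      using yz by (intro complex_vector.subspace_add[OF core_subspace] scaleR_subspace[OF core_subspace])
    then show ?thesis
      using False by (intro exI[of _ "sn n (n - c) *\<^sub>R y + cn n (n - c) *\<^sub>R z"]) (simp add: k ket_def)
  qed
  then obtain w where w: "(ket \<kappa>, w) \<in> core" ..
  then have "(ket \<kappa>, w) \<in> all_kets.diag ket_ev" using core_subset by blast
  then have "w = ket_ev \<kappa> *\<^sub>R ket \<kappa>"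
    using all_kets.diag_v[OF assms, of ket_ev] all_kets.diag_single_valued[of ket_ev] unfolding single_valued_def by blast
  then show ?thesis using w by simp
qed

lemma core_dense: "all_kets.diag ket_ev \<subseteq> closure core"
proof clarify
  fix x1 x2 y1 y2 assume xy: "((x1, x2), (y1, y2)) \<in> all_kets.diag ket_ev"
  define x y where "x = (x1, x2)" and "y = (y1, y2)"
  have xy: "(x, y) \<in> all_kets.diag ket_ev" using xy by (simp add: x_def y_def)
  have "(x, y) \<in> closure core"
    unfolding closure_approachable
  proof (intro allI impI)
    fix e :: real assume "0 < e"
    then have e: "0 < e / 2" by simp
    obtain S where S: "finite S" "S \<subseteq> ket_index" "norm (x - all_kets.proj S x) < e / 2" "norm (y - all_kets.proj S y) < e / 2"
      by (rule all_kets.diag_approx[OF xy e]) (rule that)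
    have "(all_kets.proj S x, all_kets.proj S y) = (\<Sum>\<kappa>\<in>S. scaleC (cinner (ket \<kappa>) x) (ket \<kappa>, ket_ev \<kappa> *\<^sub>R ket \<kappa>))"
    proof -
      have "scaleC (of_real (ket_ev \<kappa>) * c) (ket \<kappa>) = scaleC c (ket_ev \<kappa> *\<^sub>R ket \<kappa>)" for \<kappa> c
        by (simp add: scaleC_scaleC mult.commute flip: scaleC_of_real)
      then have "all_kets.proj S y = (\<Sum>\<kappa>\<in>S. scaleC (cinner (ket \<kappa>) x) (ket_ev \<kappa> *\<^sub>R ket \<kappa>))"
        unfolding all_kets.diag_proj[OF xy S(2)] by (intro sum.cong) auto
      then show ?thesis
        unfolding all_kets.proj_def by (intro prod_eqI) (simp_all add: fst_sum snd_sum scaleC_Pair)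
    qed
    moreover have "\<dots> \<in> core"
      using S(2) core_ket
      by (intro complex_vector.subspace_sum[OF core_subspace] complex_vector.subspace_scale[OF core_subspace]) auto
    ultimately have "(all_kets.proj S x, all_kets.proj S y) \<in> core" by simp
    moreover have "dist (all_kets.proj S x, all_kets.proj S y) (x, y) < e"
    proof -
      have "dist (all_kets.proj S x, all_kets.proj S y) (x, y) \<le> dist (all_kets.proj S x) x + dist (all_kets.proj S y) y"
        unfolding dist_Pair_Pair by (rule sqrt_sum_squares_le_sum) auto
      then show ?thesis using S by (simp add: dist_norm norm_minus_commute)
    qed
    ultimately show "\<exists>z\<in>core. dist z (x, y) < e" by blast
  qed
  then show "((x1, x2), (y1, y2)) \<in> closure core" by (simp add: x_def y_def)
qed

text \<open>
  The commutator is a sum of two weighted shifts, one within the spinor components and one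
  exchanging them.
\<close>

lemma part_family_bound:
  assumes ac: "almost_commuting \<delta> \<gamma> g" and \<delta>: "\<bar>\<delta>\<bar> = 1" and u: "\<And>n i. 0 \<le> i \<Longrightarrow> i \<le> n \<Longrightarrow> \<bar>u n i\<bar> \<le> L"
  shows "\<exists>M\<ge>0. \<forall>S z. finite S \<longrightarrow> S \<subseteq> tensor_index \<longrightarrow>
    norm (\<Sum>(t, n, i, c)\<in>S. scaleC (z (t, n, i, c))
      ((u n i * g n c) *\<^sub>R dirac_tensor (t, n + \<delta>, i + \<tau>, c + \<gamma>) - shifted_dirac \<delta> \<tau> \<gamma> (u n i) g (t, n, i, c)))
    \<le> M * norm (\<Sum>\<kappa>\<in>S. scaleC (z \<kappa>) (tensor \<kappa>))"
proof -
  obtain M where M: "0 \<le> M"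
    "\<And>\<kappa>. \<kappa> \<in> tensor_index \<Longrightarrow> sdiag \<delta> \<tau> \<gamma> \<kappa> \<in> tensor_index \<Longrightarrow> \<bar>kdiag \<delta> \<gamma> g \<kappa>\<bar> \<le> M"
    "\<And>\<kappa>. \<kappa> \<in> tensor_index \<Longrightarrow> soff \<delta> \<tau> \<gamma> \<kappa> \<in> tensor_index \<Longrightarrow> \<bar>koff \<delta> \<gamma> g \<kappa>\<bar> \<le> M"
    using almost_commuting_bound[OF ac \<delta>, of \<tau>] by blast
  have L: "0 \<le> L" using u[of 0 0] by simp
  define U where "U = (\<lambda>(t :: bool, n, i, c :: int). u n i)"
  have U: "\<bar>U \<kappa>\<bar> \<le> L" if "\<kappa> \<in> tensor_index" for \<kappa> using that u by (auto simp: U_def tensor_index_def)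
  have UM: "\<bar>U \<kappa> * x\<bar> \<le> L * M" if "\<kappa> \<in> tensor_index" "\<bar>x\<bar> \<le> M" for \<kappa> x
    unfolding abs_mult using U[OF that(1)] that(2) L by (intro mult_mono) auto
  show ?thesis
  proof (intro exI[of _ "2 * (L * M)"] conjI allI impI)
    show "0 \<le> 2 * (L * M)" using L M by simp
    fix S z assume S: "finite S" "S \<subseteq> tensor_index"
    have eq: "(\<Sum>(t, n, i, c)\<in>S. scaleC (z (t, n, i, c))
        ((u n i * g n c) *\<^sub>R dirac_tensor (t, n + \<delta>, i + \<tau>, c + \<gamma>) - shifted_dirac \<delta> \<tau> \<gamma> (u n i) g (t, n, i, c))) =
      (\<Sum>\<kappa>\<in>S. scaleC (z \<kappa>) ((U \<kappa> * kdiag \<delta> \<gamma> g \<kappa>) *\<^sub>R tensor (sdiag \<delta> \<tau> \<gamma> \<kappa>)) +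
        scaleC (z \<kappa>) ((U \<kappa> * koff \<delta> \<gamma> g \<kappa>) *\<^sub>R tensor (soff \<delta> \<tau> \<gamma> \<kappa>)))"
    proof (rule sum.cong[OF refl])
      fix \<kappa> assume "\<kappa> \<in> S"
      obtain t n i c where k: "\<kappa> = (t, n, i, c)" by (cases \<kappa>) auto
      show "(case \<kappa> of (t, n, i, c) \<Rightarrow> scaleC (z (t, n, i, c))
          ((u n i * g n c) *\<^sub>R dirac_tensor (t, n + \<delta>, i + \<tau>, c + \<gamma>) - shifted_dirac \<delta> \<tau> \<gamma> (u n i) g (t, n, i, c))) =
        scaleC (z \<kappa>) ((U \<kappa> * kdiag \<delta> \<gamma> g \<kappa>) *\<^sub>R tensor (sdiag \<delta> \<tau> \<gamma> \<kappa>)) +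
          scaleC (z \<kappa>) ((U \<kappa> * koff \<delta> \<gamma> g \<kappa>) *\<^sub>R tensor (soff \<delta> \<tau> \<gamma> \<kappa>))"
        unfolding k prod.case part_commutator U_def by (simp add: scaleC_add_right)
    qed
    have "norm (\<Sum>\<kappa>\<in>S. scaleC (z \<kappa>) ((U \<kappa> * kdiag \<delta> \<gamma> g \<kappa>) *\<^sub>R tensor (sdiag \<delta> \<tau> \<gamma> \<kappa>)) +
        scaleC (z \<kappa>) ((U \<kappa> * koff \<delta> \<gamma> g \<kappa>) *\<^sub>R tensor (soff \<delta> \<tau> \<gamma> \<kappa>))) \<le>
        norm (\<Sum>\<kappa>\<in>S. scaleC (z \<kappa>) ((U \<kappa> * kdiag \<delta> \<gamma> g \<kappa>) *\<^sub>R tensor (sdiag \<delta> \<tau> \<gamma> \<kappa>))) +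
        norm (\<Sum>\<kappa>\<in>S. scaleC (z \<kappa>) ((U \<kappa> * koff \<delta> \<gamma> g \<kappa>) *\<^sub>R tensor (soff \<delta> \<tau> \<gamma> \<kappa>)))"
      unfolding sum.distrib by (rule norm_triangle_ineq)
    also have "\<dots> \<le> L * M * norm (\<Sum>\<kappa>\<in>S. scaleC (z \<kappa>) (tensor \<kappa>)) + L * M * norm (\<Sum>\<kappa>\<in>S. scaleC (z \<kappa>) (tensor \<kappa>))"
    proof (rule add_mono)
      have LM: "0 \<le> L * M" using L M by simp
      show "norm (\<Sum>\<kappa>\<in>S. scaleC (z \<kappa>) ((U \<kappa> * kdiag \<delta> \<gamma> g \<kappa>) *\<^sub>R tensor (sdiag \<delta> \<tau> \<gamma> \<kappa>)))
          \<le> L * M * norm (\<Sum>\<kappa>\<in>S. scaleC (z \<kappa>) (tensor \<kappa>))"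
      proof (rule shift_family_bound[OF S shift_inj(1) LM])
        fix \<kappa> assume k: "\<kappa> \<in> S" "sdiag \<delta> \<tau> \<gamma> \<kappa> \<in> tensor_index"
        then have "\<kappa> \<in> tensor_index" using S by blast
        then show "\<bar>U \<kappa> * kdiag \<delta> \<gamma> g \<kappa>\<bar> \<le> L * M" using k M(2) by (intro UM)
      qed
      show "norm (\<Sum>\<kappa>\<in>S. scaleC (z \<kappa>) ((U \<kappa> * koff \<delta> \<gamma> g \<kappa>) *\<^sub>R tensor (soff \<delta> \<tau> \<gamma> \<kappa>)))
          \<le> L * M * norm (\<Sum>\<kappa>\<in>S. scaleC (z \<kappa>) (tensor \<kappa>))"
      proof (rule shift_family_bound[OF S shift_inj(2) LM])
        fix \<kappa> assume k: "\<kappa> \<in> S" "soff \<delta> \<tau> \<gamma> \<kappa> \<in> tensor_index"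
        then have "\<kappa> \<in> tensor_index" using S by blast
        then show "\<bar>U \<kappa> * koff \<delta> \<gamma> g \<kappa>\<bar> \<le> L * M" using k M(3) by (intro UM)
      qed
    qed
    finally show "norm (\<Sum>(t, n, i, c)\<in>S. scaleC (z (t, n, i, c))
      ((u n i * g n c) *\<^sub>R dirac_tensor (t, n + \<delta>, i + \<tau>, c + \<gamma>) - shifted_dirac \<delta> \<tau> \<gamma> (u n i) g (t, n, i, c)))
      \<le> 2 * (L * M) * norm (\<Sum>\<kappa>\<in>S. scaleC (z \<kappa>) (tensor \<kappa>))"
      unfolding eq by simp
  qed
qed

text \<open>
  A generator is a sum of two shift operators, one that raises and one that lowers the spin;
  for each the commutator is bounded on the core.
\<close>

lemma T1_commutator:
  assumes ab: "a = 0 \<or> a = 1" "b = 0 \<or> b = 1"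
  shows "bounded_commutator (all_kets.diag ket_ev) (spinor_rep q \<eta> (T 1 a b))"
proof -
  have d: "\<bar>1 :: int\<bar> = 1" "\<bar>- 1 :: int\<bar> = 1" by simp_all
  obtain M where M: "0 \<le> M" "\<And>S z. finite S \<Longrightarrow> S \<subseteq> tensor_index \<Longrightarrow>
    norm (\<Sum>(t, n, i, c)\<in>S. scaleC (z (t, n, i, c))
      ((cR a n i * cgA b n c) *\<^sub>R dirac_tensor (t, n + 1, i + a, c + b) - shifted_dirac 1 a b (cR a n i) (cgA b) (t, n, i, c)))
    \<le> M * norm (\<Sum>\<kappa>\<in>S. scaleC (z \<kappa>) (tensor \<kappa>))"
    using part_family_bound[where u = "cR a" and \<tau> = a, OF almost_commuting_raise[OF ab(2)] d(1) cR_cL_bound(1)[OF ab(1)]]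
    by blast
  obtain M' where M': "0 \<le> M'" "\<And>S z. finite S \<Longrightarrow> S \<subseteq> tensor_index \<Longrightarrow>
    norm (\<Sum>(t, n, i, c)\<in>S. scaleC (z (t, n, i, c))
      ((cL a n i * cgB b n c) *\<^sub>R dirac_tensor (t, n + - 1, i + (a - 1), c + (b - 1)) -
        shifted_dirac (- 1) (a - 1) (b - 1) (cL a n i) (cgB b) (t, n, i, c)))
    \<le> M' * norm (\<Sum>\<kappa>\<in>S. scaleC (z \<kappa>) (tensor \<kappa>))"
    using part_family_bound[where u = "cL a" and \<tau> = "a - 1", OF almost_commuting_lower[OF ab(2)] d(2) cR_cL_bound(2)[OF ab(1)]]
    by blast
  obtain B where B: "\<And>x. norm (spinor_rep q \<eta> (T 1 a b) x) \<le> B * norm x"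
    using spinor_rep_bounded[OF T_QA] by blast
  show ?thesis
  proof (rule bounded_commutator_core[OF all_kets.diag_subspace all_kets.diag_single_valued all_kets.diag_closed
        core_subset core_subspace core_dense spinor_rep_add[OF T_QA] B])
    fix x y assume "(x, y) \<in> core"
    then obtain S z where S: "finite S" "S \<subseteq> tensor_index" "(x, y) = (\<Sum>\<kappa>\<in>S. scaleC (z \<kappa>) (tensor \<kappa>, dirac_tensor \<kappa>))"
      unfolding core_def by (rule span_eq_comb) (rule that)
    have xy: "x = (\<Sum>\<kappa>\<in>S. scaleC (z \<kappa>) (tensor \<kappa>))" "y = (\<Sum>\<kappa>\<in>S. scaleC (z \<kappa>) (dirac_tensor \<kappa>))"
      using arg_cong[OF S(3), of fst] arg_cong[OF S(3), of snd] by (simp_all add: fst_sum snd_sum scaleC_Pair)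
    define Z where "Z = (\<lambda>(t, n, i, c). (cR a n i * cgA b n c) *\<^sub>R dirac_tensor (t, n + 1, i + a, c + b) +
      (cL a n i * cgB b n c) *\<^sub>R dirac_tensor (t, n + - 1, i + (a - 1), c + (b - 1)))"
    note D = all_kets.diag_subspace[of ket_ev]
    have Z: "(spinor_rep q \<eta> (T 1 a b) (tensor \<kappa>), Z \<kappa>) \<in> all_kets.diag ket_ev" if k: "\<kappa> \<in> tensor_index" for \<kappa>
    proof -
      obtain t n i c where k: "\<kappa> = (t, n, i, c)" "0 \<le> n" using k by (auto simp: tensor_index_def)
      have "(cR a n i * cgA b n c) *\<^sub>R (tensor (t, n + 1, i + a, c + b), dirac_tensor (t, n + 1, i + a, c + b)) +
        (cL a n i * cgB b n c) *\<^sub>R (tensor (t, n + - 1, i + (a - 1), c + (b - 1)), dirac_tensor (t, n + - 1, i + (a - 1), c + (b - 1)))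
        \<in> all_kets.diag ket_ev"
        by (intro complex_vector.subspace_add[OF D] scaleR_subspace[OF D] tensor_diag)
      then show ?thesis unfolding k(1) spinor_rep_tensor[OF ab k(2)] Z_def by simp
    qed
    define w where "w = (\<Sum>\<kappa>\<in>S. scaleC (z \<kappa>) (Z \<kappa>))"
    have "(spinor_rep q \<eta> (T 1 a b) x, w) = (\<Sum>\<kappa>\<in>S. scaleC (z \<kappa>) (spinor_rep q \<eta> (T 1 a b) (tensor \<kappa>), Z \<kappa>))"
      by (rule prod_eqI) (simp_all add: xy w_def spinor_rep_sum spinor_rep_scaleC T_QA fst_sum snd_sum scaleC_Pair)
    also have "\<dots> \<in> all_kets.diag ket_ev"
      using S Z by (intro complex_vector.subspace_sum[OF D] complex_vector.subspace_scale[OF D]) auto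
    finally have in_D: "(spinor_rep q \<eta> (T 1 a b) x, w) \<in> all_kets.diag ket_ev" .
    let ?X = "\<Sum>(t, n, i, c)\<in>S. scaleC (z (t, n, i, c))
        ((cR a n i * cgA b n c) *\<^sub>R dirac_tensor (t, n + 1, i + a, c + b) - shifted_dirac 1 a b (cR a n i) (cgA b) (t, n, i, c))"
    let ?Y = "\<Sum>(t, n, i, c)\<in>S. scaleC (z (t, n, i, c))
        ((cL a n i * cgB b n c) *\<^sub>R dirac_tensor (t, n + - 1, i + (a - 1), c + (b - 1)) -
          shifted_dirac (- 1) (a - 1) (b - 1) (cL a n i) (cgB b) (t, n, i, c))"
    have "w - spinor_rep q \<eta> (T 1 a b) y = (\<Sum>\<kappa>\<in>S. scaleC (z \<kappa>) (Z \<kappa> - spinor_rep q \<eta> (T 1 a b) (dirac_tensor \<kappa>)))"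
      by (simp add: xy w_def spinor_rep_sum spinor_rep_scaleC T_QA sum_subtractf complex_vector.scale_right_diff_distrib)
    also have "\<dots> = ?X + ?Y"
      unfolding sum.distrib[symmetric]
    proof (rule sum.cong[OF refl])
      fix \<kappa> assume "\<kappa> \<in> S"
      then obtain t n i c where k: "\<kappa> = (t, n, i, c)" "0 \<le> n" using S by (auto simp: tensor_index_def)
      show "scaleC (z \<kappa>) (Z \<kappa> - spinor_rep q \<eta> (T 1 a b) (dirac_tensor \<kappa>)) =
        (case \<kappa> of (t, n, i, c) \<Rightarrow> scaleC (z (t, n, i, c))
          ((cR a n i * cgA b n c) *\<^sub>R dirac_tensor (t, n + 1, i + a, c + b) - shifted_dirac 1 a b (cR a n i) (cgA b) (t, n, i, c))) +
        (case \<kappa> of (t, n, i, c) \<Rightarrow> scaleC (z (t, n, i, c))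
          ((cL a n i * cgB b n c) *\<^sub>R dirac_tensor (t, n + - 1, i + (a - 1), c + (b - 1)) -
            shifted_dirac (- 1) (a - 1) (b - 1) (cL a n i) (cgB b) (t, n, i, c)))"
        unfolding k(1) prod.case spinor_rep_dirac_tensor[OF ab k(2)] Z_def scaleC_add_right[symmetric]
        by (simp only: add_diff_add)
    qed
    finally have eq: "w - spinor_rep q \<eta> (T 1 a b) y = ?X + ?Y" .
    have "norm ?X \<le> M * norm x" "norm ?Y \<le> M' * norm x"
      unfolding xy(1) by (rule M(2)[OF S(1,2)], rule M'(2)[OF S(1,2)])
    then have "norm (w - spinor_rep q \<eta> (T 1 a b) y) \<le> M * norm x + M' * norm x"
      unfolding eq by (rule norm_triangle_mono)
    then show "\<exists>w. (spinor_rep q \<eta> (T 1 a b) x, w) \<in> all_kets.diag ket_ev \<and>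
        norm (w - spinor_rep q \<eta> (T 1 a b) y) \<le> (M + M') * norm x"
      using in_D by (intro exI[of _ w]) (simp add: distrib_right)
  qed
qed

lemma spinor_rep_algebra:
  assumes "a \<in> QA"
  shows "b \<in> QA \<Longrightarrow> spinor_rep q \<eta> (a + b) x = spinor_rep q \<eta> a x + spinor_rep q \<eta> b x"
    and "spinor_rep q \<eta> (fscale c a) x = scaleC c (spinor_rep q \<eta> a x)"
    and "b \<in> QA \<Longrightarrow> spinor_rep q \<eta> (fmult a b) x = spinor_rep q \<eta> a (spinor_rep q \<eta> b x)"
    and "spinor_rep q \<eta> counit x = x"
    and "cinner (spinor_rep q \<eta> (fstar q a) x) y = cinner x (spinor_rep q \<eta> a y)"
  using assms by (cases x; cases y; simp add: spinor_rep_def gns_algebra gns_counit gns_adjoint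
      scaleC_prod_def cinner_prod_def)+

lemma spinor_commutator:
  assumes "a \<in> QA"
  shows "bounded_commutator (all_kets.diag ket_ev) (spinor_rep q \<eta> a)"
  using assms
proof (rule QA_induct)
  have "spinor_rep q \<eta> 0 = (\<lambda>x. scaleC 0 (spinor_rep q \<eta> counit x))"
    using spinor_rep_algebra(2)[OF counit_QA, of 0] by (auto simp: fun_eq_iff)
  moreover have id: "bounded_commutator (all_kets.diag ket_ev) (spinor_rep q \<eta> counit)"
    unfolding bounded_commutator_def using spinor_rep_algebra(4)[OF counit_QA] by (intro exI[of _ 0]) auto
  ultimately show "bounded_commutator (all_kets.diag ket_ev) (spinor_rep q \<eta> 0)"
    using bounded_commutator_scale[OF id all_kets.diag_subspace, of 0] by simp
  show "bounded_commutator (all_kets.diag ket_ev) (spinor_rep q \<eta> counit)" by (rule id)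
  show "bounded_commutator (all_kets.diag ket_ev) (spinor_rep q \<eta> (x + y))"
    if xy: "x \<in> QA" "y \<in> QA" "bounded_commutator (all_kets.diag ket_ev) (spinor_rep q \<eta> x)"
      "bounded_commutator (all_kets.diag ket_ev) (spinor_rep q \<eta> y)" for x y
  proof -
    have "spinor_rep q \<eta> (x + y) = (\<lambda>z. spinor_rep q \<eta> x z + spinor_rep q \<eta> y z)"
      using spinor_rep_algebra(1)[OF xy(1,2)] by (rule ext)
    then show ?thesis using bounded_commutator_add[OF xy(3,4) all_kets.diag_subspace] by simp
  qed
  show "bounded_commutator (all_kets.diag ket_ev) (spinor_rep q \<eta> (fscale c x))"
    if x: "x \<in> QA" "bounded_commutator (all_kets.diag ket_ev) (spinor_rep q \<eta> x)" for c x
  proof -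
    have "spinor_rep q \<eta> (fscale c x) = (\<lambda>z. scaleC c (spinor_rep q \<eta> x z))"
      using spinor_rep_algebra(2)[OF x(1)] by (rule ext)
    then show ?thesis using bounded_commutator_scale[OF x(2) all_kets.diag_subspace] by simp
  qed
  show "bounded_commutator (all_kets.diag ket_ev) (spinor_rep q \<eta> (fmult (T 1 a b) x))"
    if ab: "a = 0 \<or> a = 1" "b = 0 \<or> b = 1" and x: "x \<in> QA" "bounded_commutator (all_kets.diag ket_ev) (spinor_rep q \<eta> x)" for a b x
  proof -
    obtain B where B: "0 \<le> B" "\<And>z. norm (spinor_rep q \<eta> (T 1 a b) z) \<le> B * norm z"
      using spinor_rep_bounded[OF T_QA] by blast
    obtain B' where B': "\<And>z. norm (spinor_rep q \<eta> x z) \<le> B' * norm z"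
      using spinor_rep_bounded[OF x(1)] by blast
    have "spinor_rep q \<eta> (fmult (T 1 a b) x) = (\<lambda>z. spinor_rep q \<eta> (T 1 a b) (spinor_rep q \<eta> x z))"
      using spinor_rep_algebra(3)[OF T_QA x(1)] by (rule ext)
    then show ?thesis
      using bounded_commutator_compose[OF T1_commutator[OF ab] x(2) spinor_rep_diff[OF T_QA] B(2) B' B(1)] by simp
  qed
qed

end

section \<open>The coinvariant spinors\<close>

context L2_completion
begin

text \<open>
  The Haar state is faithful, since the matrix coefficients are orthogonal and of positive
  length.
\<close>

lemma eta_eq_0:
  assumes "a \<in> QA" "\<eta> a = 0"
  shows "a = 0"
proof -
  have "a \<in> functional.span (Tk ` ix)" using assms(1) by (simp add: QA_span)
  then obtain t r where t: "finite t" "t \<subseteq> Tk ` ix" "a = (\<Sum>x\<in>t. fscale (r x) x)"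
    unfolding functional.span_explicit by blast
  have tQA: "x \<in> QA" if "x \<in> t" for x using that t(2) unfolding QA_span by (auto intro: functional.span_base)
  have "r x = 0" if x: "x \<in> t" for x
  proof -
    obtain n i j where k: "x = T n i j" "0 \<le> i" "i \<le> n" "0 \<le> j" "j \<le> n"
      using x t(2) by (auto simp: Tk_def ix_def)
    have sum: "IP x (\<Sum>y\<in>s. fscale (r y) y) = (\<Sum>y\<in>s. r y * IP x y)" if "s \<subseteq> t" for s
      using finite_subset[OF that t(1)] that
    proof (induction s rule: finite_induct)
      case empty
      have "IP x 0 = 0" by (simp add: IP_def haar_0)
      then show ?case by simp
    next
      case (insert y s)
      have "IP x (fscale (r y) y + (\<Sum>y\<in>s. fscale (r y) y)) = r y * IP x y + IP x (\<Sum>y\<in>s. fscale (r y) y)"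
        using insert.prems tQA[OF x] tQA by (subst IP_add_right) (auto intro!: QA_sum QA_scale simp: IP_scale_right)
      then show ?case using insert by simp
    qed
    have off: "IP x y = (if y = x then of_real (nrm n i) else 0)" if y: "y \<in> t" for y
    proof -
      obtain n' i' j' where k': "y = T n' i' j'" "0 \<le> i'" "i' \<le> n'" "0 \<le> j'" "j' \<le> n'"
        using y t(2) by (auto simp: Tk_def ix_def)
      have "y = x \<longleftrightarrow> (n', i', j') = (n, i, j)"
        using inj_onD[OF Tk_inj, of "(n', i', j')" "(n, i, j)"] k k' by (auto simp: Tk_def ix_def)
      then show ?thesis using IP_T[of i n j n' i' j'] k k' by simp
    qed
    have "0 = cinner (\<eta> x) (\<eta> a)" using assms(2) by simp
    also have "\<dots> = IP x a" by (rule eta_inner[OF tQA[OF x] assms(1)])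
    also have "\<dots> = (\<Sum>y\<in>t. r y * IP x y)" unfolding t(3) by (rule sum) simp
    also have "\<dots> = (\<Sum>y\<in>t. if y = x then r x * of_real (nrm n i) else 0)"
      by (rule sum.cong) (auto simp: off)
    also have "\<dots> = r x * of_real (nrm n i)" using x t(1) by simp
    finally show ?thesis using nrm_pos[of n i] k by simp
  qed
  then show ?thesis unfolding t(3) by (intro sum.neutral) simp
qed

lemma eta_inject:
  assumes "a \<in> QA" "b \<in> QA" "\<eta> a = \<eta> b"
  shows "a = b"
proof -
  have "a + fscale (- 1) b = 0"
    using assms eta_diff[OF assms(1,2)] by (intro eta_eq_0 QA_add QA_scale) (simp_all del: functional.scale_minus_left)
  then show ?thesis by (auto simp: fun_eq_iff pointwise)
qed

end

locale projective_spectral = weighted_projective q k l + L2_completion q \<eta>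
  for q :: real and k l :: nat and \<eta> :: "functional \<Rightarrow> 'h::complex_hilbert"
begin

text \<open>
  The common degree of both components of \<open>ket\<close> under the coaction on spinors.
\<close>

definition ket_deg :: "bool \<times> int \<times> int \<times> int \<Rightarrow> int" where
  "ket_deg = (\<lambda>(s, n, i, c). (int l - int k) * i - (int k + int l) * c + int k * (n - 1))"

definition coinv_index :: "(bool \<times> int \<times> int \<times> int) set" where
  "coinv_index = {\<kappa> \<in> ket_index. ket_deg \<kappa> = 0}"

lemma ket_deg_iff: "ket_deg (s, n, i, c) = 0 \<longleftrightarrow> deg n i c = int k" "ket_deg (s, n, i, c) = 0 \<longleftrightarrow> deg n i (c + 1) = - int l"
  by (auto simp: ket_deg_def deg_def algebra_simps)

lemma coinv_index_subset: "coinv_index \<subseteq> ket_index" by (auto simp: coinv_index_def)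

sublocale coinv_kets: orthonormal coinv_index ket
  using all_kets.orthonormal_subfamily[OF coinv_index_subset] .

lemma ket_ev_abs: "\<kappa> \<in> ket_index \<Longrightarrow> \<bar>ket_ev \<kappa>\<bar> = of_int (fst (snd \<kappa>) + 1)"
  by (auto simp: ket_index_def ket_ev_def)

sublocale coinv_kets: discrete_diagonal coinv_index ket ket_ev
proof
  show "1 \<le> \<bar>ket_ev \<kappa>\<bar>" if "\<kappa> \<in> coinv_index" for \<kappa>
    using that ket_ev_abs[of \<kappa>] by (auto simp: coinv_index_def ket_index_def)
  fix r :: real
  have "{\<kappa> \<in> coinv_index. \<bar>ket_ev \<kappa>\<bar> \<le> r} \<subseteq> UNIV \<times> {0..\<lfloor>r\<rfloor>} \<times> {0..\<lfloor>r\<rfloor>} \<times> {- 1..\<lfloor>r\<rfloor>}"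
  proof
    fix \<kappa> assume "\<kappa> \<in> {\<kappa> \<in> coinv_index. \<bar>ket_ev \<kappa>\<bar> \<le> r}"
    then have k: "\<kappa> \<in> ket_index" "\<bar>ket_ev \<kappa>\<bar> \<le> r" by (auto simp: coinv_index_def)
    obtain s n i c where e: "\<kappa> = (s, n, i, c)" by (cases \<kappa>) auto
    have "of_int (n + 1) \<le> r" using k ket_ev_abs[of \<kappa>] e by simp
    then have "n + 1 \<le> \<lfloor>r\<rfloor>" by (simp add: le_floor_iff)
    then show "\<kappa> \<in> UNIV \<times> {0..\<lfloor>r\<rfloor>} \<times> {0..\<lfloor>r\<rfloor>} \<times> {- 1..\<lfloor>r\<rfloor>}"
      using k(1) by (auto simp: e ket_index_def split: if_splits)
  qed
  then show "finite {\<kappa> \<in> coinv_index. \<bar>ket_ev \<kappa>\<bar> \<le> r}" by (rule finite_subset) auto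
qed

definition coinv_image :: "('h \<times> 'h) set" where
  "coinv_image = map_prod \<eta> \<eta> ` (U (int k) \<times> U (- int l))"

lemma coinv_image_subspace: "complex_vector.subspace coinv_image"
  unfolding complex_vector.subspace_def
proof (intro conjI ballI allI)
  have "map_prod \<eta> \<eta> (0, 0) \<in> coinv_image" unfolding coinv_image_def by (intro imageI) (simp add: U_0)
  then show "0 \<in> coinv_image" by (simp add: eta_0 zero_prod_def)
  show "x + y \<in> coinv_image" if xy: "x \<in> coinv_image" "y \<in> coinv_image" for x y
  proof -
    obtain a b a' b' where ab: "x = (\<eta> a, \<eta> b)" "y = (\<eta> a', \<eta> b')"
      "a \<in> U (int k)" "b \<in> U (- int l)" "a' \<in> U (int k)" "b' \<in> U (- int l)"
      using xy by (auto simp: coinv_image_def)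
    then have "map_prod \<eta> \<eta> (a + a', b + b') \<in> coinv_image"
      unfolding coinv_image_def by (intro imageI) (simp add: U_add)
    then show ?thesis using ab U_QA by (simp add: eta_add)
  qed
  show "scaleC c x \<in> coinv_image" if x: "x \<in> coinv_image" for c x
  proof -
    obtain a b where ab: "x = (\<eta> a, \<eta> b)" "a \<in> U (int k)" "b \<in> U (- int l)"
      using x by (auto simp: coinv_image_def)
    then have "map_prod \<eta> \<eta> (fscale c a, fscale c b) \<in> coinv_image"
      unfolding coinv_image_def by (intro imageI) (simp add: U_scale)
    then show ?thesis using ab U_QA by (simp add: eta_scale scaleC_prod_def)
  qed
qed

text \<open>
  A coinvariant simple tensor is a combination of the two eigenvectors of its pair, and all of
  these have degree zero; conversely both components of an eigenvector of degree zero are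
  coinvariant.
\<close>

lemma coinv_image_span: "coinv_image = complex_vector.span (ket ` coinv_index)"
proof
  let ?S = "complex_vector.span (ket ` coinv_index)"
  have T: "(\<eta> (T n i c), 0) \<in> ?S" if d: "deg n i c = int k" for n i c
  proof (cases "0 \<le> n")
    case True
    have "tensor (True, n, i, c) \<in> ?S"
      using d by (intro tensor_span) (auto simp: coinv_index_def ket_deg_iff(1))
    then show ?thesis unfolding eta_T_tensor(1)[OF True] by (rule scaleR_span)
  next
    case False
    then have "T n i c = 0" by (intro T_out) auto
    then show ?thesis using complex_vector.span_zero[of "ket ` coinv_index"] by (simp add: eta_0 zero_prod_def)
  qed
  have T': "(0, \<eta> (T n i c)) \<in> ?S" if d: "deg n i c = - int l" for n i c
  proof (cases "0 \<le> n")
    case True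
    have "tensor (False, n, i, c) \<in> ?S"
      using d by (intro tensor_span) (auto simp: coinv_index_def ket_deg_iff(2))
    then show ?thesis unfolding eta_T_tensor(2)[OF True] by (rule scaleR_span)
  next
    case False
    then have "T n i c = 0" by (intro T_out) auto
    then show ?thesis using complex_vector.span_zero[of "ket ` coinv_index"] by (simp add: eta_0 zero_prod_def)
  qed
  have 1: "a \<in> QA \<and> (\<eta> a, 0) \<in> ?S" if "a \<in> U (int k)" for a
    using that
  proof (rule U_induct)
    show "0 \<in> QA \<and> (\<eta> 0, 0) \<in> ?S"
      using complex_vector.span_zero[of "ket ` coinv_index"] by (simp add: QA_0 eta_0 zero_prod_def)
    show "x + y \<in> QA \<and> (\<eta> (x + y), 0) \<in> ?S" if "x \<in> QA \<and> (\<eta> x, 0) \<in> ?S" "y \<in> QA \<and> (\<eta> y, 0) \<in> ?S" for x y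
      using that complex_vector.span_add[of "(\<eta> x, 0)" "ket ` coinv_index" "(\<eta> y, 0)"] by (simp add: QA_add eta_add)
    show "fscale c x \<in> QA \<and> (\<eta> (fscale c x), 0) \<in> ?S" if "x \<in> QA \<and> (\<eta> x, 0) \<in> ?S" for c x
      using that complex_vector.span_scale[of "(\<eta> x, 0)" "ket ` coinv_index" c] by (simp add: QA_scale eta_scale scaleC_prod_def)
  qed (use T T_QA in blast)
  have 2: "b \<in> QA \<and> (0, \<eta> b) \<in> ?S" if "b \<in> U (- int l)" for b
    using that
  proof (rule U_induct)
    show "0 \<in> QA \<and> (0, \<eta> 0) \<in> ?S"
      using complex_vector.span_zero[of "ket ` coinv_index"] by (simp add: QA_0 eta_0 zero_prod_def)
    show "x + y \<in> QA \<and> (0, \<eta> (x + y)) \<in> ?S" if "x \<in> QA \<and> (0, \<eta> x) \<in> ?S" "y \<in> QA \<and> (0, \<eta> y) \<in> ?S" for x y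
      using that complex_vector.span_add[of "(0, \<eta> x)" "ket ` coinv_index" "(0, \<eta> y)"] by (simp add: QA_add eta_add)
    show "fscale c x \<in> QA \<and> (0, \<eta> (fscale c x)) \<in> ?S" if "x \<in> QA \<and> (0, \<eta> x) \<in> ?S" for c x
      using that complex_vector.span_scale[of "(0, \<eta> x)" "ket ` coinv_index" c] by (simp add: QA_scale eta_scale scaleC_prod_def)
  qed (use T' T_QA in blast)
  show "coinv_image \<subseteq> ?S"
  proof
    fix x assume "x \<in> coinv_image"
    then obtain a b where ab: "x = (\<eta> a, \<eta> b)" "a \<in> U (int k)" "b \<in> U (- int l)"
      by (auto simp: coinv_image_def)
    have "(\<eta> a, 0) + (0, \<eta> b) \<in> ?S"
      using 1[OF ab(2)] 2[OF ab(3)] by (intro complex_vector.span_add) auto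
    then show "x \<in> ?S" by (simp add: ab)
  qed
  show "?S \<subseteq> coinv_image"
  proof (rule complex_vector.span_minimal[OF _ coinv_image_subspace], rule subsetI)
    fix x assume "x \<in> ket ` coinv_index"
    then obtain s n i c where x: "x = ket (s, n, i, c)" "ket_deg (s, n, i, c) = 0" by (auto simp: coinv_index_def)
    have e: "(eps n i c, 0) \<in> coinv_image" "(0, eps n i (c + 1)) \<in> coinv_image"
    proof -
      have "T n i c \<in> U (int k)" "T n i (c + 1) \<in> U (- int l)"
        using x(2) ket_deg_iff T_U by blast+
      then have "map_prod \<eta> \<eta> (T n i c, 0) \<in> coinv_image" "map_prod \<eta> \<eta> (0, T n i (c + 1)) \<in> coinv_image"
        unfolding coinv_image_def by (intro imageI; simp add: U_0)+
      then have "(hp (2 * i - n) * rt (n + 1)) *\<^sub>R (\<eta> (T n i c), 0) \<in> coinv_image"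
        "(hp (2 * i - n) * rt (n + 1)) *\<^sub>R (0, \<eta> (T n i (c + 1))) \<in> coinv_image"
        by (auto intro!: scaleR_subspace[OF coinv_image_subspace] simp: eta_0 simp del: scaleR_Pair)
      then show "(eps n i c, 0) \<in> coinv_image" "(0, eps n i (c + 1)) \<in> coinv_image" by (simp_all add: eps_def)
    qed
    then have E: "tensor (True, n, i, c) \<in> coinv_image" "tensor (False, n, i, c + 1) \<in> coinv_image" by (simp_all add: tensor_def)
    show "x \<in> coinv_image"
      unfolding x ket_def
      using E by (auto intro!: complex_vector.subspace_add[OF coinv_image_subspace]
          complex_vector.subspace_diff[OF coinv_image_subspace] scaleR_subspace[OF coinv_image_subspace])
  qed
qed

lemma H_theta_eq: "H_theta q k l \<eta> = coinv_kets.Hs"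
  unfolding H_theta_def coinv_kets.Hs_def coinvariant_spinors_eq coinv_image_def[symmetric] coinv_image_span ..

lemma coinv_image_Hs: "coinv_image \<subseteq> coinv_kets.Hs"
  unfolding coinv_image_span coinv_kets.Hs_def by (rule closure_subset)

text \<open>
  The restriction stays within the subspace: coefficients that vanish for \<open>x\<close> vanish for the
  image of \<open>x\<close>.
\<close>

lemma diag_restrict: "(x, y) \<in> coinv_kets.diag ket_ev \<longleftrightarrow> (x, y) \<in> all_kets.diag ket_ev \<and> x \<in> coinv_kets.Hs"
proof -
  have Q: "z \<in> coinv_kets.Hs \<longleftrightarrow> (\<forall>\<kappa>\<in>ket_index - coinv_index. cinner (ket \<kappa>) z = 0)" for z
    using all_kets.Hs_subfamily[OF coinv_index_subset] unfolding coinv_kets.Hs_def all_kets_Hs by auto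
  have split: "(\<forall>\<kappa>\<in>ket_index. R \<kappa>) \<longleftrightarrow> (\<forall>\<kappa>\<in>coinv_index. R \<kappa>) \<and> (\<forall>\<kappa>\<in>ket_index - coinv_index. R \<kappa>)" for R
    using coinv_index_subset by blast
  show ?thesis
    unfolding coinv_kets.diag_def all_kets.diag_def all_kets_Hs split mem_Collect_eq prod.case Q by auto
qed

lemma dirac_theta_diag: "dirac_theta q k l \<eta> = coinv_kets.diag ket_ev"
proof (intro equalityI subrelI)
  fix x z assume "(x, z) \<in> dirac_theta q k l \<eta>"
  then obtain y where "z = y + (1/2) *\<^sub>R x" "(x, y) \<in> dirac q \<eta>" "x \<in> coinv_kets.Hs"
    by (auto simp: dirac_theta_def H_theta_eq)
  then show "(x, z) \<in> coinv_kets.diag ket_ev" unfolding diag_restrict using dirac_shift by blast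
next
  fix x z assume "(x, z) \<in> coinv_kets.diag ket_ev"
  then have z: "(x, z) \<in> all_kets.diag ket_ev" "x \<in> coinv_kets.Hs" by (simp_all add: diag_restrict)
  have "(x, z - (1/2) *\<^sub>R x) \<in> dirac q \<eta>" unfolding dirac_shift using z(1) by simp
  moreover have "z = (z - (1/2) *\<^sub>R x) + (1/2) *\<^sub>R x" by simp
  ultimately show "(x, z) \<in> dirac_theta q k l \<eta>"
    unfolding dirac_theta_def H_theta_eq mem_Collect_eq using z(2) by blast
qed

section \<open>The spectral triple\<close>

lemma spinor_rep_coinv:
  assumes a: "a \<in> U 0" and x: "x \<in> coinv_kets.Hs"
  shows "spinor_rep q \<eta> a x \<in> coinv_kets.Hs"
proof -
  have aQ: "a \<in> QA" using a by (rule U_QA)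
  have cont: "continuous_on (closure coinv_image) (spinor_rep q \<eta> a)"
  proof -
    have "spinor_rep q \<eta> a = (\<lambda>z. (gns q \<eta> a (fst z), gns q \<eta> a (snd z)))"
      by (auto simp: spinor_rep_def)
    then show ?thesis using aQ by (simp only:) (intro continuous_intros)
  qed
  have "spinor_rep q \<eta> a ` coinv_image \<subseteq> coinv_image"
  proof
    fix y assume "y \<in> spinor_rep q \<eta> a ` coinv_image"
    then obtain b c where bc: "b \<in> U (int k)" "c \<in> U (- int l)" "y = spinor_rep q \<eta> a (\<eta> b, \<eta> c)"
      by (auto simp: coinv_image_def)
    have "y = map_prod \<eta> \<eta> (fmult a b, fmult a c)"
      using bc aQ U_QA by (simp add: spinor_rep_def gns_eta)
    then show "y \<in> coinv_image"
      unfolding coinv_image_def using U_mult[OF a bc(1)] U_mult[OF a bc(2)] by auto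
  qed
  then have "spinor_rep q \<eta> a ` coinv_image \<subseteq> closure coinv_image" using closure_subset by blast
  from image_closure_subset[OF cont closed_closure this]
  show ?thesis using x unfolding coinv_kets.Hs_def coinv_image_span[symmetric] by blast
qed

text \<open>
  The coinvariant spinor with components \<open>T 1 0 0\<close> and \<open>T 1 0 1\<close> separates the algebra: the
  quantum determinant recovers \<open>a\<close> from its products with the two components.
\<close>

lemma U0_left_cancel:
  assumes a: "a \<in> U 0" "b \<in> U 0" and eq: "\<forall>x\<in>coinv_kets.Hs. spinor_rep q \<eta> a x = spinor_rep q \<eta> b x"
  shows "a = b"
proof -
  have Q: "a \<in> QA" "b \<in> QA" using a U_QA by auto
  have "T 1 0 0 \<in> U (int k)" "T 1 0 1 \<in> U (- int l)" by (auto intro!: T_U simp: deg_def)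
  then have "map_prod \<eta> \<eta> (T 1 0 0, T 1 0 1) \<in> coinv_image" unfolding coinv_image_def by (intro imageI) simp
  then have "spinor_rep q \<eta> a (\<eta> (T 1 0 0), \<eta> (T 1 0 1)) = spinor_rep q \<eta> b (\<eta> (T 1 0 0), \<eta> (T 1 0 1))"
    using eq coinv_image_Hs by auto
  then have "\<eta> (fmult a (T 1 0 0)) = \<eta> (fmult b (T 1 0 0))" "\<eta> (fmult a (T 1 0 1)) = \<eta> (fmult b (T 1 0 1))"
    using Q T_QA by (simp_all add: spinor_rep_def gns_eta)
  then have e: "fmult a (T 1 0 0) = fmult b (T 1 0 0)" "fmult a (T 1 0 1) = fmult b (T 1 0 1)"
    using Q T_QA by (auto intro!: eta_inject QA_mult)
  have unit: "x = fmult (fmult x (T 1 0 0)) (T 1 1 1) + fscale (of_real (- q)) (fmult (fmult x (T 1 0 1)) (T 1 1 0))" for x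
  proof -
    have "fmult x (fmult (T 1 0 0) (T 1 1 1) + fscale (of_real (- q)) (fmult (T 1 0 1) (T 1 1 0))) = x"
      unfolding T1_determinant by simp
    then show ?thesis by (simp only: fmult_add_right fmult_scale_right fmult_assoc)
  qed
  show ?thesis using unit[of a] unit[of b] unfolding e by simp
qed

lemma WPq_simps:
  "carrier (WPq q k l) = U 0" "monoid.mult (WPq q k l) = fmult" "one (WPq q k l) = counit"
  "add (WPq q k l) = (+)" "smult (WPq q k l) = fscale" "star (WPq q k l) = fstar q"
  by (simp_all add: WPq_eq)

lemma coinv_rep_faithful: "faithful_star_rep (WPq q k l) coinv_kets.Hs (spinor_rep q \<eta>)"
  unfolding faithful_star_rep_def WPq_simps
proof (intro conjI ballI allI impI)
  show "bounded_operator_on coinv_kets.Hs (spinor_rep q \<eta> a)" if a: "a \<in> U 0" for a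
    unfolding bounded_operator_on_def
    using spinor_rep_coinv[OF a] spinor_rep_add[OF U_QA[OF a]] spinor_rep_scaleC[OF U_QA[OF a]]
      spinor_rep_bounded[OF U_QA[OF a]] by blast
  show "spinor_rep q \<eta> counit x = x" for x by (rule spinor_rep_algebra(4)[OF counit_QA])
  show "spinor_rep q \<eta> (a + b) x = spinor_rep q \<eta> a x + spinor_rep q \<eta> b x" if "a \<in> U 0" "b \<in> U 0" for a b x
    using that U_QA by (intro spinor_rep_algebra(1)) auto
  show "spinor_rep q \<eta> (fscale c a) x = scaleC c (spinor_rep q \<eta> a x)" if "a \<in> U 0" for a c x
    using that U_QA by (intro spinor_rep_algebra(2)) auto
  show "spinor_rep q \<eta> (fmult a b) x = spinor_rep q \<eta> a (spinor_rep q \<eta> b x)" if "a \<in> U 0" "b \<in> U 0" for a b x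
    using that U_QA by (intro spinor_rep_algebra(3)) auto
  show "cinner (spinor_rep q \<eta> (fstar q a) x) y = cinner x (spinor_rep q \<eta> a y)" if "a \<in> U 0" for a x y
    using that U_QA by (intro spinor_rep_algebra(5)) auto
  show "a = b" if "a \<in> U 0" "b \<in> U 0" "\<forall>x\<in>coinv_kets.Hs. spinor_rep q \<eta> a x = spinor_rep q \<eta> b x" for a b
    using that by (rule U0_left_cancel)
qed

lemma coinv_commutator:
  assumes a: "a \<in> U 0" shows "bounded_commutator (coinv_kets.diag ket_ev) (spinor_rep q \<eta> a)"
proof -
  obtain C where C: "\<forall>(x, y)\<in>all_kets.diag ket_ev. \<exists>z. (spinor_rep q \<eta> a x, z) \<in> all_kets.diag ket_ev \<and>
      norm (z - spinor_rep q \<eta> a y) \<le> C * norm x"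
    using spinor_commutator[OF U_QA[OF a]] unfolding bounded_commutator_def by blast
  show ?thesis
    unfolding bounded_commutator_def
  proof (intro exI[of _ C] ballI, rule prod.case_eq_if[THEN iffD2])
    fix p assume p: "p \<in> coinv_kets.diag ket_ev"
    obtain x y where xy: "p = (x, y)" by (cases p) auto
    have D: "(x, y) \<in> all_kets.diag ket_ev" "x \<in> coinv_kets.Hs" using p by (simp_all add: xy diag_restrict)
    then obtain z where z: "(spinor_rep q \<eta> a x, z) \<in> all_kets.diag ket_ev" "norm (z - spinor_rep q \<eta> a y) \<le> C * norm x"
      using C by blast
    have "(spinor_rep q \<eta> a x, z) \<in> coinv_kets.diag ket_ev"
      unfolding diag_restrict using z(1) spinor_rep_coinv[OF a D(2)] by blast
    then show "\<exists>z. (spinor_rep q \<eta> a (fst p), z) \<in> coinv_kets.diag ket_ev \<and>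
        norm (z - spinor_rep q \<eta> a (snd p)) \<le> C * norm (fst p)"
      using z(2) by (intro exI[of _ z]) (simp add: xy)
  qed
qed

lemma coinv_spectral_triple: "odd_spectral_triple (WPq q k l) (spinor_rep q \<eta>) coinv_kets.Hs (coinv_kets.diag ket_ev)"
  unfolding odd_spectral_triple_def WPq_simps
  using WPq_star_algebra coinv_kets.Hs_closed_csubspace coinv_rep_faithful coinv_kets.diag_self_adjoint
    coinv_kets.diag_compact_resolvent coinv_commutator by blast

section \<open>Counting eigenvalues\<close>

definition ev_mult :: "real \<Rightarrow> nat" where "ev_mult e = card {\<kappa> \<in> coinv_index. ket_ev \<kappa> = e}"

text \<open>
  The eigenvalue fixes sign and spin; then the row determines the column, as the degree
  vanishes.
\<close>

lemma ev_mult_upper: "real (ev_mult e) \<le> \<bar>e\<bar>"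
proof (cases "\<exists>\<kappa>\<in>coinv_index. ket_ev \<kappa> = e")
  case False
  then have "{\<kappa> \<in> coinv_index. ket_ev \<kappa> = e} = {}" by auto
  then have "ev_mult e = 0" unfolding ev_mult_def by (simp only: card.empty)
  then show ?thesis by simp
next
  case True
  then obtain \<kappa>\<^sub>0 where k0: "\<kappa>\<^sub>0 \<in> coinv_index" "ket_ev \<kappa>\<^sub>0 = e" by blast
  obtain s n i\<^sub>0 c\<^sub>0 where e0: "\<kappa>\<^sub>0 = (s, n, i\<^sub>0, c\<^sub>0)" by (cases \<kappa>\<^sub>0) auto
  have n: "0 \<le> n" using k0 by (auto simp: e0 coinv_index_def ket_index_def)
  have e: "e = (if s then of_int (n + 1) else - of_int (n + 1))" using k0 by (simp add: e0 ket_ev_def)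
  have same: "s' = s \<and> n' = n" if "(s', n', i, c) \<in> coinv_index" "ket_ev (s', n', i, c) = e" for s' n' i c
  proof -
    have "0 \<le> n'" using that(1) by (auto simp: coinv_index_def ket_index_def)
    moreover have "(if s' then real_of_int (n' + 1) else - of_int (n' + 1)) = (if s then of_int (n + 1) else - of_int (n + 1))"
      using that(2) unfolding e by (simp add: ket_ev_def)
    ultimately show ?thesis using n by (auto split: if_splits)
  qed
  have inj: "inj_on (\<lambda>(s, n, i, c). i) {\<kappa> \<in> coinv_index. ket_ev \<kappa> = e}"
  proof (rule inj_onI)
    fix \<kappa> \<kappa>' assume a: "\<kappa> \<in> {\<kappa> \<in> coinv_index. ket_ev \<kappa> = e}" "\<kappa>' \<in> {\<kappa> \<in> coinv_index. ket_ev \<kappa> = e}"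
      "(\<lambda>(s, n, i, c). i) \<kappa> = (\<lambda>(s, n, i, c). i) \<kappa>'"
    then obtain i c c' where k: "\<kappa> = (s, n, i, c)" "\<kappa>' = (s, n, i, c')"
      using same by (cases \<kappa>; cases \<kappa>') auto
    have "ket_deg (s, n, i, c) = ket_deg (s, n, i, c')" using a by (auto simp: coinv_index_def k)
    then have "(int k + int l) * c = (int k + int l) * c'" by (simp add: ket_deg_def)
    then show "\<kappa> = \<kappa>'" using k_pos k by auto
  qed
  have "card {\<kappa> \<in> coinv_index. ket_ev \<kappa> = e} \<le> card {0..n}"
  proof (rule card_inj_on_le[OF inj])
    show "(\<lambda>(s, n, i, c). i) ` {\<kappa> \<in> coinv_index. ket_ev \<kappa> = e} \<subseteq> {0..n}"
      using same by (fastforce simp: coinv_index_def ket_index_def)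
  qed simp
  then have "real (ev_mult e) \<le> real (nat (n + 1))" by (simp add: ev_mult_def)
  also have "\<dots> = \<bar>e\<bar>" using n e by auto
  finally show ?thesis .
qed

text \<open>
  For \<open>n = 2 p - 1\<close> the degree of the positive eigenvectors vanishes at the row and column
  \<open>p - 1\<close>, and the solutions propagate along the direction \<open>(k + l, l - k)\<close>. The points with
  parameter \<open>t\<close> up to \<open>(p - 1) div (k + l)\<close> stay in range.
\<close>

lemma ev_mult_lower:
  assumes p: "1 \<le> p"
  shows "2 * real p \<in> ket_ev ` coinv_index" "real p / real (k + l) \<le> real (ev_mult (2 * real p))"
proof -
  define f where "f t = (True, 2 * int p - 1, int p - 1 + (int k + int l) * int t, int p - 1 + (int l - int k) * int t)" for t :: nat
  define M where "M = (p - 1) div (k + l)"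
  have f: "f t \<in> coinv_index \<and> ket_ev (f t) = 2 * real p" if t: "t \<le> M" for t
  proof -
    have "(k + l) * t \<le> (k + l) * M" using t by simp
    also have "\<dots> \<le> p - 1" unfolding M_def by (rule times_div_less_eq_dividend)
    finally have b: "(int k + int l) * int t \<le> int p - 1"
      using p by (simp flip: of_nat_add of_nat_mult) 
    have nn: "0 \<le> int k * int t" "0 \<le> int l * int t" by simp_all
    have "ket_deg (f t) = 0" by (simp add: ket_deg_def f_def algebra_simps)
    moreover have "f t \<in> ket_index"
    proof -
      define x y where "x = int k * int t" and "y = int l * int t"
      have e: "(int k + int l) * int t = x + y" "(int l - int k) * int t = y - x"
        by (simp_all add: x_def y_def algebra_simps)
      have "0 \<le> x" "0 \<le> y" "x + y \<le> int p - 1" using nn b e by (simp_all add: x_def y_def)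
      then show ?thesis unfolding f_def ket_index_def e using p by simp
    qed
    ultimately show ?thesis using p by (simp add: coinv_index_def f_def ket_ev_def)
  qed
  show "2 * real p \<in> ket_ev ` coinv_index" using f[of 0] by (metis image_eqI zero_le)
  have inj: "inj_on f {..M}" using k_pos by (auto simp: inj_on_def f_def)
  have fin: "finite {\<kappa> \<in> coinv_index. ket_ev \<kappa> = 2 * real p}"
    using coinv_kets.discrete[of "2 * real p"] by (rule finite_subset[rotated]) auto
  have "card (f ` {..M}) \<le> card {\<kappa> \<in> coinv_index. ket_ev \<kappa> = 2 * real p}"
    using f by (intro card_mono[OF fin]) auto
  then have M: "M + 1 \<le> ev_mult (2 * real p)" by (simp add: ev_mult_def card_image[OF inj])
  have "p \<le> (k + l) * (M + 1)"
  proof -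
    have "p - 1 < (k + l) * ((p - 1) div (k + l) + 1)"
      using k_pos dividend_less_times_div[of "k + l" "p - 1"] by simp
    then show ?thesis using p by (simp add: M_def)
  qed
  then have "real p \<le> real ((M + 1) * (k + l))" unfolding of_nat_le_iff by (simp only: mult.commute)
  moreover have "0 < real (k + l)" using k_pos by simp
  ultimately have "real p / real (k + l) \<le> real (M + 1)"
    by (simp only: of_nat_mult pos_divide_le_eq)
  then show "real p / real (k + l) \<le> real (ev_mult (2 * real p))" using M by linarith
qed

definition eigenvalue_sum :: "real \<Rightarrow> real" where
  "eigenvalue_sum \<Lambda> = (\<Sum>e | e \<in> ket_ev ` coinv_index \<and> \<bar>e\<bar> \<le> \<Lambda>. real (ev_mult e) / e\<^sup>2)"

lemma harm_upper: "1 \<le> n \<Longrightarrow> harm n \<le> 1 + ln (real n)"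
  using decseqD[OF decseq_harm_diff_ln, of 0 "n - 1"] by (simp add: harm_expand)

lemma eigenvalues_finite: "finite {e. e \<in> ket_ev ` coinv_index \<and> \<bar>e\<bar> \<le> \<Lambda>}"
proof -
  have "{e. e \<in> ket_ev ` coinv_index \<and> \<bar>e\<bar> \<le> \<Lambda>} \<subseteq> ket_ev ` {\<kappa> \<in> coinv_index. \<bar>ket_ev \<kappa>\<bar> \<le> \<Lambda>}" by auto
  then show ?thesis using coinv_kets.discrete[of \<Lambda>] finite_surj by blast
qed

lemma eigenvalue_sum_upper:
  assumes "1 \<le> \<Lambda>" shows "eigenvalue_sum \<Lambda> \<le> 2 * (1 + ln \<Lambda>)"
proof -
  define n where "n = nat \<lfloor>\<Lambda>\<rfloor>"
  have n: "1 \<le> n" "real n \<le> \<Lambda>" using assms by (auto simp: n_def le_nat_iff le_floor_iff)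
  \<comment> \<open>All eigenvalues are nonzero integers.\<close>
  define A B where "A = real ` {1..n}" and "B = (\<lambda>d. - real d) ` {1..n}"
  have "{e. e \<in> ket_ev ` coinv_index \<and> \<bar>e\<bar> \<le> \<Lambda>} \<subseteq> A \<union> B"
  proof
    fix e assume "e \<in> {e. e \<in> ket_ev ` coinv_index \<and> \<bar>e\<bar> \<le> \<Lambda>}"
    then obtain \<kappa> where k: "\<kappa> \<in> coinv_index" "e = ket_ev \<kappa>" "\<bar>e\<bar> \<le> \<Lambda>" by auto
    obtain s m i c where e: "\<kappa> = (s, m, i, c)" by (cases \<kappa>) auto
    have m: "0 \<le> m" using k by (auto simp: e coinv_index_def ket_index_def)
    define d where "d = nat (m + 1)"
    have d: "real d = of_int (m + 1)" "1 \<le> d" using m by (auto simp: d_def)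
    have "real d \<le> \<Lambda>" using k m by (auto simp: e ket_ev_def d split: if_splits)
    then have "d \<le> n" by (simp add: n_def le_nat_floor)
    then have "d \<in> {1..n}" using d by simp
    moreover have "e = real d \<or> e = - real d" using k by (simp add: e ket_ev_def d)
    ultimately show "e \<in> A \<union> B" unfolding A_def B_def by blast
  qed
  then have "eigenvalue_sum \<Lambda> \<le> (\<Sum>e\<in>A \<union> B. real (ev_mult e) / e\<^sup>2)"
    unfolding eigenvalue_sum_def by (intro sum_mono2) (auto simp: A_def B_def)
  also have "\<dots> \<le> (\<Sum>e\<in>A \<union> B. 1 / \<bar>e\<bar>)"
  proof (rule sum_mono)
    fix e assume "e \<in> A \<union> B"
    then have "e \<noteq> 0" by (auto simp: A_def B_def)
    have "real (ev_mult e) / e\<^sup>2 \<le> \<bar>e\<bar> / e\<^sup>2" using ev_mult_upper by (intro divide_right_mono) auto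
    also have "\<dots> = 1 / \<bar>e\<bar>" using \<open>e \<noteq> 0\<close> by (simp add: power2_eq_square field_simps)
    finally show "real (ev_mult e) / e\<^sup>2 \<le> 1 / \<bar>e\<bar>" .
  qed
  also have "\<dots> \<le> (\<Sum>e\<in>A. 1 / \<bar>e\<bar>) + (\<Sum>e\<in>B. 1 / \<bar>e\<bar>)"
    by (subst sum_Un) (auto simp: A_def B_def intro!: sum_nonneg)
  also have "(\<Sum>e\<in>A. 1 / \<bar>e\<bar>) = harm n"
    unfolding A_def by (subst sum.reindex) (auto simp: inj_on_def harm_def inverse_eq_divide)
  also have "(\<Sum>e\<in>B. 1 / \<bar>e\<bar>) = harm n"
    unfolding B_def by (subst sum.reindex) (auto simp: inj_on_def harm_def inverse_eq_divide)
  also have "harm n + harm n \<le> 2 * (1 + ln (real n))" using harm_upper[OF n(1)] by simp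
  also have "\<dots> \<le> 2 * (1 + ln \<Lambda>)" using n by simp
  finally show ?thesis .
qed

text \<open>The even eigenvalues alone contribute a multiple of the harmonic sum.\<close>

lemma eigenvalue_sum_lower:
  assumes "2 \<le> \<Lambda>" shows "ln (\<Lambda> / 2) / (4 * real (k + l)) \<le> eigenvalue_sum \<Lambda>"
proof -
  define n where "n = nat \<lfloor>\<Lambda> / 2\<rfloor>"
  have n: "\<Lambda> / 2 \<le> real n + 1" using assms unfolding n_def by linarith
  have nL: "2 * real p \<le> \<Lambda>" if "p \<le> n" for p
  proof -
    have "real p \<le> \<Lambda> / 2" using that assms unfolding n_def by (simp add: le_nat_iff le_floor_iff)
    then show ?thesis by simp
  qed
  have kl: "0 < real (k + l)" using k_pos by simp
  have "ln (\<Lambda> / 2) / (4 * real (k + l)) \<le> harm n / (4 * real (k + l))"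
  proof (rule divide_right_mono)
    have "ln (\<Lambda> / 2) \<le> ln (real n + 1)" using n assms by (subst ln_le_cancel_iff) auto
    then show "ln (\<Lambda> / 2) \<le> harm n" using ln_le_harm[of n] by linarith
  qed (use kl in simp)
  also have "\<dots> = (\<Sum>p=1..n. (1 / real p) / (4 * real (k + l)))"
    by (simp add: harm_def sum_divide_distrib inverse_eq_divide)
  also have "\<dots> \<le> (\<Sum>p=1..n. real (ev_mult (2 * real p)) / (2 * real p)\<^sup>2)"
  proof (rule sum_mono)
    fix p assume "p \<in> {1..n}"
    then have p: "1 \<le> p" by simp
    have "(1 / real p) / (4 * real (k + l)) = (real p / real (k + l)) / (2 * real p)\<^sup>2"
    proof -
      have "(1 / real p) / (4 * K) = (real p / K) / (2 * real p)\<^sup>2" for K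
        using p by (simp add: power2_eq_square field_simps)
      then show ?thesis .
    qed
    also have "\<dots> \<le> real (ev_mult (2 * real p)) / (2 * real p)\<^sup>2"
      using ev_mult_lower(2)[OF p] by (intro divide_right_mono) auto
    finally show "(1 / real p) / (4 * real (k + l)) \<le> real (ev_mult (2 * real p)) / (2 * real p)\<^sup>2" .
  qed
  also have "\<dots> = (\<Sum>e\<in>(\<lambda>p. 2 * real p) ` {1..n}. real (ev_mult e) / e\<^sup>2)"
    by (subst sum.reindex) (auto simp: inj_on_def)
  also have "\<dots> \<le> eigenvalue_sum \<Lambda>"
    unfolding eigenvalue_sum_def
  proof (rule sum_mono2[OF eigenvalues_finite])
    show "(\<lambda>p. 2 * real p) ` {1..n} \<subseteq> {e. e \<in> ket_ev ` coinv_index \<and> \<bar>e\<bar> \<le> \<Lambda>}"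
      using ev_mult_lower(1) nL by auto
  qed auto
  finally show ?thesis .
qed

lemma eigenvalue_sum_bigtheta: "eigenvalue_sum \<in> \<Theta>(\<lambda>\<Lambda>. ln \<Lambda>)"
proof (rule bigthetaI')
  have kl: "0 < real (k + l)" using k_pos by simp
  show "0 < 1 / (8 * real (k + l))" using kl by simp
  show "(0::real) < 4" by simp
  show "\<forall>\<^sub>F \<Lambda> in at_top. 1 / (8 * real (k + l)) * norm (ln \<Lambda>) \<le> norm (eigenvalue_sum \<Lambda>) \<and> norm (eigenvalue_sum \<Lambda>) \<le> 4 * norm (ln \<Lambda>)"
    using eventually_ge_at_top[of "exp 2"]
  proof eventually_elim
    fix \<Lambda> :: real assume L: "exp 2 \<le> \<Lambda>"
    have "4 \<le> exp (2::real)"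
    proof -
      have "2 \<le> exp (1::real)" using exp_ge_add_one_self[of 1] by simp
      then have "2 * 2 \<le> exp (1::real) * exp 1" by (intro mult_mono) auto
      then show ?thesis by (simp flip: exp_add)
    qed
    then have L4: "4 \<le> \<Lambda>" using L by simp
    have ln2: "2 \<le> ln \<Lambda>" using L L4 by (subst ln_ge_iff) auto
    have F0: "0 \<le> eigenvalue_sum \<Lambda>" unfolding eigenvalue_sum_def by (intro sum_nonneg) auto
    have "ln 4 \<le> ln \<Lambda>" using L4 by simp
    moreover have "ln (4::real) = 2 * ln 2" using ln_realpow[of 2 2] by simp
    ultimately have "ln \<Lambda> / 2 \<le> ln (\<Lambda> / 2)" using L4 by (simp add: ln_div)
    then have "ln \<Lambda> / 2 / (4 * real (k + l)) \<le> ln (\<Lambda> / 2) / (4 * real (k + l))"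
      using kl by (intro divide_right_mono) auto
    then have "1 / (8 * real (k + l)) * ln \<Lambda> \<le> eigenvalue_sum \<Lambda>" using eigenvalue_sum_lower[of \<Lambda>] L4 by simp
    moreover have "eigenvalue_sum \<Lambda> \<le> 4 * ln \<Lambda>" using eigenvalue_sum_upper[of \<Lambda>] L4 ln2 by simp
    ultimately show "1 / (8 * real (k + l)) * norm (ln \<Lambda>) \<le> norm (eigenvalue_sum \<Lambda>) \<and> norm (eigenvalue_sum \<Lambda>) \<le> 4 * norm (ln \<Lambda>)"
      using F0 ln2 by simp
  qed
qed

lemma coinv_two_summable: "two_summable coinv_kets.Hs (coinv_kets.diag ket_ev)"
  using coinv_kets.two_summableI eigenvalue_sum_bigtheta unfolding eigenvalue_sum_def[abs_def] ev_mult_def .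

end

theorem theorem2:
  fixes q :: real and k l :: nat and \<eta> :: "functional \<Rightarrow> 'h::complex_hilbert"
  assumes "0 < q" and "q < 1"
    and "k > 0" and "l > 0" and "coprime k l"
    and "is_L2_completion q \<eta>"
  shows "odd_spectral_triple (WPq q k l) (spinor_rep q \<eta>) (H_theta q k l \<eta>) (dirac_theta q k l \<eta>) \<and>
         two_summable (H_theta q k l \<eta>) (dirac_theta q k l \<eta>)"
proof -
  interpret projective_spectral q k l \<eta>
    by unfold_locales (use assms in auto)
  show ?thesis
    unfolding H_theta_eq dirac_theta_diag using coinv_spectral_triple coinv_two_summable by blast
qed

end
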